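(* Let $\mathcal{F}\colon \mathfrak{U}_{\mathbb{C}}\to \mathsf{LCS}_{\mathbb{C}}$ be an $S^1\ltimes\mathbb{C}$-equivariant prefactorization algebra on $\mathbb{C}$ with values in locally convex spaces which is holomorphic. Then the linear space $$\mathbf{V}(\mathcal{F}):=\bigoplus_{\Delta\in\mathbb{Z}}\mathcal{F}^0_\Delta$$ has the structure of a $\mathbb{Z}$-graded vertex algebra (with weight-$\Delta$ component $\mathcal{F}^0_\Delta$) induced by the prefactorization algebra structure and the equivariant structure of $\mathcal{F}$, namely the one given by the following (well-defined) data: - vacuum: $|0\rangle=\{\mathcal{F}^{\varnothing}_{D_R(0)}(1_{\mathcal{F}})\}_{R>0}$, where $1_{\mathcal{F}}\in\mathcal{F}(\varnothing)$ is the image of $1\in\mathbb{C}$ under the unit $\mathbb{C}\to\mathcal{F}(\varnothing)$; - translation operator: $Ta=\{\partial_z\mu^R_z(a)|_{z=0}\}_{R>0}$ for homogeneous $a$; - state-field correspondence: $Y(a,z)b=\sum_{n\in\mathbb{Z}}z^{-n-1}a_{(n)}b$ with $a_{(n)}b=\{(a_{(n)}b)_R\}_{R>0}$ for homogeneous $a,b$, where $(a_{(n)}b)_R\in\mathcal{F}(D_R(0))$ are the coefficients of the Laurent expansion $\mu^R_{z,0}(a\otimes b)=\sum_{n\in\mathbb{Z}}z^{-n-1}(a_{(n)}b)_R$ of the holomorphic function $z\mapsto \mu^R_{z,0}(a\otimes b)$ on $D_R(0)\setminus\{0\}$. Additionally, if $\mathcal{F}$ is locally constant, then the vertex algebra $\mathbf{V}(\mathcal{F})$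 is commutative.
   Context: All linear spaces are over $\mathbb{C}$. $D_R(z)=\{\zeta\in\mathbb{C}: |\zeta-z|<R\}$, $D_\infty(z)=\mathbb{C}$; $\mathrm{Conf}_l(E)=\{(z_1,\dots,z_l)\in E^l: z_i\ne z_j\ (i\neq j)\}$. $\mathsf{LCS}_{\mathbb{C}}$ is the category of locally convex spaces over $\mathbb{C}$ and continuous linear maps, symmetric monoidal with unit $\mathbb{C}$ and the (uncompleted) projective tensor product: $X\otimes Y$ is the algebraic tensor product with the finest locally convex topology for which $X\times Y\to X\otimes Y$ is continuous. **Prefactorization algebras.** Let $X$ be a topological space, $\mathsf{M}$ a symmetric monoidal category with unit object $1_{\mathsf{M}}$, $\mathfrak{U}_X$ the poset of open subsets of $X$. Write $U\sqcup V\subset W$ for: $U\cap V=\varnothing$ and $U\cup V\subset W$. A precosheaf is a functor $\mathcal{F}\colon\mathfrak{U}_X\to\mathsf{M}$, with maps $\mathcal{F}^U_V\colon\mathcal{F}(U)\to\mathcal{F}(V)$ for $U\subset V$. A prefactorization algebra is a precosheaf $\mathcal{F}$ with morphisms $\mathcal{F}^{U,V}_W\colon\mathcal{F}(U)\otimes\mathcal{F}(V)\to\mathcal{F}(W)$ for $U\sqcup V\subset W$ and a unit $\eta\colon 1_{\mathsf{M}}\to\mathcal{F}(\varnothing)$ such that: (i) $\mathcal{F}^V_W\circ\mathcal{F}^{U_1,U_2}_V=\mathcal{F}^{U_1,U_2}_W$ if $U_1\sqcup U_2\subset V\subset W$, and $\mathcal{F}^{V_1,V_2}_W\circ(\mathcal{F}^{U_1}_{V_1}\otimes\mathcal{F}^{U_2}_{V_2})=\mathcal{F}^{U_1,U_2}_W$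 if $U_i\subset V_i$, $V_1\sqcup V_2\subset W$; (ii) $\mathcal{F}^{U_2,U_1}_V\circ(\text{braiding})=\mathcal{F}^{U_1,U_2}_V$; (iii) if $U_1\sqcup U_2\subset V_1$, $U_2\sqcup U_3\subset V_2$, $U_1\sqcup V_2\subset W$, $V_1\sqcup U_3\subset W$, then $\mathcal{F}^{V_1,U_3}_W\circ(\mathcal{F}^{U_1,U_2}_{V_1}\otimes\mathrm{id})=\mathcal{F}^{U_1,V_2}_W\circ(\mathrm{id}\otimes\mathcal{F}^{U_2,U_3}_{V_2})\circ(\text{associator})$; (iv) $\mathcal{F}^{\varnothing,U}_U\circ(\eta\otimes\mathrm{id})$ is the left unitor. Multi-variable products are defined inductively by $\mathcal{F}^{U_1,\dots,U_n}_V=\mathcal{F}^{U_1\sqcup\cdots\sqcup U_{n-1},U_n}_V\circ(\mathcal{F}^{U_1,\dots,U_{n-1}}_{U_1\sqcup\cdots\sqcup U_{n-1}}\otimes\mathrm{id})$. **Equivariance.** If a group $G$ acts on $X$, a $G$-equivariant prefactorization algebra is a prefactorization algebra $\mathcal{F}$ with morphisms $\sigma_{a,U}\colon\mathcal{F}(U)\to\mathcal{F}(aU)$ ($a\in G$, $U$ open) natural in $U$ (i.e. $\mathcal{F}^{aU}_{aV}\sigma_{a,U}=\sigma_{a,V}\mathcal{F}^U_V$) such that $\sigma_{ab,U}=\sigma_{a,bU}\sigma_{b,U}$, $\sigma_{1,U}=\mathrm{id}$, $\sigma_{a,W}\circ\mathcal{F}^{U,V}_W=\mathcal{F}^{aU,aV}_{aW}\circ(\sigma_{a,U}\otimes\sigma_{a,V})$,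 and $\sigma_{a,\varnothing}\circ\eta=\eta$. Here $G=S^1\ltimes\mathbb{C}$, $S^1=\{q\in\mathbb{C}:|q|=1\}$, acts on $\mathbb{C}$ by $(q,z)\cdot w=qw+z$; write $q$ for $(q,0)$. **Costalk and weights.** The costalk at $0$ is $\mathcal{F}^0=\varprojlim_{U\ni 0}\mathcal{F}(U)$, i.e. families $(a_R)_{R>0}\in\prod_{R>0}\mathcal{F}(D_R(0))$ with $\mathcal{F}^{D_r(0)}_{D_R(0)}(a_r)=a_R$ for $r<R$, with projections $\mathcal{F}^0_U\colon\mathcal{F}^0\to\mathcal{F}(U)$. For $\Delta\in\mathbb{Z}$, $\mathcal{F}(D_R(0))_\Delta=\{a:\sigma_{q,D_R(0)}a=q^\Delta a\ \forall q\in S^1\}$, and $\mathcal{F}^0_\Delta\subset\mathcal{F}^0$ consists of the families with all $a_R\in\mathcal{F}(D_R(0))_\Delta$; elements of $\mathcal{F}^0_\Delta$ are called homogeneous. **The maps $\mu$.** For $(z_1,\dots,z_l)\in\mathrm{Conf}_l(D_R(0))$, $\mu^R_{z_1,\dots,z_l}\colon(\mathcal{F}^0)^{\otimes l}\to\mathcal{F}(D_R(0))$ is the composite of $\bigotimes_i\mathcal{F}^0_{D_r(0)}$, $\bigotimes_i\sigma_{(1,z_i),D_r(0)}$ and $\mathcal{F}^{D_r(z_1),\dots,D_r(z_l)}_{D_R(0)}$, for any $r>0$ with the $D_r(z_i)$ pairwise disjoint and contained in $D_R(0)$ (independent of $r$). **Holomorphic functions.** For $U\subset\mathbb{C}^n$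 open and $E$ a Hausdorff locally convex space, $f\colon U\to E$ is holomorphic if for every $a\in U$ there is $\xi\in E^n$ with $\bigl(f(z)-f(a)-\sum_i(z_i-a_i)\xi_i\bigr)/|z-a|\to0$ as $z\to a$. **Holomorphic prefactorization algebra.** $\mathcal{F}$ ($S^1\ltimes\mathbb{C}$-equivariant, values in $\mathsf{LCS}_{\mathbb{C}}$) is holomorphic if: (i) for $0<r<R$, $\Delta\in\mathbb{Z}$, $\mathcal{F}^{D_r(0)}_{D_R(0)}\colon\mathcal{F}(D_r(0))_\Delta\to\mathcal{F}(D_R(0))_\Delta$ is a linear isomorphism; (ii) for each $R\in\mathbb{R}_{>0}$, $\mathcal{F}(D_R(0))_\Delta=0$ for $\Delta\ll0$; (iii) for each $R\in\mathbb{R}_{>0}$, $\mathcal{F}(D_R(0))$ is quasi-complete and Hausdorff; (iv) for $R\in\mathbb{R}_{>0}$ and homogeneous $a_1,\dots,a_l\in\mathcal{F}^0$, the function $\mathrm{Conf}_l(D_R(0))\to\mathcal{F}(D_R(0))$, $(z_i)\mapsto\mu^R_{z_1,\dots,z_l}(a_1\otimes\cdots\otimes a_l)$ is holomorphic. **Locally constant.** A prefactorization algebra $\mathcal{F}$ on $\mathbb{C}$ is locally constant if $\mathcal{F}^{D_r(z)}_{D_R(w)}$ is an isomorphism whenever $0<r<R\le\infty$ and $D_r(z)\subset D_R(w)$. **Vertex algebras.** A vertex algebra is $(V,|0\rangle,T,Y)$ with $V$ a linear space, $|0\rangle\in V$, $T\in\mathrm{End}(V)$, and a linear map $a\mapsto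 Y(a,z)=\sum_{n\in\mathbb{Z}}z^{-n-1}a_{(n)}$ into fields ($Y(a,z)b\in V((z))$ for all $b$) such that: $Y(|0\rangle,z)=\mathrm{id}$, $Y(a,z)|0\rangle\in V[[z]]$ with constant term $a$; $T|0\rangle=0$, $[T,Y(a,z)]=\partial_zY(a,z)$; for all $a,b$ there is $N\in\mathbb{N}$ with $(z-w)^N[Y(a,z),Y(b,w)]=0$. It is commutative if $[Y(a,z),Y(b,w)]=0$ for all $a,b$. It is $\mathbb{Z}$-graded if $V=\bigoplus_{\Delta\in\mathbb{Z}}V_\Delta$ with $|0\rangle\in V_0$ and $a_{(n)}b\in V_{\Delta+\Delta'-n-1}$ for $a\in V_\Delta$, $b\in V_{\Delta'}$. *)

theory Defs
  imports
    "HOL-Analysis.Analysis"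
    "HOL-Algebra.Module"
    "HOL-Algebra.Group_Action"
    "HOL-Algebra.Algebraic_Closure_Type"
    "HOL-Library.Poly_Mapping"
begin

section \<open>Locally convex spaces over the complex numbers\<close>

abbreviation complex_ring :: "complex ring" where
  "complex_ring \<equiv> ring_of_type_algebra"

text \<open>
  Spaces are given by explicit carriers, since the values of a prefactorization algebra form a
  family of spaces indexed by the open sets. The fields \<open>mult\<close> and \<open>one\<close> inherited from the
  ring record are never used.
\<close>

record 'a lcs = "(complex, 'a) module" +
  lcs_topology :: "'a topology"

locale locally_convex_space =
  Module.module complex_ring E for E :: "('a, 'm) lcs_scheme" (structure) +
  assumes topspace_eq: "topspace (lcs_topology E) = carrier E"
    and continuous_add:
      "continuous_map (prod_topology (lcs_topology E) (lcs_topology E)) (lcs_topology E)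
         (\<lambda>(x, y). x \<oplus> y)"
    and continuous_smult:
      "continuous_map (prod_topology euclidean (lcs_topology E)) (lcs_topology E)
         (\<lambda>(c, x). c \<odot> x)"
    and locally_convex:
      "\<lbrakk>openin (lcs_topology E) U; \<zero> \<in> U\<rbrakk> \<Longrightarrow>
         \<exists>C W. openin (lcs_topology E) W \<and> \<zero> \<in> W \<and> W \<subseteq> C \<and> C \<subseteq> U \<and>
           (\<forall>x\<in>C. \<forall>y\<in>C. \<forall>t::real. 0 \<le> t \<and> t \<le> 1 \<longrightarrow>
              (complex_of_real t \<odot> x) \<oplus> (complex_of_real (1 - t) \<odot> y) \<in> C)"

text \<open>Morphisms are compared on the carrier of their source only.\<close>

definition lcs_hom :: "('a, 'm) lcs_scheme \<Rightarrow> ('b, 'n) lcs_scheme \<Rightarrow> ('a \<Rightarrow> 'b) set" where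
  "lcs_hom E E' = {f \<in> carrier E \<rightarrow> carrier E'.
     (\<forall>x\<in>carrier E. \<forall>y\<in>carrier E. f (x \<oplus>\<^bsub>E\<^esub> y) = f x \<oplus>\<^bsub>E'\<^esub> f y) \<and>
     (\<forall>c. \<forall>x\<in>carrier E. f (c \<odot>\<^bsub>E\<^esub> x) = c \<odot>\<^bsub>E'\<^esub> f x) \<and>
     continuous_map (lcs_topology E) (lcs_topology E') f}"

definition lcs_isomorphism ::
    "('a, 'm) lcs_scheme \<Rightarrow> ('b, 'n) lcs_scheme \<Rightarrow> ('a \<Rightarrow> 'b) \<Rightarrow> bool" where
  "lcs_isomorphism E E' f \<longleftrightarrow> f \<in> lcs_hom E E' \<and>
     (\<exists>g\<in>lcs_hom E' E. (\<forall>x\<in>carrier E. g (f x) = x) \<and> (\<forall>y\<in>carrier E'. f (g y) = y))"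

definition complex_lcs :: "complex lcs" where
  "complex_lcs = \<lparr>carrier = UNIV, monoid.mult = (*), one = 1, zero = 0, add = (+),
     smult = (*), lcs_topology = euclidean\<rparr>"

definition lcs_bounded :: "('a, 'm) lcs_scheme \<Rightarrow> 'a set \<Rightarrow> bool" where
  "lcs_bounded E B \<longleftrightarrow> B \<subseteq> carrier E \<and>
     (\<forall>U. openin (lcs_topology E) U \<and> \<zero>\<^bsub>E\<^esub> \<in> U \<longrightarrow>
        (\<exists>s>0. \<forall>c::complex. s \<le> cmod c \<longrightarrow> B \<subseteq> (\<lambda>x. c \<odot>\<^bsub>E\<^esub> x) ` U))"

definition lcs_cauchy_filter :: "('a, 'm) lcs_scheme \<Rightarrow> 'a filter \<Rightarrow> bool" where
  "lcs_cauchy_filter E \<Phi> \<longleftrightarrow> \<Phi> \<noteq> bot \<and> \<Phi> \<le> principal (carrier E) \<and>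
     (\<forall>U. openin (lcs_topology E) U \<and> \<zero>\<^bsub>E\<^esub> \<in> U \<longrightarrow>
        (\<exists>A \<subseteq> carrier E. eventually (\<lambda>x. x \<in> A) \<Phi> \<and> (\<forall>x\<in>A. \<forall>y\<in>A. x \<ominus>\<^bsub>E\<^esub> y \<in> U)))"

definition lcs_complete_set :: "('a, 'm) lcs_scheme \<Rightarrow> 'a set \<Rightarrow> bool" where
  "lcs_complete_set E S \<longleftrightarrow>
     (\<forall>\<Phi>. lcs_cauchy_filter E \<Phi> \<and> \<Phi> \<le> principal S \<longrightarrow>
        (\<exists>x\<in>S. limitin (lcs_topology E) (\<lambda>y. y) x \<Phi>))"

definition quasi_complete :: "('a, 'm) lcs_scheme \<Rightarrow> bool" where
  "quasi_complete E \<longleftrightarrow>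
     (\<forall>B. closedin (lcs_topology E) B \<and> lcs_bounded E B \<longrightarrow> lcs_complete_set E B)"


section \<open>Vector-valued holomorphic functions\<close>

text \<open>
  A point of the \<open>n\<close>-dimensional complex space is an extensional function on \<open>{..<n}\<close>, so that
  \<open>n\<close> may vary inside a formula.
\<close>

abbreviation cspace :: "nat \<Rightarrow> (nat \<Rightarrow> complex) topology" where
  "cspace n \<equiv> product_topology (\<lambda>_. euclidean) {..<n}"

definition lcs_holomorphic_on ::
    "('a, 'm) lcs_scheme \<Rightarrow> nat \<Rightarrow> (nat \<Rightarrow> complex) set \<Rightarrow> ((nat \<Rightarrow> complex) \<Rightarrow> 'a) \<Rightarrow> bool" where
  "lcs_holomorphic_on E n U f \<longleftrightarrow> openin (cspace n) U \<and> f \<in> U \<rightarrow> carrier E \<and>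
     (\<forall>a\<in>U. \<exists>\<xi> \<in> {..<n} \<rightarrow> carrier E.
        limitin (lcs_topology E)
          (\<lambda>z. complex_of_real (inverse (L2_set (\<lambda>i. cmod (z i - a i)) {..<n})) \<odot>\<^bsub>E\<^esub>
                 ((f z \<ominus>\<^bsub>E\<^esub> f a) \<ominus>\<^bsub>E\<^esub> (\<Oplus>\<^bsub>E\<^esub>i\<in>{..<n}. (z i - a i) \<odot>\<^bsub>E\<^esub> \<xi> i)))
          \<zero>\<^bsub>E\<^esub> (atin (cspace n) a))"

definition has_lcs_derivative ::
    "('a, 'm) lcs_scheme \<Rightarrow> (complex \<Rightarrow> 'a) \<Rightarrow> complex \<Rightarrow> 'a \<Rightarrow> bool" where
  "has_lcs_derivative E f z d \<longleftrightarrow>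
     limitin (lcs_topology E) (\<lambda>w. inverse (w - z) \<odot>\<^bsub>E\<^esub> (f w \<ominus>\<^bsub>E\<^esub> f z)) d (at z)"

definition lcs_derivative :: "('a, 'm) lcs_scheme \<Rightarrow> (complex \<Rightarrow> 'a) \<Rightarrow> complex \<Rightarrow> 'a" where
  "lcs_derivative E f z = (THE d. has_lcs_derivative E f z d)"

text \<open>
  \<open>f z\<close> is the sum of \<open>z\<^bsup>-n-1\<^esup> c\<^sub>n\<close> over all integers \<open>n\<close>, as an unconditionally
  convergent series, on the punctured disk of radius \<open>R\<close> about 0.
\<close>

definition has_lcs_laurent_expansion ::
    "('a, 'm) lcs_scheme \<Rightarrow> real \<Rightarrow> (complex \<Rightarrow> 'a) \<Rightarrow> (int \<Rightarrow> 'a) \<Rightarrow> bool" where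
  "has_lcs_laurent_expansion E R f c \<longleftrightarrow> range c \<subseteq> carrier E \<and>
     (\<forall>z\<in>ball 0 R - {0}.
        limitin (lcs_topology E) (\<lambda>S. \<Oplus>\<^bsub>E\<^esub>n\<in>S. (z powi (- n - 1)) \<odot>\<^bsub>E\<^esub> c n) (f z)
          (finite_subsets_at_top UNIV))"

definition lcs_laurent_coeff ::
    "('a, 'm) lcs_scheme \<Rightarrow> real \<Rightarrow> (complex \<Rightarrow> 'a) \<Rightarrow> int \<Rightarrow> 'a" where
  "lcs_laurent_coeff E R f = (THE c. has_lcs_laurent_expansion E R f c)"


section \<open>The projective tensor product\<close>

text \<open>
  The algebraic tensor product is the free vector space on the product of the carriers, modulo
  the span of the bilinearity relations; its elements are equivalence classes.
\<close>

type_synonym ('a, 'b) tensor = "(('a \<times> 'b) \<Rightarrow>\<^sub>0 complex) set"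

definition tensor_free ::
    "('a, 'm) lcs_scheme \<Rightarrow> ('b, 'n) lcs_scheme \<Rightarrow> (('a \<times> 'b) \<Rightarrow>\<^sub>0 complex) set" where
  "tensor_free E F = {\<phi>. Poly_Mapping.keys \<phi> \<subseteq> carrier E \<times> carrier F}"

inductive_set tensor_null ::
    "('a, 'm) lcs_scheme \<Rightarrow> ('b, 'n) lcs_scheme \<Rightarrow> (('a \<times> 'b) \<Rightarrow>\<^sub>0 complex) set"
  for E :: "('a, 'm) lcs_scheme" and F :: "('b, 'n) lcs_scheme" where
  add_left: "\<lbrakk>x \<in> carrier E; x' \<in> carrier E; y \<in> carrier F\<rbrakk> \<Longrightarrow>
     Poly_Mapping.single (x \<oplus>\<^bsub>E\<^esub> x', y) 1 - Poly_Mapping.single (x, y) 1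
       - Poly_Mapping.single (x', y) 1 \<in> tensor_null E F"
| add_right: "\<lbrakk>x \<in> carrier E; y \<in> carrier F; y' \<in> carrier F\<rbrakk> \<Longrightarrow>
     Poly_Mapping.single (x, y \<oplus>\<^bsub>F\<^esub> y') 1 - Poly_Mapping.single (x, y) 1
       - Poly_Mapping.single (x, y') 1 \<in> tensor_null E F"
| smult_left: "\<lbrakk>x \<in> carrier E; y \<in> carrier F\<rbrakk> \<Longrightarrow>
     Poly_Mapping.single (c \<odot>\<^bsub>E\<^esub> x, y) 1 - Poly_Mapping.single (x, y) c \<in> tensor_null E F"
| smult_right: "\<lbrakk>x \<in> carrier E; y \<in> carrier F\<rbrakk> \<Longrightarrow>
     Poly_Mapping.single (x, c \<odot>\<^bsub>F\<^esub> y) 1 - Poly_Mapping.single (x, y) c \<in> tensor_null E F"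
| zero: "0 \<in> tensor_null E F"
| add: "\<lbrakk>\<phi> \<in> tensor_null E F; \<psi> \<in> tensor_null E F\<rbrakk> \<Longrightarrow> \<phi> + \<psi> \<in> tensor_null E F"
| smult: "\<phi> \<in> tensor_null E F \<Longrightarrow> Poly_Mapping.map (\<lambda>d. c * d) \<phi> \<in> tensor_null E F"

definition tensor_rel ::
    "('a, 'm) lcs_scheme \<Rightarrow> ('b, 'n) lcs_scheme \<Rightarrow> (('a \<times> 'b) \<Rightarrow>\<^sub>0 complex) rel" where
  "tensor_rel E F =
     {(\<phi>, \<psi>). \<phi> \<in> tensor_free E F \<and> \<psi> \<in> tensor_free E F \<and> \<phi> - \<psi> \<in> tensor_null E F}"

definition pure_tensor ::
    "('a, 'm) lcs_scheme \<Rightarrow> ('b, 'n) lcs_scheme \<Rightarrow> 'a \<Rightarrow> 'b \<Rightarrow> ('a, 'b) tensor" where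
  "pure_tensor E F x y = tensor_rel E F `` {Poly_Mapping.single (x, y) 1}"

definition tensor_with_topology ::
    "('a, 'm) lcs_scheme \<Rightarrow> ('b, 'n) lcs_scheme \<Rightarrow> ('a, 'b) tensor topology
      \<Rightarrow> ('a, 'b) tensor lcs" where
  "tensor_with_topology E F \<tau> =
     \<lparr>carrier = tensor_free E F // tensor_rel E F,
      monoid.mult = undefined,
      one = undefined,
      zero = tensor_rel E F `` {0},
      add = (\<lambda>A B. \<Union>\<phi>\<in>A. \<Union>\<psi>\<in>B. tensor_rel E F `` {\<phi> + \<psi>}),
      smult = (\<lambda>c A. \<Union>\<phi>\<in>A. tensor_rel E F `` {Poly_Mapping.map (\<lambda>d. c * d) \<phi>}),
      lcs_topology = \<tau>\<rparr>"

text \<open>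
  The finest admissible topology is the supremum of all admissible ones, since a supremum of
  locally convex topologies is again locally convex.
\<close>

definition projective_topology ::
    "('a, 'm) lcs_scheme \<Rightarrow> ('b, 'n) lcs_scheme \<Rightarrow> ('a, 'b) tensor topology" where
  "projective_topology E F = topology_generated_by
     (\<Union>{ {A. openin \<tau> A} | \<tau>. locally_convex_space (tensor_with_topology E F \<tau>) \<and>
        continuous_map (prod_topology (lcs_topology E) (lcs_topology F)) \<tau>
          (\<lambda>(x, y). pure_tensor E F x y) })"

definition tensor ::
    "('a, 'm) lcs_scheme \<Rightarrow> ('b, 'n) lcs_scheme \<Rightarrow> ('a, 'b) tensor lcs" where
  "tensor E F = tensor_with_topology E F (projective_topology E F)"

text \<open>
  The linear map on a tensor product that sends each pure tensor of \<open>x\<close> and \<open>y\<close> to \<open>h x y\<close>, for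
  \<open>h\<close> bilinear; the value then does not depend on the chosen representative.
\<close>

definition tensor_lift ::
    "('c, 'm) lcs_scheme \<Rightarrow> ('a \<Rightarrow> 'b \<Rightarrow> 'c) \<Rightarrow> ('a, 'b) tensor \<Rightarrow> 'c" where
  "tensor_lift G h A = (let \<phi> = (SOME \<phi>. \<phi> \<in> A) in
     \<Oplus>\<^bsub>G\<^esub>p\<in>Poly_Mapping.keys \<phi>. Poly_Mapping.lookup \<phi> p \<odot>\<^bsub>G\<^esub> h (fst p) (snd p))"

definition tensor_map ::
    "('c, 'm) lcs_scheme \<Rightarrow> ('d, 'n) lcs_scheme \<Rightarrow> ('a \<Rightarrow> 'c) \<Rightarrow> ('b \<Rightarrow> 'd)
      \<Rightarrow> ('a, 'b) tensor \<Rightarrow> ('c, 'd) tensor" where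
  "tensor_map E' F' f g = tensor_lift (tensor E' F') (\<lambda>x y. pure_tensor E' F' (f x) (g y))"

definition braiding ::
    "('a, 'm) lcs_scheme \<Rightarrow> ('b, 'n) lcs_scheme \<Rightarrow> ('a, 'b) tensor \<Rightarrow> ('b, 'a) tensor" where
  "braiding E F = tensor_lift (tensor F E) (\<lambda>x y. pure_tensor F E y x)"

definition associator ::
    "('a, 'm) lcs_scheme \<Rightarrow> ('b, 'n) lcs_scheme \<Rightarrow> ('c, 'k) lcs_scheme
      \<Rightarrow> (('a, 'b) tensor, 'c) tensor \<Rightarrow> ('a, ('b, 'c) tensor) tensor" where
  "associator E F G = tensor_lift (tensor E (tensor F G))
     (\<lambda>t z. tensor_lift (tensor E (tensor F G))
        (\<lambda>x y. pure_tensor E (tensor F G) x (pure_tensor F G y z)) t)"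

definition left_unitor :: "('a, 'm) lcs_scheme \<Rightarrow> (complex, 'a) tensor \<Rightarrow> 'a" where
  "left_unitor E = tensor_lift E (\<lambda>c x. c \<odot>\<^bsub>E\<^esub> x)"


section \<open>Prefactorization algebras with values in locally convex spaces\<close>

record ('x, 'a) pfa =
  pf_space :: "'x set \<Rightarrow> 'a lcs"
  pf_ext :: "'x set \<Rightarrow> 'x set \<Rightarrow> 'a \<Rightarrow> 'a"
  pf_prod :: "'x set \<Rightarrow> 'x set \<Rightarrow> 'x set \<Rightarrow> ('a, 'a) tensor \<Rightarrow> 'a"
  pf_unit :: "complex \<Rightarrow> 'a"

definition disjoint_in :: "'x set \<Rightarrow> 'x set \<Rightarrow> 'x set \<Rightarrow> bool" where
  "disjoint_in U V W \<longleftrightarrow> U \<inter> V = {} \<and> U \<union> V \<subseteq> W"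

locale prefactorization_algebra =
  fixes F :: "('x::topological_space, 'a, 'm) pfa_scheme"
  assumes space_lcs: "open U \<Longrightarrow> locally_convex_space (pf_space F U)"
    and ext_hom: "\<lbrakk>open U; open V; U \<subseteq> V\<rbrakk> \<Longrightarrow>
      pf_ext F U V \<in> lcs_hom (pf_space F U) (pf_space F V)"
    and ext_id: "\<lbrakk>open U; a \<in> carrier (pf_space F U)\<rbrakk> \<Longrightarrow> pf_ext F U U a = a"
    and ext_ext: "\<lbrakk>open U; open V; open W; U \<subseteq> V; V \<subseteq> W; a \<in> carrier (pf_space F U)\<rbrakk> \<Longrightarrow>
      pf_ext F V W (pf_ext F U V a) = pf_ext F U W a"
    and prod_hom: "\<lbrakk>open U; open V; open W; disjoint_in U V W\<rbrakk> \<Longrightarrow>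
      pf_prod F U V W \<in> lcs_hom (tensor (pf_space F U) (pf_space F V)) (pf_space F W)"
    and unit_hom: "pf_unit F \<in> lcs_hom complex_lcs (pf_space F {})"
    and ext_prod: "\<lbrakk>open U1; open U2; open V; open W; disjoint_in U1 U2 V; V \<subseteq> W;
        t \<in> carrier (tensor (pf_space F U1) (pf_space F U2))\<rbrakk> \<Longrightarrow>
      pf_ext F V W (pf_prod F U1 U2 V t) = pf_prod F U1 U2 W t"
    and prod_ext: "\<lbrakk>open U1; open U2; open V1; open V2; open W; U1 \<subseteq> V1; U2 \<subseteq> V2;
        disjoint_in V1 V2 W; t \<in> carrier (tensor (pf_space F U1) (pf_space F U2))\<rbrakk> \<Longrightarrow>
      pf_prod F V1 V2 W
        (tensor_map (pf_space F V1) (pf_space F V2) (pf_ext F U1 V1) (pf_ext F U2 V2) t) =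
      pf_prod F U1 U2 W t"
    and prod_braiding: "\<lbrakk>open U1; open U2; open V; disjoint_in U1 U2 V;
        t \<in> carrier (tensor (pf_space F U1) (pf_space F U2))\<rbrakk> \<Longrightarrow>
      pf_prod F U2 U1 V (braiding (pf_space F U1) (pf_space F U2) t) = pf_prod F U1 U2 V t"
    and prod_assoc: "\<lbrakk>open U1; open U2; open U3; open V1; open V2; open W;
        disjoint_in U1 U2 V1; disjoint_in U2 U3 V2; disjoint_in U1 V2 W; disjoint_in V1 U3 W;
        u \<in> carrier (tensor (tensor (pf_space F U1) (pf_space F U2)) (pf_space F U3))\<rbrakk> \<Longrightarrow>
      pf_prod F V1 U3 W
        (tensor_map (pf_space F V1) (pf_space F U3) (pf_prod F U1 U2 V1) (\<lambda>x. x) u) =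
      pf_prod F U1 V2 W
        (tensor_map (pf_space F U1) (pf_space F V2) (\<lambda>x. x) (pf_prod F U2 U3 V2)
          (associator (pf_space F U1) (pf_space F U2) (pf_space F U3) u))"
    and prod_unit: "\<lbrakk>open U; v \<in> carrier (tensor complex_lcs (pf_space F U))\<rbrakk> \<Longrightarrow>
      pf_prod F {} U U (tensor_map (pf_space F {}) (pf_space F U) (pf_unit F) (\<lambda>x. x) v) =
      left_unitor (pf_space F U) v"

text \<open>
  The value of the \<open>n\<close>-variable product, for the open sets \<open>U 0, \<dots>, U (n - 1)\<close> inside \<open>W\<close>, at
  the pure tensor of \<open>x 0, \<dots>, x (n - 1)\<close>. The empty product is the image of the unit.
\<close>

fun pf_multiprod ::
    "('x, 'a, 'm) pfa_scheme \<Rightarrow> (nat \<Rightarrow> 'x set) \<Rightarrow> nat \<Rightarrow> 'x set \<Rightarrow> (nat \<Rightarrow> 'a) \<Rightarrow> 'a" where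
  "pf_multiprod F U 0 W x = pf_ext F {} W (pf_unit F 1)"
| "pf_multiprod F U (Suc 0) W x = pf_ext F (U 0) W (x 0)"
| "pf_multiprod F U (Suc (Suc n)) W x =
     pf_prod F (\<Union>i<Suc n. U i) (U (Suc n)) W
       (pure_tensor (pf_space F (\<Union>i<Suc n. U i)) (pf_space F (U (Suc n)))
          (pf_multiprod F U (Suc n) (\<Union>i<Suc n. U i) x) (x (Suc n)))"

record ('x, 'a, 'g) equivariant_pfa = "('x, 'a) pfa" +
  pf_sigma :: "'g \<Rightarrow> 'x set \<Rightarrow> 'a \<Rightarrow> 'a"

locale equivariant_prefactorization_algebra =
  group_action G UNIV act + prefactorization_algebra F
  for G :: "('g, 'k) monoid_scheme" (structure)
    and act :: "'g \<Rightarrow> 'x::topological_space \<Rightarrow> 'x"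
    and F :: "('x, 'a, 'g, 'm) equivariant_pfa_scheme" +
  assumes act_continuous: "g \<in> carrier G \<Longrightarrow> continuous_on UNIV (act g)"
    and sigma_hom: "\<lbrakk>g \<in> carrier G; open U\<rbrakk> \<Longrightarrow>
      pf_sigma F g U \<in> lcs_hom (pf_space F U) (pf_space F (act g ` U))"
    and sigma_natural: "\<lbrakk>g \<in> carrier G; open U; open V; U \<subseteq> V; a \<in> carrier (pf_space F U)\<rbrakk> \<Longrightarrow>
      pf_ext F (act g ` U) (act g ` V) (pf_sigma F g U a) = pf_sigma F g V (pf_ext F U V a)"
    and sigma_mult: "\<lbrakk>g \<in> carrier G; h \<in> carrier G; open U; a \<in> carrier (pf_space F U)\<rbrakk> \<Longrightarrow>
      pf_sigma F (g \<otimes> h) U a = pf_sigma F g (act h ` U) (pf_sigma F h U a)"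
    and sigma_one: "\<lbrakk>open U; a \<in> carrier (pf_space F U)\<rbrakk> \<Longrightarrow> pf_sigma F \<one> U a = a"
    and sigma_prod: "\<lbrakk>g \<in> carrier G; open U; open V; open W; disjoint_in U V W;
        t \<in> carrier (tensor (pf_space F U) (pf_space F V))\<rbrakk> \<Longrightarrow>
      pf_sigma F g W (pf_prod F U V W t) =
      pf_prod F (act g ` U) (act g ` V) (act g ` W)
        (tensor_map (pf_space F (act g ` U)) (pf_space F (act g ` V))
           (pf_sigma F g U) (pf_sigma F g V) t)"
    and sigma_unit: "g \<in> carrier G \<Longrightarrow> pf_sigma F g {} (pf_unit F c) = pf_unit F c"

definition rigid_motions :: "(complex \<times> complex) monoid" where
  "rigid_motions = \<lparr>carrier = {(q, z). cmod q = 1},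
     monoid.mult = (\<lambda>(q, z) (q', z'). (q * q', q * z' + z)), one = (1, 0)\<rparr>"

definition rigid_action :: "complex \<times> complex \<Rightarrow> complex \<Rightarrow> complex" where
  "rigid_action = (\<lambda>(q, z) w. q * w + z)"

type_synonym 'a planar_pfa = "(complex, 'a, complex \<times> complex) equivariant_pfa"

definition locally_constant :: "(complex, 'a, 'm) pfa_scheme \<Rightarrow> bool" where
  "locally_constant F \<longleftrightarrow>
     (\<forall>z w (r::real) (R::ereal).
        let D = ball z r; D' = {\<zeta>. ereal (dist w \<zeta>) < R}
        in 0 < r \<and> ereal r < R \<and> D \<subseteq> D' \<longrightarrow>
             lcs_isomorphism (pf_space F D) (pf_space F D') (pf_ext F D D'))"


section \<open>Costalk, weights and holomorphic prefactorization algebras\<close>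

definition disk_weight :: "'a planar_pfa \<Rightarrow> real \<Rightarrow> int \<Rightarrow> 'a set" where
  "disk_weight F R \<Delta> = {a \<in> carrier (pf_space F (ball 0 R)).
     \<forall>q. cmod q = 1 \<longrightarrow> pf_sigma F (q, 0) (ball 0 R) a = (q powi \<Delta>) \<odot>\<^bsub>pf_space F (ball 0 R)\<^esub> a}"

definition costalk :: "'a planar_pfa \<Rightarrow> (complex, real \<Rightarrow> 'a) module" where
  "costalk F =
     \<lparr>carrier = {a \<in> \<Pi>\<^sub>E R\<in>{0<..}. carrier (pf_space F (ball 0 R)).
        \<forall>r R. 0 < r \<and> r < R \<longrightarrow> pf_ext F (ball 0 r) (ball 0 R) (a r) = a R},
      monoid.mult = undefined,
      one = undefined,
      zero = (\<lambda>R\<in>{0<..}. \<zero>\<^bsub>pf_space F (ball 0 R)\<^esub>),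
      add = (\<lambda>a b. \<lambda>R\<in>{0<..}. a R \<oplus>\<^bsub>pf_space F (ball 0 R)\<^esub> b R),
      smult = (\<lambda>c a. \<lambda>R\<in>{0<..}. c \<odot>\<^bsub>pf_space F (ball 0 R)\<^esub> a R)\<rparr>"

definition costalk_weight :: "'a planar_pfa \<Rightarrow> int \<Rightarrow> (complex, real \<Rightarrow> 'a) module" where
  "costalk_weight F \<Delta> =
     (costalk F)\<lparr>carrier := {a \<in> carrier (costalk F). \<forall>R>0. a R \<in> disk_weight F R \<Delta>}\<rparr>"

definition homogeneous :: "'a planar_pfa \<Rightarrow> (real \<Rightarrow> 'a) \<Rightarrow> bool" where
  "homogeneous F a \<longleftrightarrow> (\<exists>\<Delta>. a \<in> carrier (costalk_weight F \<Delta>))"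

definition conf :: "nat \<Rightarrow> complex set \<Rightarrow> (nat \<Rightarrow> complex) set" where
  "conf l E = {z \<in> {..<l} \<rightarrow>\<^sub>E E. inj_on z {..<l}}"

text \<open>
  The value of \<open>\<mu>\<close> at the pure tensor of \<open>a 0, \<dots>, a (l - 1)\<close>. Any admissible radius \<open>r\<close>
  yields the same value. The projection of the costalk element \<open>a i\<close> to the disk of
  radius \<open>r\<close> is \<open>a i r\<close>.
\<close>

definition mu ::
    "'a planar_pfa \<Rightarrow> nat \<Rightarrow> real \<Rightarrow> (nat \<Rightarrow> complex) \<Rightarrow> (nat \<Rightarrow> real \<Rightarrow> 'a) \<Rightarrow> 'a" where
  "mu F l R z a =
     (let r = (SOME r. 0 < r \<and> (\<forall>i<l. ball (z i) r \<subseteq> ball 0 R) \<and>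
                 disjoint_family_on (\<lambda>i. ball (z i) r) {..<l})
      in pf_multiprod F (\<lambda>i. ball (z i) r) l (ball 0 R)
           (\<lambda>i. pf_sigma F (1, z i) (ball 0 r) (a i r)))"

definition holomorphic_pfa :: "'a planar_pfa \<Rightarrow> bool" where
  "holomorphic_pfa F \<longleftrightarrow>
     (\<forall>r R \<Delta>. 0 < r \<and> r < R \<longrightarrow>
        bij_betw (pf_ext F (ball 0 r) (ball 0 R)) (disk_weight F r \<Delta>) (disk_weight F R \<Delta>)) \<and>
     (\<forall>R>0. \<exists>N. \<forall>\<Delta><N. disk_weight F R \<Delta> = {\<zero>\<^bsub>pf_space F (ball 0 R)\<^esub>}) \<and>
     (\<forall>R>0. quasi_complete (pf_space F (ball 0 R)) \<and>
        Hausdorff_space (lcs_topology (pf_space F (ball 0 R)))) \<and>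
     (\<forall>R>0. \<forall>l a. (\<forall>i<l. homogeneous F (a i)) \<longrightarrow>
        lcs_holomorphic_on (pf_space F (ball 0 R)) l (conf l (ball 0 R)) (\<lambda>z. mu F l R z a))"


section \<open>Vertex algebras\<close>

text \<open>\<open>va_mode A a n b\<close> is \<open>a\<^bsub>(n)\<^esub> b\<close>.\<close>

record 'v vertex_data =
  va_space :: "(complex, 'v) module"
  va_vacuum :: 'v
  va_transl :: "'v \<Rightarrow> 'v"
  va_mode :: "'v \<Rightarrow> int \<Rightarrow> 'v \<Rightarrow> 'v"

text \<open>The coefficient of \<open>z\<^bsup>m\<^esup>\<close> in \<open>Y(a,z) b\<close>.\<close>

definition va_field :: "('v, 'm) vertex_data_scheme \<Rightarrow> 'v \<Rightarrow> int \<Rightarrow> 'v \<Rightarrow> 'v" where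
  "va_field A a m b = va_mode A a (- m - 1) b"

text \<open>The coefficient of \<open>z\<^bsup>m\<^esup> w\<^bsup>n\<^esup>\<close> in \<open>[Y(a,z), Y(b,w)] c\<close>.\<close>

definition va_commutator ::
    "('v, 'm) vertex_data_scheme \<Rightarrow> 'v \<Rightarrow> 'v \<Rightarrow> 'v \<Rightarrow> int \<Rightarrow> int \<Rightarrow> 'v" where
  "va_commutator A a b c m n =
     va_field A a m (va_field A b n c) \<ominus>\<^bsub>va_space A\<^esub> va_field A b n (va_field A a m c)"

text \<open>Multiplication of a formal distribution in \<open>z, w\<close> by \<open>z - w\<close>.\<close>

definition mult_diff ::
    "(complex, 'v) module \<Rightarrow> (int \<Rightarrow> int \<Rightarrow> 'v) \<Rightarrow> int \<Rightarrow> int \<Rightarrow> 'v" where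
  "mult_diff V f m n = f (m - 1) n \<ominus>\<^bsub>V\<^esub> f m (n - 1)"

definition linear_on :: "(complex, 'v) module \<Rightarrow> ('v \<Rightarrow> 'v) \<Rightarrow> bool" where
  "linear_on V f \<longleftrightarrow> f \<in> carrier V \<rightarrow> carrier V \<and>
     (\<forall>x\<in>carrier V. \<forall>y\<in>carrier V. f (x \<oplus>\<^bsub>V\<^esub> y) = f x \<oplus>\<^bsub>V\<^esub> f y) \<and>
     (\<forall>c. \<forall>x\<in>carrier V. f (c \<odot>\<^bsub>V\<^esub> x) = c \<odot>\<^bsub>V\<^esub> f x)"

locale vertex_algebra =
  Module.module complex_ring "va_space A" for A :: "('v, 'm) vertex_data_scheme" +
  assumes vacuum_closed: "va_vacuum A \<in> carrier (va_space A)"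
    and transl_linear: "linear_on (va_space A) (va_transl A)"
    and mode_linear_right: "a \<in> carrier (va_space A) \<Longrightarrow> linear_on (va_space A) (va_mode A a n)"
    and mode_linear_left:
      "b \<in> carrier (va_space A) \<Longrightarrow> linear_on (va_space A) (\<lambda>a. va_mode A a n b)"
    and field: "\<lbrakk>a \<in> carrier (va_space A); b \<in> carrier (va_space A)\<rbrakk> \<Longrightarrow>
      \<exists>M. \<forall>m<M. va_field A a m b = \<zero>\<^bsub>va_space A\<^esub>"
    and field_vacuum: "b \<in> carrier (va_space A) \<Longrightarrow>
      va_field A (va_vacuum A) m b = (if m = 0 then b else \<zero>\<^bsub>va_space A\<^esub>)"
    and creation_regular: "\<lbrakk>a \<in> carrier (va_space A); m < 0\<rbrakk> \<Longrightarrow>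
      va_field A a m (va_vacuum A) = \<zero>\<^bsub>va_space A\<^esub>"
    and creation_constant: "a \<in> carrier (va_space A) \<Longrightarrow> va_field A a 0 (va_vacuum A) = a"
    and transl_vacuum: "va_transl A (va_vacuum A) = \<zero>\<^bsub>va_space A\<^esub>"
    and transl_covariance: "\<lbrakk>a \<in> carrier (va_space A); b \<in> carrier (va_space A)\<rbrakk> \<Longrightarrow>
      va_transl A (va_field A a m b) \<ominus>\<^bsub>va_space A\<^esub> va_field A a m (va_transl A b) =
      complex_of_int (m + 1) \<odot>\<^bsub>va_space A\<^esub> va_field A a (m + 1) b"
    and locality: "\<lbrakk>a \<in> carrier (va_space A); b \<in> carrier (va_space A)\<rbrakk> \<Longrightarrow>
      \<exists>N::nat. \<forall>c\<in>carrier (va_space A). \<forall>m n.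
        (mult_diff (va_space A) ^^ N) (va_commutator A a b c) m n = \<zero>\<^bsub>va_space A\<^esub>"

definition commutative_va :: "('v, 'm) vertex_data_scheme \<Rightarrow> bool" where
  "commutative_va A \<longleftrightarrow>
     (\<forall>a\<in>carrier (va_space A). \<forall>b\<in>carrier (va_space A). \<forall>c\<in>carrier (va_space A).
        \<forall>m n. va_commutator A a b c m n = \<zero>\<^bsub>va_space A\<^esub>)"

definition internal_direct_sum :: "(complex, 'v) module \<Rightarrow> (int \<Rightarrow> 'v set) \<Rightarrow> bool" where
  "internal_direct_sum V C \<longleftrightarrow> (\<forall>\<Delta>. submodule (C \<Delta>) complex_ring V) \<and>
     (\<forall>v\<in>carrier V. \<exists>!u. (\<forall>\<Delta>. u \<Delta> \<in> C \<Delta>) \<and> finite {\<Delta>. u \<Delta> \<noteq> \<zero>\<^bsub>V\<^esub>} \<and>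
        v = (\<Oplus>\<^bsub>V\<^esub>\<Delta>\<in>{\<Delta>. u \<Delta> \<noteq> \<zero>\<^bsub>V\<^esub>}. u \<Delta>))"

locale graded_vertex_algebra = vertex_algebra A
  for A :: "('v, 'm) vertex_data_scheme" and C :: "int \<Rightarrow> 'v set" +
  assumes grading: "internal_direct_sum (va_space A) C"
    and vacuum_weight: "va_vacuum A \<in> C 0"
    and mode_weight: "\<lbrakk>a \<in> C \<Delta>; b \<in> C \<Delta>'\<rbrakk> \<Longrightarrow> va_mode A a n b \<in> C (\<Delta> + \<Delta>' - n - 1)"


section \<open>The vertex algebra of a holomorphic prefactorization algebra\<close>

definition direct_sum :: "(int \<Rightarrow> (complex, 'v) module) \<Rightarrow> (complex, int \<Rightarrow> 'v) module" where
  "direct_sum M =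
     \<lparr>carrier = {v. (\<forall>\<Delta>. v \<Delta> \<in> carrier (M \<Delta>)) \<and> finite {\<Delta>. v \<Delta> \<noteq> \<zero>\<^bsub>M \<Delta>\<^esub>}},
      monoid.mult = undefined,
      one = undefined,
      zero = (\<lambda>\<Delta>. \<zero>\<^bsub>M \<Delta>\<^esub>),
      add = (\<lambda>v w \<Delta>. v \<Delta> \<oplus>\<^bsub>M \<Delta>\<^esub> w \<Delta>),
      smult = (\<lambda>c v \<Delta>. c \<odot>\<^bsub>M \<Delta>\<^esub> v \<Delta>)\<rparr>"

definition summand_incl :: "(int \<Rightarrow> (complex, 'v) module) \<Rightarrow> int \<Rightarrow> 'v \<Rightarrow> int \<Rightarrow> 'v" where
  "summand_incl M \<Delta> x = (\<lambda>\<Delta>'. if \<Delta>' = \<Delta> then x else \<zero>\<^bsub>M \<Delta>'\<^esub>)"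

definition vacuum_family :: "'a planar_pfa \<Rightarrow> real \<Rightarrow> 'a" where
  "vacuum_family F = (\<lambda>R\<in>{0<..}. pf_ext F {} (ball 0 R) (pf_unit F 1))"

definition mu1 :: "'a planar_pfa \<Rightarrow> real \<Rightarrow> (real \<Rightarrow> 'a) \<Rightarrow> complex \<Rightarrow> 'a" where
  "mu1 F R a z = mu F 1 R ((!) [z]) ((!) [a])"

text \<open>The two-point function with the second point at the origin.\<close>

definition mu2 :: "'a planar_pfa \<Rightarrow> real \<Rightarrow> (real \<Rightarrow> 'a) \<Rightarrow> (real \<Rightarrow> 'a) \<Rightarrow> complex \<Rightarrow> 'a" where
  "mu2 F R a b z = mu F 2 R ((!) [z, 0]) ((!) [a, b])"

definition transl_family :: "'a planar_pfa \<Rightarrow> (real \<Rightarrow> 'a) \<Rightarrow> real \<Rightarrow> 'a" where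
  "transl_family F a = (\<lambda>R\<in>{0<..}. lcs_derivative (pf_space F (ball 0 R)) (mu1 F R a) 0)"

definition mode_family ::
    "'a planar_pfa \<Rightarrow> (real \<Rightarrow> 'a) \<Rightarrow> int \<Rightarrow> (real \<Rightarrow> 'a) \<Rightarrow> real \<Rightarrow> 'a" where
  "mode_family F a n b =
     (\<lambda>R\<in>{0<..}. lcs_laurent_coeff (pf_space F (ball 0 R)) R (mu2 F R a b) n)"

text \<open>
  The operations are the (bi)linear extensions of those on homogeneous elements. The
  translation operator raises weights by 1, and the mode \<open>n\<close> product of weights \<open>i\<close> and \<open>j\<close> has
  weight \<open>i + j - n - 1\<close>.
\<close>

definition vertex_algebra_of :: "'a planar_pfa \<Rightarrow> (int \<Rightarrow> real \<Rightarrow> 'a) vertex_data" where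
  "vertex_algebra_of F =
     \<lparr>va_space = direct_sum (costalk_weight F),
      va_vacuum = summand_incl (costalk_weight F) 0 (vacuum_family F),
      va_transl = (\<lambda>v \<Delta>. transl_family F (v (\<Delta> - 1))),
      va_mode = (\<lambda>u n v \<Delta>.
        \<Oplus>\<^bsub>costalk_weight F \<Delta>\<^esub>i\<in>{i. u i \<noteq> \<zero>\<^bsub>costalk_weight F i\<^esub>}.
          mode_family F (u i) n (v (\<Delta> + n + 1 - i)))\<rparr>"

definition weight_component :: "'a planar_pfa \<Rightarrow> int \<Rightarrow> (int \<Rightarrow> real \<Rightarrow> 'a) set" where
  "weight_component F \<Delta> = summand_incl (costalk_weight F) \<Delta> ` carrier (costalk_weight F \<Delta>)"

end

theory Submission
  imports Defs "HOL-Complex_Analysis.Complex_Analysis"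
begin

text \<open>
  Continuous functionals separate the points of the spaces \<open>F (ball 0 R)\<close> by Hahn--Banach, so every
  identity reduces to one for scalar holomorphic functions. Quasi-completeness is needed only for the
  existence of Laurent coefficients: averages over roots of unity converge to them, and these
  averages are finite sums of values of the function.

  The modes of \<open>a\<close> and \<open>b\<close> have weight \<open>\<Delta> + \<Delta>' - n - 1\<close> by rotation equivariance, so they vanish for
  large \<open>n\<close> because weights are bounded below. Translation covariance is the chain rule for
  \<open>t \<mapsto> \<mu>(z + t, t)\<close>. For locality, the iterated fields are the expansions of the three-point
  function \<open>\<mu>(z, w, 0)\<close> in \<open>\<bar>w\<bar> < \<bar>z\<bar>\<close> and \<open>\<bar>z\<bar> < \<bar>w\<bar>\<close>. Associativity of the factorization products
  bounds the pole on the diagonal by the order \<open>N\<close> of the two-point function, so after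
  multiplication by \<open>(z - w) ^ N\<close> the two expansions have the same coefficients. If \<open>F\<close> is locally
  constant, the first insertion can be moved freely, the two-point function extends over
  \<open>z = 0\<close>, and one may take \<open>N = 0\<close>.
\<close>

section \<open>Complex vector spaces with explicit carriers\<close>

text \<open>Most identities rest on pulling functionals back. Structure maps are continuous, and so
  is a product with one factor fixed; a functional on \<open>disk 0 R\<close> composed with such a
  map is a functional on a smaller disk, to which the one- and two-point theory applies unchanged.
  The derivative of the two-point function in its second point, the inner expansion of the
  three-point function and its pole on the diagonal all arise in this way, the remaining insertions
  being absorbed into the functional. This is what gives locality an exponent \<open>N\<close> valid
  for every third vector.

  The obstacle is that scalar identities recognise a vector but do not produce it. For the Laurent
  coefficients the scalar estimates therefore have to be uniform over all functionals dominated by a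
  given seminorm.

  Holomorphy is available for homogeneous insertions only. Iterated modes stay within reach because
  a mode of homogeneous elements is homogeneous again; the passage to the direct sum is purely
  algebraic.\<close>

lemma complex_ring_simps [simp]:
  "carrier complex_ring = UNIV" "x \<otimes>\<^bsub>complex_ring\<^esub> y = x * y" "\<one>\<^bsub>complex_ring\<^esub> = 1"
  "x \<oplus>\<^bsub>complex_ring\<^esub> y = x + y" "\<zero>\<^bsub>complex_ring\<^esub> = 0"
  by (simp_all add: ring_of_type_algebra_def)

locale complex_space = Module.module complex_ring E
  for E :: "(complex, 'a, 'm) module_scheme" (structure)
begin

lemma scale_closed [simp, intro]: "x \<in> carrier E \<Longrightarrow> c \<odot> x \<in> carrier E"
  using smult_closed by simp

lemma scale_add_left: "x \<in> carrier E \<Longrightarrow> (c + d) \<odot> x = c \<odot> x \<oplus> d \<odot> x"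
  using smult_l_distr[of c d x] by simp

lemma scale_add_right: "x \<in> carrier E \<Longrightarrow> y \<in> carrier E \<Longrightarrow> c \<odot> (x \<oplus> y) = c \<odot> x \<oplus> c \<odot> y"
  using smult_r_distr[of c x y] by simp

lemma scale_scale: "x \<in> carrier E \<Longrightarrow> c \<odot> (d \<odot> x) = (c * d) \<odot> x"
  using smult_assoc1[of c d x] by simp

lemma scale_one [simp]: "x \<in> carrier E \<Longrightarrow> 1 \<odot> x = x"
  using smult_one[of x] by simp

lemma scale_zero_left [simp]: "x \<in> carrier E \<Longrightarrow> 0 \<odot> x = \<zero>"
  using smult_l_null[of x] by simp

lemma scale_zero_right [simp]: "c \<odot> \<zero> = \<zero>"
  using smult_r_null[of c] by simp

lemma minus_eq_scale: "x \<in> carrier E \<Longrightarrow> \<ominus> x = (-1) \<odot> x"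
proof -
  assume x: "x \<in> carrier E"
  have "(1 + (-1)) \<odot> x = x \<oplus> (-1) \<odot> x"
    using x scale_add_left[OF x, of 1 "-1"] by simp
  then have "(-1) \<odot> x \<oplus> x = \<zero>"
    using scale_add_left[OF x, of "-1" 1] scale_one[OF x] scale_zero_left[OF x] by simp
  then show ?thesis by (rule M.minus_equality[OF _ x]) (rule scale_closed[OF x])
qed

lemma diff_eq_scale: "x \<in> carrier E \<Longrightarrow> y \<in> carrier E \<Longrightarrow> x \<ominus> y = x \<oplus> (-1) \<odot> y"
  by (simp add: a_minus_def minus_eq_scale)

lemma diff_self [simp]: "x \<in> carrier E \<Longrightarrow> x \<ominus> x = \<zero>"
  by (simp add: a_minus_def r_neg)

lemma diff_zero [simp]: "x \<in> carrier E \<Longrightarrow> x \<ominus> \<zero> = x"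
  by (simp add: a_minus_def)

lemma scale_diff: "x \<in> carrier E \<Longrightarrow> y \<in> carrier E \<Longrightarrow> c \<odot> (x \<ominus> y) = c \<odot> x \<ominus> c \<odot> y"
  by (simp add: diff_eq_scale scale_add_right scale_scale)

lemma diff_add_cancel: "x \<in> carrier E \<Longrightarrow> y \<in> carrier E \<Longrightarrow> y \<oplus> (x \<ominus> y) = x"
  by (metis a_assoc a_comm a_inv_closed a_minus_def l_neg minus_closed r_zero)

lemma diff_eq_zero_iff: "x \<in> carrier E \<Longrightarrow> y \<in> carrier E \<Longrightarrow> x \<ominus> y = \<zero> \<longleftrightarrow> x = y"
  using diff_add_cancel[of x y] by auto

lemma scale_add_swap:
  "\<lbrakk>a \<in> carrier E; b \<in> carrier E; c \<in> carrier E; d \<in> carrier E\<rbrakk> \<Longrightarrow>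
     (a \<oplus> b) \<oplus> (c \<oplus> d) = (a \<oplus> c) \<oplus> (b \<oplus> d)"
  by (simp add: a_ac)

end


section \<open>The Hahn--Banach theorem\<close>

text \<open>
  A sublinear functional that is minimal in the pointwise order is linear: its infimal
  convolution with the ray through \<open>x\<close> is sublinear and smaller, hence equal to it, so that the
  functional is odd.
\<close>

context complex_space
begin

definition sublinear :: "('a \<Rightarrow> real) \<Rightarrow> bool" where
  "sublinear q \<longleftrightarrow> (\<forall>x\<in>carrier E. \<forall>y\<in>carrier E. q (x \<oplus> y) \<le> q x + q y) \<and>
     (\<forall>t\<ge>0. \<forall>x\<in>carrier E. q (complex_of_real t \<odot> x) = t * q x)"

text \<open>The largest sublinear functional below \<open>q\<close> with value at most
  \<open>- q x\<close> at \<open>-x\<close>: if \<open>g\<close> is one, then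
  \<open>g y \<le> g (y + t x) + t g (-x) \<le> q (y + t x) - t q x\<close>.\<close>

definition lower_along :: "('a \<Rightarrow> real) \<Rightarrow> 'a \<Rightarrow> 'a \<Rightarrow> real" where
  "lower_along q x y = (INF t\<in>{0..}. q (y \<oplus> complex_of_real t \<odot> x) - t * q x)"

lemma sublinearD:
  assumes "sublinear q"
  shows "x \<in> carrier E \<Longrightarrow> y \<in> carrier E \<Longrightarrow> q (x \<oplus> y) \<le> q x + q y"
    and "t \<ge> 0 \<Longrightarrow> x \<in> carrier E \<Longrightarrow> q (complex_of_real t \<odot> x) = t * q x"
  using assms by (auto simp: sublinear_def)

lemma sublinear_zero: "sublinear q \<Longrightarrow> q \<zero> = 0"
  using sublinearD(2)[of q 0 \<zero>] by simp

lemma sublinear_minus: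
  assumes "sublinear q" "x \<in> carrier E"
  shows "- q ((-1) \<odot> x) \<le> q x"
proof -
  have "x \<oplus> (-1) \<odot> x = \<zero>" using assms(2) by (metis diff_eq_scale diff_self)
  with sublinearD(1)[OF assms(1), of x "(-1) \<odot> x"] assms sublinear_zero[OF assms(1)]
  show ?thesis by simp
qed

text \<open>Writing \<open>t x\<close> as \<open>(y + t x) - y\<close> gives a lower bound free of
  \<open>t\<close>, so the infimum in \<open>lower_along\<close> is taken over a set bounded
  below.\<close>

lemma lower_along_bound:
  assumes q: "sublinear q" and [simp]: "x \<in> carrier E" "y \<in> carrier E" and t: "t \<ge> 0"
  shows "- q ((-1) \<odot> y) \<le> q (y \<oplus> complex_of_real t \<odot> x) - t * q x"
proof -
  have "complex_of_real t \<odot> x = (y \<oplus> complex_of_real t \<odot> x) \<oplus> (-1) \<odot> y"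
    by (metis \<open>x \<in> carrier E\<close> \<open>y \<in> carrier E\<close> a_assoc a_comm add.m_closed diff_eq_scale
        diff_self r_zero scale_closed)
  then have "t * q x = q ((y \<oplus> complex_of_real t \<odot> x) \<oplus> (-1) \<odot> y)"
    using sublinearD(2)[OF q t, of x] by simp
  also have "\<dots> \<le> q (y \<oplus> complex_of_real t \<odot> x) + q ((-1) \<odot> y)"
    by (rule sublinearD(1)[OF q]) auto
  finally show ?thesis by simp
qed

lemma lower_along_le:
  assumes q: "sublinear q" and [simp]: "x \<in> carrier E" "y \<in> carrier E" and t: "t \<ge> 0"
  shows "lower_along q x y \<le> q (y \<oplus> complex_of_real t \<odot> x) - t * q x"
  unfolding lower_along_def
  by (rule cINF_lower)
    (use t lower_along_bound[OF q] in \<open>auto intro!: bdd_belowI2[where m="- q ((-1) \<odot> y)"]\<close>)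

lemma lower_along_le_self:
  assumes q: "sublinear q" and [simp]: "x \<in> carrier E" "y \<in> carrier E"
  shows "lower_along q x y \<le> q y"
  using lower_along_le[OF assms, of 0] by simp

lemma lower_along_sublinear:
  assumes q: "sublinear q" and [simp]: "x \<in> carrier E"
  shows "sublinear (lower_along q x)"
  unfolding sublinear_def
proof (intro conjI ballI allI impI)
  fix y z assume [simp]: "y \<in> carrier E" "z \<in> carrier E"
  have *: "lower_along q x (y \<oplus> z) \<le> (q (y \<oplus> complex_of_real s \<odot> x) - s * q x)
      + (q (z \<oplus> complex_of_real t \<odot> x) - t * q x)" if "s \<ge> 0" "t \<ge> 0" for s t
  proof -
    have "lower_along q x (y \<oplus> z) \<le> q (y \<oplus> z \<oplus> complex_of_real (s + t) \<odot> x) - (s + t) * q x"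
      by (rule lower_along_le[OF q]) (use that in auto)
    also have "y \<oplus> z \<oplus> complex_of_real (s + t) \<odot> x
        = (y \<oplus> complex_of_real s \<odot> x) \<oplus> (z \<oplus> complex_of_real t \<odot> x)"
      by (simp add: scale_add_left scale_add_swap)
    also have "q \<dots> \<le> q (y \<oplus> complex_of_real s \<odot> x) + q (z \<oplus> complex_of_real t \<odot> x)"
      by (rule sublinearD(1)[OF q]) auto
    finally show ?thesis by (simp add: algebra_simps)
  qed
  have "lower_along q x (y \<oplus> z) - (q (y \<oplus> complex_of_real s \<odot> x) - s * q x) \<le> lower_along q x z"
    if "s \<ge> 0" for s
    unfolding lower_along_def[of q x z]
    by (rule cINF_greatest) (use *[OF that] in \<open>auto simp: algebra_simps\<close>)
  then have "lower_along q x (y \<oplus> z) - lower_along q x z \<le> lower_along q x y"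
    unfolding lower_along_def[of q x y]
    by (intro cINF_greatest) (auto simp: algebra_simps)
  then show "lower_along q x (y \<oplus> z) \<le> lower_along q x y + lower_along q x z" by simp
next
  \<comment> \<open>One inequality is enough: the reverse one is this inequality with
    \<open>1 / s\<close> in place of \<open>s\<close> and \<open>s y\<close> in place of
    \<open>y\<close>.\<close>
  have le: "lower_along q x (complex_of_real s \<odot> y) \<le> s * lower_along q x y"
    if s: "s > 0" and [simp]: "y \<in> carrier E" for s y
  proof -
    have "lower_along q x (complex_of_real s \<odot> y) / s
        \<le> q (y \<oplus> complex_of_real t \<odot> x) - t * q x" if "t \<ge> 0" for t
    proof -
      have "lower_along q x (complex_of_real s \<odot> y) \<le>
         q (complex_of_real s \<odot> y \<oplus> complex_of_real (s * t) \<odot> x) - (s * t) * q x"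
        by (rule lower_along_le[OF q]) (use that s in auto)
      also have "complex_of_real s \<odot> y \<oplus> complex_of_real (s * t) \<odot> x
         = complex_of_real s \<odot> (y \<oplus> complex_of_real t \<odot> x)"
        by (simp add: scale_add_right scale_scale)
      also have "q \<dots> = s * q (y \<oplus> complex_of_real t \<odot> x)"
        using s by (intro sublinearD(2)[OF q]) auto
      also have "\<dots> - (s * t) * q x = (q (y \<oplus> complex_of_real t \<odot> x) - t * q x) * s"
        by (simp add: Rings.left_diff_distrib Rings.right_diff_distrib mult_ac)
      finally show ?thesis unfolding pos_divide_le_eq[OF s] .
    qed
    then have "lower_along q x (complex_of_real s \<odot> y) / s \<le> lower_along q x y"
      unfolding lower_along_def[of q x y] by (intro cINF_greatest) auto
    then show ?thesis using s by (simp add: field_simps)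
  qed
  fix s :: real and y assume s: "s \<ge> 0" and [simp]: "y \<in> carrier E"
  show "lower_along q x (complex_of_real s \<odot> y) = s * lower_along q x y"
  proof (cases "s = 0")
    case True
    have "lower_along q x \<zero> \<le> 0"
      using lower_along_le_self[OF q, of x \<zero>] sublinear_zero[OF q] by simp
    moreover have "0 \<le> lower_along q x \<zero>"
      unfolding lower_along_def by (intro cINF_greatest) (auto simp: sublinearD(2)[OF q])
    ultimately show ?thesis using True by simp
  next
    case False
    then have s: "s > 0" using s by simp
    have "lower_along q x (complex_of_real (1 / s) \<odot> (complex_of_real s \<odot> y))
       \<le> (1 / s) * lower_along q x (complex_of_real s \<odot> y)"
      by (rule le) (use s in auto)
    moreover have "complex_of_real (1 / s) \<odot> (complex_of_real s \<odot> y) = y"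
      using s by (simp add: scale_scale)
    ultimately have "s * lower_along q x y \<le> lower_along q x (complex_of_real s \<odot> y)"
      using s by (simp add: field_simps)
    with le[OF s, of y] show ?thesis by simp
  qed
qed

text \<open>Zorn's lemma for the pointwise order, reversed so that a maximal element is a pointwise
  minimal functional. Chains are bounded because every member satisfies
  \<open>- p (-x) \<le> q x\<close>, which makes the pointwise infimum finite.\<close>

lemma minimal_sublinear_exists:
  assumes p: "sublinear p"
  obtains f where "sublinear f" "\<And>x. x \<in> carrier E \<Longrightarrow> f x \<le> p x"
    "\<And>q x. sublinear q \<Longrightarrow> (\<And>y. y \<in> carrier E \<Longrightarrow> q y \<le> f y) \<Longrightarrow> x \<in> carrier E \<Longrightarrow> q x = f x"
proof -
  \<comment> \<open>Values off the carrier are pinned to 0: the order compares whole functions, and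
    a competitor that is smaller on the carrier can then be cut off to a comparable one.\<close>
  define A where "A = {q. sublinear q \<and> (\<forall>x\<in>carrier E. q x \<le> p x) \<and> (\<forall>x. x \<notin> carrier E \<longrightarrow> q x = 0)}"
  define r where "r = relation_of (\<lambda>q u::'a \<Rightarrow> real. \<forall>x. u x \<le> q x) A"
  define cut where "cut = (\<lambda>q::'a \<Rightarrow> real. \<lambda>x. if x \<in> carrier E then q x else 0)"
  have cut: "sublinear (cut q)" if "sublinear q" for q
    using that by (simp add: sublinear_def cut_def)
  have po: "partial_order_on A r"
    unfolding r_def by (rule partial_order_on_relation_ofI) (auto intro: order_trans intro!: ext antisym)
  have bound: "- p ((-1) \<odot> x) \<le> q x" if "q \<in> A" "x \<in> carrier E" for q x
  proof -
    have "- q ((-1) \<odot> x) \<le> q x" using that sublinear_minus by (auto simp: A_def)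
    moreover have "q ((-1) \<odot> x) \<le> p ((-1) \<odot> x)" using that by (auto simp: A_def)
    ultimately show ?thesis by linarith
  qed
  have "\<exists>u\<in>A. \<forall>q\<in>C. \<forall>x. u x \<le> q x" if C: "C \<in> Chains r" for C
  proof (cases "C = {}")
    case True
    then show ?thesis using cut[OF p] by (intro bexI[of _ "cut p"]) (auto simp: A_def cut_def)
  next
    case False
    have CA: "C \<subseteq> A" using C by (auto simp: Chains_def r_def relation_of_def)
    have chain: "(\<forall>x. a x \<le> b x) \<or> (\<forall>x. b x \<le> a x)" if "a \<in> C" "b \<in> C" for a b
      using C that by (auto simp: Chains_def r_def relation_of_def)
    define u where "u = cut (\<lambda>x. INF q\<in>C. q x)"
    have u_le: "u x \<le> q x" if "q \<in> C" "x \<in> carrier E" for q x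
      unfolding u_def cut_def using that CA bound
      by (auto intro!: cINF_lower bdd_belowI2[where m="- p ((-1) \<odot> x)"])
    have u_ge: "m \<le> u x" if "x \<in> carrier E" "\<And>q. q \<in> C \<Longrightarrow> m \<le> q x" for m x
      unfolding u_def cut_def using that False by (auto intro!: cINF_greatest)
    have "sublinear u"
      unfolding sublinear_def
    proof (intro conjI ballI allI impI)
      fix x y assume xy [simp]: "x \<in> carrier E" "y \<in> carrier E"
      \<comment> \<open>The smaller of two chain members bounds both summands at once; this is where
        comparability in the chain enters.\<close>
      have *: "u (x \<oplus> y) \<le> a x + b y" if ab: "a \<in> C" "b \<in> C" for a b
      proof -
        obtain c where c: "c \<in> C" "c x \<le> a x" "c y \<le> b y" using chain[OF ab] ab by blast
        have "u (x \<oplus> y) \<le> c (x \<oplus> y)" using c by (intro u_le) auto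
        also have "\<dots> \<le> c x + c y" using c CA by (intro sublinearD) (auto simp: A_def)
        finally show ?thesis using c by linarith
      qed
      have "u (x \<oplus> y) - a x \<le> u y" if "a \<in> C" for a
        using *[OF that] by (intro u_ge) (auto simp: algebra_simps)
      then have "u (x \<oplus> y) - u y \<le> u x" by (intro u_ge) (auto simp: algebra_simps)
      then show "u (x \<oplus> y) \<le> u x + u y" by simp
    next
      fix t :: real and x assume t: "t \<ge> 0" and x [simp]: "x \<in> carrier E"
      have hom: "q (complex_of_real t \<odot> x) = t * q x" if "q \<in> C" for q
        using that CA t by (intro sublinearD) (auto simp: A_def)
      show "u (complex_of_real t \<odot> x) = t * u x"
      proof (rule antisym)
        show "t * u x \<le> u (complex_of_real t \<odot> x)"
        proof -
          have "t * u x \<le> q (complex_of_real t \<odot> x)" if "q \<in> C" for q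
            unfolding hom[OF that] using u_le[OF that x] t by (rule mult_left_mono)
          then show ?thesis by (intro u_ge) auto
        qed
        show "u (complex_of_real t \<odot> x) \<le> t * u x"
        proof (cases "t = 0")
          case True
          obtain q where "q \<in> C" using False by auto
          then show ?thesis using u_le[of q "complex_of_real t \<odot> x"] hom[of q] True by auto
        next
          case False
          then have "u (complex_of_real t \<odot> x) / t \<le> u x"
            using hom t u_le[of _ "complex_of_real t \<odot> x"] by (intro u_ge) (auto simp: field_simps)
          then show ?thesis using t False by (simp add: field_simps)
        qed
      qed
    qed
    moreover have "u x \<le> p x" if "x \<in> carrier E" for x
    proof -
      obtain q where q: "q \<in> C" using False by auto
      then have "q x \<le> p x" using CA that by (auto simp: A_def)
      with u_le[OF q that] show ?thesis by linarith
    qed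
    ultimately have "u \<in> A" by (auto simp: A_def u_def cut_def)
    moreover have "u x \<le> q x" if "q \<in> C" for q x
    proof (cases "x \<in> carrier E")
      case True then show ?thesis using u_le that by auto
    next
      case False then show ?thesis using that CA by (auto simp: A_def u_def cut_def)
    qed
    ultimately show ?thesis by blast
  qed
  then obtain f where f: "f \<in> A" "\<And>q. q \<in> A \<Longrightarrow> (\<forall>x. q x \<le> f x) \<Longrightarrow> q = f"
    using predicate_Zorn[OF po[unfolded r_def]] unfolding r_def by blast
  show ?thesis
  proof (rule that[of f])
    show "f x \<le> p x" if "x \<in> carrier E" for x using f(1) that by (auto simp: A_def)
    show "sublinear f" using f(1) by (auto simp: A_def)
    fix q x assume q: "sublinear q" "\<And>y. y \<in> carrier E \<Longrightarrow> q y \<le> f y" and x: "x \<in> carrier E"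
    have "cut q \<in> A" using cut[OF q(1)] q(2) f(1) by (fastforce simp: A_def cut_def)
    moreover have "cut q y \<le> f y" for y using q(2) f(1) by (auto simp: A_def cut_def)
    ultimately have "cut q = f" using f(2) by blast
    then show "q x = f x" using x by (auto simp: cut_def)
  qed
qed

text \<open>The minimal functional is taken below \<open>lower_along p x\<close> instead of
  \<open>p\<close>. This forces \<open>f (-x) \<le> - p x\<close>, and once \<open>f\<close> is
  known to be odd it reads \<open>p x \<le> f x\<close>, which gives equality at the prescribed
  point.\<close>

lemma real_hahn_banach:
  assumes p: "sublinear p" and x: "x \<in> carrier E"
  obtains f where "\<And>y z. y \<in> carrier E \<Longrightarrow> z \<in> carrier E \<Longrightarrow> f (y \<oplus> z) = f y + (f z :: real)"
    "\<And>t y. y \<in> carrier E \<Longrightarrow> f (complex_of_real t \<odot> y) = t * f y"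
    "\<And>y. y \<in> carrier E \<Longrightarrow> f y \<le> p y" "f x = p x"
proof -
  obtain f where f: "sublinear f" "\<And>y. y \<in> carrier E \<Longrightarrow> f y \<le> lower_along p x y"
    and min: "\<And>q y. sublinear q \<Longrightarrow> (\<And>y. y \<in> carrier E \<Longrightarrow> q y \<le> f y) \<Longrightarrow> y \<in> carrier E \<Longrightarrow> q y = f y"
    using minimal_sublinear_exists[OF lower_along_sublinear[OF p x]] by blast
  have odd: "f ((-1) \<odot> y) = - f y" if [simp]: "y \<in> carrier E" for y
  proof -
    have "f ((-1) \<odot> y) = lower_along f y ((-1) \<odot> y)"
      using min[OF lower_along_sublinear[OF f(1)], of y] lower_along_le_self[OF f(1)] by simp
    also have "\<dots> \<le> f ((-1) \<odot> y \<oplus> complex_of_real 1 \<odot> y) - 1 * f y"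
      by (rule lower_along_le[OF f(1)]) auto
    also have "(-1) \<odot> y \<oplus> complex_of_real 1 \<odot> y = \<zero>"
      using scale_add_left[of y "-1" 1] by simp
    finally have "f ((-1) \<odot> y) \<le> - f y" using sublinear_zero[OF f(1)] by simp
    with sublinear_minus[OF f(1), of y] show ?thesis by simp
  qed
  have add: "f (y \<oplus> z) = f y + f z" if [simp]: "y \<in> carrier E" "z \<in> carrier E" for y z
  proof (rule antisym)
    have "f ((-1) \<odot> (y \<oplus> z)) \<le> f ((-1) \<odot> y) + f ((-1) \<odot> z)"
      unfolding scale_add_right[OF that] by (rule sublinearD[OF f(1)]) auto
    then show "f y + f z \<le> f (y \<oplus> z)" by (simp add: odd)
  qed (rule sublinearD(1)[OF f(1) that])
  have hom: "f (complex_of_real t \<odot> y) = t * f y" if [simp]: "y \<in> carrier E" for t y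
  proof (cases "t \<ge> 0")
    case False
    have "f (complex_of_real t \<odot> y) = f ((-1) \<odot> (complex_of_real (-t) \<odot> y))"
      by (simp add: scale_scale)
    also have "\<dots> = - (-t * f y)"
      using False sublinearD(2)[OF f(1), of "-t" y] by (subst odd) auto
    finally show ?thesis by simp
  qed (use sublinearD(2)[OF f(1)] in auto)
  have le: "f y \<le> p y" if "y \<in> carrier E" for y
    using f(2)[OF that] lower_along_le_self[OF p x that] by linarith
  have "f ((-1) \<odot> x) \<le> p ((-1) \<odot> x \<oplus> complex_of_real 1 \<odot> x) - 1 * p x"
    using f(2)[of "(-1) \<odot> x"] lower_along_le[OF p x, of "(-1) \<odot> x" 1] x by simp
  also have "(-1) \<odot> x \<oplus> complex_of_real 1 \<odot> x = \<zero>"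
    using scale_add_left[of x "-1" 1] x by simp
  finally have "p x \<le> f x" using sublinear_zero[OF p] odd[OF x] by simp
  then have "f x = p x" using le[OF x] by simp
  show ?thesis by (rule that[of f]) (fact add hom le \<open>f x = p x\<close>)+
qed

text \<open>The complex functional with real part \<open>f\<close> is \<open>f y - i f (i y)\<close>.\<close>

lemma hahn_banach:
  assumes add: "\<And>x y. x \<in> carrier E \<Longrightarrow> y \<in> carrier E \<Longrightarrow> p (x \<oplus> y) \<le> p x + p y"
    and hom: "\<And>c x. x \<in> carrier E \<Longrightarrow> p (c \<odot> x) = cmod c * p x"
    and x: "x \<in> carrier E"
  obtains \<phi> where "\<And>y z. y \<in> carrier E \<Longrightarrow> z \<in> carrier E \<Longrightarrow> \<phi> (y \<oplus> z) = \<phi> y + \<phi> z"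
    "\<And>c y. y \<in> carrier E \<Longrightarrow> \<phi> (c \<odot> y) = c * \<phi> y"
    "\<And>y. y \<in> carrier E \<Longrightarrow> cmod (\<phi> y) \<le> p y" "\<phi> x = complex_of_real (p x)"
proof -
  have "sublinear p" by (auto simp: sublinear_def add hom)
  from real_hahn_banach[OF this x] obtain f where
    fadd: "\<And>y z. y \<in> carrier E \<Longrightarrow> z \<in> carrier E \<Longrightarrow> f (y \<oplus> z) = f y + f z"
    and fhom: "\<And>t y. y \<in> carrier E \<Longrightarrow> f (complex_of_real t \<odot> y) = t * f y"
    and fle: "\<And>y. y \<in> carrier E \<Longrightarrow> f y \<le> p y" and fx: "f x = p x" by metis
  define \<phi> where "\<phi> = (\<lambda>y. Complex (f y) (- f (\<i> \<odot> y)))"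
  have padd: "\<phi> (y \<oplus> z) = \<phi> y + \<phi> z" if "y \<in> carrier E" "z \<in> carrier E" for y z
    using that by (simp add: \<phi>_def fadd scale_add_right complex_eq_iff)
  have phom: "\<phi> (c \<odot> y) = c * \<phi> y" if [simp]: "y \<in> carrier E" for c y
  proof -
    have split: "f (c \<odot> y) = Re c * f y + Im c * f (\<i> \<odot> y)" for c
    proof -
      have "c \<odot> y = (complex_of_real (Re c) + complex_of_real (Im c) * \<i>) \<odot> y"
        by (metis complex_eq mult.commute)
      also have "\<dots> = complex_of_real (Re c) \<odot> y \<oplus> complex_of_real (Im c) \<odot> (\<i> \<odot> y)"
        by (simp add: scale_add_left scale_scale)
      finally show ?thesis by (simp add: fadd fhom)
    qed
    have "\<i> \<odot> (c \<odot> y) = (\<i> * c) \<odot> y" by (simp add: scale_scale)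
    then show ?thesis using split[of c] split[of "\<i> * c"]
      by (simp add: \<phi>_def complex_eq_iff algebra_simps)
  qed
  have ple: "cmod (\<phi> y) \<le> p y" if [simp]: "y \<in> carrier E" for y
  proof (cases "\<phi> y = 0")
    case True
    have "p (y \<oplus> (-1) \<odot> y) = 0" using hom[of \<zero> 0] by (simp flip: diff_eq_scale)
    then have "0 \<le> p y" using add[of y "(-1) \<odot> y"] hom[of y "-1"] by simp
    then show ?thesis using True by simp
  next
    case False
    \<comment> \<open>A unimodular factor that makes \<open>\<phi> (c y)\<close> real and equal to
      \<open>cmod (\<phi> y)\<close>, so that the bound on the real part \<open>f\<close> becomes a
      bound on the modulus.\<close>
    define c where "c = cnj (\<phi> y) / cmod (\<phi> y)"
    have c: "cmod c = 1" using False by (simp add: c_def norm_divide)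
    have "\<phi> (c \<odot> y) = cmod (\<phi> y)"
      using False by (simp add: phom c_def complex_norm_square[symmetric, unfolded power2_eq_square] field_simps flip: of_real_mult)
    then have "f (c \<odot> y) = cmod (\<phi> y)" by (simp add: \<phi>_def complex_eq_iff)
    then show ?thesis using fle[of "c \<odot> y"] hom[of y c] c by simp
  qed
  \<comment> \<open>The real part alone already attains the bound on the modulus, which leaves
    nothing for the imaginary part.\<close>
  have "\<phi> x = complex_of_real (p x)"
  proof -
    have "Re (\<phi> x) = p x" by (simp add: \<phi>_def fx)
    moreover have "cmod (\<phi> x) \<le> p x" using ple x by simp
    ultimately have "Im (\<phi> x) = 0"
      by (metis cmod_power2 abs_Re_le_cmod abs_ge_self antisym add_cancel_left_right zero_eq_power2 order_trans)
    then show ?thesis using \<open>Re (\<phi> x) = p x\<close> by (simp add: complex_eq_iff)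
  qed
  show ?thesis by (rule that[of \<phi>]) (fact padd phom ple \<open>\<phi> x = p x\<close>)+
qed

end

section \<open>Continuous seminorms and the dual space\<close>

text \<open>Continuity is demanded at the origin and spreads to other points by subadditivity;
  nonnegativity follows from the first two clauses.\<close>

definition cts_seminorm :: "('a, 'm) lcs_scheme \<Rightarrow> ('a \<Rightarrow> real) \<Rightarrow> bool" where
  "cts_seminorm E p \<longleftrightarrow>
     (\<forall>x\<in>carrier E. \<forall>y\<in>carrier E. p (x \<oplus>\<^bsub>E\<^esub> y) \<le> p x + p y) \<and>
     (\<forall>c. \<forall>x\<in>carrier E. p (c \<odot>\<^bsub>E\<^esub> x) = cmod c * p x) \<and>
     (\<forall>e>0. \<exists>W. openin (lcs_topology E) W \<and> \<zero>\<^bsub>E\<^esub> \<in> W \<and> (\<forall>x\<in>W. p x < e))"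

abbreviation lcs_dual :: "('a, 'm) lcs_scheme \<Rightarrow> ('a \<Rightarrow> complex) set" where
  "lcs_dual E \<equiv> lcs_hom E complex_lcs"

lemma lcs_homD:
  assumes "f \<in> lcs_hom E E'"
  shows lcs_hom_closed: "x \<in> carrier E \<Longrightarrow> f x \<in> carrier E'"
    and lcs_hom_add: "x \<in> carrier E \<Longrightarrow> y \<in> carrier E \<Longrightarrow> f (x \<oplus>\<^bsub>E\<^esub> y) = f x \<oplus>\<^bsub>E'\<^esub> f y"
    and lcs_hom_scale: "x \<in> carrier E \<Longrightarrow> f (c \<odot>\<^bsub>E\<^esub> x) = c \<odot>\<^bsub>E'\<^esub> f x"
    and lcs_hom_continuous: "continuous_map (lcs_topology E) (lcs_topology E') f"
  using assms by (auto simp: lcs_hom_def)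

lemma lcs_hom_compose:
  "f \<in> lcs_hom E E' \<Longrightarrow> g \<in> lcs_hom E' E'' \<Longrightarrow> (\<lambda>x. g (f x)) \<in> lcs_hom E E''"
  unfolding lcs_hom_def by (auto simp: Pi_iff intro: continuous_map_compose[unfolded o_def])

lemma lcs_dual_add:
  "\<phi> \<in> lcs_dual E \<Longrightarrow> x \<in> carrier E \<Longrightarrow> y \<in> carrier E \<Longrightarrow> \<phi> (x \<oplus>\<^bsub>E\<^esub> y) = \<phi> x + \<phi> y"
  by (simp add: lcs_hom_def complex_lcs_def)

lemma lcs_dual_scale: "\<phi> \<in> lcs_dual E \<Longrightarrow> x \<in> carrier E \<Longrightarrow> \<phi> (c \<odot>\<^bsub>E\<^esub> x) = c * \<phi> x"
  by (simp add: lcs_hom_def complex_lcs_def)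

locale lcs_module = complex_space E for E :: "('a, 'm) lcs_scheme" (structure)

sublocale locally_convex_space \<subseteq> lcs_module E ..

context lcs_module
begin

lemma hom_zero:
  assumes "complex_space E'" "f \<in> lcs_hom E E'"
  shows "f \<zero> = \<zero>\<^bsub>E'\<^esub>"
proof -
  interpret E': complex_space E' by fact
  have "f (0 \<odot> \<zero>) = 0 \<odot>\<^bsub>E'\<^esub> f \<zero>" using assms(2) by (intro lcs_hom_scale) auto
  then show ?thesis using lcs_hom_closed[OF assms(2), of \<zero>] by simp
qed

lemma hom_diff:
  assumes "complex_space E'" "f \<in> lcs_hom E E'" "x \<in> carrier E" "y \<in> carrier E"
  shows "f (x \<ominus> y) = f x \<ominus>\<^bsub>E'\<^esub> f y"
proof -
  interpret E': complex_space E' by fact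
  show ?thesis
    using assms by (simp add: diff_eq_scale E'.diff_eq_scale lcs_hom_add[OF assms(2)]
        lcs_hom_scale[OF assms(2)] lcs_hom_closed[OF assms(2)])
qed

end

lemma complex_space_complex_lcs: "complex_space complex_lcs"
  unfolding complex_space_def
  by (rule moduleI)
    (auto intro!: abelian_groupI simp: complex_lcs_def algebra_simps, metis add.right_inverse)

lemma complex_lcs_simps [simp]:
  "\<zero>\<^bsub>complex_lcs\<^esub> = 0" "x \<oplus>\<^bsub>complex_lcs\<^esub> y = x + y" "c \<odot>\<^bsub>complex_lcs\<^esub> x = c * x"
  "carrier complex_lcs = UNIV" "lcs_topology complex_lcs = euclidean"
  "x \<ominus>\<^bsub>complex_lcs\<^esub> y = x - y"
proof -
  interpret complex_space complex_lcs by (rule complex_space_complex_lcs)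
  have "x \<ominus>\<^bsub>complex_lcs\<^esub> y = x \<oplus>\<^bsub>complex_lcs\<^esub> (-1) \<odot>\<^bsub>complex_lcs\<^esub> y"
    by (rule diff_eq_scale) (auto simp: complex_lcs_def)
  then show "x \<ominus>\<^bsub>complex_lcs\<^esub> y = x - y" by (simp add: complex_lcs_def)
qed (simp_all add: complex_lcs_def)

context lcs_module
begin

lemma dual_zero: "\<phi> \<in> lcs_dual E \<Longrightarrow> \<phi> \<zero> = 0"
  using hom_zero[OF complex_space_complex_lcs] by simp

lemma dual_diff: "\<phi> \<in> lcs_dual E \<Longrightarrow> x \<in> carrier E \<Longrightarrow> y \<in> carrier E \<Longrightarrow> \<phi> (x \<ominus> y) = \<phi> x - \<phi> y"
  using hom_diff[OF complex_space_complex_lcs] by simp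

lemma dual_finsum:
  assumes "\<phi> \<in> lcs_dual E" "finite A" "f \<in> A \<rightarrow> carrier E"
  shows "\<phi> (\<Oplus>i\<in>A. f i) = (\<Sum>i\<in>A. \<phi> (f i))"
  using assms(2,3)
proof (induction A rule: finite_induct)
  case empty then show ?case by (simp add: dual_zero[OF assms(1)])
next
  case (insert a A)
  then show ?case by (simp add: M.finsum_insert lcs_dual_add[OF assms(1)] M.finsum_closed)
qed

end

section \<open>Gauges, continuous seminorms and the separation of points by functionals\<close>

context locally_convex_space
begin

lemma openin_translate:
  assumes "openin (lcs_topology E) U" "a \<in> carrier E"
  shows "openin (lcs_topology E) {x \<in> carrier E. x \<oplus> a \<in> U}"
proof -
  have "continuous_map (lcs_topology E) (prod_topology (lcs_topology E) (lcs_topology E)) (\<lambda>x. (x, a))"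
    using assms(2) by (auto intro!: continuous_map_pairedI simp: topspace_eq)
  from openin_continuous_map_preimage[OF continuous_map_compose[OF this continuous_add] assms(1)]
  show ?thesis by (simp add: topspace_eq)
qed

lemma openin_scale:
  assumes "openin (lcs_topology E) U"
  shows "openin (lcs_topology E) {x \<in> carrier E. c \<odot> x \<in> U}"
proof -
  have "continuous_map (lcs_topology E) (prod_topology euclidean (lcs_topology E)) (\<lambda>x. (c, x))"
    by (auto intro!: continuous_map_pairedI)
  from openin_continuous_map_preimage[OF continuous_map_compose[OF this continuous_smult] assms(1)]
  show ?thesis by (simp add: topspace_eq)
qed

text \<open>Applied with \<open>c = 0\<close>: at the zero vector it yields a neighbourhood stable
  under small scalars, at an arbitrary \<open>x\<close> it shows that neighbourhoods of 0 absorb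
  \<open>x\<close>.\<close>

lemma smult_near:
  assumes "openin (lcs_topology E) U" "c \<odot> a \<in> U" "a \<in> carrier E"
  obtains d W where "d > 0" "openin (lcs_topology E) W" "a \<in> W"
    "\<And>c' x. dist c' c < d \<Longrightarrow> x \<in> W \<Longrightarrow> c' \<odot> x \<in> U"
proof -
  have "openin (prod_topology euclidean (lcs_topology E))
      {z \<in> topspace (prod_topology euclidean (lcs_topology E)). (case z of (c, x) \<Rightarrow> c \<odot> x) \<in> U}"
    by (rule openin_continuous_map_preimage[OF continuous_smult assms(1)])
  then obtain V W where VW: "openin euclidean V" "openin (lcs_topology E) W" "c \<in> V" "a \<in> W"
    "V \<times> W \<subseteq> {z \<in> topspace (prod_topology euclidean (lcs_topology E)). (case z of (c, x) \<Rightarrow> c \<odot> x) \<in> U}"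
    using assms(2,3) unfolding openin_prod_topology_alt
    by (auto dest!: spec[of _ c] spec[of _ a] simp: topspace_eq)
  then obtain d where "d > 0" "ball c d \<subseteq> V" by (metis open_contains_ball open_openin)
  have "c' \<odot> x \<in> U" if "dist c' c < d" "x \<in> W" for c' x
  proof -
    have "(c', x) \<in> V \<times> W" using that \<open>ball c d \<subseteq> V\<close> by (auto simp: dist_commute)
    then show ?thesis using VW(5) by auto
  qed
  then show ?thesis using VW \<open>d > 0\<close> by (intro that[of d W]) auto
qed

lemma cts_seminormD:
  assumes "cts_seminorm E p"
  shows seminorm_add: "x \<in> carrier E \<Longrightarrow> y \<in> carrier E \<Longrightarrow> p (x \<oplus> y) \<le> p x + p y"
    and seminorm_scale: "x \<in> carrier E \<Longrightarrow> p (c \<odot> x) = cmod c * p x"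
  using assms by (auto simp: cts_seminorm_def)

lemma seminorm_zero: "cts_seminorm E p \<Longrightarrow> p \<zero> = 0"
  using seminorm_scale[of p \<zero> 0] by simp

lemma seminorm_diff_commute:
  assumes "cts_seminorm E p" "x \<in> carrier E" "y \<in> carrier E"
  shows "p (x \<ominus> y) = p (y \<ominus> x)"
proof -
  have "x \<ominus> y = (-1) \<odot> (y \<ominus> x)"
    using assms by (simp add: diff_eq_scale scale_add_right scale_scale a_comm)
  then show ?thesis using seminorm_scale[OF assms(1), of "y \<ominus> x" "-1"] assms by simp
qed

lemma seminorm_diff_le:
  assumes "cts_seminorm E p" "x \<in> carrier E" "y \<in> carrier E"
  shows "p (x \<ominus> y) \<le> p x + p y"
  using seminorm_add[OF assms(1), of x "(-1) \<odot> y"] seminorm_scale[OF assms(1), of y "-1"] assms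
  by (simp add: diff_eq_scale)

lemma seminorm_triangle:
  assumes "cts_seminorm E p" "x \<in> carrier E" "y \<in> carrier E"
  shows "p x \<le> p y + p (x \<ominus> y)"
  using seminorm_add[OF assms(1), of y "x \<ominus> y"] assms by (simp add: diff_add_cancel)

lemma seminorm_nonneg:
  assumes "cts_seminorm E p" "x \<in> carrier E"
  shows "0 \<le> p x"
  using seminorm_diff_le[OF assms assms(2)] seminorm_zero[OF assms(1)] assms(2) by simp

text \<open>The Minkowski gauge of the balanced core \<open>B\<close> of a convex neighbourhood
  \<open>C\<close>. Convexity of \<open>B\<close> gives subadditivity, balancedness gives
  homogeneity for complex scalars, and \<open>W'\<close> witnesses that \<open>B\<close> is still a
  neighbourhood of 0.\<close>

lemma seminorm_exists:
  assumes U: "openin (lcs_topology E) U" "\<zero> \<in> U"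
  obtains p where "cts_seminorm E p" "\<And>x. x \<in> carrier E \<Longrightarrow> p x < 1 \<Longrightarrow> x \<in> U"
proof -
  obtain C W where CW: "openin (lcs_topology E) W \<and> \<zero> \<in> W \<and> W \<subseteq> C \<and> C \<subseteq> U \<and>
     (\<forall>x\<in>C. \<forall>y\<in>C. \<forall>t::real. 0 \<le> t \<and> t \<le> 1 \<longrightarrow>
        (complex_of_real t \<odot> x) \<oplus> (complex_of_real (1 - t) \<odot> y) \<in> C)"
    using locally_convex[OF U] by (elim exE)
  then have W: "openin (lcs_topology E) W" "\<zero> \<in> W" "W \<subseteq> C" "C \<subseteq> U"
    by simp_all
  have convC: "(complex_of_real t \<odot> x) \<oplus> (complex_of_real (1 - t) \<odot> y) \<in> C"
    if "x \<in> C" "y \<in> C" "0 \<le> t" "t \<le> 1" for x y and t :: real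
    using CW that by simp
  define B where "B = {x \<in> carrier E. \<forall>c. cmod c \<le> 1 \<longrightarrow> c \<odot> x \<in> C}"
  obtain d W1 where d: "d > 0" "openin (lcs_topology E) W1" "\<zero> \<in> W1"
    and dW: "\<And>c x. dist c 0 < d \<Longrightarrow> x \<in> W1 \<Longrightarrow> c \<odot> x \<in> W"
    using smult_near[OF W(1), of 0 \<zero>] W(2) by auto
  \<comment> \<open>The factor \<open>2 / d\<close> is undone by scalars of the form
    \<open>c (d / 2)\<close>, whose modulus is below \<open>d\<close> whenever
    \<open>cmod c \<le> 1\<close>.\<close>
  define W' where "W' = {x \<in> carrier E. complex_of_real (2 / d) \<odot> x \<in> W1}"
  have W': "openin (lcs_topology E) W'" "\<zero> \<in> W'"
    unfolding W'_def using d by (auto intro: openin_scale)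
  have W'B: "x \<in> B" if "x \<in> W'" for x
  proof -
    have x: "x \<in> carrier E" "complex_of_real (2 / d) \<odot> x \<in> W1" using that by (auto simp: W'_def)
    have "c \<odot> x \<in> C" if "cmod c \<le> 1" for c
    proof -
      have "(c * complex_of_real (d / 2)) \<odot> (complex_of_real (2 / d) \<odot> x) \<in> W"
        by (rule dW) (use that d x in \<open>auto simp: norm_mult\<close>)
      moreover have "(c * complex_of_real (d / 2)) \<odot> (complex_of_real (2 / d) \<odot> x) = c \<odot> x"
        using x d by (simp add: scale_scale)
      ultimately show ?thesis using W by auto
    qed
    then show ?thesis using x by (auto simp: B_def)
  qed
  have Bbal: "c \<odot> x \<in> B" if "x \<in> B" "cmod c \<le> 1" for c x
    using that mult_le_one[OF _ _ that(2)] by (auto simp: B_def scale_scale norm_mult)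
  have Bconv: "(complex_of_real t \<odot> x) \<oplus> (complex_of_real (1 - t) \<odot> y) \<in> B"
    if "x \<in> B" "y \<in> B" "0 \<le> t" "t \<le> 1" for x y and t :: real
  proof -
    have "c \<odot> ((complex_of_real t \<odot> x) \<oplus> (complex_of_real (1 - t) \<odot> y)) =
      (complex_of_real t \<odot> (c \<odot> x)) \<oplus> (complex_of_real (1 - t) \<odot> (c \<odot> y))" for c
      using that by (simp add: B_def scale_add_right scale_scale mult.commute)
    then show ?thesis using that convC by (simp add: B_def)
  qed
  define S where "S x = {t. t > 0 \<and> complex_of_real (1 / t) \<odot> x \<in> B}" for x
  define p where "p x = Inf (S x)" for x
  have Smono: "t \<in> S x" if "s \<in> S x" "s \<le> t" "x \<in> carrier E" for s t x
  proof -
    have "complex_of_real (s / t) \<odot> (complex_of_real (1 / s) \<odot> x) \<in> B"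
      using that by (intro Bbal[of "complex_of_real (1 / s) \<odot> x"]) (auto simp: S_def norm_divide)
    then show ?thesis using that by (simp add: S_def scale_scale)
  qed
  have Sne: "S x \<noteq> {}" if x: "x \<in> carrier E" for x
  proof -
    obtain d' W2 where d': "d' > 0" "x \<in> W2" "\<And>c y. dist c 0 < d' \<Longrightarrow> y \<in> W2 \<Longrightarrow> c \<odot> y \<in> W'"
      using smult_near[OF W'(1), of 0 x] W'(2) x scale_zero_left[OF x] by metis
    then have "complex_of_real (1 / (2 / d')) \<odot> x \<in> W'" by (intro d') auto
    then have "2 / d' \<in> S x" using W'B d' by (auto simp: S_def)
    then show ?thesis by auto
  qed
  have Sbd: "bdd_below (S x)" for x by (auto simp: S_def intro!: bdd_belowI[where m=0])
  have ple: "p x \<le> t" if "t \<in> S x" for t x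
    unfolding p_def using that Sbd by (rule cInf_lower)
  have pge: "m \<le> p x" if "x \<in> carrier E" "\<And>t. t \<in> S x \<Longrightarrow> m \<le> t" for m x
    unfolding p_def using that Sne by (intro cInf_greatest) auto
  have padd: "p (x \<oplus> y) \<le> p x + p y" if [simp]: "x \<in> carrier E" "y \<in> carrier E" for x y
  proof -
    have *: "p (x \<oplus> y) \<le> s + t" if st: "s \<in> S x" "t \<in> S y" for s t
    proof -
      have pos: "s > 0" "t > 0" using st by (auto simp: S_def)
      \<comment> \<open>The vector \<open>(x + y) / (s + t)\<close> is the convex combination of
        \<open>x / s\<close> and \<open>y / t\<close> with weights \<open>s / (s + t)\<close> and
        \<open>t / (s + t)\<close>.\<close>
      have "complex_of_real (s / (s + t)) \<odot> (complex_of_real (1 / s) \<odot> x) \<oplus>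
         complex_of_real (1 - s / (s + t)) \<odot> (complex_of_real (1 / t) \<odot> y) \<in> B"
        using st pos by (intro Bconv) (auto simp: S_def)
      also have "1 - s / (s + t) = t / (s + t)" using pos by (simp add: field_simps)
      also have "complex_of_real (s / (s + t)) \<odot> (complex_of_real (1 / s) \<odot> x) \<oplus>
         complex_of_real (t / (s + t)) \<odot> (complex_of_real (1 / t) \<odot> y) =
         complex_of_real (1 / (s + t)) \<odot> (x \<oplus> y)"
        using pos by (simp add: scale_scale scale_add_right)
      finally have "s + t \<in> S (x \<oplus> y)" using pos by (simp add: S_def)
      then show ?thesis by (rule ple)
    qed
    have "p (x \<oplus> y) - s \<le> p y" if "s \<in> S x" for s
      using *[OF that] by (intro pge) (auto simp: algebra_simps)
    then have "p (x \<oplus> y) - p y \<le> p x" by (intro pge) (auto simp: algebra_simps)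
    then show ?thesis by simp
  qed
  have p0: "p \<zero> = 0"
  proof (rule antisym)
    have "\<zero> \<in> B" using W'(2) W'B by auto
    then have "e \<in> S \<zero>" if "e > 0" for e using that by (simp add: S_def)
    then have "p \<zero> \<le> 0 + e" if "e > 0" for e using ple[of e \<zero>] that by simp
    then show "p \<zero> \<le> 0" by (rule field_le_epsilon)
    show "0 \<le> p \<zero>" by (rule pge) (auto simp: S_def)
  qed
  have ple': "p (c \<odot> x) \<le> cmod c * p x" if [simp]: "x \<in> carrier E" for c x
  proof (cases "c = 0")
    case False
    have "p (c \<odot> x) / cmod c \<le> t" if "t \<in> S x" for t
    proof -
      have "(c / complex_of_real (cmod c)) \<odot> (complex_of_real (1 / t) \<odot> x) \<in> B"
        using that False by (intro Bbal[of "complex_of_real (1 / t) \<odot> x"]) (auto simp: S_def norm_divide)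
      also have "(c / complex_of_real (cmod c)) \<odot> (complex_of_real (1 / t) \<odot> x) =
         complex_of_real (1 / (cmod c * t)) \<odot> (c \<odot> x)"
        by (simp add: scale_scale mult.commute)
      finally have "cmod c * t \<in> S (c \<odot> x)" using that False by (simp add: S_def)
      from ple[OF this] show ?thesis using False by (simp add: field_simps)
    qed
    then have "p (c \<odot> x) / cmod c \<le> p x" by (intro pge) auto
    then show ?thesis using False by (simp add: field_simps)
  qed (simp add: p0)
  have pscale: "p (c \<odot> x) = cmod c * p x" if [simp]: "x \<in> carrier E" for c x
  proof (cases "c = 0")
    case False
    have "p ((1 / c) \<odot> (c \<odot> x)) \<le> cmod (1 / c) * p (c \<odot> x)" by (rule ple') auto
    then have "cmod c * p x \<le> p (c \<odot> x)"
      using False by (simp add: scale_scale norm_divide field_simps)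
    with ple'[of x c] show ?thesis by simp
  qed (simp add: p0)
  have "\<exists>V. openin (lcs_topology E) V \<and> \<zero> \<in> V \<and> (\<forall>x\<in>V. p x < e)" if e: "e > 0" for e
  proof (intro exI conjI ballI)
    show "openin (lcs_topology E) {x \<in> carrier E. complex_of_real (2 / e) \<odot> x \<in> W'}"
      by (rule openin_scale[OF W'(1)])
    show "\<zero> \<in> {x \<in> carrier E. complex_of_real (2 / e) \<odot> x \<in> W'}" using W' by simp
    fix x assume "x \<in> {x \<in> carrier E. complex_of_real (2 / e) \<odot> x \<in> W'}"
    then have "e / 2 \<in> S x" using W'B e by (auto simp: S_def)
    from ple[OF this] show "p x < e" using e by simp
  qed
  then have "cts_seminorm E p" using padd pscale by (auto simp: cts_seminorm_def)
  moreover have "x \<in> U" if x: "x \<in> carrier E" "p x < 1" for x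
  proof -
    obtain t where "t \<in> S x" "t < 1" using cInf_lessD[OF Sne[OF x(1)]] x(2) by (auto simp: p_def)
    then have "1 \<in> S x" using Smono[of t x 1] x by auto
    then have "x \<in> B" using x by (simp add: S_def)
    then have "1 \<odot> x \<in> C" using norm_one unfolding B_def by (metis (no_types, lifting) mem_Collect_eq order_refl)
    then show ?thesis using x W by auto
  qed
  ultimately show ?thesis using that by blast
qed

lemma seminorm_ball_open:
  assumes p: "cts_seminorm E p" and a: "a \<in> carrier E" and e: "e > 0"
  obtains W where "openin (lcs_topology E) W" "a \<in> W" "\<And>x. x \<in> W \<Longrightarrow> p (x \<ominus> a) < e"
proof -
  obtain W where W: "openin (lcs_topology E) W" "\<zero> \<in> W" "\<And>x. x \<in> W \<Longrightarrow> p x < e"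
    using p e by (auto simp: cts_seminorm_def)
  define V where "V = {x \<in> carrier E. x \<oplus> (-1) \<odot> a \<in> W}"
  have "openin (lcs_topology E) V" unfolding V_def using a by (intro openin_translate W) auto
  moreover have "a \<in> V" using a W by (simp add: V_def flip: diff_eq_scale)
  moreover have "p (x \<ominus> a) < e" if "x \<in> V" for x
    using that W a by (simp add: V_def diff_eq_scale)
  ultimately show ?thesis using that by blast
qed

text \<open>Balls of continuous seminorms form a neighbourhood base at every point:
  \<open>seminorm_ball_open\<close> makes them neighbourhoods, and \<open>seminorm_exists\<close>,
  applied to a translate, makes them small enough.\<close>

lemma limitin_iff_seminorm:
  "limitin (lcs_topology E) f l \<Phi> \<longleftrightarrow> l \<in> carrier E \<and> eventually (\<lambda>x. f x \<in> carrier E) \<Phi> \<and>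
     (\<forall>p. cts_seminorm E p \<longrightarrow> ((\<lambda>x. p (f x \<ominus> l)) \<longlongrightarrow> 0) \<Phi>)" (is "?L \<longleftrightarrow> ?R")
proof
  assume L: ?L
  then have l: "l \<in> carrier E" by (auto simp: limitin_def topspace_eq)
  have "eventually (\<lambda>x. f x \<in> topspace (lcs_topology E)) \<Phi>"
    using L unfolding limitin_def by blast
  then have ev: "eventually (\<lambda>x. f x \<in> carrier E) \<Phi>" by (simp add: topspace_eq)
  have "((\<lambda>x. p (f x \<ominus> l)) \<longlongrightarrow> 0) \<Phi>" if p: "cts_seminorm E p" for p
  proof (rule tendstoI)
    fix e :: real assume "e > 0"
    then obtain W where W: "openin (lcs_topology E) W" "l \<in> W" "\<And>x. x \<in> W \<Longrightarrow> p (x \<ominus> l) < e"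
      using seminorm_ball_open[OF p l] by metis
    have "eventually (\<lambda>x. f x \<in> W) \<Phi>" using L W(1,2) by (auto simp: limitin_def)
    with ev show "eventually (\<lambda>x. dist (p (f x \<ominus> l)) 0 < e) \<Phi>"
      by eventually_elim (use W seminorm_nonneg[OF p] l in auto)
  qed
  with l ev show ?R by auto
next
  assume R: ?R
  show ?L unfolding limitin_def
  proof (intro conjI allI impI)
    show "l \<in> topspace (lcs_topology E)" using R by (simp add: topspace_eq)
    fix U assume U: "openin (lcs_topology E) U \<and> l \<in> U"
    have "openin (lcs_topology E) {x \<in> carrier E. x \<oplus> l \<in> U}"
      using U R by (intro openin_translate) auto
    then obtain p where p: "cts_seminorm E p"
      "\<And>x. x \<in> carrier E \<Longrightarrow> p x < 1 \<Longrightarrow> x \<in> {x \<in> carrier E. x \<oplus> l \<in> U}"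
      using seminorm_exists[of "{x \<in> carrier E. x \<oplus> l \<in> U}"] U R by auto
    have "((\<lambda>x. p (f x \<ominus> l)) \<longlongrightarrow> 0) \<Phi>" using R p by auto
    then have "eventually (\<lambda>x. p (f x \<ominus> l) < 1) \<Phi>" by (rule order_tendstoD) simp
    moreover have "eventually (\<lambda>x. f x \<in> carrier E) \<Phi>" using R by auto
    ultimately show "eventually (\<lambda>x. f x \<in> U) \<Phi>"
    proof eventually_elim
      case (elim x)
      then have "(f x \<ominus> l) \<oplus> l \<in> U" using p(2)[of "f x \<ominus> l"] R by auto
      then show ?case using elim R by (simp add: a_comm diff_add_cancel)
    qed
  qed
qed

lemma continuous_map_seminorm:
  assumes p: "cts_seminorm E p"
  shows "continuous_map (lcs_topology E) euclideanreal p"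
  unfolding continuous_map_atin limitin_canonical_iff
proof
  fix a assume "a \<in> topspace (lcs_topology E)"
  then have a: "a \<in> carrier E" by (simp add: topspace_eq)
  have "continuous_map (lcs_topology E) (lcs_topology E) (\<lambda>x. x)" by simp
  then have "limitin (lcs_topology E) (\<lambda>x. x) a (atin (lcs_topology E) a)"
    using a unfolding continuous_map_atin by (simp add: topspace_eq)
  then have lim: "((\<lambda>x. p (x \<ominus> a)) \<longlongrightarrow> 0) (atin (lcs_topology E) a)"
    and ev: "eventually (\<lambda>x. x \<in> carrier E) (atin (lcs_topology E) a)"
    using p by (auto simp: limitin_iff_seminorm)
  have "((\<lambda>x. p x - p a) \<longlongrightarrow> 0) (atin (lcs_topology E) a)"
  proof (rule Lim_null_comparison[OF _ lim])
    show "\<forall>\<^sub>F x in atin (lcs_topology E) a. norm (p x - p a) \<le> p (x \<ominus> a)"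
      using ev
    proof eventually_elim
      case (elim x)
      then show ?case using seminorm_triangle[OF p, of x a] seminorm_triangle[OF p, of a x] a
          seminorm_diff_commute[OF p, of x a] by simp
    qed
  qed
  then show "(p \<longlongrightarrow> p a) (atin (lcs_topology E) a)" by (simp add: LIM_zero_iff)
qed

lemma dual_seminorm:
  assumes "\<phi> \<in> lcs_dual E"
  shows "cts_seminorm E (\<lambda>x. cmod (\<phi> x))"
  unfolding cts_seminorm_def
proof (intro conjI ballI allI impI)
  fix e :: real assume "e > 0"
  have "openin (lcs_topology E) {x \<in> topspace (lcs_topology E). \<phi> x \<in> ball 0 e}"
    using lcs_hom_continuous[OF assms] by (intro openin_continuous_map_preimage) auto
  then show "\<exists>W. openin (lcs_topology E) W \<and> \<zero> \<in> W \<and> (\<forall>x\<in>W. cmod (\<phi> x) < e)"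
    using \<open>e > 0\<close> by (intro exI[of _ "{x \<in> topspace (lcs_topology E). \<phi> x \<in> ball 0 e}"])
      (auto simp: topspace_eq dual_zero[OF assms])
qed (use assms in \<open>auto simp: lcs_dual_add lcs_dual_scale norm_mult norm_triangle_ineq\<close>)

lemma limitin_hom:
  assumes "f \<in> lcs_hom E E'" "limitin (lcs_topology E) u l \<Phi>"
  shows "limitin (lcs_topology E') (\<lambda>x. f (u x)) (f l) \<Phi>"
  using continuous_map_limit[OF lcs_hom_continuous[OF assms(1)] assms(2)] by (simp add: o_def)

lemma limitin_dual:
  assumes "\<phi> \<in> lcs_dual E" "limitin (lcs_topology E) u l \<Phi>"
  shows "((\<lambda>x. \<phi> (u x)) \<longlongrightarrow> \<phi> l) \<Phi>"
  using limitin_hom[OF assms] by simp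

text \<open>The domination \<open>cmod (\<phi> y) \<le> p y\<close> yields continuity as well, since
  the increment of \<open>\<phi>\<close> at \<open>a\<close> is bounded by
  \<open>p (x - a)\<close>.\<close>

lemma lcs_hahn_banach:
  assumes p: "cts_seminorm E p" and x: "x \<in> carrier E"
  obtains \<phi> where "\<phi> \<in> lcs_dual E" "\<And>y. y \<in> carrier E \<Longrightarrow> cmod (\<phi> y) \<le> p y" "\<phi> x = complex_of_real (p x)"
proof -
  obtain \<phi> where add: "\<And>y z. y \<in> carrier E \<Longrightarrow> z \<in> carrier E \<Longrightarrow> \<phi> (y \<oplus> z) = \<phi> y + \<phi> z"
    and scale: "\<And>c y. y \<in> carrier E \<Longrightarrow> \<phi> (c \<odot> y) = c * \<phi> y"
    and le: "\<And>y. y \<in> carrier E \<Longrightarrow> cmod (\<phi> y) \<le> p y" and eq: "\<phi> x = complex_of_real (p x)"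
    by (rule hahn_banach[OF cts_seminormD[OF p] x]) (assumption | rule that)+
  have "continuous_map (lcs_topology E) euclidean \<phi>"
    unfolding continuous_map_atin limitin_canonical_iff
  proof
    fix a assume "a \<in> topspace (lcs_topology E)"
    then have a: "a \<in> carrier E" by (simp add: topspace_eq)
    have "continuous_map (lcs_topology E) (lcs_topology E) (\<lambda>x. x)" by simp
    then have "limitin (lcs_topology E) (\<lambda>x. x) a (atin (lcs_topology E) a)"
      using a unfolding continuous_map_atin by (simp add: topspace_eq)
    then have lim: "((\<lambda>x. p (x \<ominus> a)) \<longlongrightarrow> 0) (atin (lcs_topology E) a)"
      and ev: "eventually (\<lambda>x. x \<in> carrier E) (atin (lcs_topology E) a)"
      using p by (auto simp: limitin_iff_seminorm)
    have "((\<lambda>x. \<phi> x - \<phi> a) \<longlongrightarrow> 0) (atin (lcs_topology E) a)"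
    proof (rule Lim_null_comparison[OF _ lim])
      show "\<forall>\<^sub>F x in atin (lcs_topology E) a. norm (\<phi> x - \<phi> a) \<le> p (x \<ominus> a)"
        using ev
      proof eventually_elim
        case (elim x)
        have "\<phi> (x \<ominus> a) = \<phi> x - \<phi> a" using elim a by (simp add: diff_eq_scale add scale)
        then show ?case using le[of "x \<ominus> a"] elim a by simp
      qed
    qed
    then show "(\<phi> \<longlongrightarrow> \<phi> a) (atin (lcs_topology E) a)" by (simp add: LIM_zero_iff)
  qed
  then have "\<phi> \<in> lcs_dual E" using add scale by (auto simp: lcs_hom_def)
  then show ?thesis using le eq that by blast
qed

text \<open>A neighbourhood of 0 that misses \<open>x\<close> has a gauge that does not vanish at
  \<open>x\<close>, and Hahn--Banach turns this gauge into a functional with the same value at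
  \<open>x\<close>.\<close>

lemma dual_separates:
  assumes H: "Hausdorff_space (lcs_topology E)" and x: "x \<in> carrier E"
    and 0: "\<And>\<phi>. \<phi> \<in> lcs_dual E \<Longrightarrow> \<phi> x = 0"
  shows "x = \<zero>"
proof (rule ccontr)
  assume "x \<noteq> \<zero>"
  then obtain U V where UV: "openin (lcs_topology E) U" "openin (lcs_topology E) V" "\<zero> \<in> U" "x \<in> V" "disjnt U V"
    using H x unfolding Hausdorff_space_def by (metis topspace_eq zero_closed)
  obtain p where p: "cts_seminorm E p" "\<And>x. x \<in> carrier E \<Longrightarrow> p x < 1 \<Longrightarrow> x \<in> U"
    using seminorm_exists[OF UV(1,3)] by metis
  obtain \<phi> where "\<phi> \<in> lcs_dual E" "\<phi> x = complex_of_real (p x)"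
    using lcs_hahn_banach[OF p(1) x] by metis
  then have "p x = 0" using 0[of \<phi>] by simp
  then have "x \<in> U" using p(2) x by simp
  then show False using UV by (auto simp: disjnt_def)
qed

lemma dual_eqI:
  assumes H: "Hausdorff_space (lcs_topology E)" and "x \<in> carrier E" "y \<in> carrier E"
    and "\<And>\<phi>. \<phi> \<in> lcs_dual E \<Longrightarrow> \<phi> x = \<phi> y"
  shows "x = y"
proof -
  have "x \<ominus> y = \<zero>" by (rule dual_separates[OF H]) (use assms in \<open>auto simp: dual_diff\<close>)
  then show ?thesis using assms by (simp add: diff_eq_zero_iff)
qed

end

section \<open>Laurent expansions of scalar functions\<close>

text \<open>
  Laurent series are indexed as in the theory of vertex algebras: \<open>res_coeff r h n\<close> is the
  coefficient of \<open>z powi (- n - 1)\<close>.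
\<close>

definition res_coeff :: "real \<Rightarrow> (complex \<Rightarrow> complex) \<Rightarrow> int \<Rightarrow> complex" where
  "res_coeff r h n = contour_integral (circlepath 0 r) (\<lambda>z. h z * z powi n) / (2 * pi * \<i>)"

lemma res_coeff_cong:
  assumes "r > 0" "\<And>z. cmod z = r \<Longrightarrow> f z = g z"
  shows "res_coeff r f n = res_coeff r g n"
proof -
  have "contour_integral (circlepath 0 r) (\<lambda>z. f z * z powi n) =
     contour_integral (circlepath 0 r) (\<lambda>z. g z * z powi n)"
    by (rule contour_integral_cong) (use assms in \<open>auto simp: sphere_def\<close>)
  then show ?thesis by (simp add: res_coeff_def)
qed

lemma continuous_on_powi_sphere:
  "r > 0 \<Longrightarrow> continuous_on (sphere (0::complex) r) (\<lambda>z. z powi n)"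
  by (intro continuous_intros) auto

lemma circle_integrable:
  assumes "r > 0" "continuous_on (sphere 0 r) f"
  shows "(\<lambda>z. f z * z powi n) contour_integrable_on (circlepath 0 r)"
  by (rule contour_integrable_continuous_circlepath)
    (use assms in \<open>auto intro!: continuous_intros continuous_on_powi_sphere\<close>)

lemma res_coeff_add:
  assumes "r > 0" "continuous_on (sphere 0 r) f" "continuous_on (sphere 0 r) g"
  shows "res_coeff r (\<lambda>z. f z + g z) n = res_coeff r f n + res_coeff r g n"
  using contour_integral_add[OF circle_integrable[OF assms(1,2)] circle_integrable[OF assms(1,3)], of n n]
  by (simp add: res_coeff_def ring_distribs add_divide_distrib)

lemma res_coeff_cmult:
  assumes "r > 0" "continuous_on (sphere 0 r) f"
  shows "res_coeff r (\<lambda>z. c * f z) n = c * res_coeff r f n"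
  using contour_integral_lmul[OF circle_integrable[OF assms], of c n]
  by (simp add: res_coeff_def mult.assoc)

lemma res_coeff_diff:
  assumes "r > 0" "continuous_on (sphere 0 r) f" "continuous_on (sphere 0 r) g"
  shows "res_coeff r (\<lambda>z. f z - g z) n = res_coeff r f n - res_coeff r g n"
  using contour_integral_diff[OF circle_integrable[OF assms(1,2)] circle_integrable[OF assms(1,3)], of n n]
  by (simp add: res_coeff_def ring_distribs diff_divide_distrib)

lemma res_coeff_shift:
  assumes "r > 0"
  shows "res_coeff r (\<lambda>z. z * f z) n = res_coeff r f (n + 1)"
proof -
  have "contour_integral (circlepath 0 r) (\<lambda>z. z * f z * z powi n) =
     contour_integral (circlepath 0 r) (\<lambda>z. f z * z powi (n + 1))"
    by (rule contour_integral_cong) (use assms in \<open>auto simp: power_int_add\<close>)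
  then show ?thesis by (simp add: res_coeff_def)
qed

text \<open>Cauchy's estimate: \<open>n\<close> powers of \<open>r\<close> come from the integrand
  and one from the length of the circle.\<close>

lemma res_coeff_bound:
  assumes r: "r > 0" and "continuous_on (sphere 0 r) h" and M: "\<And>z. cmod z = r \<Longrightarrow> cmod (h z) \<le> M"
  shows "cmod (res_coeff r h n) \<le> M * r powi (n + 1)"
proof -
  have M0: "M \<ge> 0" using order_trans[OF norm_ge_zero M[of "of_real r"]] r by simp
  have "cmod (contour_integral (circlepath 0 r) (\<lambda>z. h z * z powi n)) \<le> (M * r powi n) * (2 * pi * r)"
    by (rule has_contour_integral_bound_circlepath[OF has_contour_integral_integral[OF circle_integrable]])
      (use assms M0 in \<open>auto simp: norm_mult norm_power_int intro!: mult_right_mono\<close>)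
  also have "\<dots> = M * r powi (n + 1) * (2 * pi)"
    using r by (simp add: power_int_add)
  finally show ?thesis by (simp add: res_coeff_def norm_divide norm_mult field_simps)
qed

lemma contour_integral_circle_powi:
  assumes r: "r > 0"
  shows "contour_integral (circlepath 0 r) (\<lambda>z. z powi k) = (if k = -1 then 2 * pi * \<i> else 0)"
proof (cases "k = -1")
  case True
  then show ?thesis using contour_integral_circlepath[OF r, of 0]
    by (simp add: power_int_minus field_simps)
next
  case False
  have "((\<lambda>z. z powi k) has_contour_integral 0) (circlepath 0 r)"
  proof (rule Cauchy_theorem_primitive[where S = "-{0}" and f = "\<lambda>z. z powi (k + 1) / of_int (k + 1)"])
    fix x :: complex assume "x \<in> -{0}"
    have ne: "(of_int (k + 1) :: complex) \<noteq> 0" using False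
      by (metis add_eq_0_iff2 of_int_eq_0_iff)
    show "((\<lambda>z. z powi (k + 1) / of_int (k + 1)) has_field_derivative x powi k) (at x within -{0})"
    proof (rule DERIV_cong)
      show "((\<lambda>z. z powi (k + 1) / of_int (k + 1)) has_field_derivative
          of_int (k + 1) * x powi k / of_int (k + 1)) (at x within -{0})"
        using \<open>x \<in> -{0}\<close> by (auto intro!: derivative_eq_intros)
    qed (use ne in simp)
  qed (use r in auto)
  then show ?thesis using False contour_integral_unique by auto
qed

text \<open>The linear homotopy between two concentric circles moves every point along its ray from
  the origin, so it stays inside the punctured disk.\<close>

lemma res_coeff_radius:
  assumes h: "h holomorphic_on ball 0 R - {0}" and "0 < r" "r < R" "0 < s" "s < R"
  shows "res_coeff r h n = res_coeff s h n"
proof -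
  have "homotopic_loops (ball 0 R - {0}) (circlepath 0 r) (circlepath (0::complex) s)"
  proof (rule homotopic_loops_linear)
    fix t :: real assume "t \<in> {0..1}"
    show "closed_segment (circlepath 0 r t) (circlepath 0 s t) \<subseteq> ball (0::complex) R - {0}"
    proof
      fix x assume "x \<in> closed_segment (circlepath 0 r t) (circlepath (0::complex) s t)"
      then obtain u where u: "0 \<le> u" "u \<le> 1"
        and x: "x = (1 - u) *\<^sub>R circlepath 0 r t + u *\<^sub>R circlepath 0 s t"
        by (auto simp: closed_segment_def)
      have x': "x = complex_of_real ((1 - u) * r + u * s) * exp (2 * of_real pi * \<i> * of_real t)"
        unfolding x circlepath by (simp add: scaleR_conv_of_real algebra_simps)
      have "(1 - u) * r + u * s > 0"
        using u assms by (cases "u = 0") (auto intro: add_nonneg_pos)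
      moreover have "(1 - u) * r + u * s < R"
      proof -
        have "(1 - u) * r + u * s \<le> (1 - u) * max r s + u * max r s"
          using u by (intro add_mono mult_left_mono) auto
        also have "\<dots> = max r s" by (simp add: algebra_simps)
        finally show ?thesis using assms by auto
      qed
      moreover have "cmod (exp (2 * of_real pi * \<i> * of_real t)) = 1" by (simp add: norm_exp_eq_Re)
      ultimately show "x \<in> ball 0 R - {0}" unfolding x' by (simp add: norm_mult del: of_real_add of_real_mult)
    qed
  qed auto
  then have "contour_integral (circlepath 0 r) (\<lambda>z. h z * z powi n) =
      contour_integral (circlepath 0 s) (\<lambda>z. h z * z powi n)"
    by (rule Cauchy_theorem_homotopic_loops) (auto intro!: holomorphic_intros h open_delete)
  then show ?thesis by (simp add: res_coeff_def)
qed

lemma uniform_limit_eq_rhs: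
  assumes "uniform_limit S f h F" "\<And>x. x \<in> S \<Longrightarrow> h x = g x"
  shows "uniform_limit S f g F"
  using assms(1) by (rule uniform_limit_cong'[THEN iffD1, rotated 2]) (simp_all add: assms(2))

text \<open>In the indexing used here the half \<open>n \<ge> 0\<close> is the principal part of a
  Laurent series, and \<open>n = - k - 1\<close> with \<open>k \<ge> 0\<close> is the term of
  exponent \<open>k\<close>.\<close>

lemma has_sum_int_halves:
  fixes f :: "int \<Rightarrow> 'a :: banach"
  assumes "summable (\<lambda>k. norm (f (int k)))" "(\<lambda>k. f (int k)) sums a"
    and "summable (\<lambda>k. norm (f (- int k - 1)))" "(\<lambda>k. f (- int k - 1)) sums b"
  shows "(f has_sum (a + b)) UNIV"
proof -
  have "(f has_sum a) (range int)"
    using norm_summable_imp_has_sum[OF assms(1,2)] by (subst has_sum_reindex) (auto simp: o_def)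
  moreover have "(f has_sum b) (range (\<lambda>k. - int k - 1))"
    using norm_summable_imp_has_sum[OF assms(3,4)] by (subst has_sum_reindex) (auto simp: o_def inj_def)
  moreover have "range int \<union> range (\<lambda>k. - int k - 1) = UNIV"
  proof -
    have "n \<in> range int \<union> range (\<lambda>k. - int k - 1)" for n
    proof (cases "n \<ge> 0")
      case True then show ?thesis by (metis UnI1 nonneg_int_cases rangeI)
    next
      case False
      then have "n = - int (nat (- n - 1)) - 1" by simp
      then show ?thesis by (metis UnI2 rangeI)
    qed
    then show ?thesis by auto
  qed
  moreover have "range int \<inter> range (\<lambda>k. - int k - 1) = {}" by auto
  ultimately show ?thesis using has_sum_Un_disjoint by metis
qed

text \<open>A majorant decaying in both directions; \<open>\<bar>n + 1\<bar>\<close> is the absolute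
  value of the exponent \<open>- n - 1\<close> that belongs to the index \<open>n\<close>.\<close>

definition geo_weight :: "real \<Rightarrow> int \<Rightarrow> real" where
  "geo_weight q n = q ^ nat \<bar>n + 1\<bar>"

lemma geo_weight_summable:
  assumes "0 \<le> q" "q < 1"
  shows "geo_weight q summable_on UNIV"
proof -
  have 1: "geo_weight q (int k) = q * q ^ k" for k
    by (simp add: geo_weight_def nat_add_distrib)
  have 2: "geo_weight q (- int k - 1) = q ^ k" for k by (simp add: geo_weight_def)
  have "summable (\<lambda>k. q ^ k)" using assms by (intro summable_geometric) auto
  then have "(geo_weight q has_sum (suminf (\<lambda>k. geo_weight q (int k)) + suminf (\<lambda>k. geo_weight q (- int k - 1)))) UNIV"
    using assms by (intro has_sum_int_halves summable_sums) (auto simp: 1 2 norm_mult norm_power intro!: summable_mult)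
  then show ?thesis by (auto simp: summable_on_def)
qed

text \<open>Cauchy's estimate on the inner circle for \<open>n \<ge> 0\<close> and on the outer
  circle for \<open>n < 0\<close>. The function enters only through its bound \<open>M\<close> on
  these two circles, so the estimate is uniform over every family that shares \<open>M\<close>; in
  the vector-valued case this family is \<open>\<phi> \<circ> f\<close> for all
  \<open>\<phi>\<close> dominated by one seminorm.\<close>

lemma laurent_term_bound:
  assumes h: "h holomorphic_on ball 0 R - {0}" and r: "0 < r0" "r0 < \<rho>" "\<rho> < r1" "r1 < R"
    and M: "\<And>z. cmod z = r0 \<or> cmod z = r1 \<Longrightarrow> cmod (h z) \<le> M"
    and q: "q = max (r0 / \<rho>) (\<rho> / r1)" and z: "cmod z = \<rho>" and s: "0 < s" "s < R"
  shows "cmod (z powi (- n - 1) * res_coeff s h n) \<le> M * geo_weight q n"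
proof -
  have cont: "continuous_on (sphere 0 r) h" if "0 < r" "r < R" for r
    by (rule continuous_on_subset[OF holomorphic_on_imp_continuous_on[OF h]]) (use that in auto)
  have M0: "M \<ge> 0" using order_trans[OF norm_ge_zero M[of "of_real r0"]] r by simp
  show ?thesis
  proof (cases "n \<ge> 0")
    case True
    have "cmod (res_coeff s h n) \<le> M * r0 powi (n + 1)"
      using res_coeff_bound[OF _ cont[of r0], of M] res_coeff_radius[OF h, of s r0] M r s by auto
    then have "cmod (z powi (- n - 1) * res_coeff s h n) \<le> \<rho> powi (- n - 1) * (M * r0 powi (n + 1))"
      using r by (auto simp: norm_mult norm_power_int z intro!: mult_left_mono)
    also have "\<dots> = M * (r0 / \<rho>) ^ nat (n + 1)"
    proof -
      have "\<rho> powi (- n - 1) = inverse (\<rho> powi (n + 1))"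
        by (metis add_uminus_conv_diff minus_add_distrib power_int_minus)
      then show ?thesis using True by (simp add: power_int_def power_divide field_simps)
    qed
    also have "\<dots> \<le> M * q ^ nat (n + 1)"
      using M0 r q by (intro mult_left_mono power_mono) auto
    finally show ?thesis using True by (simp add: geo_weight_def)
  next
    case False
    have "cmod (res_coeff s h n) \<le> M * r1 powi (n + 1)"
      using res_coeff_bound[OF _ cont[of r1], of M] res_coeff_radius[OF h, of s r1] M r s by auto
    then have "cmod (z powi (- n - 1) * res_coeff s h n) \<le> \<rho> powi (- n - 1) * (M * r1 powi (n + 1))"
      using r by (auto simp: norm_mult norm_power_int z intro!: mult_left_mono)
    also have "\<dots> = M * (\<rho> / r1) ^ nat (- n - 1)"
    proof -
      have "r1 powi (n + 1) = inverse (r1 powi (- n - 1))"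
        by (metis minus_add_distrib add_uminus_conv_diff minus_minus power_int_minus)
      then show ?thesis using False by (simp add: power_int_def power_divide field_simps)
    qed
    also have "\<dots> \<le> M * q ^ nat (- n - 1)"
      using M0 r q by (intro mult_left_mono power_mono) auto
    also have "nat (- n - 1) = nat \<bar>n + 1\<bar>" using False by simp
    finally show ?thesis by (simp add: geo_weight_def)
  qed
qed

lemma summable_int_halves:
  fixes f :: "int \<Rightarrow> complex"
  assumes "\<And>n. norm (f n) \<le> M * geo_weight q n" "0 \<le> q" "q < 1"
  shows "summable (\<lambda>k. norm (f (int k)))" "summable (\<lambda>k. norm (f (- int k - 1)))"
proof -
  have s: "summable (\<lambda>k. q ^ k)" using assms by (intro summable_geometric) auto
  show "summable (\<lambda>k. norm (f (int k)))"
    by (rule summable_comparison_test'[OF summable_mult[OF s, of "M * q"], of 0])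
      (use assms(1)[of "int k" for k] in \<open>auto simp: geo_weight_def nat_add_distrib mult_ac\<close>)
  show "summable (\<lambda>k. norm (f (- int k - 1)))"
    by (rule summable_comparison_test'[OF summable_mult[OF s, of M], of 0])
      (use assms(1)[of "- int k - 1" for k] in \<open>auto simp: geo_weight_def\<close>)
qed

text \<open>Cauchy's formula for the annulus, with both kernels expanded into geometric series.\<close>

lemma laurent_has_sum:
  assumes h: "h holomorphic_on ball 0 R - {0}" and w: "w \<noteq> 0" "cmod w < R" and s: "0 < s" "s < R"
  shows "((\<lambda>n. w powi (- n - 1) * res_coeff s h n) has_sum h w) UNIV"
proof -
  define A where "A = ball (0::complex) R - {0}"
  have opA: "open A" unfolding A_def by (intro open_delete) auto
  define \<rho> where "\<rho> = cmod w"
  obtain r0 r1 where r: "0 < r0" "r0 < \<rho>" "\<rho> < r1" "r1 < R"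
    using w dense[of 0 \<rho>] dense[of \<rho> R] by (auto simp: \<rho>_def)
  have "\<rho> > 0" using r by linarith
  have cont: "continuous_on (sphere 0 r) h" if "0 < r" "r < R" for r
    by (rule continuous_on_subset[OF holomorphic_on_imp_continuous_on[OF h]]) (use that in auto)
  have "bounded (h ` (sphere 0 r0 \<union> sphere 0 r1))"
    using r by (intro compact_imp_bounded compact_continuous_image continuous_on_closed_Un cont) auto
  then obtain M where M: "M > 0" "\<And>z. cmod z = r0 \<or> cmod z = r1 \<Longrightarrow> cmod (h z) \<le> M"
    unfolding bounded_pos by auto
  define q where "q = max (r0 / \<rho>) (\<rho> / r1)"
  have q: "0 \<le> q" "q < 1" using r by (auto simp: q_def le_max_iff_disj)
  define c where "c n = w powi (- n - 1) * res_coeff s h n" for n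
  have cb: "norm (c n) \<le> M * geo_weight q n" for n
    unfolding c_def by (rule laurent_term_bound[OF h r M(2) q_def \<rho>_def[symmetric] s])
  \<comment> \<open>The difference quotient extends holomorphically across \<open>w\<close>, so its
    integrals over the two circles agree; splitting off the elementary integrals of
    \<open>1 / (z - w)\<close> isolates \<open>h w\<close>.\<close>
  define g where "g = (\<lambda>z. if z = w then deriv h w else (h z - h w) / (z - w))"
  have "g holomorphic_on A"
    unfolding g_def using h w opA unfolding A_def
    by (intro pole_lemma) (auto simp: interior_open)
  then have "res_coeff r1 g 0 = res_coeff r0 g 0"
    unfolding A_def using r by (intro res_coeff_radius[where R = R]) auto
  moreover have int1: "(\<lambda>z. h z / (z - w)) contour_integrable_on circlepath 0 r"
      and int2: "(\<lambda>z. h w / (z - w)) contour_integrable_on circlepath 0 r"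
    if "0 < r" "r < R" "r \<noteq> \<rho>" for r
    using that cont[of r] by (auto intro!: contour_integrable_continuous_circlepath continuous_intros simp: \<rho>_def)
  moreover have "res_coeff r g 0 = (contour_integral (circlepath 0 r) (\<lambda>z. h z / (z - w)) -
      h w * contour_integral (circlepath 0 r) (\<lambda>z. 1 / (z - w))) / (2 * pi * \<i>)"
    if r: "0 < r" "r < R" "r \<noteq> \<rho>" for r
  proof -
    have "contour_integral (circlepath 0 r) (\<lambda>z. g z * z powi 0) =
       contour_integral (circlepath 0 r) (\<lambda>z. h z / (z - w) - h w / (z - w))"
      by (rule contour_integral_cong) (use r in \<open>auto simp: g_def \<rho>_def diff_divide_distrib\<close>)
    also have "\<dots> = contour_integral (circlepath 0 r) (\<lambda>z. h z / (z - w)) -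
        contour_integral (circlepath 0 r) (\<lambda>z. h w / (z - w))"
      by (rule contour_integral_diff[OF int1[OF r] int2[OF r]])
    also have "contour_integral (circlepath 0 r) (\<lambda>z. h w / (z - w)) =
       h w * contour_integral (circlepath 0 r) (\<lambda>z. 1 / (z - w))"
    proof -
      have "(\<lambda>z. 1 / (z - w)) contour_integrable_on circlepath 0 r"
        using r by (auto intro!: contour_integrable_continuous_circlepath continuous_intros simp: \<rho>_def)
      from contour_integral_lmul[OF this, of "h w"] show ?thesis by simp
    qed
    finally show ?thesis by (simp add: res_coeff_def)
  qed
  moreover have "contour_integral (circlepath 0 r1) (\<lambda>z. 1 / (z - w)) = 2 * pi * \<i>"
    using Cauchy_integral_circlepath_simple[of "\<lambda>_. 1" 0 r1 w] r
    by (auto simp: \<rho>_def intro: contour_integral_unique)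
  moreover have "contour_integral (circlepath 0 r0) (\<lambda>z. 1 / (z - w)) = 0"
  proof -
    have "((\<lambda>z. 1 / (z - w)) has_contour_integral 0) (circlepath 0 r0)"
      by (rule Cauchy_theorem_convex_simple[of _ "ball 0 \<rho>"])
        (use r in \<open>auto intro!: holomorphic_intros simp: \<rho>_def\<close>)
    then show ?thesis by (rule contour_integral_unique)
  qed
  ultimately have main: "h w = contour_integral (circlepath 0 r1) (\<lambda>z. h z / (z - w)) / (2 * pi * \<i>)
     - contour_integral (circlepath 0 r0) (\<lambda>z. h z / (z - w)) / (2 * pi * \<i>)"
    using r by (simp add: field_simps)
  \<comment> \<open>One statement for both kernels: \<open>u = w / z\<close> and
    \<open>v = 1 / z\<close> on the outer circle, \<open>u = z / w\<close> and
    \<open>v = - 1 / w\<close> on the inner one.\<close>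
  have geo: "uniform_limit (sphere 0 r) (\<lambda>K z. \<Sum>k<K. h z * u z ^ k * v z) (\<lambda>z. h z * v z / (1 - u z)) sequentially"
    if r: "0 < r" "r < R" and u: "\<And>z. cmod z = r \<Longrightarrow> cmod (u z) = q'" and q': "q' < 1" "0 \<le> q'"
      and v: "\<And>z. cmod z = r \<Longrightarrow> cmod (v z) \<le> V" for r u q' v V
  proof -
    have "bounded (h ` sphere 0 r)"
      using r by (intro compact_imp_bounded compact_continuous_image cont) auto
    then obtain M' where M': "M' > 0" "\<And>z. cmod z = r \<Longrightarrow> cmod (h z) \<le> M'"
      unfolding bounded_pos by auto
    have "uniform_limit (sphere 0 r) (\<lambda>K z. \<Sum>k<K. h z * u z ^ k * v z) (\<lambda>z. suminf (\<lambda>k. h z * u z ^ k * v z)) sequentially"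
    proof (rule Weierstrass_m_test)
      show "norm (h z * u z ^ k * v z) \<le> M' * q' ^ k * V" if "z \<in> sphere 0 r" for k z
        unfolding norm_mult norm_power using that u M' v q' by (intro mult_mono) auto
      show "summable (\<lambda>k. M' * q' ^ k * V)"
        using q' by (intro summable_mult summable_mult2 summable_geometric) auto
    qed
    moreover have "suminf (\<lambda>k. h z * u z ^ k * v z) = h z * v z / (1 - u z)" if "z \<in> sphere 0 r" for z
    proof -
      have "(\<lambda>k. h z * u z ^ k * v z) sums (h z * (1 / (1 - u z)) * v z)"
        using that u q' by (intro sums_mult sums_mult2 geometric_sums) auto
      then show ?thesis by (simp add: sums_iff)
    qed
    ultimately show ?thesis by (rule uniform_limit_eq_rhs)
  qed
  have part1: "(\<lambda>k. c (- int k - 1)) sums (contour_integral (circlepath 0 r1) (\<lambda>z. h z / (z - w)) / (2 * pi * \<i>))"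
  proof -
    have "uniform_limit (sphere 0 r1) (\<lambda>K z. \<Sum>k<K. h z * (w / z) ^ k * (1 / z)) (\<lambda>z. h z * (1 / z) / (1 - w / z)) sequentially"
      by (rule geo[where q' = "\<rho> / r1" and V = "1 / r1"]) (use r in \<open>auto simp: norm_divide \<rho>_def\<close>)
    then have "uniform_limit (sphere 0 r1) (\<lambda>K z. \<Sum>k<K. h z * (w / z) ^ k * (1 / z)) (\<lambda>z. h z / (z - w)) sequentially"
      by (rule uniform_limit_eq_rhs) (use r in \<open>auto simp: \<rho>_def field_simps\<close>)
    then have "(\<lambda>K. contour_integral (circlepath 0 r1) (\<lambda>z. \<Sum>k<K. h z * (w / z) ^ k * (1 / z)))
       \<longlonglongrightarrow> contour_integral (circlepath 0 r1) (\<lambda>z. h z / (z - w))"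
      using r cont[of r1] by (intro contour_integral_uniform_limit_circlepath)
        (auto intro!: always_eventually contour_integrable_continuous_circlepath continuous_intros)
    moreover have "contour_integral (circlepath 0 r1) (\<lambda>z. \<Sum>k<K. h z * (w / z) ^ k * (1 / z)) =
        (\<Sum>k<K. c (- int k - 1)) * (2 * pi * \<i>)" for K
    proof -
      have "contour_integral (circlepath 0 r1) (\<lambda>z. \<Sum>k<K. h z * (w / z) ^ k * (1 / z)) =
        contour_integral (circlepath 0 r1) (\<lambda>z. \<Sum>k<K. w ^ k * (h z * z powi (- int k - 1)))"
        by (rule contour_integral_cong)
          (use r in \<open>auto intro!: sum.cong simp: power_int_diff power_int_minus power_divide field_simps\<close>)
      also have "\<dots> = (\<Sum>k<K. w ^ k * contour_integral (circlepath 0 r1) (\<lambda>z. h z * z powi (- int k - 1)))"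
        using r cont[of r1]
        by (subst contour_integral_sum) (auto intro!: sum.cong contour_integral_lmul contour_integrable_lmul circle_integrable)
      also have "\<dots> = (\<Sum>k<K. c (- int k - 1) * (2 * pi * \<i>))"
        using res_coeff_radius[OF h, of s r1] s r
        by (intro sum.cong) (auto simp: c_def res_coeff_def)
      finally show ?thesis by (simp add: sum_distrib_right)
    qed
    ultimately have "(\<lambda>K. (\<Sum>k<K. c (- int k - 1)) * (2 * pi * \<i>) / (2 * pi * \<i>))
       \<longlonglongrightarrow> contour_integral (circlepath 0 r1) (\<lambda>z. h z / (z - w)) / (2 * pi * \<i>)"
      by (intro tendsto_divide) auto
    then show ?thesis by (simp add: sums_def)
  qed
  have part2: "(\<lambda>k. c (int k)) sums (- contour_integral (circlepath 0 r0) (\<lambda>z. h z / (z - w)) / (2 * pi * \<i>))"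
  proof -
    have "uniform_limit (sphere 0 r0) (\<lambda>K z. \<Sum>k<K. h z * (z / w) ^ k * (- 1 / w)) (\<lambda>z. h z * (- 1 / w) / (1 - z / w)) sequentially"
      by (rule geo[where q' = "r0 / \<rho>" and V = "1 / \<rho>"])
        (use r \<open>\<rho> > 0\<close> in \<open>auto simp: norm_divide \<rho>_def\<close>)
    then have "uniform_limit (sphere 0 r0) (\<lambda>K z. \<Sum>k<K. h z * (z / w) ^ k * (- 1 / w)) (\<lambda>z. h z / (z - w)) sequentially"
      by (rule uniform_limit_eq_rhs) (use r w in \<open>auto simp: \<rho>_def divide_simps\<close>, auto simp: algebra_simps)
    then have "(\<lambda>K. contour_integral (circlepath 0 r0) (\<lambda>z. \<Sum>k<K. h z * (z / w) ^ k * (- 1 / w)))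
       \<longlonglongrightarrow> contour_integral (circlepath 0 r0) (\<lambda>z. h z / (z - w))"
      using r w cont[of r0] by (intro contour_integral_uniform_limit_circlepath)
        (auto intro!: always_eventually contour_integrable_continuous_circlepath continuous_intros)
    moreover have "contour_integral (circlepath 0 r0) (\<lambda>z. \<Sum>k<K. h z * (z / w) ^ k * (- 1 / w)) =
        - ((\<Sum>k<K. c (int k)) * (2 * pi * \<i>))" for K
    proof -
      have "contour_integral (circlepath 0 r0) (\<lambda>z. \<Sum>k<K. h z * (z / w) ^ k * (- 1 / w)) =
        contour_integral (circlepath 0 r0) (\<lambda>z. \<Sum>k<K. (- (w powi (- int k - 1))) * (h z * z powi int k))"
        by (rule contour_integral_cong)
          (use r w in \<open>auto intro!: sum.cong simp: power_int_diff power_int_minus power_divide field_simps\<close>)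
      also have "\<dots> = (\<Sum>k<K. (- (w powi (- int k - 1))) * contour_integral (circlepath 0 r0) (\<lambda>z. h z * z powi int k))"
      proof -
        have int: "(\<lambda>z. h z * z powi int k) contour_integrable_on circlepath 0 r0" for k
          by (rule circle_integrable) (use r cont in auto)
        show ?thesis
          by (subst contour_integral_sum, simp, rule contour_integrable_lmul[OF int])
            (rule sum.cong[OF refl contour_integral_lmul[OF int]])
      qed
      also have "\<dots> = (\<Sum>k<K. - (c (int k) * (2 * pi * \<i>)))"
        using res_coeff_radius[OF h, of s r0] s r
        by (intro sum.cong) (auto simp: c_def res_coeff_def simp del: power_int_of_nat)
      finally show ?thesis by (simp add: sum_distrib_right sum_negf)
    qed
    ultimately have "(\<lambda>K. - (- ((\<Sum>k<K. c (int k)) * (2 * pi * \<i>))) / (2 * pi * \<i>))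
       \<longlonglongrightarrow> - contour_integral (circlepath 0 r0) (\<lambda>z. h z / (z - w)) / (2 * pi * \<i>)"
      by (intro tendsto_divide tendsto_minus) auto
    then show ?thesis by (simp add: sums_def)
  qed
  have "(c has_sum (- contour_integral (circlepath 0 r0) (\<lambda>z. h z / (z - w)) / (2 * pi * \<i>) +
      contour_integral (circlepath 0 r1) (\<lambda>z. h z / (z - w)) / (2 * pi * \<i>))) UNIV"
    by (intro has_sum_int_halves part1 part2 summable_int_halves[OF cb q])
  moreover have "- contour_integral (circlepath 0 r0) (\<lambda>z. h z / (z - w)) / (2 * pi * \<i>) +
      contour_integral (circlepath 0 r1) (\<lambda>z. h z / (z - w)) / (2 * pi * \<i>) = h w"
    unfolding main by simp
  ultimately show ?thesis unfolding c_def by simp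
qed

text \<open>Unconditional convergence at the single point \<open>r\<close> is absolute convergence,
  and the moduli of the terms depend on \<open>cmod z\<close> only. Hence the series converges
  uniformly on the circle, and termwise integration leaves the term with
  \<open>m - n - 1 = -1\<close>.\<close>

lemma res_coeff_has_sum:
  assumes r: "r > 0" and sum: "\<And>z. cmod z = r \<Longrightarrow> ((\<lambda>n. z powi (- n - 1) * c n) has_sum h z) UNIV"
  shows "res_coeff r h m = c m"
proof -
  have "(\<lambda>n. of_real r powi (- n - 1) * c n) summable_on UNIV"
    using sum[of "of_real r"] r by (auto simp: summable_on_def)
  then have "(\<lambda>n. norm (of_real r powi (- n - 1) * c n)) summable_on UNIV"
    by (rule summable_on_iff_abs_summable_on_complex[THEN iffD1])
  then have summ: "(\<lambda>n. r powi (- n - 1) * cmod (c n) * r powi m) summable_on UNIV"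
    using r by (intro summable_on_cmult_left) (simp add: norm_mult norm_power_int)
  have "uniform_limit (sphere 0 r) (\<lambda>Y z. \<Sum>n\<in>Y. z powi (- n - 1) * c n * z powi m)
      (\<lambda>z. \<Sum>\<^sub>\<infinity>n. z powi (- n - 1) * c n * z powi m) (finite_subsets_at_top UNIV)"
    by (rule Weierstrass_m_test_general[OF _ summ]) (use r in \<open>auto simp: norm_mult norm_power_int\<close>)
  moreover have "(\<Sum>\<^sub>\<infinity>n. z powi (- n - 1) * c n * z powi m) = h z * z powi m" if "z \<in> sphere 0 r" for z
    using has_sum_cmult_left[OF sum[of z], of "z powi m"] that by (auto intro: infsumI)
  ultimately have "uniform_limit (sphere 0 r) (\<lambda>Y z. \<Sum>n\<in>Y. z powi (- n - 1) * c n * z powi m)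
      (\<lambda>z. h z * z powi m) (finite_subsets_at_top UNIV)"
    by (rule uniform_limit_eq_rhs) auto
  then have lim: "((\<lambda>Y. contour_integral (circlepath 0 r) (\<lambda>z. \<Sum>n\<in>Y. z powi (- n - 1) * c n * z powi m))
      \<longlongrightarrow> contour_integral (circlepath 0 r) (\<lambda>z. h z * z powi m)) (finite_subsets_at_top UNIV)"
    using r by (intro contour_integral_uniform_limit_circlepath)
      (auto intro!: always_eventually contour_integrable_continuous_circlepath continuous_intros)
  have eq: "contour_integral (circlepath 0 r) (\<lambda>z. \<Sum>n\<in>Y. z powi (- n - 1) * c n * z powi m) = c m * (2 * pi * \<i>)"
    if Y: "finite Y" "m \<in> Y" for Y
  proof -
    have pw: "z powi (- n - 1) * c n * z powi m = c n * z powi (m - n - 1)" if "z \<noteq> 0" for z n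
    proof -
      have eq: "m - n - 1 = (- n - 1) + m" by simp
      show ?thesis unfolding eq power_int_add[OF disjI1[OF that]] by (simp only: mult_ac)
    qed
    have "contour_integral (circlepath 0 r) (\<lambda>z. \<Sum>n\<in>Y. z powi (- n - 1) * c n * z powi m) =
       contour_integral (circlepath 0 r) (\<lambda>z. \<Sum>n\<in>Y. c n * z powi (m - n - 1))"
      by (rule contour_integral_cong) (use r in \<open>auto intro!: sum.cong pw\<close>)
    also have "\<dots> = (\<Sum>n\<in>Y. c n * contour_integral (circlepath 0 r) (\<lambda>z. z powi (m - n - 1)))"
      using r Y(1) by (subst contour_integral_sum)
        (auto intro!: sum.cong contour_integral_lmul contour_integrable_lmul contour_integrable_continuous_circlepath continuous_intros)
    also have "\<dots> = (\<Sum>n\<in>Y. if n = m then c m * (2 * pi * \<i>) else 0)"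
      using r by (intro sum.cong) (auto simp: contour_integral_circle_powi)
    finally show ?thesis using Y by simp
  qed
  have "eventually (\<lambda>Y. contour_integral (circlepath 0 r) (\<lambda>z. \<Sum>n\<in>Y. z powi (- n - 1) * c n * z powi m) = c m * (2 * pi * \<i>))
      (finite_subsets_at_top UNIV)"
    unfolding eventually_finite_subsets_at_top using eq by (intro exI[of _ "{m}"]) auto
  then have "((\<lambda>Y. contour_integral (circlepath 0 r) (\<lambda>z. \<Sum>n\<in>Y. z powi (- n - 1) * c n * z powi m))
      \<longlongrightarrow> c m * (2 * pi * \<i>)) (finite_subsets_at_top UNIV)"
    by (rule tendsto_eventually)
  with lim have "contour_integral (circlepath 0 r) (\<lambda>z. h z * z powi m) = c m * (2 * pi * \<i>)"
    by (intro tendsto_unique[OF _ lim]) auto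
  then show ?thesis by (simp add: res_coeff_def)
qed

section \<open>Poles, derivatives and parameter integrals in terms of Laurent coefficients\<close>

lemma res_coeff_holomorphic_nonneg:
  assumes "h holomorphic_on ball 0 R" "0 < r" "r < R" "n \<ge> 0"
  shows "res_coeff r h n = 0"
proof -
  have "((\<lambda>z. h z * z powi n) has_contour_integral 0) (circlepath 0 r)"
    by (rule Cauchy_theorem_convex_simple[of _ "ball 0 R"])
      (use assms in \<open>auto intro!: holomorphic_intros simp: power_int_def\<close>)
  then show ?thesis by (simp add: res_coeff_def contour_integral_unique)
qed

lemma res_coeff_holomorphic_value:
  assumes "h holomorphic_on ball 0 R" "0 < r" "r < R"
  shows "res_coeff r h (-1) = h 0"
proof -
  have "h holomorphic_on cball 0 r" by (rule holomorphic_on_subset[OF assms(1)]) (use assms in auto)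
  then have "((\<lambda>u. h u / (u - 0)) has_contour_integral 2 * of_real pi * \<i> * h 0) (circlepath 0 r)"
    by (rule Cauchy_integral_circlepath_simple) (use assms in auto)
  then have "contour_integral (circlepath 0 r) (\<lambda>u. h u / (u - 0)) = 2 * of_real pi * \<i> * h 0"
    by (rule contour_integral_unique)
  moreover have "h u / (u - 0) = h u * u powi (-1)" for u by (simp add: power_int_minus divide_inverse)
  ultimately have eq: "contour_integral (circlepath 0 r) (\<lambda>u. h u * u powi (-1)) = 2 * of_real pi * \<i> * h 0"
    by (simp only:)
  show ?thesis unfolding res_coeff_def eq by simp
qed

text \<open>After multiplication by \<open>x ^ N\<close> only nonnegative powers of \<open>x\<close>
  survive. Their moduli increase with \<open>cmod x\<close>, so the absolutely convergent series at
  \<open>y\<close>, on the boundary circle, dominates all of them.\<close>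

lemma bounded_by_pole:
  assumes h: "h holomorphic_on ball 0 s - {0}" and s: "s > 0"
    and zero: "\<And>n. n \<ge> int N \<Longrightarrow> res_coeff (s / 2) h n = 0"
  shows "\<exists>B. \<forall>x. 0 < cmod x \<and> cmod x \<le> s / 2 \<longrightarrow> cmod (x ^ N * h x) \<le> B"
proof -
  define c where "c = res_coeff (s / 2) h"
  have sum: "((\<lambda>n. x powi (- n - 1) * c n) has_sum h x) UNIV" if "0 < cmod x" "cmod x \<le> s / 2" for x
    unfolding c_def by (rule laurent_has_sum[OF h]) (use that s in auto)
  define y where "y = complex_of_real (s / 2)"
  have y: "0 < cmod y" "cmod y \<le> s / 2" "y \<noteq> 0" using s by (auto simp: y_def)
  have "(\<lambda>n. y ^ N * (y powi (- n - 1) * c n)) summable_on UNIV"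
    using has_sum_cmult_right[OF sum[OF y(1,2)]] by (auto simp: summable_on_def)
  then have "(\<lambda>n. norm (y ^ N * (y powi (- n - 1) * c n))) summable_on UNIV"
    by (rule summable_on_iff_abs_summable_on_complex[THEN iffD1])
  then obtain B where B: "((\<lambda>n. norm (y ^ N * (y powi (- n - 1) * c n))) has_sum B) UNIV"
    by (auto simp: summable_on_def)
  have "cmod (x ^ N * h x) \<le> B" if x: "0 < cmod x" "cmod x \<le> s / 2" for x
  proof (rule norm_infsum_le[OF has_sum_cmult_right[OF sum[OF x]] B])
    fix n :: int
    show "norm (x ^ N * (x powi (- n - 1) * c n)) \<le> norm (y ^ N * (y powi (- n - 1) * c n))"
    proof (cases "n \<ge> int N")
      case True then show ?thesis using zero by (simp add: c_def)
    next
      case False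
      have pw: "u ^ N * u powi (- n - 1) = u ^ nat (int N - n - 1)" if "u \<noteq> 0" for u :: complex
      proof -
        have "u ^ N * u powi (- n - 1) = u powi (int N + (- n - 1))"
          using that by (simp add: power_int_add[OF disjI1] del: add_diff_eq)
        also have "\<dots> = u ^ nat (int N - n - 1)" using False by (simp add: power_int_def algebra_simps)
        finally show ?thesis .
      qed
      have "x \<noteq> 0" using x by auto
      have "norm (x ^ N * (x powi (- n - 1) * c n)) = cmod x ^ nat (int N - n - 1) * cmod (c n)"
        using pw[OF \<open>x \<noteq> 0\<close>] by (metis mult.assoc norm_mult norm_power)
      also have "\<dots> \<le> cmod y ^ nat (int N - n - 1) * cmod (c n)"
        using x s by (intro mult_right_mono power_mono) (auto simp: y_def)
      also have "\<dots> = norm (y ^ N * (y powi (- n - 1) * c n))"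
        using pw[OF y(3)] by (metis mult.assoc norm_mult norm_power)
      finally show ?thesis .
    qed
  qed
  then show ?thesis by blast
qed

text \<open>Integration by parts: \<open>h z * z powi n\<close> is a primitive on the punctured
  disk, so its derivative has integral zero over the circle.\<close>

lemma res_coeff_deriv:
  assumes h: "h holomorphic_on ball 0 R - {0}" and r: "0 < r" "r < R"
  shows "res_coeff r (deriv h) n = - of_int n * res_coeff r h (n - 1)"
proof -
  define A where "A = ball (0::complex) R - {0}"
  have opA: "open A" unfolding A_def by (intro open_delete) auto
  have h': "deriv h holomorphic_on A" using holomorphic_deriv[OF h] opA by (auto simp: A_def)
  have cont: "continuous_on (sphere 0 r) (deriv h)" "continuous_on (sphere 0 r) h"
    by (rule continuous_on_subset[OF holomorphic_on_imp_continuous_on[OF h']]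
             continuous_on_subset[OF holomorphic_on_imp_continuous_on[OF h]]; use r in \<open>force simp: A_def\<close>)+
  have "((\<lambda>z. deriv h z * z powi n + of_int n * (h z * z powi (n - 1))) has_contour_integral 0) (circlepath 0 r)"
  proof (rule Cauchy_theorem_primitive[where S = A and f = "\<lambda>z. h z * z powi n"])
    fix x assume x: "x \<in> A"
    have "(h has_field_derivative deriv h x) (at x)"
      using h x opA holomorphic_derivI unfolding A_def by blast
    then have 1: "(h has_field_derivative deriv h x) (at x within A)"
      by (rule has_field_derivative_at_within)
    have 2: "((\<lambda>z. z powi n) has_field_derivative of_int n * x powi (n - 1)) (at x within A)"
      using x by (auto simp: A_def intro!: derivative_eq_intros)
    show "((\<lambda>z. h z * z powi n) has_field_derivative
          deriv h x * x powi n + of_int n * (h x * x powi (n - 1))) (at x within A)"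
      using DERIV_mult[OF 1 2] by (simp add: mult_ac)
  qed (use r in \<open>auto simp: A_def\<close>)
  then have "contour_integral (circlepath 0 r) (\<lambda>z. deriv h z * z powi n + of_int n * (h z * z powi (n - 1))) = 0"
    by (rule contour_integral_unique)
  then have "contour_integral (circlepath 0 r) (\<lambda>z. deriv h z * z powi n) +
      of_int n * contour_integral (circlepath 0 r) (\<lambda>z. h z * z powi (n - 1)) = 0"
    using cont r by (subst (asm) contour_integral_add)
      (auto intro!: circle_integrable contour_integrable_lmul simp: contour_integral_lmul circle_integrable)
  then show ?thesis by (simp add: res_coeff_def field_simps add_eq_0_iff2)
qed

text \<open>A non-integrable integrand has the default integral 0 on both sides, so a nonzero scalar
  can be moved out in every case.\<close>

lemma contour_integral_cdiv:
  assumes "c \<noteq> 0"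
  shows "contour_integral g (\<lambda>x. f x / c * u x) = contour_integral g (\<lambda>x. f x * u x) / c"
proof (cases "(\<lambda>x. f x * u x) contour_integrable_on g")
  case True
  then show ?thesis using contour_integral_div[OF True, of c] by simp
next
  case False
  then have "\<not> (\<lambda>x. f x / c * u x) contour_integrable_on g"
    using contour_integrable_lmul[of "\<lambda>x. f x / c * u x" g c] assms by auto
  with False show ?thesis by (simp add: not_integrable_contour_integral)
qed

lemma res_coeff_swap:
  assumes "0 < r" "0 < s" and f: "continuous_on (sphere 0 r \<times> sphere 0 s) (\<lambda>(z, w). f z w)"
  shows "res_coeff r (\<lambda>z. res_coeff s (f z) n) m = res_coeff s (\<lambda>w. res_coeff r (\<lambda>z. f z w) m) n"
proof -
  have fz: "continuous_on (sphere 0 s) (f z)" if "cmod z = r" for z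
  proof -
    have "continuous_on (sphere 0 s) (\<lambda>w. (\<lambda>(z, w). f z w) (z, w))"
      by (rule continuous_on_compose2[OF f]) (use that in \<open>auto intro!: continuous_intros\<close>)
    then show ?thesis by simp
  qed
  have fw: "continuous_on (sphere 0 r) (\<lambda>z. f z w)" if "cmod w = s" for w
  proof -
    have "continuous_on (sphere 0 r) (\<lambda>z. (\<lambda>(z, w). f z w) (z, w))"
      by (rule continuous_on_compose2[OF f]) (use that in \<open>auto intro!: continuous_intros\<close>)
    then show ?thesis by simp
  qed
  define F where "F z w = f z w * w powi n * z powi m" for z w
  have "continuous_on (sphere 0 r \<times> sphere 0 s) (\<lambda>(z, w). F z w)"
    unfolding F_def case_prod_beta using f assms
    by (auto intro!: continuous_intros simp: case_prod_beta)
  then have "contour_integral (circlepath 0 r) (\<lambda>z. contour_integral (circlepath 0 s) (F z)) =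
     contour_integral (circlepath 0 s) (\<lambda>w. contour_integral (circlepath 0 r) (\<lambda>z. F z w))"
    using assms by (intro contour_integral_swap) (auto intro!: continuous_intros simp: vector_derivative_circlepath)
  moreover have "contour_integral (circlepath 0 r) (\<lambda>z. contour_integral (circlepath 0 s) (F z)) =
      contour_integral (circlepath 0 r) (\<lambda>z. contour_integral (circlepath 0 s) (\<lambda>w. f z w * w powi n) * z powi m)"
    unfolding F_def using assms fz
    by (intro contour_integral_cong contour_integral_rmul circle_integrable) auto
  moreover have "contour_integral (circlepath 0 s) (\<lambda>w. contour_integral (circlepath 0 r) (\<lambda>z. F z w)) =
      contour_integral (circlepath 0 s) (\<lambda>w. contour_integral (circlepath 0 r) (\<lambda>z. f z w * z powi m) * w powi n)"
  proof (rule contour_integral_cong[OF refl])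
    fix w :: complex assume "w \<in> path_image (circlepath 0 s)"
    then have w: "cmod w = s" using assms by auto
    have "contour_integral (circlepath 0 r) (\<lambda>z. F z w) =
      contour_integral (circlepath 0 r) (\<lambda>z. f z w * z powi m * w powi n)"
      by (simp add: F_def mult_ac)
    then show "contour_integral (circlepath 0 r) (\<lambda>z. F z w) =
        contour_integral (circlepath 0 r) (\<lambda>z. f z w * z powi m) * w powi n"
      using contour_integral_rmul[OF circle_integrable[OF assms(1) fw[OF w]]] by simp
  qed
  ultimately show ?thesis
    using contour_integral_cdiv[of "2 * pi * \<i>"] by (simp add: res_coeff_def)
qed

text \<open>The index \<open>-2\<close> belongs to the exponent 1, that is, to the linear Taylor
  coefficient.\<close>

lemma res_coeff_deriv_zero:
  assumes "f holomorphic_on ball 0 d" "0 < s" "s < d"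
  shows "deriv f 0 = res_coeff s f (-2)"
proof -
  have 1: "f holomorphic_on cball 0 s" by (rule holomorphic_on_subset[OF assms(1)]) (use assms in auto)
  have 2: "f holomorphic_on ball 0 s" by (rule holomorphic_on_subset[OF assms(1)]) (use assms in auto)
  have "contour_integral (circlepath 0 s) (\<lambda>u. f u / (u - 0)^2) = (2 * pi * \<i>) * deriv f 0"
    by (rule Cauchy_contour_integral_circlepath_2[OF holomorphic_on_imp_continuous_on[OF 1] 2])
      (use assms in simp)
  moreover have "f u / (u - 0)^2 = f u * u powi (-2)" for u
    by (simp add: power_int_def divide_inverse power_inverse)
  ultimately show ?thesis by (simp add: res_coeff_def)
qed

text \<open>Differentiation under the integral sign, through Cauchy's formula and Fubini.\<close>

lemma deriv_res_coeff:
  assumes r: "0 < r" and s: "0 < s" "s < d"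
    and cont: "continuous_on (sphere 0 s \<times> sphere 0 r) (\<lambda>(t, z). k z t)"
    and holk: "\<And>z. cmod z = r \<Longrightarrow> k z holomorphic_on ball 0 d"
    and holf: "f holomorphic_on ball 0 d"
    and f: "\<And>t. cmod t = s \<Longrightarrow> f t = res_coeff r (\<lambda>z. k z t) n"
  shows "deriv f 0 = res_coeff r (\<lambda>z. deriv (k z) 0) n"
proof -
  have "deriv f 0 = res_coeff s f (-2)" by (rule res_coeff_deriv_zero[OF holf s])
  also have "\<dots> = res_coeff s (\<lambda>t. res_coeff r (\<lambda>z. k z t) n) (-2)"
    by (rule res_coeff_cong[OF s(1) f])
  also have "\<dots> = res_coeff r (\<lambda>z. res_coeff s (k z) (-2)) n"
    by (rule res_coeff_swap[OF s(1) r cont])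
  also have "\<dots> = res_coeff r (\<lambda>z. deriv (k z) 0) n"
    by (rule res_coeff_cong[OF r]) (simp add: res_coeff_deriv_zero[OF holk s])
  finally show ?thesis .
qed

text \<open>
  Averages over roots of unity recover the Laurent coefficients, with an error that depends on
  the function only through a bound for the terms of its expansion.
\<close>

definition unity_root :: "nat \<Rightarrow> nat \<Rightarrow> complex" where
  "unity_root N k = cis (2 * pi * real k / real N)"

lemma norm_unity_root [simp]: "cmod (unity_root N k) = 1"
  by (simp add: unity_root_def)

lemma unity_root_nonzero [simp]: "unity_root N k \<noteq> 0"
  using norm_unity_root[of N k] by force

text \<open>A geometric sum whose ratio \<open>\<omega>\<close> satisfies
  \<open>\<omega> ^ N = 1\<close> and differs from 1, because \<open>N\<close> does not divide the
  nonzero integer \<open>j\<close> of smaller modulus.\<close>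

lemma sum_unity_root_powi:
  assumes "0 < \<bar>j\<bar>" "\<bar>j\<bar> < int N"
  shows "(\<Sum>k<N. unity_root N k powi j) = 0"
proof -
  define \<omega> where "\<omega> = unity_root N 1 powi j"
  have N: "N > 0" using assms by auto
  have pw: "unity_root N k = unity_root N 1 ^ k" for k
    by (simp add: unity_root_def Complex.DeMoivre mult_ac)
  have "unity_root N k powi j = \<omega> ^ k" for k
    unfolding pw[of k] \<omega>_def by (simp flip: power_int_mult power_int_of_nat add: mult.commute)
  then have "(\<Sum>k<N. unity_root N k powi j) = (\<Sum>k<N. \<omega> ^ k)" by simp
  moreover have "\<omega> ^ N = 1"
  proof -
    have "\<omega> ^ N = (unity_root N 1 ^ N) powi j"
      unfolding \<omega>_def by (simp flip: power_int_mult power_int_of_nat add: mult.commute)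
    also have "unity_root N 1 ^ N = 1" using N by (simp add: unity_root_def Complex.DeMoivre)
    finally show ?thesis by simp
  qed
  moreover have "\<omega> \<noteq> 1"
  proof
    assume "\<omega> = 1"
    define J where "J = nat \<bar>j\<bar>"
    have "unity_root N 1 ^ J = 1"
    proof (cases "j \<ge> 0")
      case True
      then show ?thesis using \<open>\<omega> = 1\<close> by (simp add: J_def \<omega>_def power_int_def)
    next
      case False
      then show ?thesis using \<open>\<omega> = 1\<close> by (simp add: J_def \<omega>_def power_int_def power_inverse)
    qed
    moreover have "unity_root N 1 ^ J = exp (2 * of_real pi * \<i> * of_nat (J) / of_nat N)"
      by (simp only: unity_root_def Complex.DeMoivre) (simp add: cis_conv_exp mult_ac)
    ultimately have "N dvd J" using complex_root_unity_eq_1[of N "J"] N by simp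
    then have "N \<le> J" using assms by (intro dvd_imp_le) (auto simp: J_def)
    then show False using assms by (simp add: J_def)
  qed
  ultimately show ?thesis by (simp add: geometric_sum)
qed

text \<open>The Riemann sum of the integral in \<open>res_coeff\<close> with equidistant nodes; the
  differential contributes one factor \<open>z\<close>, hence the exponent
  \<open>m + 1\<close>.\<close>

definition unity_average :: "nat \<Rightarrow> int \<Rightarrow> real \<Rightarrow> (complex \<Rightarrow> complex) \<Rightarrow> complex" where
  "unity_average N m \<rho> h =
     (\<Sum>k<N. (of_real \<rho> * unity_root N k) powi (m + 1) / of_nat N * h (of_real \<rho> * unity_root N k))"

lemma has_sum_finite_sum:
  fixes f :: "'i \<Rightarrow> 'b \<Rightarrow> complex"
  assumes "finite I" "\<And>i. i \<in> I \<Longrightarrow> (f i has_sum s i) B"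
  shows "((\<lambda>x. \<Sum>i\<in>I. f i x) has_sum (\<Sum>i\<in>I. s i)) B"
  using assms by (induction I rule: finite_induct) (auto intro!: has_sum_add has_sum_0)

lemma has_sum_diff_complex:
  fixes f g :: "'b \<Rightarrow> complex"
  assumes "(f has_sum a) S" "(g has_sum b) S"
  shows "((\<lambda>x. f x - g x) has_sum (a - b)) S"
proof -
  have "((\<lambda>x. - g x) has_sum - b) S" using assms(2) by (simp add: has_sum_uminus)
  from has_sum_add[OF assms(1) this] show ?thesis by simp
qed

text \<open>Averaging multiplies the \<open>n\<close>-th coefficient by a factor \<open>A n\<close>
  that is 1 for \<open>n = m\<close> and 0 for the other indices at distance less than
  \<open>N\<close> from \<open>m\<close>. Beyond this window aliasing leaves factors of modulus at
  most 1, so the error is a tail of the majorant.\<close>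

lemma unity_average_error:
  assumes \<rho>: "\<rho> > 0" and N: "N > 0"
    and sum: "\<And>z. cmod z = \<rho> \<Longrightarrow> ((\<lambda>n. z powi (- n - 1) * c n) has_sum h z) UNIV"
    and bound: "\<And>n. cmod (of_real \<rho> powi (- n - 1) * c n) \<le> M * geo_weight q n"
    and q: "0 \<le> q" "q < 1"
  shows "cmod (unity_average N m \<rho> h - c m) \<le>
    \<rho> powi (m + 1) * M * (infsum (geo_weight q) UNIV - sum (geo_weight q) {m - int N<..<m + int N})"
proof -
  define S where "S = {m - int N<..<m + int N}"
  define A where "A n = (\<Sum>k<N. unity_root N k powi (m - n)) / of_nat N" for n
  define d where "d n = of_real \<rho> powi (m - n) * c n * A n" for n
  have fS: "finite S" "m \<in> S" using N by (auto simp: S_def)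
  have A0: "A n = 0" if "n \<in> S - {m}" for n
    using that sum_unity_root_powi[of "m - n" N] by (auto simp: A_def S_def)
  have Am: "A m = 1" using N by (simp add: A_def)
  have Ale: "cmod (A n) \<le> 1" for n
  proof -
    have "cmod (\<Sum>k<N. unity_root N k powi (m - n)) \<le> (\<Sum>k<N. 1)"
      by (rule sum_norm_le) (simp add: norm_power_int)
    then show ?thesis using N by (simp add: A_def norm_divide)
  qed
  have "((\<lambda>n. \<Sum>k<N. (of_real \<rho> * unity_root N k) powi (m + 1) / of_nat N *
       ((of_real \<rho> * unity_root N k) powi (- n - 1) * c n)) has_sum unity_average N m \<rho> h) UNIV"
    unfolding unity_average_def using \<rho>
    by (intro has_sum_finite_sum has_sum_cmult_right sum) (auto simp: norm_mult)
  moreover have "(\<Sum>k<N. (of_real \<rho> * unity_root N k) powi (m + 1) / of_nat N *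
       ((of_real \<rho> * unity_root N k) powi (- n - 1) * c n)) = d n" for n
  proof -
    have "z powi (m + 1) * z powi (- n - 1) = z powi (m - n)" if "z \<noteq> 0" for z :: complex
      using that by (simp flip: power_int_add)
    then have "z powi (m + 1) / of_nat N * (z powi (- n - 1) * c n) = z powi (m - n) * c n / of_nat N"
      if "z \<noteq> 0" for z :: complex
      using that by (metis (no_types, lifting) mult.assoc times_divide_eq_left)
    then have "(\<Sum>k<N. (of_real \<rho> * unity_root N k) powi (m + 1) / of_nat N *
       ((of_real \<rho> * unity_root N k) powi (- n - 1) * c n)) =
       (\<Sum>k<N. (of_real \<rho> * unity_root N k) powi (m - n) * c n / of_nat N)"
      using \<rho> by (intro sum.cong) auto
    then show ?thesis
      by (simp add: d_def A_def power_int_mult_distrib sum_distrib_left sum_divide_distrib mult_ac)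
  qed
  ultimately have "(d has_sum unity_average N m \<rho> h) UNIV" by simp
  moreover have "(d has_sum c m) S"
  proof (rule has_sum_finiteI[OF fS(1)])
    have "sum d S = d m + sum d (S - {m})" using fS by (simp add: sum.remove)
    also have "sum d (S - {m}) = 0" by (rule sum.neutral) (auto simp: d_def A0)
    finally show "c m = sum d S" by (simp add: d_def Am)
  qed
  ultimately have "(d has_sum (unity_average N m \<rho> h - c m)) (UNIV - S)"
    by (rule has_sum_Diff) auto
  moreover have "(geo_weight q has_sum (infsum (geo_weight q) UNIV - sum (geo_weight q) S)) (UNIV - S)"
    by (rule has_sum_Diff[OF has_sum_infsum[OF geo_weight_summable[OF q]] has_sum_finite[OF fS(1)]]) auto
  then have "((\<lambda>n. \<rho> powi (m + 1) * M * geo_weight q n) has_sum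
      (\<rho> powi (m + 1) * M * (infsum (geo_weight q) UNIV - sum (geo_weight q) S))) (UNIV - S)"
    by (rule has_sum_cmult_right)
  moreover have "cmod (d n) \<le> \<rho> powi (m + 1) * M * geo_weight q n" for n
  proof -
    have "of_real \<rho> powi (m - n) = of_real \<rho> powi (m + 1) * (of_real \<rho> powi (- n - 1) :: complex)"
      using \<rho> by (simp flip: power_int_add)
    then have "cmod (d n) = \<rho> powi (m + 1) * cmod (of_real \<rho> powi (- n - 1) * c n) * cmod (A n)"
      using \<rho> by (simp add: d_def norm_mult norm_power_int)
    also have "\<dots> \<le> \<rho> powi (m + 1) * (M * geo_weight q n) * 1"
      using \<rho> Ale order_trans[OF norm_ge_zero bound] by (intro mult_mono bound) auto
    finally show ?thesis by (simp add: mult_ac)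
  qed
  ultimately show ?thesis unfolding S_def[symmetric] by (rule norm_infsum_le)
qed

lemma geo_weight_tail_tendsto:
  assumes q: "0 \<le> q" "q < 1"
  shows "(\<lambda>N. infsum (geo_weight q) UNIV - sum (geo_weight q) {m - int N<..<m + int N}) \<longlonglongrightarrow> 0"
proof -
  have "((\<lambda>S. sum (geo_weight q) S) \<longlongrightarrow> infsum (geo_weight q) UNIV) (finite_subsets_at_top UNIV)"
    using geo_weight_summable[OF q] has_sum_infsum has_sum_def by blast
  moreover have "filterlim (\<lambda>N. {m - int N<..<m + int N}) (finite_subsets_at_top UNIV) sequentially"
    unfolding filterlim_finite_subsets_at_top
  proof (intro allI impI)
    fix S :: "int set" assume "finite S \<and> S \<subseteq> UNIV"
    then have "finite S" by simp
    define B where "B = nat (Max (insert 0 ((\<lambda>x. \<bar>x - m\<bar>) ` S))) + 1"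
    have "\<bar>x - m\<bar> < int B" if "x \<in> S" for x
    proof -
      have "\<bar>x - m\<bar> \<le> Max (insert 0 ((\<lambda>x. \<bar>x - m\<bar>) ` S))" using that \<open>finite S\<close> by (intro Max_ge) auto
      then show ?thesis unfolding B_def by linarith
    qed
    then have "S \<subseteq> {m - int N<..<m + int N}" if "N \<ge> B" for N using that by fastforce
    then show "\<forall>\<^sub>F N in sequentially. finite {m - int N<..<m + int N} \<and> S \<subseteq> {m - int N<..<m + int N} \<and>
          {m - int N<..<m + int N} \<subseteq> UNIV"
      by (auto simp: eventually_sequentially)
  qed
  ultimately have "(\<lambda>N. sum (geo_weight q) {m - int N<..<m + int N}) \<longlonglongrightarrow> infsum (geo_weight q) UNIV"
    by (rule filterlim_compose)
  from tendsto_diff[OF tendsto_const this, of "infsum (geo_weight q) UNIV"] show ?thesis by simp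
qed


section \<open>Two-variable expansions in opposite regions\<close>

text \<open>Multiplication by \<open>z - w\<close> in mode indexing: \<open>A m n\<close> is the
  coefficient of \<open>z powi (- m - 1) * w powi (- n - 1)\<close>, and a factor \<open>z\<close>
  lets the old coefficient at \<open>m + 1\<close> appear at \<open>m\<close>.\<close>

definition coeff_diff :: "(int \<Rightarrow> int \<Rightarrow> complex) \<Rightarrow> int \<Rightarrow> int \<Rightarrow> complex" where
  "coeff_diff A m n = A (m + 1) n - A m (n + 1)"

lemma funpow_coeff_diff_minus:
  "(coeff_diff ^^ N) (\<lambda>p q. A p q - B p q) p q = (coeff_diff ^^ N) A p q - (coeff_diff ^^ N) B p q"
proof (induction N arbitrary: A B)
  case (Suc N)
  have "coeff_diff (\<lambda>p q. A p q - B p q) = (\<lambda>p q. coeff_diff A p q - coeff_diff B p q)"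
    by (simp add: fun_eq_iff coeff_diff_def)
  then show ?case by (simp add: funpow_Suc_right Suc.IH del: funpow.simps)
qed simp

text \<open>
  A function on the configurations of two points in a punctured disk, expanded in the regions
  \<open>\<bar>w\<bar> < \<bar>z\<bar>\<close> and \<open>\<bar>z\<bar> < \<bar>w\<bar>\<close>. If \<open>(z - w) ^ N\<close> removes the singularity on the diagonal, the circle
  \<open>\<bar>z\<bar> = const\<close> can be moved across \<open>w\<close>.
\<close>

lemma opposite_expansions_bounded:
  fixes h :: "complex \<Rightarrow> complex \<Rightarrow> complex"
  assumes R: "R > 0"
    and cont: "continuous_on {(z, w). z \<in> ball 0 R - {0} \<and> w \<in> ball 0 R - {0} \<and> z \<noteq> w} (\<lambda>(z, w). h z w)"
    and hol: "\<And>w. w \<in> ball 0 R - {0} \<Longrightarrow> (\<lambda>z. h z w) holomorphic_on (ball 0 R - {0} - {w})"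
    and bounded: "\<And>w. w \<in> ball 0 R - {0} \<Longrightarrow> \<exists>B. eventually (\<lambda>z. cmod (h z w) \<le> B) (at w)"
    and a: "\<And>z w. 0 < cmod w \<Longrightarrow> cmod w < cmod z \<Longrightarrow> cmod z < R \<Longrightarrow>
        ((\<lambda>n. w powi (- n - 1) * a n z) has_sum h z w) UNIV"
    and b: "\<And>z w. 0 < cmod z \<Longrightarrow> cmod z < cmod w \<Longrightarrow> cmod w < R \<Longrightarrow>
        ((\<lambda>m. z powi (- m - 1) * b m w) has_sum h z w) UNIV"
    and A: "\<And>r m n. 0 < r \<Longrightarrow> r < R \<Longrightarrow> res_coeff r (a n) m = A m n"
    and B: "\<And>r m n. 0 < r \<Longrightarrow> r < R \<Longrightarrow> res_coeff r (b m) n = B m n"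
  shows "A m n = B m n"
proof -
  \<comment> \<open>Throughout \<open>w\<close> stays on the middle circle; \<open>z\<close> runs
    over the outer circle for the first expansion and over the inner circle for the second.\<close>
  define r0 r r1 where "r0 = R / 4" and "r = R / 2" and "r1 = 3 * R / 4"
  have r: "0 < r0" "r0 < r" "r < r1" "r1 < R" using R by (auto simp: r0_def r_def r1_def)
  have "A m n = res_coeff r1 (a n) m" using A r by auto
  also have "\<dots> = res_coeff r1 (\<lambda>z. res_coeff r (h z) n) m"
    by (rule res_coeff_cong) (use r in \<open>auto intro!: res_coeff_has_sum[symmetric] a\<close>)
  also have "\<dots> = res_coeff r (\<lambda>w. res_coeff r1 (\<lambda>z. h z w) m) n"
    by (rule res_coeff_swap) (use r in \<open>auto intro!: continuous_on_subset[OF cont]\<close>)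
  also have "\<dots> = res_coeff r (\<lambda>w. res_coeff r0 (\<lambda>z. h z w) m) n"
  proof (rule res_coeff_cong)
    fix w :: complex assume w: "cmod w = r"
    then have w': "w \<in> ball 0 R - {0}" using r by auto
    \<comment> \<open>Boundedness near \<open>w\<close> makes the singularity removable, and the
      extension can be integrated over a circle on either side of \<open>w\<close> with the same
      result.\<close>
    have "w \<in> interior (ball 0 R - {0})" using w' by (subst interior_open) (auto intro: open_delete)
    from holomorphic_on_extend_bounded[OF hol[OF w'] this] bounded[OF w']
    obtain g where g: "g holomorphic_on ball 0 R - {0}" "\<And>z. z \<in> ball 0 R - {0} - {w} \<Longrightarrow> g z = h z w"
      by blast
    have "res_coeff r1 (\<lambda>z. h z w) m = res_coeff r1 g m"
      by (rule res_coeff_cong, use r in simp, rule g(2)[symmetric]) (use r w in auto)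
    also have "\<dots> = res_coeff r0 g m" by (rule res_coeff_radius[OF g(1)]) (use r in auto)
    also have "\<dots> = res_coeff r0 (\<lambda>z. h z w) m"
      by (rule res_coeff_cong, use r in simp, rule g(2)) (use r w in auto)
    finally show "res_coeff r1 (\<lambda>z. h z w) m = res_coeff r0 (\<lambda>z. h z w) m" .
  qed (use r in auto)
  also have "\<dots> = res_coeff r (b m) n"
    by (rule res_coeff_cong) (use r in \<open>auto intro!: res_coeff_has_sum b\<close>)
  also have "\<dots> = B m n" using B r by auto
  finally show ?thesis .
qed

text \<open>One factor \<open>z - w\<close> at a time is absorbed into \<open>h\<close>. On the
  coefficients of either expansion it acts by \<open>coeff_diff\<close>, and when no factor is left
  the function is bounded near the diagonal.\<close>

lemma opposite_expansions:
  fixes h :: "complex \<Rightarrow> complex \<Rightarrow> complex"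
  assumes R: "R > 0"
    and "continuous_on {(z, w). z \<in> ball 0 R - {0} \<and> w \<in> ball 0 R - {0} \<and> z \<noteq> w} (\<lambda>(z, w). h z w)"
    and "\<And>w. w \<in> ball 0 R - {0} \<Longrightarrow> (\<lambda>z. h z w) holomorphic_on (ball 0 R - {0} - {w})"
    and "\<And>w. w \<in> ball 0 R - {0} \<Longrightarrow> \<exists>B. eventually (\<lambda>z. cmod ((z - w) ^ N * h z w) \<le> B) (at w)"
    and "\<And>z w. 0 < cmod w \<Longrightarrow> cmod w < cmod z \<Longrightarrow> cmod z < R \<Longrightarrow>
        ((\<lambda>n. w powi (- n - 1) * a n z) has_sum h z w) UNIV"
    and "\<And>z w. 0 < cmod z \<Longrightarrow> cmod z < cmod w \<Longrightarrow> cmod w < R \<Longrightarrow>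
        ((\<lambda>m. z powi (- m - 1) * b m w) has_sum h z w) UNIV"
    and "\<And>n. continuous_on (ball 0 R - {0}) (a n)" "\<And>n. continuous_on (ball 0 R - {0}) (b n)"
    and "\<And>r m n. 0 < r \<Longrightarrow> r < R \<Longrightarrow> res_coeff r (a n) m = A m n"
    and "\<And>r m n. 0 < r \<Longrightarrow> r < R \<Longrightarrow> res_coeff r (b m) n = B m n"
  shows "(coeff_diff ^^ N) A m n = (coeff_diff ^^ N) B m n"
  using assms(2-)
proof (induction N arbitrary: h a b A B)
  case 0
  then show ?case using opposite_expansions_bounded[OF R, of h a b A B m n] by simp
next
  case (Suc N)
  have shift: "((\<lambda>n. w powi (- n - 1) * f (n + 1)) has_sum w * s) UNIV"
    if "((\<lambda>n. w powi (- n - 1) * f n) has_sum s) UNIV" "w \<noteq> 0" for w s :: complex and f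
  proof -
    have "((\<lambda>n. w * (w powi (- n - 1) * f n)) has_sum w * s) UNIV"
      using that by (intro has_sum_cmult_right)
    moreover have "bij_betw (\<lambda>n::int. n + 1) UNIV UNIV" by (rule bij_betwI[where g = "\<lambda>n. n - 1"]) auto
    ultimately have *: "((\<lambda>n. w * (w powi (- (n + 1) - 1) * f (n + 1))) has_sum w * s) UNIV"
      using has_sum_reindex_bij_betw[of "\<lambda>n::int. n + 1" UNIV UNIV "\<lambda>n. w * (w powi (- n - 1) * f n)"] by simp
    have eq: "w * (w powi (- (n + 1) - 1) * f (n + 1)) = w powi (- n - 1) * f (n + 1)" for n
    proof -
      have "- n - 1 = 1 + (- (n + 1) - 1)" by simp
      then have "w powi (- n - 1) = w powi 1 * w powi (- (n + 1) - 1)"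
        using power_int_add[of w 1 "- (n + 1) - 1"] that(2) by metis
      then show ?thesis by (simp only: power_int_1_right mult.assoc)
    qed
    show ?thesis using * unfolding eq .
  qed
  have cont: "continuous_on (sphere 0 r) (a n)" "continuous_on (sphere 0 r) (b n)" if "0 < r" "r < R" for r n
    by (rule continuous_on_subset[OF Suc.prems(6)] continuous_on_subset[OF Suc.prems(7)]; use that in force)+
  have "(coeff_diff ^^ N) (coeff_diff A) m n = (coeff_diff ^^ N) (coeff_diff B) m n"
  proof (rule Suc.IH[where h = "\<lambda>z w. (z - w) * h z w"
        and a = "\<lambda>n z. z * a n z - a (n + 1) z" and b = "\<lambda>m w. b (m + 1) w - w * b m w"])
    show "continuous_on {(z, w). z \<in> ball 0 R - {0} \<and> w \<in> ball 0 R - {0} \<and> z \<noteq> w} (\<lambda>(z, w). (z - w) * h z w)"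
      using continuous_on_mult[OF continuous_on_diff[OF continuous_on_fst[OF continuous_on_id]
            continuous_on_snd[OF continuous_on_id]] Suc.prems(1)]
      by (simp add: case_prod_unfold)
    show "(\<lambda>z. (z - w) * h z w) holomorphic_on ball 0 R - {0} - {w}" if "w \<in> ball 0 R - {0}" for w
      using Suc.prems(2)[OF that] by (intro holomorphic_intros)
    show "\<exists>B. \<forall>\<^sub>F z in at w. cmod ((z - w) ^ N * ((z - w) * h z w)) \<le> B" if "w \<in> ball 0 R - {0}" for w
      using Suc.prems(3)[OF that] by (simp add: mult_ac)
    show "((\<lambda>n. w powi (- n - 1) * (z * a n z - a (n + 1) z)) has_sum (z - w) * h z w) UNIV"
      if "0 < cmod w" "cmod w < cmod z" "cmod z < R" for z w
      using has_sum_diff_complex[OF has_sum_cmult_right[OF Suc.prems(4)[OF that], of z] shift[OF Suc.prems(4)[OF that]]] that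
      by (simp add: algebra_simps)
    show "((\<lambda>m. z powi (- m - 1) * (b (m + 1) w - w * b m w)) has_sum (z - w) * h z w) UNIV"
      if "0 < cmod z" "cmod z < cmod w" "cmod w < R" for z w
      using has_sum_diff_complex[OF shift[OF Suc.prems(5)[OF that]] has_sum_cmult_right[OF Suc.prems(5)[OF that], of w]] that
      by (simp add: algebra_simps)
    show "continuous_on (ball 0 R - {0}) (\<lambda>z. z * a n z - a (n + 1) z)" for n
      using Suc.prems(6) by (intro continuous_intros)
    show "continuous_on (ball 0 R - {0}) (\<lambda>w. b (n + 1) w - w * b n w)" for n
      using Suc.prems(7) by (intro continuous_intros)
    show "res_coeff r (\<lambda>z. z * a n z - a (n + 1) z) m = coeff_diff A m n" if "0 < r" "r < R" for r m n
      using that cont[OF that] Suc.prems(8)[OF that]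
      by (subst res_coeff_diff) (auto intro!: continuous_intros simp: res_coeff_shift coeff_diff_def)
    show "res_coeff r (\<lambda>w. b (m + 1) w - w * b m w) n = coeff_diff B m n" if "0 < r" "r < R" for r m n
      using that cont[OF that] Suc.prems(9)[OF that]
      by (subst res_coeff_diff) (auto intro!: continuous_intros simp: res_coeff_shift coeff_diff_def)
  qed
  then show ?case by (simp add: funpow_swap1)
qed

section \<open>Laurent expansions in quasi-complete spaces\<close>

lemma has_lcs_laurent_dual:
  assumes "locally_convex_space E" "has_lcs_laurent_expansion E R f c" "\<phi> \<in> lcs_dual E" "z \<in> ball 0 R - {0}"
  shows "((\<lambda>n. z powi (- n - 1) * \<phi> (c n)) has_sum \<phi> (f z)) UNIV"
proof -
  interpret locally_convex_space E by fact
  have c: "\<And>n. c n \<in> carrier E"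
    and lim: "limitin (lcs_topology E) (\<lambda>S. \<Oplus>\<^bsub>E\<^esub>n\<in>S. (z powi (- n - 1)) \<odot>\<^bsub>E\<^esub> c n) (f z) (finite_subsets_at_top UNIV)"
    using assms(2,4) by (auto simp: has_lcs_laurent_expansion_def)
  have "((\<lambda>S. \<phi> (\<Oplus>\<^bsub>E\<^esub>n\<in>S. (z powi (- n - 1)) \<odot>\<^bsub>E\<^esub> c n)) \<longlongrightarrow> \<phi> (f z)) (finite_subsets_at_top UNIV)"
    by (rule limitin_dual[OF assms(3) lim])
  moreover have "eventually (\<lambda>S. \<phi> (\<Oplus>\<^bsub>E\<^esub>n\<in>S. (z powi (- n - 1)) \<odot>\<^bsub>E\<^esub> c n) =
      (\<Sum>n\<in>S. z powi (- n - 1) * \<phi> (c n))) (finite_subsets_at_top UNIV)"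
    by (rule eventually_finite_subsets_at_top_weakI) (use c assms(3) in \<open>auto simp: dual_finsum lcs_dual_scale\<close>)
  ultimately show ?thesis
    unfolding has_sum_def by (rule Lim_transform_eventually)
qed

lemma has_lcs_laurent_res_coeff:
  assumes "locally_convex_space E" "has_lcs_laurent_expansion E R f c" "\<phi> \<in> lcs_dual E" "0 < r" "r < R"
  shows "res_coeff r (\<lambda>z. \<phi> (f z)) n = \<phi> (c n)"
  by (rule res_coeff_has_sum[OF assms(4)]) (rule has_lcs_laurent_dual[OF assms(1-3)], use assms(4,5) in auto)

text \<open>Every functional recovers its values on the coefficients as contour integrals, and
  functionals separate points. This justifies the definite description in
  \<open>lcs_laurent_coeff\<close>.\<close>

lemma has_lcs_laurent_unique:
  assumes E: "locally_convex_space E" "Hausdorff_space (lcs_topology E)"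
    and "has_lcs_laurent_expansion E R f c" "has_lcs_laurent_expansion E R f d" and R: "R > 0"
  shows "c = d"
proof
  fix n
  interpret locally_convex_space E by fact
  show "c n = d n"
  proof (rule dual_eqI[OF E(2)])
    show "c n \<in> carrier E" "d n \<in> carrier E"
      using assms(3,4) by (auto simp: has_lcs_laurent_expansion_def)
    fix \<phi> assume "\<phi> \<in> lcs_dual E"
    then show "\<phi> (c n) = \<phi> (d n)"
      using has_lcs_laurent_res_coeff[OF E(1) assms(3), of \<phi> "R/2" n]
        has_lcs_laurent_res_coeff[OF E(1) assms(4), of \<phi> "R/2" n] R by simp
  qed
qed

section \<open>Existence of vector-valued Laurent coefficients from quasi-completeness\<close>

context locally_convex_space
begin

lemma lcs_bounded_seminormI:
  assumes "B \<subseteq> carrier E" "\<And>p. cts_seminorm E p \<Longrightarrow> \<exists>M. \<forall>x\<in>B. p x \<le> M"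
  shows "lcs_bounded E B"
  unfolding lcs_bounded_def
proof (intro conjI allI impI)
  fix U assume U: "openin (lcs_topology E) U \<and> \<zero> \<in> U"
  then obtain p where p: "cts_seminorm E p" "\<And>x. x \<in> carrier E \<Longrightarrow> p x < 1 \<Longrightarrow> x \<in> U"
    using seminorm_exists by metis
  obtain M where M: "\<And>x. x \<in> B \<Longrightarrow> p x \<le> M" using assms(2)[OF p(1)] by blast
  show "\<exists>s>0. \<forall>c::complex. s \<le> cmod c \<longrightarrow> B \<subseteq> (\<lambda>x. c \<odot> x) ` U"
  proof (intro exI conjI allI impI subsetI)
    \<comment> \<open>The absolute value covers a negative \<open>M\<close>, possible for empty
      \<open>B\<close>; the summand 1 keeps \<open>c\<close> away from 0 and makes the quotient
      strictly smaller than 1.\<close>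
    show "\<bar>M\<bar> + 1 > 0" by simp
    fix c :: complex and x assume c: "\<bar>M\<bar> + 1 \<le> cmod c" and x: "x \<in> B"
    have c0: "c \<noteq> 0" using c by auto
    have xc: "x \<in> carrier E" using x assms(1) by auto
    have "p (inverse c \<odot> x) = p x / cmod c"
      using xc by (simp add: seminorm_scale[OF p(1)] norm_inverse divide_inverse mult.commute)
    also have "\<dots> < 1" using M[OF x] c c0 by (simp add: divide_less_eq)
    finally have "inverse c \<odot> x \<in> U" using p(2) xc by auto
    moreover have "x = c \<odot> (inverse c \<odot> x)" using c0 xc by (simp add: scale_scale)
    ultimately show "x \<in> (\<lambda>x. c \<odot> x) ` U" by blast
  qed
qed (rule assms(1))

lemma cauchy_seminormI:
  assumes s: "\<And>n. s n \<in> carrier E"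
    and c: "\<And>p e. cts_seminorm E p \<Longrightarrow> e > 0 \<Longrightarrow> \<exists>N. \<forall>m\<ge>N. \<forall>n\<ge>N. p (s m \<ominus> s n) < (e::real)"
  shows "lcs_cauchy_filter E (filtermap s sequentially)"
  unfolding lcs_cauchy_filter_def
proof (intro conjI allI impI)
  show "filtermap s sequentially \<noteq> bot" by (simp add: filtermap_bot_iff)
  show "filtermap s sequentially \<le> principal (carrier E)"
    using s by (simp add: le_principal eventually_filtermap)
  fix U assume U: "openin (lcs_topology E) U \<and> \<zero> \<in> U"
  then obtain p where p: "cts_seminorm E p" "\<And>x. x \<in> carrier E \<Longrightarrow> p x < 1 \<Longrightarrow> x \<in> U"
    using seminorm_exists by metis
  obtain N where N: "\<And>m n. m \<ge> N \<Longrightarrow> n \<ge> N \<Longrightarrow> p (s m \<ominus> s n) < 1"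
    using c[OF p(1), of 1] by auto
  show "\<exists>A\<subseteq>carrier E. (\<forall>\<^sub>F x in filtermap s sequentially. x \<in> A) \<and> (\<forall>x\<in>A. \<forall>y\<in>A. x \<ominus> y \<in> U)"
  proof (intro exI conjI ballI)
    show "s ` {N..} \<subseteq> carrier E" using s by auto
    show "\<forall>\<^sub>F x in filtermap s sequentially. x \<in> s ` {N..}"
      by (auto simp: eventually_filtermap eventually_sequentially)
    show "x \<ominus> y \<in> U" if "x \<in> s ` {N..}" "y \<in> s ` {N..}" for x y
      using that s N by (auto intro!: p(2) minus_closed)
  qed
qed

text \<open>Completeness is granted on closed bounded sets only. One bound \<open>M p\<close> is
  fixed for every continuous seminorm, and the set \<open>B\<close> cut out by all these bounds is
  closed and bounded and contains the whole sequence.\<close>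

lemma quasi_complete_convergent:
  assumes qc: "quasi_complete E" and s: "\<And>n. s n \<in> carrier E"
    and b: "\<And>p. cts_seminorm E p \<Longrightarrow> \<exists>M. \<forall>n. p (s n) \<le> M"
    and c: "\<And>p e. cts_seminorm E p \<Longrightarrow> e > 0 \<Longrightarrow> \<exists>N. \<forall>m\<ge>N. \<forall>n\<ge>N. p (s m \<ominus> s n) < (e::real)"
  obtains l where "limitin (lcs_topology E) s l sequentially"
proof -
  have "\<exists>M. \<forall>p. cts_seminorm E p \<longrightarrow> (\<forall>n. p (s n) \<le> M p)"
    by (rule choice) (use b in blast)
  then obtain M where M: "\<And>p n. cts_seminorm E p \<Longrightarrow> p (s n) \<le> M p" by blast
  define B where "B = {x \<in> carrier E. \<forall>p. cts_seminorm E p \<longrightarrow> p x \<le> M p}"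
  have "B = topspace (lcs_topology E) \<inter> (\<Inter>p\<in>{p. cts_seminorm E p}. {x \<in> topspace (lcs_topology E). p x \<in> {..M p}})"
    by (auto simp: B_def topspace_eq)
  moreover have "closedin (lcs_topology E) \<dots>"
  proof (cases "{p. cts_seminorm E p} = {}")
    case False
    then show ?thesis
      by (intro closedin_Int closedin_topspace closedin_INT closedin_continuous_map_preimage)
        (auto intro: continuous_map_seminorm)
  qed auto
  ultimately have "closedin (lcs_topology E) B" by simp
  moreover have "lcs_bounded E B" by (rule lcs_bounded_seminormI) (auto simp: B_def)
  ultimately have "lcs_complete_set E B" using qc by (auto simp: quasi_complete_def)
  moreover have "filtermap s sequentially \<le> principal B"
    using s M by (simp add: le_principal eventually_filtermap B_def)
  moreover have "lcs_cauchy_filter E (filtermap s sequentially)" by (rule cauchy_seminormI) (fact s c)+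
  ultimately obtain x where "limitin (lcs_topology E) (\<lambda>y. y) x (filtermap s sequentially)"
    unfolding lcs_complete_set_def by blast
  then have "limitin (lcs_topology E) s x sequentially"
    by (simp add: limitin_def eventually_filtermap)
  then show ?thesis using that by blast
qed

text \<open>For each functional the coefficient \<open>c' \<phi> m\<close> is a number; the point is
  to find one vector that realises all of them. Knowing the scalar limits one functional at a time
  would only give weak convergence of the averages. The same rate for all \<open>\<phi>\<close>
  dominated by \<open>p\<close> makes them Cauchy for \<open>p\<close>, and it also makes the
  resulting series converge in the original topology.\<close>

theorem laurent_expansion_exists:
  assumes qc: "quasi_complete E" and R: "R > 0"
    and f: "\<And>z. z \<in> ball 0 R - {0} \<Longrightarrow> f z \<in> carrier E"
    and hol: "\<And>\<phi>. \<phi> \<in> lcs_dual E \<Longrightarrow> (\<lambda>z. \<phi> (f z)) holomorphic_on ball 0 R - {0}"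
    and cont: "\<And>p. cts_seminorm E p \<Longrightarrow> continuous_on (ball 0 R - {0}) (\<lambda>z. p (f z))"
  obtains c where "has_lcs_laurent_expansion E R f c"
proof -
  \<comment> \<open>A bound for \<open>p \<circ> f\<close> on two circles bounds
    \<open>\<phi> \<circ> f\<close> there for every \<open>\<phi>\<close> dominated by
    \<open>p\<close>, which is the input required by \<open>laurent_term_bound\<close>.\<close>
  have bnd: "\<exists>M. \<forall>z. cmod z = a \<or> cmod z = b \<longrightarrow> p (f z) \<le> M"
    if p: "cts_seminorm E p" and ab: "0 < a" "a < R" "0 < b" "b < R" for p a b
  proof -
    have "sphere 0 a \<union> sphere 0 b \<subseteq> ball (0::complex) R - {0}" using ab by auto
    then have "compact ((\<lambda>z. p (f z)) ` (sphere 0 a \<union> sphere 0 b))"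
      by (intro compact_continuous_image continuous_on_subset[OF cont[OF p]]) auto
    then have "bounded ((\<lambda>z. p (f z)) ` (sphere 0 a \<union> sphere 0 b))" by (rule compact_imp_bounded)
    then obtain M where "\<And>y. y \<in> (\<lambda>z. p (f z)) ` (sphere 0 a \<union> sphere 0 b) \<Longrightarrow> norm y \<le> M"
      unfolding bounded_iff by blast
    then have "\<forall>z. cmod z = a \<or> cmod z = b \<longrightarrow> p (f z) \<le> M" by fastforce
    then show ?thesis by blast
  qed
  define c' where "c' \<phi> n = res_coeff (R / 2) (\<lambda>z. \<phi> (f z)) n" for \<phi> n
  have expand: "((\<lambda>n. z powi (- n - 1) * c' \<phi> n) has_sum \<phi> (f z)) UNIV"
    if "\<phi> \<in> lcs_dual E" "z \<in> ball 0 R - {0}" for \<phi> z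
    unfolding c'_def by (rule laurent_has_sum[OF hol]) (use that R in auto)
  text \<open>Since the bound is uniform in \<open>\<phi>\<close>, Hahn--Banach turns it into an estimate of \<open>p\<close> itself.\<close>
  have term_bound: "\<exists>M q. M \<ge> 0 \<and> 0 \<le> q \<and> q < 1 \<and> (\<forall>\<phi> z n. \<phi> \<in> lcs_dual E \<longrightarrow> (\<forall>x\<in>carrier E. cmod (\<phi> x) \<le> p x) \<longrightarrow>
      cmod z = \<rho> \<longrightarrow> cmod (z powi (- n - 1) * c' \<phi> n) \<le> M * geo_weight q n)"
    if p: "cts_seminorm E p" and \<rho>: "0 < \<rho>" "\<rho> < R" for p \<rho>
  proof -
    define r0 r1 where "r0 = \<rho> / 2" and "r1 = (\<rho> + R) / 2"
    have r: "0 < r0" "r0 < \<rho>" "\<rho> < r1" "r1 < R" using \<rho> by (auto simp: r0_def r1_def)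
    obtain M where M: "\<And>z. cmod z = r0 \<or> cmod z = r1 \<Longrightarrow> p (f z) \<le> M"
      using bnd[OF p, of r0 r1] r by auto
    have "0 \<le> p (f (of_real r0))" using r by (intro seminorm_nonneg[OF p] f) auto
    then have "M \<ge> 0" using M[of "of_real r0"] r by auto
    moreover have "0 \<le> max (r0 / \<rho>) (\<rho> / r1)" "max (r0 / \<rho>) (\<rho> / r1) < 1" using r by (auto simp: le_max_iff_disj)
    moreover have "cmod (z powi (- n - 1) * c' \<phi> n) \<le> M * geo_weight (max (r0 / \<rho>) (\<rho> / r1)) n"
      if \<phi>: "\<phi> \<in> lcs_dual E" "\<And>x. x \<in> carrier E \<Longrightarrow> cmod (\<phi> x) \<le> p x" and z: "cmod z = \<rho>" for \<phi> z n
      unfolding c'_def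
    proof (rule laurent_term_bound[OF hol[OF \<phi>(1)] r _ refl z])
      show "cmod (\<phi> (f z)) \<le> M" if "cmod z = r0 \<or> cmod z = r1" for z
        using \<phi>(2)[of "f z"] f[of z] M[OF that] that r by force
    qed (use R in auto)
    ultimately show ?thesis by blast
  qed
  define \<rho> where "\<rho> = R / 2"
  have \<rho>: "0 < \<rho>" "\<rho> < R" using R by (auto simp: \<rho>_def)
  \<comment> \<open>The number of nodes is \<open>Suc N\<close>, so that no average divides by
    0.\<close>
  define avg where "avg m N = (\<Oplus>k\<in>{..<Suc N}. ((of_real \<rho> * unity_root (Suc N) k) powi (m + 1) / of_nat (Suc N)) \<odot>
      f (of_real \<rho> * unity_root (Suc N) k))" for m N
  have pt: "f (of_real \<rho> * unity_root N k) \<in> carrier E" for N k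
    using \<rho> by (intro f) (auto simp: norm_mult)
  have avg_closed: "avg m N \<in> carrier E" for m N
    unfolding avg_def using pt by (intro finsum_closed) auto
  have avg_dual: "\<phi> (avg m N) = unity_average (Suc N) m \<rho> (\<lambda>z. \<phi> (f z))" if "\<phi> \<in> lcs_dual E" for \<phi> m N
    unfolding avg_def unity_average_def using pt that
    by (subst dual_finsum) (auto simp: lcs_dual_scale)
  have err: "\<exists>\<epsilon>. \<epsilon> \<longlonglongrightarrow> 0 \<and> (\<forall>\<phi> N. \<phi> \<in> lcs_dual E \<longrightarrow> (\<forall>x\<in>carrier E. cmod (\<phi> x) \<le> p x) \<longrightarrow>
      cmod (\<phi> (avg m N) - c' \<phi> m) \<le> \<epsilon> N)" if p: "cts_seminorm E p" for p m
  proof -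
    obtain M q where q: "0 \<le> q" "q < 1" and Mq: "\<And>\<phi> z n. \<phi> \<in> lcs_dual E \<Longrightarrow> (\<forall>x\<in>carrier E. cmod (\<phi> x) \<le> p x) \<Longrightarrow>
      cmod z = \<rho> \<Longrightarrow> cmod (z powi (- n - 1) * c' \<phi> n) \<le> M * geo_weight q n"
      using term_bound[OF p \<rho>] by blast
    define \<epsilon> where "\<epsilon> N = \<rho> powi (m + 1) * M *
       (infsum (geo_weight q) UNIV - sum (geo_weight q) {m - int (Suc N)<..<m + int (Suc N)})" for N
    have "\<epsilon> \<longlonglongrightarrow> \<rho> powi (m + 1) * M * 0"
      unfolding \<epsilon>_def using LIMSEQ_Suc[OF geo_weight_tail_tendsto[OF q, of m]] by (intro tendsto_mult tendsto_const)
    moreover have "cmod (\<phi> (avg m N) - c' \<phi> m) \<le> \<epsilon> N"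
      if \<phi>: "\<phi> \<in> lcs_dual E" "\<forall>x\<in>carrier E. cmod (\<phi> x) \<le> p x" for \<phi> N
      unfolding avg_dual[OF \<phi>(1)] \<epsilon>_def
    proof (rule unity_average_error)
      show "((\<lambda>n. z powi (- n - 1) * c' \<phi> n) has_sum \<phi> (f z)) UNIV" if "cmod z = \<rho>" for z
        using that \<rho> by (intro expand[OF \<phi>(1)]) auto
      show "cmod (complex_of_real \<rho> powi (- n - 1) * c' \<phi> n) \<le> M * geo_weight q n" for n
        using \<rho> by (intro Mq[OF \<phi>]) auto
    qed (use \<rho> q in auto)
    ultimately show ?thesis by auto
  qed
  have conv: "\<exists>l. limitin (lcs_topology E) (avg m) l sequentially" for m
  proof -
    have diff: "\<exists>N. \<forall>i\<ge>N. \<forall>j\<ge>N. p (avg m i \<ominus> avg m j) < e" if p: "cts_seminorm E p" and e: "e > 0" for p e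
    proof -
      obtain \<epsilon> where \<epsilon>: "\<epsilon> \<longlonglongrightarrow> 0" and le: "\<And>\<phi> N. \<phi> \<in> lcs_dual E \<Longrightarrow> (\<forall>x\<in>carrier E. cmod (\<phi> x) \<le> p x) \<Longrightarrow>
         cmod (\<phi> (avg m N) - c' \<phi> m) \<le> \<epsilon> N" using err[OF p, of m] by blast
      have "eventually (\<lambda>N. \<epsilon> N < e / 2) sequentially" using \<epsilon> e by (intro order_tendstoD) auto
      then obtain N where N: "\<And>i. i \<ge> N \<Longrightarrow> \<epsilon> i < e / 2" by (auto simp: eventually_sequentially)
      have "p (avg m i \<ominus> avg m j) < e" if "i \<ge> N" "j \<ge> N" for i j
      proof -
        have cl: "avg m i \<ominus> avg m j \<in> carrier E" using avg_closed by auto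
        obtain \<phi> where \<phi>: "\<phi> \<in> lcs_dual E" "\<And>y. y \<in> carrier E \<Longrightarrow> cmod (\<phi> y) \<le> p y"
          "\<phi> (avg m i \<ominus> avg m j) = complex_of_real (p (avg m i \<ominus> avg m j))"
          using lcs_hahn_banach[OF p cl] by metis
        have "p (avg m i \<ominus> avg m j) \<le> cmod (\<phi> (avg m i) - \<phi> (avg m j))"
          unfolding dual_diff[OF \<phi>(1) avg_closed avg_closed, symmetric] \<phi>(3) by simp
        also have "\<dots> \<le> cmod (\<phi> (avg m i) - c' \<phi> m) + cmod (\<phi> (avg m j) - c' \<phi> m)"
          using norm_triangle_ineq4[of "\<phi> (avg m i) - c' \<phi> m" "\<phi> (avg m j) - c' \<phi> m"] by simp
        also have "\<dots> < e" using le[OF \<phi>(1), of i] le[OF \<phi>(1), of j] \<phi>(2) N[OF that(1)] N[OF that(2)] by fastforce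
        finally show ?thesis .
      qed
      then show ?thesis by blast
    qed
    have bd: "\<exists>M. \<forall>n. p (avg m n) \<le> M" if p: "cts_seminorm E p" for p
    proof -
      obtain N where N: "\<And>i j. i \<ge> N \<Longrightarrow> j \<ge> N \<Longrightarrow> p (avg m i \<ominus> avg m j) < 1" using diff[OF p, of 1] by auto
      have "p (avg m n) \<le> Max ((\<lambda>n. p (avg m n)) ` {..N}) + 1" for n
      proof (cases "n \<le> N")
        case True
        then have "p (avg m n) \<le> Max ((\<lambda>n. p (avg m n)) ` {..N})" by (intro Max_ge) auto
        then show ?thesis by simp
      next
        case False
        have "p (avg m n) \<le> p (avg m N) + p (avg m n \<ominus> avg m N)"
          by (rule seminorm_triangle[OF p avg_closed avg_closed])
        moreover have "p (avg m N) \<le> Max ((\<lambda>n. p (avg m n)) ` {..N})" by (intro Max_ge) auto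
        moreover have "p (avg m n \<ominus> avg m N) < 1" by (rule N) (use False in auto)
        ultimately show ?thesis by linarith
      qed
      then show ?thesis by blast
    qed
    show ?thesis
      by (rule quasi_complete_convergent[OF qc, of "avg m"]) (use avg_closed bd diff in blast)+
  qed
  define c where "c m = (SOME l. limitin (lcs_topology E) (avg m) l sequentially)" for m
  have lim: "limitin (lcs_topology E) (avg m) (c m) sequentially" for m
    unfolding c_def using someI_ex[OF conv] .
  have c_closed: "c m \<in> carrier E" for m using lim[of m] by (auto simp: limitin_def topspace_eq)
  have c_dual: "\<phi> (c m) = c' \<phi> m" if \<phi>: "\<phi> \<in> lcs_dual E" for \<phi> m
  proof -
    have "(\<lambda>N. \<phi> (avg m N)) \<longlonglongrightarrow> \<phi> (c m)" by (rule limitin_dual[OF \<phi> lim])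
    \<comment> \<open>The seminorm \<open>cmod \<circ> \<phi>\<close> dominates
      \<open>\<phi>\<close> itself, so the uniform estimate specialises to this functional.\<close>
    moreover obtain \<epsilon> where \<epsilon>: "\<epsilon> \<longlonglongrightarrow> 0" "\<And>N. cmod (\<phi> (avg m N) - c' \<phi> m) \<le> \<epsilon> N"
      using err[OF dual_seminorm[OF \<phi>], of m] \<phi> by blast
    have "(\<lambda>N. \<phi> (avg m N) - c' \<phi> m) \<longlonglongrightarrow> 0"
      by (rule Lim_null_comparison[OF _ \<epsilon>(1)]) (use \<epsilon>(2) in auto)
    then have "(\<lambda>N. \<phi> (avg m N)) \<longlonglongrightarrow> c' \<phi> m" by (simp add: LIM_zero_iff)
    ultimately show ?thesis by (rule LIMSEQ_unique)
  qed
  have "has_lcs_laurent_expansion E R f c"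
    unfolding has_lcs_laurent_expansion_def
  proof (intro conjI ballI)
    show "range c \<subseteq> carrier E" using c_closed by auto
    fix z assume z: "z \<in> ball (0::complex) R - {0}"
    have sum_closed: "(\<Oplus>n\<in>S. (z powi (- n - 1)) \<odot> c n) \<in> carrier E" for S
      using c_closed by (intro finsum_closed) auto
    show "limitin (lcs_topology E) (\<lambda>S. \<Oplus>n\<in>S. (z powi (- n - 1)) \<odot> c n) (f z) (finite_subsets_at_top UNIV)"
      unfolding limitin_iff_seminorm
    proof (intro conjI allI impI)
      show "f z \<in> carrier E" using f z by auto
      show "\<forall>\<^sub>F S in finite_subsets_at_top UNIV. (\<Oplus>n\<in>S. (z powi (- n - 1)) \<odot> c n) \<in> carrier E"
        using sum_closed by simp
      fix p assume p: "cts_seminorm E p"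
      obtain M q where q: "0 \<le> q" "q < 1" and Mq: "\<And>\<phi> n. \<phi> \<in> lcs_dual E \<Longrightarrow> (\<forall>x\<in>carrier E. cmod (\<phi> x) \<le> p x) \<Longrightarrow>
         cmod (z powi (- n - 1) * c' \<phi> n) \<le> M * geo_weight q n"
      proof -
        have "0 < cmod z" "cmod z < R" using z by auto
        from term_bound[OF p this] show ?thesis using that by blast
      qed
      \<comment> \<open>The remainder is tested on a functional that attains \<open>p\<close> on it;
        the tail of the majorant bounds the tail of the scalar series of any functional below
        \<open>p\<close>.\<close>
      have le: "norm (p ((\<Oplus>n\<in>S. (z powi (- n - 1)) \<odot> c n) \<ominus> f z)) \<le> M * (infsum (geo_weight q) UNIV - sum (geo_weight q) S)"
        if S: "finite S" for S
      proof -
        define x where "x = (\<Oplus>n\<in>S. (z powi (- n - 1)) \<odot> c n) \<ominus> f z"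
        have x: "x \<in> carrier E" unfolding x_def using sum_closed f z by auto
        obtain \<phi> where \<phi>: "\<phi> \<in> lcs_dual E" "\<And>y. y \<in> carrier E \<Longrightarrow> cmod (\<phi> y) \<le> p y" "\<phi> x = complex_of_real (p x)"
          using lcs_hahn_banach[OF p x] by metis
        have "\<phi> x = (\<Sum>n\<in>S. z powi (- n - 1) * c' \<phi> n) - \<phi> (f z)"
          unfolding x_def using sum_closed f z c_closed S
          by (simp add: dual_diff[OF \<phi>(1)] dual_finsum[OF \<phi>(1)] lcs_dual_scale[OF \<phi>(1)] c_dual[OF \<phi>(1)])
        moreover have "cmod (\<phi> (f z) - (\<Sum>n\<in>S. z powi (- n - 1) * c' \<phi> n)) \<le> M * (infsum (geo_weight q) UNIV - sum (geo_weight q) S)"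
        proof (rule norm_infsum_le)
          show "((\<lambda>n. z powi (- n - 1) * c' \<phi> n) has_sum (\<phi> (f z) - (\<Sum>n\<in>S. z powi (- n - 1) * c' \<phi> n))) (UNIV - S)"
            by (rule has_sum_Diff[OF expand[OF \<phi>(1) z] has_sum_finite[OF S]]) auto
          show "((\<lambda>n. M * geo_weight q n) has_sum (M * (infsum (geo_weight q) UNIV - sum (geo_weight q) S))) (UNIV - S)"
            by (rule has_sum_cmult_right[OF has_sum_Diff[OF has_sum_infsum[OF geo_weight_summable[OF q]] has_sum_finite[OF S]]]) auto
          show "cmod (z powi (- n - 1) * c' \<phi> n) \<le> M * geo_weight q n" for n
            by (rule Mq) (use \<phi> in auto)
        qed
        ultimately have "cmod (\<phi> x) \<le> M * (infsum (geo_weight q) UNIV - sum (geo_weight q) S)"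
          by (simp add: norm_minus_commute)
        then show ?thesis unfolding x_def[symmetric] \<phi>(3) by simp
      qed
      have "((\<lambda>S. sum (geo_weight q) S) \<longlongrightarrow> infsum (geo_weight q) UNIV) (finite_subsets_at_top UNIV)"
        using geo_weight_summable[OF q] has_sum_infsum has_sum_def by blast
      from tendsto_mult[OF tendsto_const tendsto_diff[OF tendsto_const this], of M "infsum (geo_weight q) UNIV"]
      have "((\<lambda>S. M * (infsum (geo_weight q) UNIV - sum (geo_weight q) S)) \<longlongrightarrow> 0) (finite_subsets_at_top UNIV)"
        by simp
      then show "((\<lambda>S. p ((\<Oplus>n\<in>S. (z powi (- n - 1)) \<odot> c n) \<ominus> f z)) \<longlongrightarrow> 0) (finite_subsets_at_top UNIV)"
        by (rule Lim_null_comparison[rotated]) (rule eventually_finite_subsets_at_top_weakI, rule le)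
    qed
  qed
  then show ?thesis using that by blast
qed

end

section \<open>Tensor products\<close>

definition pm_scale :: "complex \<Rightarrow> ('k \<Rightarrow>\<^sub>0 complex) \<Rightarrow> ('k \<Rightarrow>\<^sub>0 complex)" where
  "pm_scale c \<phi> = Poly_Mapping.map (\<lambda>d. c * d) \<phi>"

lemma lookup_pm_scale [simp]: "Poly_Mapping.lookup (pm_scale c \<phi>) k = c * Poly_Mapping.lookup \<phi> k"
  unfolding pm_scale_def by transfer (simp add: when_def)

lemma tensor_null_scale: "\<phi> \<in> tensor_null E F \<Longrightarrow> pm_scale c \<phi> \<in> tensor_null E F"
  unfolding pm_scale_def by (rule tensor_null.smult)

lemma pm_scale_diff: "pm_scale c (\<phi> - \<psi>) = pm_scale c \<phi> - pm_scale c \<psi>"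
  by (rule poly_mapping_eqI) (simp add: lookup_minus algebra_simps)

lemma pm_scale_minus_one: "pm_scale (-1) \<phi> = - \<phi>"
  by (rule poly_mapping_eqI) simp

lemma pm_scale_single: "pm_scale c (Poly_Mapping.single p d) = Poly_Mapping.single p (c * d)"
  by (rule poly_mapping_eqI) (simp add: lookup_single when_def)

lemma tensor_null_diff:
  assumes "\<phi> \<in> tensor_null E F" "\<psi> \<in> tensor_null E F"
  shows "\<phi> - \<psi> \<in> tensor_null E F"
  using tensor_null.add[OF assms(1) tensor_null_scale[OF assms(2), of "-1"]]
  by (simp add: pm_scale_minus_one)

lemma tensor_null_uminus: "\<phi> \<in> tensor_null E F \<Longrightarrow> - \<phi> \<in> tensor_null E F"
  using tensor_null_diff[OF tensor_null.zero] by (metis diff_0)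

lemma tensor_free_add: "\<phi> \<in> tensor_free E F \<Longrightarrow> \<psi> \<in> tensor_free E F \<Longrightarrow> \<phi> + \<psi> \<in> tensor_free E F"
  using keys_add[of \<phi> \<psi>] by (auto simp: tensor_free_def)

lemma tensor_free_diff: "\<phi> \<in> tensor_free E F \<Longrightarrow> \<psi> \<in> tensor_free E F \<Longrightarrow> \<phi> - \<psi> \<in> tensor_free E F"
  using keys_diff[of \<phi> \<psi>] by (auto simp: tensor_free_def)

lemma tensor_free_scale: "\<phi> \<in> tensor_free E F \<Longrightarrow> pm_scale c \<phi> \<in> tensor_free E F"
  by (auto simp: tensor_free_def in_keys_iff subset_eq)

lemma tensor_free_zero: "0 \<in> tensor_free E F"
  by (simp add: tensor_free_def)

lemma tensor_free_single: "x \<in> carrier E \<Longrightarrow> y \<in> carrier F \<Longrightarrow> Poly_Mapping.single (x, y) c \<in> tensor_free E F"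
  by (simp add: tensor_free_def)

definition tensor_class where
  "tensor_class E F \<phi> = tensor_rel E F `` {\<phi>}"

lemma equiv_tensor_rel: "equiv (tensor_free E F) (tensor_rel E F)"
proof (rule equivI)
  show "tensor_rel E F \<subseteq> tensor_free E F \<times> tensor_free E F" by (auto simp: tensor_rel_def)
  show "refl_on (tensor_free E F) (tensor_rel E F)"
    by (rule refl_onI) (auto simp: tensor_rel_def tensor_null.zero)
  show "sym (tensor_rel E F)"
    by (rule symI) (use tensor_null_uminus in \<open>fastforce simp: tensor_rel_def\<close>)
  show "trans (tensor_rel E F)"
    by (rule transI) (use tensor_null.add in \<open>fastforce simp: tensor_rel_def\<close>)
qed

lemma tensor_class_eq_iff:
  "\<phi> \<in> tensor_free E F \<Longrightarrow> \<psi> \<in> tensor_free E F \<Longrightarrow>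
     tensor_class E F \<phi> = tensor_class E F \<psi> \<longleftrightarrow> \<phi> - \<psi> \<in> tensor_null E F"
  unfolding tensor_class_def
  by (subst eq_equiv_class_iff[OF equiv_tensor_rel]) (auto simp: tensor_rel_def)

lemma tensor_class_eqI:
  "\<phi> \<in> tensor_free E F \<Longrightarrow> \<psi> \<in> tensor_free E F \<Longrightarrow> \<phi> - \<psi> \<in> tensor_null E F \<Longrightarrow>
     tensor_class E F \<phi> = tensor_class E F \<psi>"
  by (simp add: tensor_class_eq_iff)

lemma in_tensor_class_iff:
  "\<phi> \<in> tensor_free E F \<Longrightarrow> \<psi> \<in> tensor_class E F \<phi> \<longleftrightarrow> \<psi> \<in> tensor_free E F \<and> \<phi> - \<psi> \<in> tensor_null E F"
  by (auto simp: tensor_class_def tensor_rel_def)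

lemma tensor_class_self: "\<phi> \<in> tensor_free E F \<Longrightarrow> \<phi> \<in> tensor_class E F \<phi>"
  by (simp add: in_tensor_class_iff tensor_null.zero)

lemma pure_tensor_class: "pure_tensor E F x y = tensor_class E F (Poly_Mapping.single (x, y) 1)"
  by (simp add: pure_tensor_def tensor_class_def)

lemma carrier_tensor_topology:
  "carrier (tensor_with_topology E F \<tau>) = tensor_class E F ` tensor_free E F"
  by (auto simp: tensor_with_topology_def quotient_def tensor_class_def)

lemma zero_tensor_topology: "\<zero>\<^bsub>tensor_with_topology E F \<tau>\<^esub> = tensor_class E F 0"
  by (simp add: tensor_with_topology_def tensor_class_def)

text \<open>The record defines a sum as a union over all representatives. Independence of the
  representatives makes every member of the union the same class; the scalar multiple is handled
  alike.\<close>

lemma add_tensor_topology: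
  assumes "\<phi> \<in> tensor_free E F" "\<psi> \<in> tensor_free E F"
  shows "tensor_class E F \<phi> \<oplus>\<^bsub>tensor_with_topology E F \<tau>\<^esub> tensor_class E F \<psi> = tensor_class E F (\<phi> + \<psi>)"
proof -
  have *: "tensor_class E F (\<phi>' + \<psi>') = tensor_class E F (\<phi> + \<psi>)"
    if "\<phi>' \<in> tensor_class E F \<phi>" "\<psi>' \<in> tensor_class E F \<psi>" for \<phi>' \<psi>'
  proof (rule tensor_class_eqI)
    have "\<phi> - \<phi>' \<in> tensor_null E F" "\<psi> - \<psi>' \<in> tensor_null E F"
      using that assms by (auto simp: in_tensor_class_iff)
    then have "- ((\<phi> - \<phi>') + (\<psi> - \<psi>')) \<in> tensor_null E F"
      by (intro tensor_null_uminus tensor_null.add)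
    moreover have "\<phi>' + \<psi>' - (\<phi> + \<psi>) = - ((\<phi> - \<phi>') + (\<psi> - \<psi>'))" by simp
    ultimately show "\<phi>' + \<psi>' - (\<phi> + \<psi>) \<in> tensor_null E F" by (simp only:)
  qed (use that assms in \<open>auto simp: in_tensor_class_iff intro: tensor_free_add\<close>)
  show ?thesis
  proof -
    have "tensor_class E F \<phi> \<oplus>\<^bsub>tensor_with_topology E F \<tau>\<^esub> tensor_class E F \<psi> =
       (\<Union>\<phi>'\<in>tensor_class E F \<phi>. \<Union>\<psi>'\<in>tensor_class E F \<psi>. tensor_class E F (\<phi>' + \<psi>'))"
      by (simp add: tensor_with_topology_def tensor_class_def)
    also have "\<dots> = (\<Union>\<phi>'\<in>tensor_class E F \<phi>. \<Union>\<psi>'\<in>tensor_class E F \<psi>. tensor_class E F (\<phi> + \<psi>))"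
      by (intro SUP_cong refl *)
    also have "\<dots> = tensor_class E F (\<phi> + \<psi>)"
      using tensor_class_self[OF assms(1)] tensor_class_self[OF assms(2)] by auto
    finally show ?thesis .
  qed
qed

lemma scale_tensor_topology:
  assumes "\<phi> \<in> tensor_free E F"
  shows "c \<odot>\<^bsub>tensor_with_topology E F \<tau>\<^esub> tensor_class E F \<phi> = tensor_class E F (pm_scale c \<phi>)"
proof -
  have *: "tensor_class E F (pm_scale c \<phi>') = tensor_class E F (pm_scale c \<phi>)"
    if "\<phi>' \<in> tensor_class E F \<phi>" for \<phi>'
  proof (rule tensor_class_eqI)
    have "\<phi>' - \<phi> \<in> tensor_null E F"
      using that assms tensor_null_uminus[of "\<phi> - \<phi>'" E F] by (simp add: in_tensor_class_iff)
    then show "pm_scale c \<phi>' - pm_scale c \<phi> \<in> tensor_null E F"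
      unfolding pm_scale_diff[symmetric] by (rule tensor_null_scale)
  qed (use that assms in \<open>auto simp: in_tensor_class_iff intro: tensor_free_scale\<close>)
  show ?thesis
  proof -
    have "c \<odot>\<^bsub>tensor_with_topology E F \<tau>\<^esub> tensor_class E F \<phi> =
       (\<Union>\<phi>'\<in>tensor_class E F \<phi>. tensor_class E F (pm_scale c \<phi>'))"
      by (simp add: tensor_with_topology_def tensor_class_def pm_scale_def)
    also have "\<dots> = (\<Union>\<phi>'\<in>tensor_class E F \<phi>. tensor_class E F (pm_scale c \<phi>))"
      by (intro SUP_cong refl *)
    also have "\<dots> = tensor_class E F (pm_scale c \<phi>)"
      using tensor_class_self[OF assms] by auto
    finally show ?thesis .
  qed
qed

lemma complex_space_tensor_topology: "complex_space (tensor_with_topology E F \<tau>)" (is "complex_space ?T")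
proof -
  note simps = carrier_tensor_topology add_tensor_topology zero_tensor_topology scale_tensor_topology
    tensor_free_add tensor_free_scale tensor_free_zero
  show ?thesis
    unfolding complex_space_def
  proof (rule moduleI)
    show "abelian_group ?T"
    proof (rule abelian_groupI)
      fix x assume "x \<in> carrier ?T"
      then obtain \<phi> where \<phi>: "\<phi> \<in> tensor_free E F" "x = tensor_class E F \<phi>" by (auto simp: simps)
      have "pm_scale (-1) \<phi> \<in> tensor_free E F" by (rule tensor_free_scale[OF \<phi>(1)])
      then show "\<exists>y\<in>carrier ?T. y \<oplus>\<^bsub>?T\<^esub> x = \<zero>\<^bsub>?T\<^esub>"
        using \<phi> by (intro bexI[of _ "tensor_class E F (pm_scale (-1) \<phi>)"]) (auto simp: simps pm_scale_minus_one)
    qed (auto simp: simps add_ac)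
  next
    fix a b x assume "x \<in> carrier ?T"
    then obtain \<phi> where \<phi>: "\<phi> \<in> tensor_free E F" "x = tensor_class E F \<phi>" by (auto simp: simps)
    have "pm_scale (a + b) \<phi> = pm_scale a \<phi> + pm_scale b \<phi>"
      by (rule poly_mapping_eqI) (simp add: lookup_add algebra_simps)
    then show "(a \<oplus>\<^bsub>complex_ring\<^esub> b) \<odot>\<^bsub>?T\<^esub> x = a \<odot>\<^bsub>?T\<^esub> x \<oplus>\<^bsub>?T\<^esub> b \<odot>\<^bsub>?T\<^esub> x"
      using \<phi> by (simp add: simps)
    have "pm_scale (a * b) \<phi> = pm_scale a (pm_scale b \<phi>)"
      by (rule poly_mapping_eqI) (simp add: algebra_simps)
    then show "(a \<otimes>\<^bsub>complex_ring\<^esub> b) \<odot>\<^bsub>?T\<^esub> x = a \<odot>\<^bsub>?T\<^esub> (b \<odot>\<^bsub>?T\<^esub> x)"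
      using \<phi> by (simp add: simps)
  next
    fix a x y assume "x \<in> carrier ?T" "y \<in> carrier ?T"
    then obtain \<phi> \<psi> where \<phi>: "\<phi> \<in> tensor_free E F" "x = tensor_class E F \<phi>"
      "\<psi> \<in> tensor_free E F" "y = tensor_class E F \<psi>" by (auto simp: simps)
    have "pm_scale a (\<phi> + \<psi>) = pm_scale a \<phi> + pm_scale a \<psi>"
      by (rule poly_mapping_eqI) (simp add: lookup_add algebra_simps)
    then show "a \<odot>\<^bsub>?T\<^esub> (x \<oplus>\<^bsub>?T\<^esub> y) = a \<odot>\<^bsub>?T\<^esub> x \<oplus>\<^bsub>?T\<^esub> a \<odot>\<^bsub>?T\<^esub> y"
      using \<phi> by (simp add: simps)
  next
    fix x assume "x \<in> carrier ?T"
    then obtain \<phi> where \<phi>: "\<phi> \<in> tensor_free E F" "x = tensor_class E F \<phi>" by (auto simp: simps)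
    have "pm_scale 1 \<phi> = \<phi>" by (rule poly_mapping_eqI) simp
    then show "\<one>\<^bsub>complex_ring\<^esub> \<odot>\<^bsub>?T\<^esub> x = x" using \<phi> by (simp add: simps)
  qed (auto simp: simps intro: cring_from_type_algebra)
qed

lemma complex_space_tensor: "complex_space (tensor E F)"
  unfolding tensor_def by (rule complex_space_tensor_topology)

lemma tensor_simps:
  "carrier (tensor E F) = tensor_class E F ` tensor_free E F"
  "\<phi> \<in> tensor_free E F \<Longrightarrow> \<psi> \<in> tensor_free E F \<Longrightarrow>
     tensor_class E F \<phi> \<oplus>\<^bsub>tensor E F\<^esub> tensor_class E F \<psi> = tensor_class E F (\<phi> + \<psi>)"
  "\<phi> \<in> tensor_free E F \<Longrightarrow> c \<odot>\<^bsub>tensor E F\<^esub> tensor_class E F \<phi> = tensor_class E F (pm_scale c \<phi>)"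
  by (simp_all add: tensor_def carrier_tensor_topology add_tensor_topology scale_tensor_topology)

lemma pure_tensor_closed: "x \<in> carrier E \<Longrightarrow> y \<in> carrier F \<Longrightarrow> pure_tensor E F x y \<in> carrier (tensor E F)"
  by (auto simp: pure_tensor_class tensor_simps tensor_free_single)

section \<open>Bilinear maps and the universal property of the tensor product\<close>

definition bilinear_into ::
    "('a, 'm) lcs_scheme \<Rightarrow> ('b, 'n) lcs_scheme \<Rightarrow> ('c, 'k) lcs_scheme \<Rightarrow> ('a \<Rightarrow> 'b \<Rightarrow> 'c) \<Rightarrow> bool" where
  "bilinear_into E F G h \<longleftrightarrow>
     (\<forall>x\<in>carrier E. \<forall>y\<in>carrier F. h x y \<in> carrier G) \<and>
     (\<forall>x\<in>carrier E. \<forall>x'\<in>carrier E. \<forall>y\<in>carrier F. h (x \<oplus>\<^bsub>E\<^esub> x') y = h x y \<oplus>\<^bsub>G\<^esub> h x' y) \<and>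
     (\<forall>x\<in>carrier E. \<forall>y\<in>carrier F. \<forall>y'\<in>carrier F. h x (y \<oplus>\<^bsub>F\<^esub> y') = h x y \<oplus>\<^bsub>G\<^esub> h x y') \<and>
     (\<forall>c. \<forall>x\<in>carrier E. \<forall>y\<in>carrier F. h (c \<odot>\<^bsub>E\<^esub> x) y = c \<odot>\<^bsub>G\<^esub> h x y) \<and>
     (\<forall>c. \<forall>x\<in>carrier E. \<forall>y\<in>carrier F. h x (c \<odot>\<^bsub>F\<^esub> y) = c \<odot>\<^bsub>G\<^esub> h x y)"

lemma bilinear_intoD:
  assumes "bilinear_into E F G h"
  shows "x \<in> carrier E \<Longrightarrow> y \<in> carrier F \<Longrightarrow> h x y \<in> carrier G"
    "x \<in> carrier E \<Longrightarrow> x' \<in> carrier E \<Longrightarrow> y \<in> carrier F \<Longrightarrow> h (x \<oplus>\<^bsub>E\<^esub> x') y = h x y \<oplus>\<^bsub>G\<^esub> h x' y"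
    "x \<in> carrier E \<Longrightarrow> y \<in> carrier F \<Longrightarrow> y' \<in> carrier F \<Longrightarrow> h x (y \<oplus>\<^bsub>F\<^esub> y') = h x y \<oplus>\<^bsub>G\<^esub> h x y'"
    "x \<in> carrier E \<Longrightarrow> y \<in> carrier F \<Longrightarrow> h (c \<odot>\<^bsub>E\<^esub> x) y = c \<odot>\<^bsub>G\<^esub> h x y"
    "x \<in> carrier E \<Longrightarrow> y \<in> carrier F \<Longrightarrow> h x (c \<odot>\<^bsub>F\<^esub> y) = c \<odot>\<^bsub>G\<^esub> h x y"
  using assms by (auto simp: bilinear_into_def)

lemma bilinear_pure_tensor:
  assumes E: "complex_space E" and F: "complex_space F"
  shows "bilinear_into E F (tensor E F) (pure_tensor E F)"
proof -
  interpret E: complex_space E by fact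
  interpret F: complex_space F by fact
  note s = pure_tensor_class tensor_simps tensor_free_single tensor_free_add tensor_free_scale
  show ?thesis
    unfolding bilinear_into_def
  proof (intro conjI ballI allI)
    fix x x' y assume xy: "x \<in> carrier E" "x' \<in> carrier E" "y \<in> carrier F"
    show "pure_tensor E F (x \<oplus>\<^bsub>E\<^esub> x') y = pure_tensor E F x y \<oplus>\<^bsub>tensor E F\<^esub> pure_tensor E F x' y"
      using tensor_null.add_left[OF xy] xy by (simp add: s) (rule tensor_class_eqI, auto simp: s diff_diff_eq)
  next
    fix x y y' assume xy: "x \<in> carrier E" "y \<in> carrier F" "y' \<in> carrier F"
    show "pure_tensor E F x (y \<oplus>\<^bsub>F\<^esub> y') = pure_tensor E F x y \<oplus>\<^bsub>tensor E F\<^esub> pure_tensor E F x y'"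
      using tensor_null.add_right[OF xy] xy by (simp add: s) (rule tensor_class_eqI, auto simp: s diff_diff_eq)
  next
    fix c x y assume xy: "x \<in> carrier E" "y \<in> carrier F"
    show "pure_tensor E F (c \<odot>\<^bsub>E\<^esub> x) y = c \<odot>\<^bsub>tensor E F\<^esub> pure_tensor E F x y"
      using tensor_null.smult_left[OF xy] xy by (simp add: s pm_scale_single) (rule tensor_class_eqI, auto simp: s)
    show "pure_tensor E F x (c \<odot>\<^bsub>F\<^esub> y) = c \<odot>\<^bsub>tensor E F\<^esub> pure_tensor E F x y"
      using tensor_null.smult_right[OF xy] xy by (simp add: s pm_scale_single) (rule tensor_class_eqI, auto simp: s)
  qed (auto intro: pure_tensor_closed)
qed

text \<open>The setting of the universal property: \<open>free_lift\<close> extends \<open>h\<close>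
  linearly to the free space and vanishes on \<open>tensor_null\<close>, so
  \<open>tensor_lift\<close>, which works with an arbitrarily chosen representative, is well defined
  and linear.\<close>

locale tensor_bilinear = G: complex_space G
  for E :: "('a, 'm) lcs_scheme" and F :: "('b, 'n) lcs_scheme" and G :: "('c, 'k) lcs_scheme" +
  fixes h :: "'a \<Rightarrow> 'b \<Rightarrow> 'c"
  assumes E: "complex_space E" and F: "complex_space F" and bil: "bilinear_into E F G h"
begin

definition free_lift :: "(('a \<times> 'b) \<Rightarrow>\<^sub>0 complex) \<Rightarrow> 'c" where
  "free_lift \<phi> = (\<Oplus>\<^bsub>G\<^esub>p\<in>Poly_Mapping.keys \<phi>. Poly_Mapping.lookup \<phi> p \<odot>\<^bsub>G\<^esub> h (fst p) (snd p))"

lemma free_lift_eq: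
  assumes "finite K" "Poly_Mapping.keys \<phi> \<subseteq> K" "K \<subseteq> carrier E \<times> carrier F"
  shows "free_lift \<phi> = (\<Oplus>\<^bsub>G\<^esub>p\<in>K. Poly_Mapping.lookup \<phi> p \<odot>\<^bsub>G\<^esub> h (fst p) (snd p))"
  unfolding free_lift_def
  by (rule G.M.add.finprod_mono_neutral_cong_left)
    (use assms bilinear_intoD(1)[OF bil] in \<open>auto simp: in_keys_iff subset_eq\<close>)

lemma free_lift_closed: "\<phi> \<in> tensor_free E F \<Longrightarrow> free_lift \<phi> \<in> carrier G"
  unfolding free_lift_def using bilinear_intoD(1)[OF bil]
  by (intro G.M.finsum_closed) (fastforce simp: tensor_free_def)

lemma free_lift_add:
  assumes "\<phi> \<in> tensor_free E F" "\<psi> \<in> tensor_free E F"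
  shows "free_lift (\<phi> + \<psi>) = free_lift \<phi> \<oplus>\<^bsub>G\<^esub> free_lift \<psi>"
proof -
  define K where "K = Poly_Mapping.keys \<phi> \<union> Poly_Mapping.keys \<psi>"
  have K: "finite K" "K \<subseteq> carrier E \<times> carrier F" using assms by (auto simp: K_def tensor_free_def)
  have hK: "h (fst p) (snd p) \<in> carrier G" if "p \<in> K" for p
    using that K bilinear_intoD(1)[OF bil] by auto
  have "free_lift (\<phi> + \<psi>) = (\<Oplus>\<^bsub>G\<^esub>p\<in>K. Poly_Mapping.lookup (\<phi> + \<psi>) p \<odot>\<^bsub>G\<^esub> h (fst p) (snd p))"
    by (rule free_lift_eq[OF K(1) _ K(2)]) (use keys_add[of \<phi> \<psi>] in \<open>auto simp: K_def\<close>)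
  also have "\<dots> = (\<Oplus>\<^bsub>G\<^esub>p\<in>K. Poly_Mapping.lookup \<phi> p \<odot>\<^bsub>G\<^esub> h (fst p) (snd p) \<oplus>\<^bsub>G\<^esub>
      Poly_Mapping.lookup \<psi> p \<odot>\<^bsub>G\<^esub> h (fst p) (snd p))"
    by (rule G.M.finsum_cong') (use hK in \<open>auto simp: lookup_add G.scale_add_left\<close>)
  also have "\<dots> = free_lift \<phi> \<oplus>\<^bsub>G\<^esub> free_lift \<psi>"
    using hK by (subst G.M.finsum_addf) (auto simp: free_lift_eq[OF K(1) _ K(2)] K_def)
  finally show ?thesis .
qed

lemma free_lift_scale:
  assumes "\<phi> \<in> tensor_free E F"
  shows "free_lift (pm_scale c \<phi>) = c \<odot>\<^bsub>G\<^esub> free_lift \<phi>"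
proof -
  define K where "K = Poly_Mapping.keys \<phi>"
  have K: "finite K" "K \<subseteq> carrier E \<times> carrier F" using assms by (auto simp: K_def tensor_free_def)
  have hK: "h (fst p) (snd p) \<in> carrier G" if "p \<in> K" for p
    using that K bilinear_intoD(1)[OF bil] by auto
  have "free_lift (pm_scale c \<phi>) = (\<Oplus>\<^bsub>G\<^esub>p\<in>K. (c * Poly_Mapping.lookup \<phi> p) \<odot>\<^bsub>G\<^esub> h (fst p) (snd p))"
    by (subst free_lift_eq[OF K(1) _ K(2)]) (auto simp: K_def in_keys_iff)
  also have "\<dots> = (\<Oplus>\<^bsub>G\<^esub>p\<in>K. c \<odot>\<^bsub>G\<^esub> (Poly_Mapping.lookup \<phi> p \<odot>\<^bsub>G\<^esub> h (fst p) (snd p)))"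
    by (rule G.M.finsum_cong') (use hK in \<open>auto simp: G.scale_scale\<close>)
  also have "\<dots> = c \<odot>\<^bsub>G\<^esub> free_lift \<phi>"
    unfolding free_lift_def K_def[symmetric] using hK K by (subst G.finsum_smult_ldistr) auto
  finally show ?thesis .
qed

lemma free_lift_diff:
  assumes "\<phi> \<in> tensor_free E F" "\<psi> \<in> tensor_free E F"
  shows "free_lift (\<phi> - \<psi>) = free_lift \<phi> \<ominus>\<^bsub>G\<^esub> free_lift \<psi>"
proof -
  have eq: "\<phi> - \<psi> = \<phi> + pm_scale (-1) \<psi>" by (simp add: pm_scale_minus_one)
  show ?thesis unfolding eq using free_lift_add[OF assms(1) tensor_free_scale[OF assms(2), of "-1"]] assms
    by (simp add: free_lift_scale G.diff_eq_scale free_lift_closed)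
qed

lemma free_lift_single:
  assumes "x \<in> carrier E" "y \<in> carrier F"
  shows "free_lift (Poly_Mapping.single (x, y) c) = c \<odot>\<^bsub>G\<^esub> h x y"
  using assms bilinear_intoD(1)[OF bil]
  by (subst free_lift_eq[of "{(x, y)}"]) (auto simp: G.M.finsum_singleton G.M.finsum_insert)

lemma tensor_null_free: "\<phi> \<in> tensor_null E F \<Longrightarrow> \<phi> \<in> tensor_free E F"
proof (induction rule: tensor_null.induct)
qed (auto intro!: tensor_free_diff tensor_free_add tensor_free_scale[unfolded pm_scale_def] tensor_free_single tensor_free_zero
      complex_space.scale_closed[OF E] complex_space.scale_closed[OF F]
      abelian_monoid.a_closed[OF abelian_group.axioms(1)[OF Module.module.axioms(2)[OF E[unfolded complex_space_def]]]]
      abelian_monoid.a_closed[OF abelian_group.axioms(1)[OF Module.module.axioms(2)[OF F[unfolded complex_space_def]]]])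

lemma free_lift_null: "\<phi> \<in> tensor_null E F \<Longrightarrow> free_lift \<phi> = \<zero>\<^bsub>G\<^esub>"
proof (induction rule: tensor_null.induct)
  interpret E: complex_space E by (rule E)
  interpret F: complex_space F by (rule F)
  note simps = free_lift_diff free_lift_single tensor_free_diff tensor_free_single bilinear_intoD[OF bil]
  {
    case (add_left x x' y)
    then have "h x y \<in> carrier G" "h x' y \<in> carrier G" by (auto simp: simps)
    then have "h x y \<oplus>\<^bsub>G\<^esub> h x' y \<ominus>\<^bsub>G\<^esub> h x y = h x' y"
      by (simp add: G.diff_eq_scale G.M.a_ac)
        (metis G.diff_eq_scale G.diff_self G.M.a_assoc G.M.a_comm G.M.r_zero G.scale_closed)
    with add_left show ?case by (simp add: simps)
  next
    case (add_right x y y')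
    then have "h x y \<in> carrier G" "h x y' \<in> carrier G" by (auto simp: simps)
    then have "h x y \<oplus>\<^bsub>G\<^esub> h x y' \<ominus>\<^bsub>G\<^esub> h x y = h x y'"
      by (simp add: G.diff_eq_scale G.M.a_ac)
        (metis G.diff_eq_scale G.diff_self G.M.a_assoc G.M.a_comm G.M.r_zero G.scale_closed)
    with add_right show ?case by (simp add: simps)
  next
    case (smult_left x y c)
    then show ?case by (simp add: simps)
  next
    case (smult_right x y c)
    then show ?case by (simp add: simps)
  next
    case zero
    then show ?case by (simp add: free_lift_def)
  next
    case (add \<phi> \<psi>)
    then show ?case by (simp add: free_lift_add tensor_null_free)
  next
    case (smult \<phi> c)
    then show ?case by (simp add: free_lift_scale tensor_null_free flip: pm_scale_def)
  }
qed

lemma tensor_lift_class: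
  assumes "\<phi> \<in> tensor_free E F"
  shows "tensor_lift G h (tensor_class E F \<phi>) = free_lift \<phi>"
proof -
  define \<psi> where "\<psi> = (SOME \<psi>. \<psi> \<in> tensor_class E F \<phi>)"
  have "\<psi> \<in> tensor_class E F \<phi>" unfolding \<psi>_def by (rule someI) (rule tensor_class_self[OF assms])
  then have \<psi>: "\<psi> \<in> tensor_free E F" "\<phi> - \<psi> \<in> tensor_null E F" by (auto simp: in_tensor_class_iff[OF assms])
  have "tensor_lift G h (tensor_class E F \<phi>) = free_lift \<psi>"
    by (simp add: tensor_lift_def free_lift_def \<psi>_def Let_def)
  also have "\<dots> = free_lift \<phi>"
    using free_lift_null[OF \<psi>(2)] free_lift_diff[OF assms \<psi>(1)] assms \<psi>(1)
    by (simp add: G.diff_eq_zero_iff free_lift_closed)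
  finally show ?thesis .
qed

lemma tensor_lift_pure:
  "x \<in> carrier E \<Longrightarrow> y \<in> carrier F \<Longrightarrow> tensor_lift G h (pure_tensor E F x y) = h x y"
  using bilinear_intoD(1)[OF bil]
  by (simp add: pure_tensor_class tensor_lift_class tensor_free_single free_lift_single)

lemma tensor_lift_linear:
  "t \<in> carrier (tensor E F) \<Longrightarrow> tensor_lift G h t \<in> carrier G"
  "t \<in> carrier (tensor E F) \<Longrightarrow> t' \<in> carrier (tensor E F) \<Longrightarrow>
     tensor_lift G h (t \<oplus>\<^bsub>tensor E F\<^esub> t') = tensor_lift G h t \<oplus>\<^bsub>G\<^esub> tensor_lift G h t'"
  "t \<in> carrier (tensor E F) \<Longrightarrow> tensor_lift G h (c \<odot>\<^bsub>tensor E F\<^esub> t) = c \<odot>\<^bsub>G\<^esub> tensor_lift G h t"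
proof -
  note simps = tensor_simps tensor_lift_class free_lift_closed free_lift_add free_lift_scale tensor_free_add tensor_free_scale
  show "t \<in> carrier (tensor E F) \<Longrightarrow> tensor_lift G h t \<in> carrier G" by (auto simp: simps)
  show "t \<in> carrier (tensor E F) \<Longrightarrow> t' \<in> carrier (tensor E F) \<Longrightarrow>
     tensor_lift G h (t \<oplus>\<^bsub>tensor E F\<^esub> t') = tensor_lift G h t \<oplus>\<^bsub>G\<^esub> tensor_lift G h t'" by (auto simp: simps)
  show "t \<in> carrier (tensor E F) \<Longrightarrow> tensor_lift G h (c \<odot>\<^bsub>tensor E F\<^esub> t) = c \<odot>\<^bsub>G\<^esub> tensor_lift G h t"
    by (auto simp: simps)
qed

end

lemma tensor_map_pure:
  assumes sp: "complex_space E" "complex_space F" "complex_space E'" "complex_space F'"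
    and f: "f \<in> carrier E \<rightarrow> carrier E'" "\<And>x y. x \<in> carrier E \<Longrightarrow> y \<in> carrier E \<Longrightarrow> f (x \<oplus>\<^bsub>E\<^esub> y) = f x \<oplus>\<^bsub>E'\<^esub> f y"
      "\<And>c x. x \<in> carrier E \<Longrightarrow> f (c \<odot>\<^bsub>E\<^esub> x) = c \<odot>\<^bsub>E'\<^esub> f x"
    and g: "g \<in> carrier F \<rightarrow> carrier F'" "\<And>x y. x \<in> carrier F \<Longrightarrow> y \<in> carrier F \<Longrightarrow> g (x \<oplus>\<^bsub>F\<^esub> y) = g x \<oplus>\<^bsub>F'\<^esub> g y"
      "\<And>c x. x \<in> carrier F \<Longrightarrow> g (c \<odot>\<^bsub>F\<^esub> x) = c \<odot>\<^bsub>F'\<^esub> g x"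
    and xy: "x \<in> carrier E" "y \<in> carrier F"
  shows "tensor_map E' F' f g (pure_tensor E F x y) = pure_tensor E' F' (f x) (g y)"
proof -
  interpret T: complex_space "tensor E' F'" by (rule complex_space_tensor)
  have "bilinear_into E F (tensor E' F') (\<lambda>x y. pure_tensor E' F' (f x) (g y))"
    unfolding bilinear_into_def using f g bilinear_intoD[OF bilinear_pure_tensor[OF sp(3,4)]]
    by (auto simp: Pi_iff)
  then interpret tensor_bilinear E F "tensor E' F'" "\<lambda>x y. pure_tensor E' F' (f x) (g y)"
    by (intro tensor_bilinear.intro tensor_bilinear_axioms.intro sp complex_space_tensor)
  show ?thesis unfolding tensor_map_def by (rule tensor_lift_pure[OF xy])
qed

lemma braiding_pure:
  assumes sp: "complex_space E" "complex_space F" and xy: "x \<in> carrier E" "y \<in> carrier F"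
  shows "braiding E F (pure_tensor E F x y) = pure_tensor F E y x"
proof -
  interpret T: complex_space "tensor F E" by (rule complex_space_tensor)
  have "bilinear_into E F (tensor F E) (\<lambda>x y. pure_tensor F E y x)"
    unfolding bilinear_into_def using bilinear_intoD[OF bilinear_pure_tensor[OF sp(2,1)]] by auto
  then interpret tensor_bilinear E F "tensor F E" "\<lambda>x y. pure_tensor F E y x"
    by (intro tensor_bilinear.intro tensor_bilinear_axioms.intro sp complex_space_tensor)
  show ?thesis unfolding braiding_def by (rule tensor_lift_pure[OF xy])
qed

lemma left_unitor_pure:
  assumes "complex_space E" "x \<in> carrier E"
  shows "left_unitor E (pure_tensor complex_lcs E c x) = c \<odot>\<^bsub>E\<^esub> x"
proof -
  interpret E: complex_space E by fact
  have "bilinear_into complex_lcs E E (\<lambda>c x. c \<odot>\<^bsub>E\<^esub> x)"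
    unfolding bilinear_into_def by (auto simp: E.scale_add_left E.scale_add_right E.scale_scale mult.commute)
  then interpret tensor_bilinear complex_lcs E E "\<lambda>c x. c \<odot>\<^bsub>E\<^esub> x"
    by (intro tensor_bilinear.intro tensor_bilinear_axioms.intro assms complex_space_complex_lcs)
  show ?thesis unfolding left_unitor_def by (rule tensor_lift_pure) (use assms in auto)
qed

text \<open>The associator is a lift inside a lift, so the inner lift has to be bilinear in
  \<open>t\<close> and \<open>z\<close>. Linearity in \<open>t\<close> is that of any lift;
  linearity in \<open>z\<close> is checked on a fixed representative of \<open>t\<close>, where the
  lift is a finite sum.\<close>

lemma associator_pure:
  assumes sp: "complex_space E" "complex_space F" "complex_space G"
    and xyz: "x \<in> carrier E" "y \<in> carrier F" "z \<in> carrier G"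
  shows "associator E F G (pure_tensor (tensor E F) G (pure_tensor E F x y) z) =
    pure_tensor E (tensor F G) x (pure_tensor F G y z)"
proof -
  define W where "W = tensor E (tensor F G)"
  define k where "k z = (\<lambda>x y. pure_tensor E (tensor F G) x (pure_tensor F G y z))" for z
  interpret W: complex_space W unfolding W_def by (rule complex_space_tensor)
  note FG = bilinear_pure_tensor[OF sp(2,3)]
  note EFG = bilinear_pure_tensor[OF sp(1) complex_space_tensor[of F G], folded W_def]
  have bk: "tensor_bilinear E F W (k z)" if "z \<in> carrier G" for z
  proof -
    have "bilinear_into E F W (k z)"
      unfolding bilinear_into_def k_def using that bilinear_intoD[OF FG] bilinear_intoD[OF EFG] by auto
    then show ?thesis
      by (intro tensor_bilinear.intro tensor_bilinear_axioms.intro sp W.complex_space_axioms)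
  qed
  have kadd: "tensor_lift W (k (z \<oplus>\<^bsub>G\<^esub> z')) t = tensor_lift W (k z) t \<oplus>\<^bsub>W\<^esub> tensor_lift W (k z') t"
    and kscale: "tensor_lift W (k (c \<odot>\<^bsub>G\<^esub> z)) t = c \<odot>\<^bsub>W\<^esub> tensor_lift W (k z) t"
    if z: "z \<in> carrier G" "z' \<in> carrier G" and t: "t \<in> carrier (tensor E F)" for z z' t c
  proof -
    interpret G: complex_space G by (rule sp)
    obtain \<phi> where \<phi>: "\<phi> \<in> tensor_free E F" "t = tensor_class E F \<phi>" using t by (auto simp: tensor_simps)
    have L: "tensor_lift W (k z) t = (\<Oplus>\<^bsub>W\<^esub>p\<in>Poly_Mapping.keys \<phi>. Poly_Mapping.lookup \<phi> p \<odot>\<^bsub>W\<^esub> k z (fst p) (snd p))"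
      if "z \<in> carrier G" for z
      using tensor_bilinear.tensor_lift_class[OF bk[OF that] \<phi>(1)] tensor_bilinear.free_lift_def[OF bk[OF that]] \<phi>(2)
      by simp
    have mem: "fst p \<in> carrier E" "snd p \<in> carrier F" if "p \<in> Poly_Mapping.keys \<phi>" for p
      using that \<phi>(1) by (auto simp: tensor_free_def)
    have kc: "k z (fst p) (snd p) \<in> carrier W" if "z \<in> carrier G" "p \<in> Poly_Mapping.keys \<phi>" for z p
      unfolding k_def using that mem bilinear_intoD(1)[OF FG] bilinear_intoD(1)[OF EFG] by auto
    have ka: "k (z \<oplus>\<^bsub>G\<^esub> z') (fst p) (snd p) = k z (fst p) (snd p) \<oplus>\<^bsub>W\<^esub> k z' (fst p) (snd p)"
      and ks: "k (c \<odot>\<^bsub>G\<^esub> z) (fst p) (snd p) = c \<odot>\<^bsub>W\<^esub> k z (fst p) (snd p)"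
      if "p \<in> Poly_Mapping.keys \<phi>" for p
      unfolding k_def using z mem[OF that] bilinear_intoD[OF FG] bilinear_intoD[OF EFG] by auto
    have "tensor_lift W (k (z \<oplus>\<^bsub>G\<^esub> z')) t = (\<Oplus>\<^bsub>W\<^esub>p\<in>Poly_Mapping.keys \<phi>.
       Poly_Mapping.lookup \<phi> p \<odot>\<^bsub>W\<^esub> k z (fst p) (snd p) \<oplus>\<^bsub>W\<^esub> Poly_Mapping.lookup \<phi> p \<odot>\<^bsub>W\<^esub> k z' (fst p) (snd p))"
      unfolding L[OF G.M.a_closed[OF z]]
      by (rule W.M.finsum_cong') (use z kc in \<open>auto simp: ka W.scale_add_right\<close>)
    also have "\<dots> = tensor_lift W (k z) t \<oplus>\<^bsub>W\<^esub> tensor_lift W (k z') t"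
      unfolding L[OF z(1)] L[OF z(2)] using z kc by (intro W.M.finsum_addf) auto
    finally show "tensor_lift W (k (z \<oplus>\<^bsub>G\<^esub> z')) t = tensor_lift W (k z) t \<oplus>\<^bsub>W\<^esub> tensor_lift W (k z') t" .
    have "tensor_lift W (k (c \<odot>\<^bsub>G\<^esub> z)) t = (\<Oplus>\<^bsub>W\<^esub>p\<in>Poly_Mapping.keys \<phi>.
       c \<odot>\<^bsub>W\<^esub> (Poly_Mapping.lookup \<phi> p \<odot>\<^bsub>W\<^esub> k z (fst p) (snd p)))"
      unfolding L[OF G.scale_closed[OF z(1)]]
      by (rule W.M.finsum_cong') (use z kc in \<open>auto simp: ks W.scale_scale mult.commute\<close>)
    also have "\<dots> = c \<odot>\<^bsub>W\<^esub> tensor_lift W (k z) t"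
      unfolding L[OF z(1)] using z kc by (subst W.finsum_smult_ldistr) auto
    finally show "tensor_lift W (k (c \<odot>\<^bsub>G\<^esub> z)) t = c \<odot>\<^bsub>W\<^esub> tensor_lift W (k z) t" .
  qed
  have "bilinear_into (tensor E F) G W (\<lambda>t z. tensor_lift W (k z) t)"
    unfolding bilinear_into_def
    using kadd kscale tensor_bilinear.tensor_lift_linear[OF bk] by auto
  then interpret A: tensor_bilinear "tensor E F" G W "\<lambda>t z. tensor_lift W (k z) t"
    by (intro tensor_bilinear.intro tensor_bilinear_axioms.intro sp complex_space_tensor W.complex_space_axioms)
  have "associator E F G (pure_tensor (tensor E F) G (pure_tensor E F x y) z) =
     tensor_lift W (k z) (pure_tensor E F x y)"
    unfolding associator_def W_def[symmetric] k_def[symmetric]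
    by (rule A.tensor_lift_pure) (use xyz in \<open>auto intro: pure_tensor_closed\<close>)
  also have "\<dots> = k z x y" by (rule tensor_bilinear.tensor_lift_pure[OF bk[OF xyz(3)] xyz(1,2)])
  finally show ?thesis by (simp add: k_def)
qed

subsection \<open>Continuity\<close>

lemma openin_generated_singleton:
  "openin (topology_generated_by {S}) U \<longleftrightarrow> U = {} \<or> U = S"
proof
  assume "openin (topology_generated_by {S}) U"
  then have "generate_topology_on {S} U" by (simp add: openin_topology_generated_by_iff)
  then show "U = {} \<or> U = S"
    by induction auto
qed (auto intro: topology_generated_by_Basis)

lemma continuous_map_indiscrete:
  assumes "f \<in> topspace S \<rightarrow> A"
  shows "continuous_map S (topology_generated_by {A}) f"
proof (rule continuous_on_generated_topo)
  fix U assume "U \<in> {A}"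
  then have "f -` U \<inter> topspace S = topspace S" using assms by auto
  then show "openin S (f -` U \<inter> topspace S)" by simp
qed (use assms in auto)

text \<open>The indiscrete topology is admissible, so the projective topology lives on the whole tensor product.\<close>

lemma indiscrete_tensor_locally_convex:
  "locally_convex_space (tensor_with_topology E F (topology_generated_by {carrier (tensor E F)}))"
    (is "locally_convex_space ?T")
proof -
  interpret complex_space ?T by (rule complex_space_tensor_topology)
  have car: "carrier ?T = carrier (tensor E F)" by (simp add: tensor_def carrier_tensor_topology)
  have top: "lcs_topology ?T = topology_generated_by {carrier ?T}"
    unfolding car by (simp add: tensor_with_topology_def)
  show ?thesis
  proof (unfold_locales, unfold top)
    show "topspace (topology_generated_by {carrier ?T}) = carrier ?T" by simp
    show "continuous_map (prod_topology (topology_generated_by {carrier ?T}) (topology_generated_by {carrier ?T}))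
       (topology_generated_by {carrier ?T}) (\<lambda>(x, y). x \<oplus>\<^bsub>?T\<^esub> y)"
      by (rule continuous_map_indiscrete) auto
    show "continuous_map (prod_topology euclidean (topology_generated_by {carrier ?T}))
       (topology_generated_by {carrier ?T}) (\<lambda>(c, x). c \<odot>\<^bsub>?T\<^esub> x)"
      by (rule continuous_map_indiscrete) auto
    fix U assume U: "openin (topology_generated_by {carrier ?T}) U" "\<zero>\<^bsub>?T\<^esub> \<in> U"
    then have "U = carrier ?T" by (auto simp: openin_generated_singleton)
    then show "\<exists>C W. openin (topology_generated_by {carrier ?T}) W \<and> \<zero>\<^bsub>?T\<^esub> \<in> W \<and> W \<subseteq> C \<and> C \<subseteq> U \<and>
           (\<forall>x\<in>C. \<forall>y\<in>C. \<forall>t::real. 0 \<le> t \<and> t \<le> 1 \<longrightarrow>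
              (complex_of_real t \<odot>\<^bsub>?T\<^esub> x) \<oplus>\<^bsub>?T\<^esub> (complex_of_real (1 - t) \<odot>\<^bsub>?T\<^esub> y) \<in> C)"
      using U by (intro exI[of _ "carrier ?T"] conjI) auto
  qed
qed

text \<open>Every subbasic open set of the projective topology is open in some admissible topology,
  for which continuity holds by definition; the indiscrete one guarantees that the union of the
  subbase covers the image.\<close>

lemma continuous_pure_tensor:
  assumes E: "locally_convex_space E" and F: "locally_convex_space F"
  shows "continuous_map (prod_topology (lcs_topology E) (lcs_topology F)) (lcs_topology (tensor E F))
    (\<lambda>(x, y). pure_tensor E F x y)"
proof -
  interpret E: locally_convex_space E by fact
  interpret F: locally_convex_space F by fact
  let ?P = "prod_topology (lcs_topology E) (lcs_topology F)" and ?f = "\<lambda>(x, y). pure_tensor E F x y"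
  let ?I = "topology_generated_by {carrier (tensor E F)}"
  have into: "?f ` topspace ?P \<subseteq> carrier (tensor E F)"
    by (auto simp: E.topspace_eq F.topspace_eq intro: pure_tensor_closed)
  have contI: "continuous_map ?P ?I ?f"
    by (rule continuous_map_indiscrete) (use into in blast)
  have top: "lcs_topology (tensor E F) = projective_topology E F" by (simp add: tensor_def tensor_with_topology_def)
  show ?thesis
    unfolding top projective_topology_def
  proof (rule continuous_on_generated_topo)
    fix U assume "U \<in> \<Union>{{A. openin \<tau> A} |\<tau>. locally_convex_space (tensor_with_topology E F \<tau>) \<and> continuous_map ?P \<tau> ?f}"
    then obtain \<tau> where \<tau>: "openin \<tau> U" "continuous_map ?P \<tau> ?f" by auto
    from openin_continuous_map_preimage[OF \<tau>(2,1)]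
    show "openin ?P (?f -` U \<inter> topspace ?P)" by (simp add: vimage_def Int_def conj_commute)
  next
    have "openin ?I (carrier (tensor E F))" by (simp add: openin_generated_singleton)
    then have "carrier (tensor E F) \<in> \<Union>{{A. openin \<tau> A} |\<tau>. locally_convex_space (tensor_with_topology E F \<tau>) \<and> continuous_map ?P \<tau> ?f}"
      using indiscrete_tensor_locally_convex contI by blast
    then show "?f ` topspace ?P \<subseteq> \<Union> (\<Union>{{A. openin \<tau> A} |\<tau>. locally_convex_space (tensor_with_topology E F \<tau>) \<and> continuous_map ?P \<tau> ?f})"
      using into by blast
  qed
qed

text \<open>Fixing one factor turns a morphism out of the projective tensor product into a morphism
  of one variable. These one-variable maps are the ones along which functionals are pulled
  back.\<close>

lemma hom_pure_tensor:
  assumes E: "locally_convex_space E" and F: "locally_convex_space F" and f: "f \<in> lcs_hom (tensor E F) G"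
  shows "bilinear_into E F G (\<lambda>x y. f (pure_tensor E F x y))"
    and "x \<in> carrier E \<Longrightarrow> (\<lambda>y. f (pure_tensor E F x y)) \<in> lcs_hom F G"
    and "y \<in> carrier F \<Longrightarrow> (\<lambda>x. f (pure_tensor E F x y)) \<in> lcs_hom E G"
proof -
  interpret E: locally_convex_space E by fact
  interpret F: locally_convex_space F by fact
  note pt = bilinear_intoD[OF bilinear_pure_tensor[OF E.complex_space_axioms F.complex_space_axioms]]
  show bil: "bilinear_into E F G (\<lambda>x y. f (pure_tensor E F x y))"
    unfolding bilinear_into_def by (auto simp: pt lcs_homD[OF f])
  have cont: "continuous_map (prod_topology (lcs_topology E) (lcs_topology F)) (lcs_topology G) (f \<circ> (\<lambda>(x, y). pure_tensor E F x y))"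
    by (rule continuous_map_compose[OF continuous_pure_tensor[OF E F] lcs_hom_continuous[OF f]])
  show "(\<lambda>y. f (pure_tensor E F x y)) \<in> lcs_hom F G" if "x \<in> carrier E"
  proof -
    have "continuous_map (lcs_topology F) (prod_topology (lcs_topology E) (lcs_topology F)) (\<lambda>y. (x, y))"
      using that by (intro continuous_map_pairedI) (auto simp: E.topspace_eq)
    from continuous_map_compose[OF this cont] show ?thesis
      using bilinear_intoD[OF bil] that by (auto simp: lcs_hom_def o_def)
  qed
  show "(\<lambda>x. f (pure_tensor E F x y)) \<in> lcs_hom E G" if "y \<in> carrier F"
  proof -
    have "continuous_map (lcs_topology E) (prod_topology (lcs_topology E) (lcs_topology F)) (\<lambda>x. (x, y))"
      using that by (intro continuous_map_pairedI) (auto simp: F.topspace_eq)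
    from continuous_map_compose[OF this cont] show ?thesis
      using bilinear_intoD[OF bil] that by (auto simp: lcs_hom_def o_def)
  qed
qed

section \<open>Products of prefactorization algebras\<close>

text \<open>The factorization product on pure tensors, which is where all computations below take
  place.\<close>

definition prod_op ::
    "('x, 'a, 'm) pfa_scheme \<Rightarrow> 'x set \<Rightarrow> 'x set \<Rightarrow> 'x set \<Rightarrow> 'a \<Rightarrow> 'a \<Rightarrow> 'a" where
  "prod_op F U V W x y = pf_prod F U V W (pure_tensor (pf_space F U) (pf_space F V) x y)"

context prefactorization_algebra
begin

lemma space_complex: "open U \<Longrightarrow> complex_space (pf_space F U)"
  using space_lcs locally_convex_space.axioms(1) by (auto simp: complex_space_def)

lemma ext_closed: "\<lbrakk>open U; open V; U \<subseteq> V; a \<in> carrier (pf_space F U)\<rbrakk> \<Longrightarrow> pf_ext F U V a \<in> carrier (pf_space F V)"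
  using lcs_hom_closed[OF ext_hom] by blast

lemma prod_op_bilinear:
  assumes "open U" "open V" "open W" "disjoint_in U V W"
  shows "bilinear_into (pf_space F U) (pf_space F V) (pf_space F W) (prod_op F U V W)"
  using hom_pure_tensor(1)[OF space_lcs space_lcs prod_hom] assms unfolding prod_op_def[abs_def] by blast

lemma prod_op_closed:
  assumes "open U" "open V" "open W" "disjoint_in U V W" "x \<in> carrier (pf_space F U)" "y \<in> carrier (pf_space F V)"
  shows "prod_op F U V W x y \<in> carrier (pf_space F W)"
  using bilinear_intoD(1)[OF prod_op_bilinear] assms by blast

lemma prod_op_hom_right:
  assumes "open U" "open V" "open W" "disjoint_in U V W" "x \<in> carrier (pf_space F U)"
  shows "prod_op F U V W x \<in> lcs_hom (pf_space F V) (pf_space F W)"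
  using hom_pure_tensor(2)[OF space_lcs space_lcs prod_hom] assms unfolding prod_op_def[abs_def] by blast

lemma prod_op_hom_left:
  assumes "open U" "open V" "open W" "disjoint_in U V W" "y \<in> carrier (pf_space F V)"
  shows "(\<lambda>x. prod_op F U V W x y) \<in> lcs_hom (pf_space F U) (pf_space F W)"
  using hom_pure_tensor(3)[OF space_lcs space_lcs prod_hom] assms unfolding prod_op_def[abs_def] by blast

lemma ext_prod_op:
  assumes "open U1" "open U2" "open V" "open W" "disjoint_in U1 U2 V" "V \<subseteq> W"
    and "x \<in> carrier (pf_space F U1)" "y \<in> carrier (pf_space F U2)"
  shows "pf_ext F V W (prod_op F U1 U2 V x y) = prod_op F U1 U2 W x y"
  unfolding prod_op_def by (rule ext_prod) (use assms in \<open>auto intro: pure_tensor_closed\<close>)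

lemma prod_op_ext:
  assumes "open U1" "open U2" "open V1" "open V2" "open W" "U1 \<subseteq> V1" "U2 \<subseteq> V2" "disjoint_in V1 V2 W"
    and "x \<in> carrier (pf_space F U1)" "y \<in> carrier (pf_space F U2)"
  shows "prod_op F V1 V2 W (pf_ext F U1 V1 x) (pf_ext F U2 V2 y) = prod_op F U1 U2 W x y"
proof -
  note h1 = lcs_homD[OF ext_hom[OF assms(1,3,6)]] and h2 = lcs_homD[OF ext_hom[OF assms(2,4,7)]]
  have "tensor_map (pf_space F V1) (pf_space F V2) (pf_ext F U1 V1) (pf_ext F U2 V2)
      (pure_tensor (pf_space F U1) (pf_space F U2) x y) =
      pure_tensor (pf_space F V1) (pf_space F V2) (pf_ext F U1 V1 x) (pf_ext F U2 V2 y)"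
    by (rule tensor_map_pure) (use assms h1 h2 in \<open>auto intro: space_complex\<close>)
  then show ?thesis
    unfolding prod_op_def
    using prod_ext[OF assms(1-8), of "pure_tensor (pf_space F U1) (pf_space F U2) x y"] assms(9,10)
    by (simp add: pure_tensor_closed)
qed

lemma prod_op_commute:
  assumes "open U1" "open U2" "open V" "disjoint_in U1 U2 V"
    and "x \<in> carrier (pf_space F U1)" "y \<in> carrier (pf_space F U2)"
  shows "prod_op F U2 U1 V y x = prod_op F U1 U2 V x y"
  unfolding prod_op_def
  using prod_braiding[OF assms(1-4), of "pure_tensor (pf_space F U1) (pf_space F U2) x y"] assms
  by (simp add: pure_tensor_closed braiding_pure space_complex)

lemma prod_op_assoc:
  assumes "open U1" "open U2" "open U3" "open V1" "open V2" "open W"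
    and d: "disjoint_in U1 U2 V1" "disjoint_in U2 U3 V2" "disjoint_in U1 V2 W" "disjoint_in V1 U3 W"
    and xyz: "x \<in> carrier (pf_space F U1)" "y \<in> carrier (pf_space F U2)" "z \<in> carrier (pf_space F U3)"
  shows "prod_op F V1 U3 W (prod_op F U1 U2 V1 x y) z = prod_op F U1 V2 W x (prod_op F U2 U3 V2 y z)"
proof -
  note sp = space_complex[OF assms(1)] space_complex[OF assms(2)] space_complex[OF assms(3)]
    space_complex[OF assms(4)] space_complex[OF assms(5)]
  note h1 = lcs_homD[OF prod_hom[OF assms(1,2,4) d(1)]] and h2 = lcs_homD[OF prod_hom[OF assms(2,3,5) d(2)]]
  have 1: "tensor_map (pf_space F V1) (pf_space F U3) (pf_prod F U1 U2 V1) (\<lambda>x. x)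
      (pure_tensor (tensor (pf_space F U1) (pf_space F U2)) (pf_space F U3)
        (pure_tensor (pf_space F U1) (pf_space F U2) x y) z) =
     pure_tensor (pf_space F V1) (pf_space F U3) (prod_op F U1 U2 V1 x y) z"
    unfolding prod_op_def
    by (rule tensor_map_pure) (use xyz sp h1 in \<open>auto intro: complex_space_tensor pure_tensor_closed\<close>)
  have 2: "tensor_map (pf_space F U1) (pf_space F V2) (\<lambda>x. x) (pf_prod F U2 U3 V2)
      (pure_tensor (pf_space F U1) (tensor (pf_space F U2) (pf_space F U3)) x
        (pure_tensor (pf_space F U2) (pf_space F U3) y z)) =
     pure_tensor (pf_space F U1) (pf_space F V2) x (prod_op F U2 U3 V2 y z)"
    unfolding prod_op_def
    by (rule tensor_map_pure) (use xyz sp h2 in \<open>auto intro: complex_space_tensor pure_tensor_closed\<close>)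
  show ?thesis
    using prod_assoc[OF assms(1-6) d, of "pure_tensor (tensor (pf_space F U1) (pf_space F U2)) (pf_space F U3)
        (pure_tensor (pf_space F U1) (pf_space F U2) x y) z"] xyz
    by (simp add: pure_tensor_closed associator_pure sp 1 2) (simp add: prod_op_def)
qed

lemma unit_closed: "pf_unit F c \<in> carrier (pf_space F {})"
  using lcs_hom_closed[OF unit_hom] by simp

lemma prod_op_unit:
  assumes "open U" "x \<in> carrier (pf_space F U)"
  shows "prod_op F {} U U (pf_unit F c) x = c \<odot>\<^bsub>pf_space F U\<^esub> x"
proof -
  have 1: "tensor_map (pf_space F {}) (pf_space F U) (pf_unit F) (\<lambda>x. x) (pure_tensor complex_lcs (pf_space F U) c x) =
     pure_tensor (pf_space F {}) (pf_space F U) (pf_unit F c) x"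
    by (rule tensor_map_pure)
      (use assms lcs_homD[OF unit_hom] in \<open>auto intro: space_complex complex_space_complex_lcs\<close>)
  have "pure_tensor complex_lcs (pf_space F U) c x \<in> carrier (tensor complex_lcs (pf_space F U))"
    using assms by (intro pure_tensor_closed) auto
  from prod_unit[OF assms(1) this] show ?thesis
    unfolding 1 left_unitor_pure[OF space_complex[OF assms(1)] assms(2)] prod_op_def .
qed

end

section \<open>Prefactorization algebras on the plane and the action of rigid motions\<close>

locale planar_pfa = equivariant_prefactorization_algebra rigid_motions rigid_action F
  for F :: "'a planar_pfa"
begin

abbreviation disk :: "complex \<Rightarrow> real \<Rightarrow> 'a lcs" where
  "disk z r \<equiv> pf_space F (ball z r)"

lemma rigid_carrier [simp]: "(q, z) \<in> carrier rigid_motions \<longleftrightarrow> cmod q = 1"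
  by (simp add: rigid_motions_def)

lemma rigid_image_ball:
  assumes "cmod q = 1"
  shows "rigid_action (q, t) ` ball z r = ball (q * z + t) r"
proof (intro equalityI subsetI)
  fix w assume "w \<in> rigid_action (q, t) ` ball z r"
  then obtain v where v: "v \<in> ball z r" "w = q * v + t" by (auto simp: rigid_action_def)
  have "dist (q * z + t) w = cmod (q * (z - v))" using v by (simp add: dist_norm algebra_simps)
  then show "w \<in> ball (q * z + t) r" using v assms by (simp add: norm_mult dist_norm)
next
  fix w assume w: "w \<in> ball (q * z + t) r"
  have q: "q \<noteq> 0" using assms by auto
  have "w = q * ((w - t) / q) + t" using q by simp
  moreover have "(w - t) / q \<in> ball z r"
  proof -
    have "z - (w - t) / q = (q * z + t - w) / q" using q by (simp add: field_simps)
    then have "dist z ((w - t) / q) = dist (q * z + t) w" using assms by (simp add: dist_norm norm_divide)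
    then show ?thesis using w by simp
  qed
  ultimately show "w \<in> rigid_action (q, t) ` ball z r" by (force simp: rigid_action_def)
qed

lemma translate_ball [simp]: "rigid_action (1, t) ` ball z r = ball (z + t) r"
  using rigid_image_ball[of 1 t z r] by simp

lemma rotate_ball: "cmod q = 1 \<Longrightarrow> rigid_action (q, 0) ` ball z r = ball (q * z) r"
  using rigid_image_ball[of q 0 z r] by simp

lemma sigma_translate_hom: "pf_sigma F (1, t) (ball z r) \<in> lcs_hom (disk z r) (disk (z + t) r)"
  using sigma_hom[of "(1, t)" "ball z r"] by simp

lemma sigma_rotate_hom: "cmod q = 1 \<Longrightarrow> pf_sigma F (q, 0) (ball z r) \<in> lcs_hom (disk z r) (disk (q * z) r)"
  using sigma_hom[of "(q, 0)" "ball z r"] by (simp add: rotate_ball)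

lemma disk_lcs: "locally_convex_space (disk z r)"
  by (rule space_lcs) simp

lemma disk_space: "complex_space (disk z r)"
  by (rule space_complex) simp

lemma sigma_prod_op:
  assumes "cmod q = 1" "open U" "open V" "open W" "disjoint_in U V W"
    and "x \<in> carrier (pf_space F U)" "y \<in> carrier (pf_space F V)"
  shows "pf_sigma F (q, t) W (prod_op F U V W x y) =
    prod_op F (rigid_action (q, t) ` U) (rigid_action (q, t) ` V) (rigid_action (q, t) ` W)
      (pf_sigma F (q, t) U x) (pf_sigma F (q, t) V y)"
proof -
  have g: "(q, t) \<in> carrier rigid_motions" using assms(1) by simp
  note h1 = lcs_homD[OF sigma_hom[OF g assms(2)]] and h2 = lcs_homD[OF sigma_hom[OF g assms(3)]]
  have op: "open (rigid_action (q, t) ` S)" if "open S" for S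
  proof -
    have q: "q \<noteq> 0" using assms(1) by auto
    then have "rigid_action (q, t) ` S = (\<lambda>w. (w - t) / q) -` S"
      by (force simp: rigid_action_def image_iff)
    also have "open \<dots>" using that q by (intro open_vimage continuous_intros) auto
    finally show ?thesis .
  qed
  have "tensor_map (pf_space F (rigid_action (q, t) ` U)) (pf_space F (rigid_action (q, t) ` V))
           (pf_sigma F (q, t) U) (pf_sigma F (q, t) V) (pure_tensor (pf_space F U) (pf_space F V) x y) =
    pure_tensor (pf_space F (rigid_action (q, t) ` U)) (pf_space F (rigid_action (q, t) ` V))
       (pf_sigma F (q, t) U x) (pf_sigma F (q, t) V y)"
    by (rule tensor_map_pure) (use assms h1 h2 in \<open>auto intro!: space_complex op\<close>)
  then show ?thesis
    unfolding prod_op_def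
    using sigma_prod[OF g assms(2-5), of "pure_tensor (pf_space F U) (pf_space F V) x y"] assms(6,7)
    by (simp add: pure_tensor_closed)
qed


section \<open>The costalk and the multi-point maps\<close>

text \<open>The costalk element \<open>a\<close> inserted at the point \<open>z\<close>, represented
  on the disk of radius \<open>r\<close> about it.\<close>

definition place :: "complex \<Rightarrow> real \<Rightarrow> (real \<Rightarrow> 'a) \<Rightarrow> 'a" where
  "place z r a = pf_sigma F (1, z) (ball 0 r) (a r)"

lemma costalk_closed: "a \<in> carrier (costalk F) \<Longrightarrow> r > 0 \<Longrightarrow> a r \<in> carrier (disk 0 r)"
  by (auto simp: costalk_def)

lemma costalk_ext:
  "a \<in> carrier (costalk F) \<Longrightarrow> 0 < r \<Longrightarrow> r \<le> R \<Longrightarrow> pf_ext F (ball 0 r) (ball 0 R) (a r) = a R"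
  using ext_id[of "ball 0 r" "a r"] costalk_closed[of a r] by (cases "r = R") (auto simp: costalk_def)

lemma place_closed: "a \<in> carrier (costalk F) \<Longrightarrow> r > 0 \<Longrightarrow> place z r a \<in> carrier (disk z r)"
  unfolding place_def using lcs_hom_closed[OF sigma_translate_hom[of z 0 r]] costalk_closed by simp

lemma place_ext:
  assumes "a \<in> carrier (costalk F)" "0 < r" "r \<le> s"
  shows "pf_ext F (ball z r) (ball z s) (place z r a) = place z s a"
  using sigma_natural[of "(1, z)" "ball 0 r" "ball 0 s" "a r"] assms costalk_closed[of a r]
    subset_ball[of r s 0] by (auto simp: place_def costalk_ext)

lemma place_0: "a \<in> carrier (costalk F) \<Longrightarrow> r > 0 \<Longrightarrow> place 0 r a = a r"
  using sigma_one[of "ball 0 r" "a r"] costalk_closed[of a r] by (simp add: place_def rigid_motions_def)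

lemma place_translate:
  assumes "a \<in> carrier (costalk F)" "0 < r"
  shows "pf_sigma F (1, t) (ball z r) (place z r a) = place (z + t) r a"
  using sigma_mult[of "(1, t)" "(1, z)" "ball 0 r" "a r"] assms costalk_closed[of a r]
  by (simp add: place_def rigid_motions_def)

lemma weight_costalk: "a \<in> carrier (costalk_weight F \<Delta>) \<Longrightarrow> a \<in> carrier (costalk F)"
  by (simp add: costalk_weight_def)

text \<open>The identity \<open>(q, 0) (1, z) = (q, q z) = (1, q z) (q, 0)\<close> in the group
  moves the rotation to the disk about the origin, where the weight is read off.\<close>

lemma place_rotate:
  assumes a: "a \<in> carrier (costalk_weight F \<Delta>)" and r: "0 < r" and q: "cmod q = 1"
  shows "pf_sigma F (q, 0) (ball z r) (place z r a) = (q powi \<Delta>) \<odot>\<^bsub>disk (q * z) r\<^esub> place (q * z) r a"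
proof -
  have ac: "a r \<in> carrier (disk 0 r)" using a r weight_costalk costalk_closed by blast
  have rot: "pf_sigma F (q, 0) (ball 0 r) (a r) = (q powi \<Delta>) \<odot>\<^bsub>disk 0 r\<^esub> a r"
    using a r q by (auto simp: costalk_weight_def disk_weight_def)
  have "pf_sigma F (q, 0) (ball z r) (place z r a) = pf_sigma F (q, q * z) (ball 0 r) (a r)"
    using sigma_mult[of "(q, 0)" "(1, z)" "ball 0 r" "a r"] ac q by (simp add: place_def rigid_motions_def)
  also have "\<dots> = pf_sigma F (1, q * z) (ball 0 r) (pf_sigma F (q, 0) (ball 0 r) (a r))"
    using sigma_mult[of "(1, q * z)" "(q, 0)" "ball 0 r" "a r"] ac q
    by (simp add: rigid_motions_def rotate_ball)
  also have "\<dots> = (q powi \<Delta>) \<odot>\<^bsub>disk (q * z) r\<^esub> place (q * z) r a"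
    unfolding rot place_def using lcs_hom_scale[OF sigma_translate_hom[of "q * z" 0 r] ac] by simp
  finally show ?thesis .
qed

lemma place_add:
  assumes "a \<in> carrier (costalk F)" "b \<in> carrier (costalk F)" "0 < r"
  shows "place z r (a \<oplus>\<^bsub>costalk F\<^esub> b) = place z r a \<oplus>\<^bsub>disk z r\<^esub> place z r b"
  using lcs_hom_add[OF sigma_translate_hom[of z 0 r] costalk_closed[OF assms(1,3)] costalk_closed[OF assms(2,3)]] assms
  by (simp add: place_def costalk_def)

lemma place_scale:
  assumes "a \<in> carrier (costalk F)" "0 < r"
  shows "place z r (c \<odot>\<^bsub>costalk F\<^esub> a) = c \<odot>\<^bsub>disk z r\<^esub> place z r a"
  using lcs_hom_scale[OF sigma_translate_hom[of z 0 r] costalk_closed[OF assms(1,2)]] assms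
  by (simp add: place_def costalk_def)

text \<open>\<open>mu\<close> reads only the first \<open>l\<close> entries of its arguments. This
  allows list-indexed points to be exchanged with the extensional points of the configuration
  space.\<close>

lemma mu_cong:
  assumes "\<And>i. i < l \<Longrightarrow> z i = z' i" "\<And>i. i < l \<Longrightarrow> a i = a' i"
  shows "mu F l R z a = mu F l R z' a'"
proof -
  have mp: "pf_multiprod F U l W x = pf_multiprod F U' l W x'"
    if "\<And>i. i < l \<Longrightarrow> U i = U' i" "\<And>i. i < l \<Longrightarrow> x i = x' i" for U U' W x x'
    using that
  proof (induction F U l W x rule: pf_multiprod.induct)
    case (3 F U n W x)
    have "(\<Union>i<Suc n. U i) = (\<Union>i<Suc n. U' i)" using 3(2) by (intro SUP_cong) auto
    moreover have "pf_multiprod F U (Suc n) (\<Union>i<Suc n. U i) x = pf_multiprod F U' (Suc n) (\<Union>i<Suc n. U i) x'"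
      by (rule 3(1)) (use 3(2,3) in auto)
    ultimately show ?case using 3(2,3) by simp
  qed auto
  have "(\<lambda>r. 0 < r \<and> (\<forall>i<l. ball (z i) r \<subseteq> ball 0 R) \<and> disjoint_family_on (\<lambda>i. ball (z i) r) {..<l}) =
      (\<lambda>r. 0 < r \<and> (\<forall>i<l. ball (z' i) r \<subseteq> ball 0 R) \<and> disjoint_family_on (\<lambda>i. ball (z' i) r) {..<l})"
    using assms by (intro ext) (auto simp: disjoint_family_on_def)
  then show ?thesis
    unfolding mu_def Let_def using assms by (auto intro!: mp)
qed

lemma mu1_eq:
  assumes a: "a \<in> carrier (costalk F)" and r: "0 < r" "ball z r \<subseteq> ball 0 R"
  shows "mu1 F R a z = pf_ext F (ball z r) (ball 0 R) (place z r a)"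
proof -
  define P where "P = (\<lambda>r. 0 < r \<and> (\<forall>i<Suc 0. ball ([z] ! i) r \<subseteq> ball 0 R) \<and>
                 disjoint_family_on (\<lambda>i. ball ([z] ! i) r) {..<Suc 0})"
  define s where "s = (SOME r. P r)"
  have "P r" using r by (auto simp: P_def disjoint_family_on_def)
  then have "P s" unfolding s_def by (rule someI)
  then have s: "0 < s" "ball z s \<subseteq> ball 0 R" by (auto simp: P_def)
  have *: "pf_ext F (ball z s) (ball 0 R) (place z s a) = pf_ext F (ball z r) (ball 0 R) (place z r a)"
    if rs: "r \<le> s" "0 < r" "ball z s \<subseteq> ball 0 R" for r s
    using ext_ext[OF open_ball open_ball open_ball subset_ball[OF rs(1)] rs(3) place_closed[OF a rs(2)]]
      place_ext[OF a rs(2,1)] by simp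
  have "mu1 F R a z = pf_ext F (ball z s) (ball 0 R) (place z s a)"
    unfolding mu1_def mu_def One_nat_def P_def[symmetric] s_def[symmetric] Let_def
    by (simp add: place_def)
  also have "\<dots> = pf_ext F (ball z r) (ball 0 R) (place z r a)"
    using *[of r s] *[of s r] r s by (cases "r \<le> s") auto
  finally show ?thesis .
qed

lemma disjoint_family_on_2: "disjoint_family_on U {..<2::nat} \<longleftrightarrow> U 0 \<inter> U 1 = {}"
proof -
  have "{..<2::nat} = {0, 1}" by auto
  then show ?thesis unfolding disjoint_family_on_def by auto
qed

lemma less_3_iff: "(i::nat) < 3 \<longleftrightarrow> i = 0 \<or> i = 1 \<or> i = 2"
  by auto

lemma disjoint_family_on_3:
  "disjoint_family_on U {..<3::nat} \<longleftrightarrow> U 0 \<inter> U 1 = {} \<and> U 0 \<inter> U 2 = {} \<and> U 1 \<inter> U 2 = {}"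
proof -
  have "{..<3::nat} = {0, 1, 2}" by auto
  then show ?thesis unfolding disjoint_family_on_def by auto
qed

definition mu2' :: "real \<Rightarrow> (real \<Rightarrow> 'a) \<Rightarrow> (real \<Rightarrow> 'a) \<Rightarrow> complex \<Rightarrow> complex \<Rightarrow> 'a" where
  "mu2' R a b z w = mu F 2 R ((!) [z, w]) ((!) [a, b])"

lemma mu2_mu2': "mu2 F R a b z = mu2' R a b z 0"
  by (simp add: mu2_def mu2'_def)

text \<open>Replaces the unspecified radius inside \<open>mu\<close> by any admissible pair of
  radii, equal or not. Two choices are compared by shrinking both to common smaller disks. Distinct
  radii matter when one point has to stay close to its neighbour's disk while the other has
  room.\<close>

lemma mu2'_eq:
  assumes a: "a \<in> carrier (costalk F)" and b: "b \<in> carrier (costalk F)"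
    and r: "0 < r" "0 < s" "disjoint_in (ball z r) (ball w s) (ball 0 R)"
  shows "mu2' R a b z w = prod_op F (ball z r) (ball w s) (ball 0 R) (place z r a) (place w s b)"
proof -
  define P where "P = (\<lambda>r. 0 < r \<and> (\<forall>i<2. ball ([z, w] ! i) r \<subseteq> ball 0 R) \<and>
                 disjoint_family_on (\<lambda>i. ball ([z, w] ! i) r) {..<2})"
  have Piff: "P t \<longleftrightarrow> 0 < t \<and> disjoint_in (ball z t) (ball w t) (ball 0 R)" for t
    unfolding P_def disjoint_family_on_2 disjoint_in_def less_2_cases_iff by auto
  define t where "t = (SOME r. P r)"
  have mono: "disjoint_in (ball z r') (ball w s') W"
    if "disjoint_in (ball z r) (ball w s) W" "r' \<le> r" "s' \<le> s" for r s r' s' W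
    using that subset_ball[of r' r z] subset_ball[of s' s w] unfolding disjoint_in_def by blast
  have "P (min r s)" unfolding Piff using r mono[OF r(3), of "min r s" "min r s"] by auto
  then have "P t" unfolding t_def by (rule someI)
  then have t: "0 < t" "disjoint_in (ball z t) (ball w t) (ball 0 R)" by (auto simp: Piff)
  have *: "prod_op F (ball z r) (ball w s) (ball 0 R) (place z r a) (place w s b) =
     prod_op F (ball z r') (ball w s') (ball 0 R) (place z r' a) (place w s' b)"
    if "disjoint_in (ball z r) (ball w s) (ball 0 R)" "r' \<le> r" "s' \<le> s" "0 < r'" "0 < s'" for r s r' s'
    using prod_op_ext[of "ball z r'" "ball w s'" "ball z r" "ball w s" "ball 0 R" "place z r' a" "place w s' b"]
      that place_ext[OF a that(4,2)] place_ext[OF b that(5,3)] place_closed[OF a that(4)] place_closed[OF b that(5)]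
    by (simp add: subset_ball)
  have "mu2' R a b z w = prod_op F (ball z t) (ball w t) (ball 0 R) (place z t a) (place w t b)"
    unfolding mu2'_def mu_def P_def[symmetric] t_def[symmetric] Let_def
    using ext_id[of "ball z t" "place z t a"] place_closed[OF a t(1)]
    by (simp add: numeral_2_eq_2 prod_op_def place_def lessThan_Suc)
  also have "\<dots> = prod_op F (ball z r) (ball w s) (ball 0 R) (place z r a) (place w s b)"
    using *[OF t(2), of "min r t" "min s t"] *[OF r(3), of "min r t" "min s t"] r t by auto
  finally show ?thesis .
qed

definition mu3 :: "real \<Rightarrow> (real \<Rightarrow> 'a) \<Rightarrow> (real \<Rightarrow> 'a) \<Rightarrow> (real \<Rightarrow> 'a) \<Rightarrow> complex \<Rightarrow> complex \<Rightarrow> complex \<Rightarrow> 'a" where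
  "mu3 R a b c z w u = mu F 3 R ((!) [z, w, u]) ((!) [a, b, c])"

text \<open>The intermediate open set \<open>V\<close> is left free, not tied to the union of the
  two disks: \<open>mu3_inner\<close> takes such a union, while \<open>mu3_near\<close> takes a
  single disk about \<open>w\<close> that contains both insertions.\<close>

lemma mu3_eq:
  assumes abc: "a \<in> carrier (costalk F)" "b \<in> carrier (costalk F)" "c \<in> carrier (costalk F)"
    and r: "0 < r" "0 < s" "0 < t" "disjoint_in (ball z r) (ball w s) V" "open V" "disjoint_in V (ball u t) (ball 0 R)"
  shows "mu3 R a b c z w u = prod_op F V (ball u t) (ball 0 R)
    (prod_op F (ball z r) (ball w s) V (place z r a) (place w s b)) (place u t c)"
proof -
  define P where "P = (\<lambda>r. 0 < r \<and> (\<forall>i<3. ball ([z, w, u] ! i) r \<subseteq> ball 0 R) \<and>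
                 disjoint_family_on (\<lambda>i. ball ([z, w, u] ! i) r) {..<3})"
  have Piff: "P t \<longleftrightarrow> 0 < t \<and> disjoint_in (ball z t) (ball w t) (ball z t \<union> ball w t) \<and>
      disjoint_in (ball z t \<union> ball w t) (ball u t) (ball 0 R)" for t
    unfolding P_def disjoint_family_on_3 disjoint_in_def by (simp add: less_3_iff) blast
  define v where "v = (SOME r. P r)"
  have P_mono: "P v" if "v \<le> r" "v \<le> s" "v \<le> t" "0 < v" for v
    unfolding Piff using that r subset_ball[of v r z] subset_ball[of v s w] subset_ball[of v t u]
    unfolding disjoint_in_def by blast
  have "P (min r (min s t))" using r by (intro P_mono) auto
  then have "P v" unfolding v_def by (rule someI)
  then have v: "0 < v" "disjoint_in (ball z v) (ball w v) (ball z v \<union> ball w v)"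
     "disjoint_in (ball z v \<union> ball w v) (ball u v) (ball 0 R)" by (auto simp: Piff)
  have *: "prod_op F V (ball u t) (ball 0 R)
    (prod_op F (ball z r) (ball w s) V (place z r a) (place w s b)) (place u t c) =
     prod_op F (ball z x \<union> ball w x) (ball u x) (ball 0 R)
    (prod_op F (ball z x) (ball w x) (ball z x \<union> ball w x) (place z x a) (place w x b)) (place u x c)"
    if d: "disjoint_in (ball z r) (ball w s) V" "disjoint_in V (ball u t) (ball 0 R)" "open V"
     and x: "x \<le> r" "x \<le> s" "x \<le> t" "0 < x" for r s t x V
  proof -
    have sub: "ball z x \<subseteq> ball z r" "ball w x \<subseteq> ball w s" "ball u x \<subseteq> ball u t" using x by (auto intro: subset_ball)
    have dx: "disjoint_in (ball z x) (ball w x) (ball z x \<union> ball w x)"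
      "disjoint_in (ball z x \<union> ball w x) (ball u x) (ball 0 R)" "ball z x \<union> ball w x \<subseteq> V"
      "disjoint_in (ball z x) (ball w x) V"
      using d sub unfolding disjoint_in_def by blast+
    note pc = place_closed[OF abc(1) x(4)] place_closed[OF abc(2) x(4)] place_closed[OF abc(3) x(4)]
    have "prod_op F (ball z r) (ball w s) V (place z r a) (place w s b) =
        prod_op F (ball z x) (ball w x) V (place z x a) (place w x b)"
      using prod_op_ext[of "ball z x" "ball w x" "ball z r" "ball w s" V "place z x a" "place w x b"]
        sub d place_ext[OF abc(1) x(4,1)] place_ext[OF abc(2) x(4,2)] pc by simp
    also have "\<dots> = pf_ext F (ball z x \<union> ball w x) V (prod_op F (ball z x) (ball w x) (ball z x \<union> ball w x) (place z x a) (place w x b))"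
      by (rule ext_prod_op[symmetric]) (use dx d pc in auto)
    finally have eq: "prod_op F (ball z r) (ball w s) V (place z r a) (place w s b) = \<dots>" .
    have op: "open (ball z x \<union> ball w x)" by (intro open_Un open_ball)
    show ?thesis
      unfolding eq place_ext[OF abc(3) x(4,3), symmetric]
      by (rule prod_op_ext[OF op open_ball d(3) open_ball open_ball dx(3) sub(3) d(2)
            prod_op_closed[OF open_ball open_ball op dx(1) pc(1,2)] pc(3)])
  qed
  have "mu3 R a b c z w u = prod_op F (ball z v \<union> ball w v) (ball u v) (ball 0 R)
    (prod_op F (ball z v) (ball w v) (ball z v \<union> ball w v) (place z v a) (place w v b)) (place u v c)"
    unfolding mu3_def mu_def P_def[symmetric] v_def[symmetric] Let_def
    using ext_id[of "ball z v" "place z v a"] place_closed[OF abc(1) v(1)]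
    by (simp add: numeral_3_eq_3 prod_op_def place_def lessThan_Suc Un_commute)
  also have "\<dots> = prod_op F V (ball u t) (ball 0 R)
    (prod_op F (ball z r) (ball w s) V (place z r a) (place w s b)) (place u t c)"
  proof -
    define x where "x = min v (min r (min s t))"
    have x: "x \<le> v" "x \<le> r" "x \<le> s" "x \<le> t" "0 < x" using r v by (auto simp: x_def)
    show ?thesis using *[OF v(2,3) open_Un[OF open_ball open_ball] x(1) x(1) x(1) x(5)] *[OF r(4,6,5) x(2-5)] by simp
  qed
  finally show ?thesis .
qed

end

section \<open>Vector-valued holomorphic functions of several variables\<close>

text \<open>A filter \<open>atin\<close> ignores its centre, whereas a curve may return to
  \<open>\<gamma> s\<close> at other parameters; the last hypothesis supplies \<open>P\<close>
  there.\<close>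

lemma eventually_atin_compose:
  assumes "continuous_map (top_of_set S) Y \<gamma>" "s \<in> S" "eventually P (atin Y (\<gamma> s))"
    and "\<And>t. t \<in> S \<Longrightarrow> t \<noteq> s \<Longrightarrow> \<gamma> t = \<gamma> s \<Longrightarrow> P (\<gamma> t)"
  shows "eventually (\<lambda>t. P (\<gamma> t)) (at s within S)"
proof -
  have "\<gamma> s \<in> topspace Y" using assms(1,2) by (auto simp: continuous_map_def)
  then obtain U where U: "openin Y U" "\<gamma> s \<in> U" "\<And>y. y \<in> U - {\<gamma> s} \<Longrightarrow> P y"
    using assms(3) by (auto simp: eventually_atin)
  have "openin (top_of_set S) {t \<in> topspace (top_of_set S). \<gamma> t \<in> U}"
    by (rule openin_continuous_map_preimage[OF assms(1) U(1)])
  then obtain T where T: "open T" "{t \<in> S. \<gamma> t \<in> U} = S \<inter> T" by (auto simp: openin_open)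
  have "P (\<gamma> t)" if "t \<in> T" "t \<in> S" "t \<noteq> s" for t
    using that T(2) U(3)[of "\<gamma> t"] assms(4)[of t] by blast
  moreover have "s \<in> T" using T(2) U(2) assms(2) by blast
  ultimately show ?thesis unfolding eventually_at_topological using T(1) by blast
qed

lemma continuous_map_cspace:
  assumes "\<And>i. i < n \<Longrightarrow> continuous_on S (\<lambda>s. \<gamma> s i)" "\<And>s. s \<in> S \<Longrightarrow> \<gamma> s \<in> extensional {..<n}"
  shows "continuous_map (top_of_set S) (cspace n) \<gamma>"
  unfolding continuous_map_componentwise using assms by (auto simp: subset_eq)

lemma cspace_coordinate_tendsto:
  assumes "i < n" "a \<in> extensional {..<n}"
  shows "((\<lambda>x. cmod (x i - a i)) \<longlongrightarrow> 0) (atin (cspace n) a)"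
proof -
  have "continuous_map (cspace n) euclidean (\<lambda>x. x i)"
    using assms(1) by (intro continuous_map_product_projection) auto
  then have "((\<lambda>x. x i) \<longlongrightarrow> a i) (atin (cspace n) a)"
    using assms by (auto simp: continuous_map_atin limitin_canonical_iff PiE_def)
  then show ?thesis by (intro tendsto_norm_zero) (simp add: LIM_zero)
qed

context locally_convex_space
begin

lemma holomorphic_remainder:
  assumes f: "lcs_holomorphic_on E n U f" and a: "a \<in> U"
  shows "\<exists>\<xi>. (\<forall>i<n. \<xi> i \<in> carrier E) \<and>
    (\<forall>p. cts_seminorm E p \<longrightarrow> ((\<lambda>z. p ((f z \<ominus> f a) \<ominus> (\<Oplus>i\<in>{..<n}. (z i - a i) \<odot> \<xi> i)) /
       L2_set (\<lambda>i. cmod (z i - a i)) {..<n}) \<longlongrightarrow> 0) (atin (cspace n) a))"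
proof -
  have U: "openin (cspace n) U" "f \<in> U \<rightarrow> carrier E" using f by (auto simp: lcs_holomorphic_on_def)
  obtain \<xi> where \<xi>: "\<xi> \<in> {..<n} \<rightarrow> carrier E" and lim: "limitin (lcs_topology E)
          (\<lambda>z. complex_of_real (inverse (L2_set (\<lambda>i. cmod (z i - a i)) {..<n})) \<odot>
                 ((f z \<ominus> f a) \<ominus> (\<Oplus>i\<in>{..<n}. (z i - a i) \<odot> \<xi> i)))
          \<zero> (atin (cspace n) a)"
    using f a unfolding lcs_holomorphic_on_def by blast
  have evU: "eventually (\<lambda>z. z \<in> U) (atin (cspace n) a)"
    using U a by (auto simp: eventually_atin)
  show ?thesis
  proof (intro exI[of _ \<xi>] conjI allI impI)
    show "\<xi> i \<in> carrier E" if "i < n" for i using \<xi> that by auto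
    fix p assume p: "cts_seminorm E p"
    have "((\<lambda>z. p (complex_of_real (inverse (L2_set (\<lambda>i. cmod (z i - a i)) {..<n})) \<odot>
                 ((f z \<ominus> f a) \<ominus> (\<Oplus>i\<in>{..<n}. (z i - a i) \<odot> \<xi> i)) \<ominus> \<zero>)) \<longlongrightarrow> 0) (atin (cspace n) a)"
      using lim p unfolding limitin_iff_seminorm by blast
    then show "((\<lambda>z. p ((f z \<ominus> f a) \<ominus> (\<Oplus>i\<in>{..<n}. (z i - a i) \<odot> \<xi> i)) /
       L2_set (\<lambda>i. cmod (z i - a i)) {..<n}) \<longlongrightarrow> 0) (atin (cspace n) a)"
    proof (rule Lim_transform_eventually)
      show "\<forall>\<^sub>F z in atin (cspace n) a. p (complex_of_real (inverse (L2_set (\<lambda>i. cmod (z i - a i)) {..<n})) \<odot>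
                 ((f z \<ominus> f a) \<ominus> (\<Oplus>i\<in>{..<n}. (z i - a i) \<odot> \<xi> i)) \<ominus> \<zero>) =
         p ((f z \<ominus> f a) \<ominus> (\<Oplus>i\<in>{..<n}. (z i - a i) \<odot> \<xi> i)) / L2_set (\<lambda>i. cmod (z i - a i)) {..<n}"
        using evU
      proof eventually_elim
        case (elim z)
        have "(\<Oplus>i\<in>{..<n}. (z i - a i) \<odot> \<xi> i) \<in> carrier E" using \<xi> by (intro finsum_closed) auto
        then have "(f z \<ominus> f a) \<ominus> (\<Oplus>i\<in>{..<n}. (z i - a i) \<odot> \<xi> i) \<in> carrier E"
          using elim a U(2) by (auto intro!: minus_closed)
        then show ?case
          by (simp add: seminorm_scale[OF p] norm_inverse divide_inverse mult.commute L2_set_nonneg)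
      qed
    qed
  qed
qed

lemma seminorm_finsum_le:
  assumes "cts_seminorm E p" "finite A" "f \<in> A \<rightarrow> carrier E"
  shows "p (\<Oplus>i\<in>A. f i) \<le> (\<Sum>i\<in>A. p (f i))"
  using assms(2,3)
proof (induction A rule: finite_induct)
  case empty then show ?case by (simp add: seminorm_zero[OF assms(1)])
next
  case (insert a A)
  then show ?case using seminorm_add[OF assms(1), of "f a" "\<Oplus>i\<in>A. f i"]
    by (auto simp: M.finsum_insert M.finsum_closed)
qed

lemma holomorphic_tendsto:
  assumes f: "lcs_holomorphic_on E n U f" and a: "a \<in> U" and p: "cts_seminorm E p"
  shows "((\<lambda>z. p (f z \<ominus> f a)) \<longlongrightarrow> 0) (atin (cspace n) a)"
proof -
  have U: "openin (cspace n) U" "f \<in> U \<rightarrow> carrier E" using f by (auto simp: lcs_holomorphic_on_def)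
  then have ae: "a \<in> extensional {..<n}" using a openin_subset by (fastforce simp: PiE_def)
  obtain \<xi> where \<xi>: "\<And>i. i < n \<Longrightarrow> \<xi> i \<in> carrier E" and
    lim: "((\<lambda>z. p ((f z \<ominus> f a) \<ominus> (\<Oplus>i\<in>{..<n}. (z i - a i) \<odot> \<xi> i)) /
       L2_set (\<lambda>i. cmod (z i - a i)) {..<n}) \<longlongrightarrow> 0) (atin (cspace n) a)"
    using holomorphic_remainder[OF f a] p by blast
  define S where "S z = (\<Oplus>i\<in>{..<n}. (z i - a i) \<odot> \<xi> i)" for z
  define L where "L z = L2_set (\<lambda>i. cmod (z i - a i)) {..<n}" for z
  have evU: "eventually (\<lambda>z. z \<in> U) (atin (cspace n) a)" using U a by (auto simp: eventually_atin)
  have S: "S z \<in> carrier E" for z unfolding S_def using \<xi> by (intro finsum_closed) auto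
  have "((\<lambda>z. (p ((f z \<ominus> f a) \<ominus> S z) / L z) * (\<Sum>i<n. cmod (z i - a i)) + (\<Sum>i<n. cmod (z i - a i) * p (\<xi> i)))
     \<longlongrightarrow> 0 * (\<Sum>i<n. 0) + (\<Sum>i<n. 0 * p (\<xi> i))) (atin (cspace n) a)"
    using lim[folded S_def L_def] ae
    by (intro tendsto_add tendsto_mult tendsto_sum cspace_coordinate_tendsto tendsto_const) auto
  then have "((\<lambda>z. (p ((f z \<ominus> f a) \<ominus> S z) / L z) * (\<Sum>i<n. cmod (z i - a i)) + (\<Sum>i<n. cmod (z i - a i) * p (\<xi> i)))
     \<longlongrightarrow> 0) (atin (cspace n) a)" by simp
  then show ?thesis
  proof (rule Lim_null_comparison[rotated])
    show "\<forall>\<^sub>F z in atin (cspace n) a. norm (p (f z \<ominus> f a)) \<le>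
      (p ((f z \<ominus> f a) \<ominus> S z) / L z) * (\<Sum>i<n. cmod (z i - a i)) + (\<Sum>i<n. cmod (z i - a i) * p (\<xi> i))"
      using evU
    proof eventually_elim
      case (elim z)
      have fz: "f z \<ominus> f a \<in> carrier E" using elim a U by auto
      have le: "L z \<le> (\<Sum>i<n. cmod (z i - a i))" unfolding L_def by (rule L2_set_le_sum) auto
      have L0: "0 \<le> L z" by (simp add: L_def L2_set_nonneg)
      have d: "(f z \<ominus> f a) \<ominus> S z \<in> carrier E" using fz S by auto
      have "p (f z \<ominus> f a) \<le> p ((f z \<ominus> f a) \<ominus> S z) + p (S z)"
        using seminorm_triangle[OF p fz S[of z]] by simp
      moreover have "p (S z) \<le> (\<Sum>i<n. cmod (z i - a i) * p (\<xi> i))"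
        unfolding S_def using seminorm_finsum_le[OF p, of "{..<n}" "\<lambda>i. (z i - a i) \<odot> \<xi> i"] \<xi>
        by (simp add: seminorm_scale[OF p])
      moreover have "p ((f z \<ominus> f a) \<ominus> S z) \<le> (p ((f z \<ominus> f a) \<ominus> S z) / L z) * (\<Sum>i<n. cmod (z i - a i))"
      proof (cases "L z = 0")
        \<comment> \<open>Division by \<open>L z = 0\<close> yields 0 by convention, so the quotient
          carries no information here; instead \<open>z = a\<close>, and the remainder
          vanishes.\<close>
        case True
        then have "z i - a i = 0" if "i < n" for i using that by (simp add: L_def L2_set_eq_0_iff)
        moreover have "z \<in> extensional {..<n}" using elim U(1) openin_subset by (fastforce simp: PiE_def)
        ultimately have "z = a" using ae by (intro extensionalityI[of _ "{..<n}"]) auto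
        have "S a = \<zero>"
          unfolding S_def by (rule M.add.finprod_one_eqI) (use \<xi> in auto)
        then show ?thesis using \<open>z = a\<close> True elim U(2) seminorm_zero[OF p] by (auto simp: Pi_iff)
      next
        case False
        then have "p ((f z \<ominus> f a) \<ominus> S z) = (p ((f z \<ominus> f a) \<ominus> S z) / L z) * L z" by simp
        also have "\<dots> \<le> (p ((f z \<ominus> f a) \<ominus> S z) / L z) * (\<Sum>i<n. cmod (z i - a i))"
          using le L0 seminorm_nonneg[OF p d] by (intro mult_left_mono) auto
        finally show ?thesis .
      qed
      ultimately show ?case using seminorm_nonneg[OF p fz] by simp
    qed
  qed
qed

lemma holomorphic_continuous_compose:
  assumes f: "lcs_holomorphic_on E n U f" and p: "cts_seminorm E p"
    and \<gamma>: "\<And>i. i < n \<Longrightarrow> continuous_on S (\<lambda>s. \<gamma> s i)" "\<And>s. s \<in> S \<Longrightarrow> \<gamma> s \<in> U"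
    and s: "s \<in> S"
  shows "((\<lambda>t. p (f (\<gamma> t) \<ominus> f (\<gamma> s))) \<longlongrightarrow> 0) (at s within S)"
proof (rule tendstoI)
  fix e :: real assume e: "e > 0"
  have U: "openin (cspace n) U" "f \<in> U \<rightarrow> carrier E" using f by (auto simp: lcs_holomorphic_on_def)
  then have Ue: "x \<in> extensional {..<n}" if "x \<in> U" for x using that openin_subset by (fastforce simp: PiE_def)
  have "continuous_map (top_of_set S) (cspace n) \<gamma>"
    by (rule continuous_map_cspace) (use \<gamma> Ue in auto)
  moreover have "eventually (\<lambda>z. dist (p (f z \<ominus> f (\<gamma> s))) 0 < e) (atin (cspace n) (\<gamma> s))"
    using holomorphic_tendsto[OF f \<gamma>(2)[OF s] p] e by (rule tendstoD)
  ultimately show "\<forall>\<^sub>F t in at s within S. dist (p (f (\<gamma> t) \<ominus> f (\<gamma> s))) 0 < e"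
  proof (rule eventually_atin_compose[OF _ s])
    have "f (\<gamma> s) \<in> carrier E" using U(2) \<gamma>(2)[OF s] by auto
    then have "p (f (\<gamma> s) \<ominus> f (\<gamma> s)) = 0" by (simp add: seminorm_zero[OF p])
    then show "dist (p (f (\<gamma> t) \<ominus> f (\<gamma> s))) 0 < e" if "\<gamma> t = \<gamma> s" for t using that e by simp
  qed
qed

lemma holomorphic_continuous_on_seminorm:
  assumes f: "lcs_holomorphic_on E n U f" and p: "cts_seminorm E p"
    and \<gamma>: "\<And>i. i < n \<Longrightarrow> continuous_on S (\<lambda>s. \<gamma> s i)" "\<And>s. s \<in> S \<Longrightarrow> \<gamma> s \<in> U"
  shows "continuous_on S (\<lambda>s. p (f (\<gamma> s)))"
  unfolding continuous_on_def
proof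
  fix s assume s: "s \<in> S"
  have fU: "f (\<gamma> t) \<in> carrier E" if "t \<in> S" for t using f \<gamma>(2)[OF that] by (auto simp: lcs_holomorphic_on_def)
  have "((\<lambda>t. p (f (\<gamma> t)) - p (f (\<gamma> s))) \<longlongrightarrow> 0) (at s within S)"
  proof (rule Lim_null_comparison[OF _ holomorphic_continuous_compose[OF f p \<gamma> s]])
    show "\<forall>\<^sub>F t in at s within S. norm (p (f (\<gamma> t)) - p (f (\<gamma> s))) \<le> p (f (\<gamma> t) \<ominus> f (\<gamma> s))"
      unfolding eventually_at_filter
    proof (intro always_eventually allI impI)
      fix t assume "t \<in> S"
      from seminorm_triangle[OF p fU[OF this] fU[OF s]] seminorm_triangle[OF p fU[OF s] fU[OF this]]
        seminorm_diff_commute[OF p fU[OF this] fU[OF s]]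
      show "norm (p (f (\<gamma> t)) - p (f (\<gamma> s))) \<le> p (f (\<gamma> t) \<ominus> f (\<gamma> s))" by simp
    qed
  qed
  then show "((\<lambda>t. p (f (\<gamma> t))) \<longlongrightarrow> p (f (\<gamma> s))) (at s within S)" by (simp add: LIM_zero_iff)
qed

lemma holomorphic_continuous_on_dual:
  assumes f: "lcs_holomorphic_on E n U f" and \<phi>: "\<phi> \<in> lcs_dual E"
    and \<gamma>: "\<And>i. i < n \<Longrightarrow> continuous_on S (\<lambda>s. \<gamma> s i)" "\<And>s. s \<in> S \<Longrightarrow> \<gamma> s \<in> U"
  shows "continuous_on S (\<lambda>s. \<phi> (f (\<gamma> s)))"
  unfolding continuous_on_def
proof
  fix s assume s: "s \<in> S"
  have fU: "f (\<gamma> t) \<in> carrier E" if "t \<in> S" for t using f \<gamma>(2)[OF that] by (auto simp: lcs_holomorphic_on_def)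
  have "((\<lambda>t. \<phi> (f (\<gamma> t)) - \<phi> (f (\<gamma> s))) \<longlongrightarrow> 0) (at s within S)"
  proof (rule Lim_null_comparison[OF _ holomorphic_continuous_compose[OF f dual_seminorm[OF \<phi>] \<gamma> s]])
    show "\<forall>\<^sub>F t in at s within S. norm (\<phi> (f (\<gamma> t)) - \<phi> (f (\<gamma> s))) \<le> cmod (\<phi> (f (\<gamma> t) \<ominus> f (\<gamma> s)))"
      unfolding eventually_at_filter using fU s
      by (intro always_eventually) (auto simp: dual_diff[OF \<phi>])
  qed
  then show "((\<lambda>t. \<phi> (f (\<gamma> t))) \<longlongrightarrow> \<phi> (f (\<gamma> s))) (at s within S)" by (simp add: LIM_zero_iff)
qed

text \<open>A single \<open>\<xi>\<close> serves all lines through \<open>a\<close>, so derivatives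
  in different directions are linear combinations of the same numbers. This is the form of the chain
  rule behind translation covariance.\<close>

lemma holomorphic_line_derivative:
  assumes f: "lcs_holomorphic_on E n U f" and a: "a \<in> U" and \<phi>: "\<phi> \<in> lcs_dual E"
  obtains \<xi> where "\<And>\<gamma> v s. \<gamma> s = a \<Longrightarrow> (\<And>t i. i < n \<Longrightarrow> \<gamma> t i = a i + (t - s) * v i) \<Longrightarrow>
     (\<And>t. \<gamma> t \<in> extensional {..<n}) \<Longrightarrow>
     ((\<lambda>t. \<phi> (f (\<gamma> t))) has_field_derivative (\<Sum>i<n. v i * \<xi> i)) (at s)"
proof -
  have U: "openin (cspace n) U" "f \<in> U \<rightarrow> carrier E" using f by (auto simp: lcs_holomorphic_on_def)
  obtain \<xi> where \<xi>: "\<And>i. i < n \<Longrightarrow> \<xi> i \<in> carrier E" and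
    lim: "\<And>p. cts_seminorm E p \<Longrightarrow> ((\<lambda>z. p ((f z \<ominus> f a) \<ominus> (\<Oplus>i\<in>{..<n}. (z i - a i) \<odot> \<xi> i)) /
       L2_set (\<lambda>i. cmod (z i - a i)) {..<n}) \<longlongrightarrow> 0) (atin (cspace n) a)"
    using holomorphic_remainder[OF f a] by blast
  have "((\<lambda>t. \<phi> (f (\<gamma> t))) has_field_derivative (\<Sum>i<n. v i * \<phi> (\<xi> i))) (at s)"
    if \<gamma>: "\<gamma> s = a" "\<And>t i. i < n \<Longrightarrow> \<gamma> t i = a i + (t - s) * v i" "\<And>t. \<gamma> t \<in> extensional {..<n}" for \<gamma> v s
  proof (cases "\<forall>i<n. v i = 0")
    \<comment> \<open>For the zero direction the curve never leaves \<open>a\<close>, where a limit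
      over punctured neighbourhoods says nothing; the composite is constant instead.\<close>
    case True
    then have "\<gamma> t = a" for t
      using \<gamma>(2)[of _ t] \<gamma>(3)[of t] \<gamma>(3)[of s] \<gamma>(1) by (intro extensionalityI[of _ "{..<n}"]) auto
    then show ?thesis using True by simp
  next
    case False
    then obtain j where j: "j < n" "v j \<noteq> 0" by auto
    define L where "L = L2_set (\<lambda>i. cmod (v i)) {..<n}"
    have "L \<noteq> 0" using j by (auto simp: L_def L2_set_eq_0_iff)
    then have L: "L > 0" using L2_set_nonneg[of "\<lambda>i. cmod (v i)" "{..<n}"] by (simp add: L_def less_le)
    have cont: "continuous_map (top_of_set UNIV) (cspace n) \<gamma>"
      by (rule continuous_map_cspace) (use \<gamma> in \<open>auto intro!: continuous_intros\<close>)
    have inj: "\<gamma> t = \<gamma> s \<Longrightarrow> t = s" for t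
      using \<gamma>(2)[OF j(1), of t] \<gamma>(2)[OF j(1), of s] j(2) by auto
    have ev: "eventually (\<lambda>t. P (\<gamma> t)) (at s)" if "eventually P (atin (cspace n) a)" for P
      by (rule eventually_atin_compose[OF cont UNIV_I]) (simp add: \<gamma>(1) that, use inj in blast)
    have evU: "eventually (\<lambda>t. \<gamma> t \<in> U) (at s)" by (rule ev) (use U a in \<open>auto simp: eventually_atin\<close>)
    have "((\<lambda>t. cmod (\<phi> ((f (\<gamma> t) \<ominus> f a) \<ominus> (\<Oplus>i\<in>{..<n}. (\<gamma> t i - a i) \<odot> \<xi> i))) /
       L2_set (\<lambda>i. cmod (\<gamma> t i - a i)) {..<n}) \<longlongrightarrow> 0) (at s)"
      by (rule tendstoI, rule ev, rule tendstoD[OF lim[OF dual_seminorm[OF \<phi>]]])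
    from tendsto_mult_right[OF this, of L]
    have "((\<lambda>t. cmod (\<phi> ((f (\<gamma> t) \<ominus> f a) \<ominus> (\<Oplus>i\<in>{..<n}. (\<gamma> t i - a i) \<odot> \<xi> i))) /
       L2_set (\<lambda>i. cmod (\<gamma> t i - a i)) {..<n} * L) \<longlongrightarrow> 0) (at s)" by simp
    then have "((\<lambda>t. (\<phi> (f (\<gamma> t)) - \<phi> (f a)) / (t - s) - (\<Sum>i<n. v i * \<phi> (\<xi> i))) \<longlongrightarrow> 0) (at s)"
    proof (rule Lim_null_comparison[rotated])
      have "\<forall>\<^sub>F t in at s. t \<noteq> s" by (simp add: eventually_at_filter)
      with evU show "\<forall>\<^sub>F t in at s. norm ((\<phi> (f (\<gamma> t)) - \<phi> (f a)) / (t - s) - (\<Sum>i<n. v i * \<phi> (\<xi> i))) \<le>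
        cmod (\<phi> ((f (\<gamma> t) \<ominus> f a) \<ominus> (\<Oplus>i\<in>{..<n}. (\<gamma> t i - a i) \<odot> \<xi> i))) /
         L2_set (\<lambda>i. cmod (\<gamma> t i - a i)) {..<n} * L"
      proof eventually_elim
        case (elim t)
        have cl: "f (\<gamma> t) \<in> carrier E" "f a \<in> carrier E" using elim a U by auto
        have sc: "(\<Oplus>i\<in>{..<n}. (\<gamma> t i - a i) \<odot> \<xi> i) \<in> carrier E" using \<xi> by (intro finsum_closed) auto
        have 1: "\<phi> (\<Oplus>i\<in>{..<n}. (\<gamma> t i - a i) \<odot> \<xi> i) = (t - s) * (\<Sum>i<n. v i * \<phi> (\<xi> i))"
          using \<xi> by (subst dual_finsum[OF \<phi>]) (auto simp: lcs_dual_scale[OF \<phi>] \<gamma>(2) sum_distrib_left mult.assoc)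
        have 2: "L2_set (\<lambda>i. cmod (\<gamma> t i - a i)) {..<n} = cmod (t - s) * L"
        proof -
          have "L2_set (\<lambda>i. cmod (\<gamma> t i - a i)) {..<n} = L2_set (\<lambda>i. cmod (t - s) * cmod (v i)) {..<n}"
            by (rule L2_set_cong) (auto simp: \<gamma>(2) norm_mult)
          then show ?thesis by (simp add: L_def L2_set_right_distrib)
        qed
        have "(\<phi> (f (\<gamma> t)) - \<phi> (f a)) / (t - s) - (\<Sum>i<n. v i * \<phi> (\<xi> i)) =
           (\<phi> (f (\<gamma> t)) - \<phi> (f a) - (t - s) * (\<Sum>i<n. v i * \<phi> (\<xi> i))) / (t - s)"
          using elim by (simp add: diff_divide_distrib)
        then show ?case
          using cl sc L elim unfolding 2 by (simp add: dual_diff[OF \<phi>] 1 norm_divide)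
      qed
    qed
    then show ?thesis using \<gamma>(1) by (simp add: has_field_derivative_iff LIM_zero_iff)
  qed
  then show ?thesis by (rule that)
qed

end

section \<open>Restriction, symmetry, equivariance and factorization of the multi-point maps\<close>

context planar_pfa
begin

lemma ext_ball_hom: "ball z r \<subseteq> ball w s \<Longrightarrow> pf_ext F (ball z r) (ball w s) \<in> lcs_hom (disk z r) (disk w s)"
  by (rule ext_hom) auto

lemma ball_subset_ball0: "cmod w + r \<le> R \<Longrightarrow> ball w r \<subseteq> ball (0::complex) R"
  by (simp add: ball_subset_ball_iff)

lemma disjoint_balls: "r + s \<le> dist z w \<Longrightarrow> ball z r \<inter> ball w s = {}" for z w :: complex
  using disjoint_ballI by blast

lemma mu1_radius:
  assumes "z \<in> ball (0::complex) R"
  obtains r where "r > 0" "ball z r \<subseteq> ball 0 R"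
  using assms that[of "R - cmod z"] ball_subset_ball0[of z "R - cmod z" R] by simp

lemma mu2_radius:
  assumes "z \<in> ball (0::complex) R" "w \<in> ball 0 R" "z \<noteq> w"
  obtains r where "r > 0" "disjoint_in (ball z r) (ball w r) (ball 0 R)"
proof -
  obtain r1 where r1: "r1 > 0" "ball z r1 \<subseteq> ball 0 R" using mu1_radius[OF assms(1)] .
  obtain r2 where r2: "r2 > 0" "ball w r2 \<subseteq> ball 0 R" using mu1_radius[OF assms(2)] .
  define r where "r = min (min r1 r2) (dist z w / 2)"
  have "ball z r \<subseteq> ball z r1" "ball w r \<subseteq> ball w r2" by (auto simp: r_def)
  moreover have "ball z r \<inter> ball w r = {}" by (rule disjoint_balls) (auto simp: r_def)
  ultimately have "disjoint_in (ball z r) (ball w r) (ball 0 R)"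
    using r1(2) r2(2) unfolding disjoint_in_def by blast
  moreover have "r > 0" using r1 r2 assms(3) by (simp add: r_def)
  ultimately show ?thesis using that by blast
qed

lemma mu1_closed: "a \<in> carrier (costalk F) \<Longrightarrow> z \<in> ball 0 R \<Longrightarrow> mu1 F R a z \<in> carrier (disk 0 R)"
  using mu1_radius[of z R] mu1_eq ext_closed place_closed by (metis open_ball)

lemma mu2'_closed:
  assumes "a \<in> carrier (costalk F)" "b \<in> carrier (costalk F)" "z \<in> ball 0 R" "w \<in> ball 0 R" "z \<noteq> w"
  shows "mu2' R a b z w \<in> carrier (disk 0 R)"
proof -
  obtain r where "r > 0" "disjoint_in (ball z r) (ball w r) (ball 0 R)" using mu2_radius[OF assms(3-5)] .
  then show ?thesis using mu2'_eq[OF assms(1,2)] prod_op_closed place_closed assms(1,2) by simp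
qed

lemma mu1_0: "a \<in> carrier (costalk F) \<Longrightarrow> R > 0 \<Longrightarrow> mu1 F R a 0 = a R"
  using mu1_eq[of a R 0 R] ext_id[of "ball 0 R" "a R"] by (simp add: place_0 costalk_closed)

lemma mu1_ext:
  assumes "a \<in> carrier (costalk F)" "z \<in> ball 0 r" "r \<le> R"
  shows "pf_ext F (ball 0 r) (ball 0 R) (mu1 F r a z) = mu1 F R a z"
proof -
  obtain s where s: "s > 0" "ball z s \<subseteq> ball 0 r" using mu1_radius[OF assms(2)] .
  have sub: "ball 0 r \<subseteq> ball (0::complex) R" using assms(3) by (rule subset_ball)
  show ?thesis
    unfolding mu1_eq[OF assms(1) s] mu1_eq[OF assms(1) s(1) subset_trans[OF s(2) sub]]
    by (rule ext_ext) (use s sub place_closed[OF assms(1) s(1)] in auto)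
qed

lemma mu2'_ext:
  assumes "a \<in> carrier (costalk F)" "b \<in> carrier (costalk F)" "z \<in> ball 0 r" "w \<in> ball 0 r" "z \<noteq> w" "r \<le> R"
  shows "pf_ext F (ball 0 r) (ball 0 R) (mu2' r a b z w) = mu2' R a b z w"
proof -
  obtain s where s: "s > 0" "disjoint_in (ball z s) (ball w s) (ball 0 r)" using mu2_radius[OF assms(3-5)] .
  have sub: "ball 0 r \<subseteq> ball (0::complex) R" using assms(6) by (rule subset_ball)
  have s': "disjoint_in (ball z s) (ball w s) (ball 0 R)" using s(2) sub unfolding disjoint_in_def by blast
  show ?thesis
    unfolding mu2'_eq[OF assms(1,2) s(1,1,2)] mu2'_eq[OF assms(1,2) s(1,1) s']
    by (rule ext_prod_op) (use s sub place_closed[OF assms(1) s(1)] place_closed[OF assms(2) s(1)] in auto)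
qed

lemma mu2'_commute:
  assumes "a \<in> carrier (costalk F)" "b \<in> carrier (costalk F)" "z \<in> ball 0 R" "w \<in> ball 0 R" "z \<noteq> w"
  shows "mu2' R b a w z = mu2' R a b z w"
proof -
  obtain s where s: "s > 0" "disjoint_in (ball z s) (ball w s) (ball 0 R)" using mu2_radius[OF assms(3-5)] .
  then have s': "disjoint_in (ball w s) (ball z s) (ball 0 R)" by (auto simp: disjoint_in_def)
  show ?thesis
    unfolding mu2'_eq[OF assms(1,2) s(1,1,2)] mu2'_eq[OF assms(2,1) s(1,1) s']
    by (rule prod_op_commute) (use s place_closed[OF assms(1) s(1)] place_closed[OF assms(2) s(1)] in auto)
qed

lemma mu2'_add_left:
  assumes "a \<in> carrier (costalk F)" "a' \<in> carrier (costalk F)" "b \<in> carrier (costalk F)"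
    "a \<oplus>\<^bsub>costalk F\<^esub> a' \<in> carrier (costalk F)" "z \<in> ball 0 R" "w \<in> ball 0 R" "z \<noteq> w"
  shows "mu2' R (a \<oplus>\<^bsub>costalk F\<^esub> a') b z w = mu2' R a b z w \<oplus>\<^bsub>disk 0 R\<^esub> mu2' R a' b z w"
proof -
  obtain s where s: "s > 0" "disjoint_in (ball z s) (ball w s) (ball 0 R)" using mu2_radius[OF assms(5-7)] .
  show ?thesis
    unfolding mu2'_eq[OF assms(1,3) s(1,1,2)] mu2'_eq[OF assms(2,3) s(1,1,2)] mu2'_eq[OF assms(4,3) s(1,1,2)]
      place_add[OF assms(1,2) s(1)]
    by (rule bilinear_intoD(2)[OF prod_op_bilinear])
      (use s place_closed[OF assms(1) s(1)] place_closed[OF assms(2) s(1)] place_closed[OF assms(3) s(1)] in auto)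
qed

lemma mu2'_scale_left:
  assumes "a \<in> carrier (costalk F)" "b \<in> carrier (costalk F)"
    "c \<odot>\<^bsub>costalk F\<^esub> a \<in> carrier (costalk F)" "z \<in> ball 0 R" "w \<in> ball 0 R" "z \<noteq> w"
  shows "mu2' R (c \<odot>\<^bsub>costalk F\<^esub> a) b z w = c \<odot>\<^bsub>disk 0 R\<^esub> mu2' R a b z w"
proof -
  obtain s where s: "s > 0" "disjoint_in (ball z s) (ball w s) (ball 0 R)" using mu2_radius[OF assms(4-6)] .
  show ?thesis
    unfolding mu2'_eq[OF assms(1,2) s(1,1,2)] mu2'_eq[OF assms(3,2) s(1,1,2)] place_scale[OF assms(1) s(1)]
    by (rule bilinear_intoD(4)[OF prod_op_bilinear])
      (use s place_closed[OF assms(1) s(1)] place_closed[OF assms(2) s(1)] in auto)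
qed

lemma mu1_rotate:
  assumes a: "a \<in> carrier (costalk_weight F \<Delta>)" and z: "z \<in> ball 0 R" and q: "cmod q = 1"
  shows "pf_sigma F (q, 0) (ball 0 R) (mu1 F R a z) = (q powi \<Delta>) \<odot>\<^bsub>disk 0 R\<^esub> mu1 F R a (q * z)"
proof -
  note ac = weight_costalk[OF a]
  obtain s where s: "s > 0" "ball z s \<subseteq> ball 0 R" using mu1_radius[OF z] .
  have s': "ball (q * z) s \<subseteq> ball 0 R" using image_mono[OF s(2), of "rigid_action (q, 0)"] by (simp add: rotate_ball[OF q])
  have "pf_sigma F (q, 0) (ball 0 R) (mu1 F R a z) =
     pf_ext F (ball (q * z) s) (ball 0 R) (pf_sigma F (q, 0) (ball z s) (place z s a))"
    unfolding mu1_eq[OF ac s]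
    using sigma_natural[of "(q, 0)" "ball z s" "ball 0 R" "place z s a"] q s place_closed[OF ac s(1)]
    by (simp add: rotate_ball)
  also have "\<dots> = (q powi \<Delta>) \<odot>\<^bsub>disk 0 R\<^esub> mu1 F R a (q * z)"
    unfolding place_rotate[OF a s(1) q] mu1_eq[OF ac s(1) s']
    by (rule lcs_hom_scale[OF ext_ball_hom[OF s']]) (rule place_closed[OF ac s(1)])
  finally show ?thesis .
qed

lemma mu2'_rotate:
  assumes a: "a \<in> carrier (costalk_weight F \<Delta>)" and b: "b \<in> carrier (costalk_weight F \<Delta>')"
    and z: "z \<in> ball 0 R" "w \<in> ball 0 R" "z \<noteq> w" and q: "cmod q = 1"
  shows "pf_sigma F (q, 0) (ball 0 R) (mu2' R a b z w) =
    (q powi (\<Delta> + \<Delta>')) \<odot>\<^bsub>disk 0 R\<^esub> mu2' R a b (q * z) (q * w)"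
proof -
  note ac = weight_costalk[OF a] and bc = weight_costalk[OF b]
  interpret D: complex_space "disk 0 R" by (rule disk_space)
  have q0: "q \<noteq> 0" using q by auto
  obtain s where s: "s > 0" "disjoint_in (ball z s) (ball w s) (ball 0 R)" using mu2_radius[OF z] .
  obtain t where t: "t > 0" "disjoint_in (ball (q * z) t) (ball (q * w) t) (ball 0 R)"
    using mu2_radius[of "q * z" R "q * w"] z q q0 by (auto simp: norm_mult)
  define u where "u = min s t"
  have u: "u > 0" "ball z u \<subseteq> ball z s" "ball w u \<subseteq> ball w s" "ball (q * z) u \<subseteq> ball (q * z) t" "ball (q * w) u \<subseteq> ball (q * w) t"
    using s t by (auto simp: u_def)
  have d: "disjoint_in (ball z u) (ball w u) (ball 0 R)" "disjoint_in (ball (q * z) u) (ball (q * w) u) (ball 0 R)"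
    using s t u unfolding disjoint_in_def by blast+
  note pc = place_closed[OF ac u(1)] place_closed[OF bc u(1)]
  note bil = bilinear_intoD[OF prod_op_bilinear[OF open_ball open_ball open_ball d(2)]]
  have "pf_sigma F (q, 0) (ball 0 R) (mu2' R a b z w) = prod_op F (ball (q * z) u) (ball (q * w) u) (ball 0 R)
     ((q powi \<Delta>) \<odot>\<^bsub>disk (q * z) u\<^esub> place (q * z) u a) ((q powi \<Delta>') \<odot>\<^bsub>disk (q * w) u\<^esub> place (q * w) u b)"
    unfolding mu2'_eq[OF ac bc u(1,1) d(1)]
    using sigma_prod_op[OF q open_ball open_ball open_ball d(1) pc, of 0]
    by (simp add: rotate_ball[OF q] place_rotate[OF a u(1) q] place_rotate[OF b u(1) q])
  also have "\<dots> = (q powi \<Delta> * q powi \<Delta>') \<odot>\<^bsub>disk 0 R\<^esub> mu2' R a b (q * z) (q * w)"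
    unfolding mu2'_eq[OF ac bc u(1,1) d(2)]
    using pc complex_space.scale_closed[OF disk_space pc(1)] complex_space.scale_closed[OF disk_space pc(2)]
    by (simp add: bil D.scale_scale complex_space.scale_closed[OF disk_space] mult.commute)
  finally show ?thesis using q0 by (simp add: power_int_add)
qed

lemma mu1_translate:
  assumes a: "a \<in> carrier (costalk F)" and z: "z \<in> ball 0 s"
    and sub: "ball t s \<subseteq> ball 0 R"
  shows "mu1 F R a (z + t) = pf_ext F (ball t s) (ball 0 R) (pf_sigma F (1, t) (ball 0 s) (mu1 F s a z))"
proof -
  obtain e where e: "e > 0" "ball z e \<subseteq> ball 0 s" using mu1_radius[OF z] .
  have e': "ball (z + t) e \<subseteq> ball t s" using image_mono[OF e(2), of "rigid_action (1, t)"] by simp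
  note pc = place_closed[OF a e(1)]
  have "pf_sigma F (1, t) (ball 0 s) (mu1 F s a z) = pf_ext F (ball (z + t) e) (ball t s) (place (z + t) e a)"
    unfolding mu1_eq[OF a e]
    using sigma_natural[of "(1, t)" "ball z e" "ball 0 s" "place z e a"] e pc place_translate[OF a e(1)]
    by simp
  then show ?thesis
    unfolding mu1_eq[OF a e(1) subset_trans[OF e' sub]]
    using ext_ext[OF open_ball open_ball open_ball e' sub pc] by simp
qed

lemma disjoint_in_translate:
  fixes z w t :: complex
  assumes "disjoint_in (ball z e) (ball w e) (ball 0 s)"
  shows "disjoint_in (ball (z + t) e) (ball (w + t) e) (ball t s)"
proof -
  have "ball (z + t) e \<inter> ball (w + t) e = rigid_action (1, t) ` (ball z e \<inter> ball w e)"
    by (subst image_Int) (auto simp: inj_on_def rigid_action_def simp flip: translate_ball)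
  moreover have "ball (z + t) e \<union> ball (w + t) e = rigid_action (1, t) ` (ball z e \<union> ball w e)"
    by (simp add: image_Un)
  moreover have "rigid_action (1, t) ` ball 0 s = ball t s" by simp
  ultimately show ?thesis using assms unfolding disjoint_in_def by (metis image_empty image_mono)
qed

lemma mu2'_translate:
  assumes a: "a \<in> carrier (costalk F)" and b: "b \<in> carrier (costalk F)"
    and z: "z \<in> ball 0 s" "w \<in> ball 0 s" "z \<noteq> w" and sub: "ball t s \<subseteq> ball 0 R"
  shows "mu2' R a b (z + t) (w + t) =
    pf_ext F (ball t s) (ball 0 R) (pf_sigma F (1, t) (ball 0 s) (mu2' s a b z w))"
proof -
  obtain e where e: "e > 0" "disjoint_in (ball z e) (ball w e) (ball 0 s)" using mu2_radius[OF z] .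
  note e' = disjoint_in_translate[OF e(2), of t]
  have e'': "disjoint_in (ball (z + t) e) (ball (w + t) e) (ball 0 R)"
    using e' sub unfolding disjoint_in_def by blast
  note pa = place_closed[OF a e(1)] and pb = place_closed[OF b e(1)]
  have "pf_sigma F (1, t) (ball 0 s) (mu2' s a b z w) =
     prod_op F (ball (z + t) e) (ball (w + t) e) (ball t s) (place (z + t) e a) (place (w + t) e b)"
    unfolding mu2'_eq[OF a b e(1,1,2)]
    using sigma_prod_op[OF norm_one open_ball open_ball open_ball e(2) pa pb, of t]
      place_translate[OF a e(1)] place_translate[OF b e(1)] by simp
  then show ?thesis
    unfolding mu2'_eq[OF a b e(1,1) e'']
    using ext_prod_op[OF open_ball open_ball open_ball open_ball e' sub pa pb] by simp
qed

text \<open>An insertion of \<open>b\<close> at a moving point of an inner disk factors through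
  \<open>mu1\<close> of that disk, while \<open>a\<close> stays a fixed factor of a product
  continuous in its second argument.\<close>

lemma mu2'_inner:
  assumes a: "a \<in> carrier (costalk F)" and b: "b \<in> carrier (costalk F)"
    and d: "disjoint_in (ball z e) (ball 0 s) (ball 0 R)" "e > 0" and w: "w \<in> ball 0 s"
  shows "mu2' R a b z w = prod_op F (ball z e) (ball 0 s) (ball 0 R) (place z e a) (mu1 F s b w)"
proof -
  obtain t where t: "t > 0" "ball w t \<subseteq> ball 0 s" using mu1_radius[OF w] .
  have d': "disjoint_in (ball z e) (ball w t) (ball 0 R)" using d t unfolding disjoint_in_def by blast
  show ?thesis
    unfolding mu2'_eq[OF a b d(2) t(1) d'] mu1_eq[OF b t]
    using prod_op_ext[OF open_ball open_ball open_ball open_ball open_ball subset_refl t(2) d(1)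
        place_closed[OF a d(2)] place_closed[OF b t(1)]]
      ext_id[OF open_ball place_closed[OF a d(2)]] by simp
qed

text \<open>Associativity regroups the product so that the last two insertions are multiplied first,
  inside the disk about the origin, and \<open>a\<close> enters as a fixed left factor.\<close>

lemma mu3_inner:
  assumes a: "a \<in> carrier (costalk F)" and b: "b \<in> carrier (costalk F)" and c: "c \<in> carrier (costalk F)"
    and d: "disjoint_in (ball z e) (ball 0 s) (ball 0 R)" "e > 0" and w: "w \<in> ball 0 s" "w \<noteq> 0"
  shows "mu3 R a b c z w 0 = prod_op F (ball z e) (ball 0 s) (ball 0 R) (place z e a) (mu2' s b c w 0)"
proof -
  have 0: "0 \<in> ball (0::complex) s" using w(1) by (auto intro: le_less_trans[OF norm_ge_zero])
  obtain t where t: "t > 0" "disjoint_in (ball w t) (ball 0 t) (ball 0 s)" using mu2_radius[OF w(1) 0 w(2)] .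
  define V where "V = ball z e \<union> ball w t"
  have V: "open V" "disjoint_in (ball z e) (ball w t) V" "disjoint_in V (ball 0 t) (ball 0 R)"
    using d t unfolding V_def disjoint_in_def by auto
  show ?thesis
    unfolding mu3_eq[OF a b c d(2) t(1) t(1) V(2) V(1) V(3)] mu2'_eq[OF b c t(1,1,2)]
    by (rule prod_op_assoc) (use V t d place_closed[OF a d(2)] place_closed[OF b t(1)] place_closed[OF c t(1)] in auto)
qed

text \<open>Only the inner product is braided: a radius small enough for all three pairs lets the
  first two insertions be exchanged inside their union \<open>V\<close>, with the third one
  untouched.\<close>

lemma mu3_commute:
  assumes a: "a \<in> carrier (costalk F)" and b: "b \<in> carrier (costalk F)" and c: "c \<in> carrier (costalk F)"
    and z: "z \<in> ball 0 R" "w \<in> ball 0 R" "z \<noteq> w" "z \<noteq> 0" "w \<noteq> 0"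
  shows "mu3 R a b c z w 0 = mu3 R b a c w z 0"
proof -
  have 0: "0 \<in> ball (0::complex) R" using z(1) by (auto intro: le_less_trans[OF norm_ge_zero])
  obtain r1 where r1: "r1 > 0" "disjoint_in (ball z r1) (ball w r1) (ball 0 R)" using mu2_radius[OF z(1-3)] .
  obtain r2 where r2: "r2 > 0" "disjoint_in (ball z r2) (ball 0 r2) (ball 0 R)" using mu2_radius[OF z(1) 0 z(4)] .
  obtain r3 where r3: "r3 > 0" "disjoint_in (ball w r3) (ball 0 r3) (ball 0 R)" using mu2_radius[OF z(2) 0 z(5)] .
  define r where "r = min r1 (min r2 r3)"
  have r: "r > 0" using r1 r2 r3 by (auto simp: r_def)
  have sub: "ball x r \<subseteq> ball x r1" "ball x r \<subseteq> ball x r2" "ball x r \<subseteq> ball x r3" for x :: complex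
    by (auto simp: r_def)
  define V where "V = ball z r \<union> ball w r"
  have V: "open V" "disjoint_in (ball z r) (ball w r) V" "disjoint_in (ball w r) (ball z r) V"
    using r1 sub(1)[of z] sub(1)[of w] unfolding V_def disjoint_in_def by auto
  have V3: "disjoint_in V (ball 0 r) (ball 0 R)"
    using r2 r3 sub(2)[of z] sub(2)[of 0] sub(3)[of w] sub(3)[of 0] unfolding V_def disjoint_in_def by blast
  show ?thesis
    unfolding mu3_eq[OF a b c r r r V(2,1) V3] mu3_eq[OF b a c r r r V(3,1) V3]
      prod_op_commute[OF open_ball open_ball V(1) V(2) place_closed[OF a r] place_closed[OF b r]] ..
qed

text \<open>The pair at \<open>x + w\<close> and \<open>w\<close> is the translate by
  \<open>w\<close> of the pair at \<open>x\<close> and 0. With the disk about \<open>w\<close> as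
  intermediate open set, the third insertion becomes a fixed right factor.\<close>

lemma mu3_near:
  assumes a: "a \<in> carrier (costalk F)" and b: "b \<in> carrier (costalk F)" and c: "c \<in> carrier (costalk F)"
    and d: "disjoint_in (ball w s) (ball 0 t) (ball 0 R)" "t > 0" and x: "x \<in> ball 0 s" "x \<noteq> 0"
  shows "mu3 R a b c (x + w) w 0 = prod_op F (ball w s) (ball 0 t) (ball 0 R)
    (pf_sigma F (1, w) (ball 0 s) (mu2' s a b x 0)) (place 0 t c)"
proof -
  have 0: "0 \<in> ball (0::complex) s" using x(1) by (auto intro: le_less_trans[OF norm_ge_zero])
  obtain e where e: "e > 0" "disjoint_in (ball x e) (ball 0 e) (ball 0 s)" using mu2_radius[OF x(1) 0 x(2)] .
  have e': "disjoint_in (ball (x + w) e) (ball w e) (ball w s)"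
    using disjoint_in_translate[OF e(2), of w] by simp
  note pa = place_closed[OF a e(1)] and pb = place_closed[OF b e(1)]
  have "pf_sigma F (1, w) (ball 0 s) (mu2' s a b x 0) =
     prod_op F (ball (x + w) e) (ball w e) (ball w s) (place (x + w) e a) (place w e b)"
    unfolding mu2'_eq[OF a b e(1,1,2)]
    using sigma_prod_op[OF norm_one open_ball open_ball open_ball e(2) pa pb, of w]
      place_translate[OF a e(1), of w x] place_translate[OF b e(1), of w 0] by simp
  then show ?thesis
    unfolding mu3_eq[OF a b c e(1,1) d(2) e' open_ball d(1)] by simp
qed

lemma unit_ext_closed: "open U \<Longrightarrow> pf_ext F {} U (pf_unit F c) \<in> carrier (pf_space F U)"
  by (rule ext_closed) (auto intro: unit_closed)

lemma vacuum_costalk: "vacuum_family F \<in> carrier (costalk_weight F 0)"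
proof -
  have 1: "pf_ext F (ball 0 r) (ball 0 R) (pf_ext F {} (ball 0 r) (pf_unit F 1)) = pf_ext F {} (ball 0 R) (pf_unit F 1)"
    if "r < R" for r R :: real
    by (rule ext_ext) (use that unit_closed in auto)
  have 2: "pf_sigma F (q, 0) (ball 0 R) (pf_ext F {} (ball 0 R) (pf_unit F 1)) = pf_ext F {} (ball 0 R) (pf_unit F 1)"
    if "cmod q = 1" for q R
    using sigma_natural[of "(q, 0)" "{}" "ball 0 R" "pf_unit F 1"] sigma_unit[of "(q, 0)" 1] that unit_closed
    by (simp add: rotate_ball)
  show ?thesis
    using 1 2 unit_ext_closed complex_space.scale_one[OF disk_space unit_ext_closed]
    by (auto simp: costalk_weight_def costalk_def disk_weight_def vacuum_family_def)
qed

lemma place_vacuum: "r > 0 \<Longrightarrow> place z r (vacuum_family F) = pf_ext F {} (ball z r) (pf_unit F 1)"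
  using sigma_natural[of "(1, z)" "{}" "ball 0 r" "pf_unit F 1"] sigma_unit[of "(1, z)" 1] unit_closed
  by (simp add: place_def vacuum_family_def)

text \<open>The vacuum is an extension from the empty set, so naturality of the product shrinks its
  disk to the empty set, where the unit axiom applies.\<close>

lemma mu2'_vacuum_left:
  assumes b: "b \<in> carrier (costalk F)" and z: "z \<in> ball 0 R" "w \<in> ball 0 R" "z \<noteq> w"
  shows "mu2' R (vacuum_family F) b z w = mu1 F R b w"
proof -
  obtain s where s: "s > 0" "disjoint_in (ball z s) (ball w s) (ball 0 R)" using mu2_radius[OF z] .
  have sub: "ball w s \<subseteq> ball 0 R" using s by (auto simp: disjoint_in_def)
  note pb = place_closed[OF b s(1)]
  have d0: "disjoint_in {} (ball w s) (ball 0 R)" "disjoint_in {} (ball w s) (ball w s)"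
    using sub by (auto simp: disjoint_in_def)
  have "mu2' R (vacuum_family F) b z w = prod_op F {} (ball w s) (ball 0 R) (pf_unit F 1) (place w s b)"
    unfolding mu2'_eq[OF weight_costalk[OF vacuum_costalk] b s(1,1,2)] place_vacuum[OF s(1)]
    using prod_op_ext[OF open_empty open_ball open_ball open_ball open_ball empty_subsetI subset_refl s(2) unit_closed pb]
      ext_id[OF open_ball pb] by simp
  also have "\<dots> = pf_ext F (ball w s) (ball 0 R) (prod_op F {} (ball w s) (ball w s) (pf_unit F 1) (place w s b))"
    by (rule ext_prod_op[symmetric]) (use d0 sub unit_closed pb in auto)
  also have "prod_op F {} (ball w s) (ball w s) (pf_unit F 1) (place w s b) = place w s b"
    using prod_op_unit[OF open_ball pb] complex_space.scale_one[OF disk_space pb] by simp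
  also have "pf_ext F (ball w s) (ball 0 R) (place w s b) = mu1 F R b w" by (rule mu1_eq[OF b s(1) sub, symmetric])
  finally show ?thesis .
qed

lemma mu2'_vacuum_right:
  assumes a: "a \<in> carrier (costalk F)" and z: "z \<in> ball 0 R" "w \<in> ball 0 R" "z \<noteq> w"
  shows "mu2' R a (vacuum_family F) z w = mu1 F R a z"
  using mu2'_commute[OF a weight_costalk[OF vacuum_costalk] z] mu2'_vacuum_left[OF a z(2,1)] z(3) by simp

lemma mu1_vacuum:
  assumes "z \<in> ball 0 R"
  shows "mu1 F R (vacuum_family F) z = pf_ext F {} (ball 0 R) (pf_unit F 1)"
proof -
  obtain s where s: "s > 0" "ball z s \<subseteq> ball 0 R" using mu1_radius[OF assms] .
  show ?thesis
    unfolding mu1_eq[OF weight_costalk[OF vacuum_costalk] s] place_vacuum[OF s(1)]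
    by (rule ext_ext) (use s unit_closed in auto)
qed

end

section \<open>Analytic properties of the multi-point maps\<close>

locale holomorphic_planar_pfa = planar_pfa +
  assumes hol: "holomorphic_pfa F"
begin

lemma weight_bij: "0 < r \<Longrightarrow> r < R \<Longrightarrow> bij_betw (pf_ext F (ball 0 r) (ball 0 R)) (disk_weight F r \<Delta>) (disk_weight F R \<Delta>)"
  using hol unfolding holomorphic_pfa_def by blast

lemma weight_bounded: "R > 0 \<Longrightarrow> \<exists>N. \<forall>\<Delta><N. disk_weight F R \<Delta> = {\<zero>\<^bsub>disk 0 R\<^esub>}"
  using hol unfolding holomorphic_pfa_def by blast

lemma disk_qc: "R > 0 \<Longrightarrow> quasi_complete (disk 0 R)"
  using hol unfolding holomorphic_pfa_def by blast

lemma disk_hausdorff: "R > 0 \<Longrightarrow> Hausdorff_space (lcs_topology (disk 0 R))"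
  using hol unfolding holomorphic_pfa_def by blast

lemma mu_holomorphic:
  "R > 0 \<Longrightarrow> (\<And>i. i < l \<Longrightarrow> homogeneous F (a i)) \<Longrightarrow>
     lcs_holomorphic_on (disk 0 R) l (conf l (ball 0 R)) (\<lambda>z. mu F l R z a)"
  using hol unfolding holomorphic_pfa_def by blast

lemma homogeneousI: "a \<in> carrier (costalk_weight F \<Delta>) \<Longrightarrow> homogeneous F a"
  by (auto simp: homogeneous_def)

lemma homogeneous_costalk: "homogeneous F a \<Longrightarrow> a \<in> carrier (costalk F)"
  by (auto simp: homogeneous_def weight_costalk)

text \<open>Configurations are extensional functions, while the multi-point maps read their points
  from lists through \<open>(!)\<close>, whose values past the end are unspecified. Restriction
  bridges the two conventions.\<close>

definition pt1 :: "complex \<Rightarrow> nat \<Rightarrow> complex" where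
  "pt1 z = restrict ((!) [z]) {..<1}"

definition pt2 :: "complex \<Rightarrow> complex \<Rightarrow> nat \<Rightarrow> complex" where
  "pt2 z w = restrict ((!) [z, w]) {..<2}"

definition pt3 :: "complex \<Rightarrow> complex \<Rightarrow> complex \<Rightarrow> nat \<Rightarrow> complex" where
  "pt3 z w u = restrict ((!) [z, w, u]) {..<3}"

lemma pt_eq [simp]:
  "pt1 z 0 = z" "pt2 z w 0 = z" "pt2 z w (Suc 0) = w" "pt3 z w u 0 = z" "pt3 z w u (Suc 0) = w" "pt3 z w u 2 = u"
  by (simp_all add: pt1_def pt2_def pt3_def)

lemma pt_extensional:
  "pt1 z \<in> extensional {..<1}" "pt1 z \<in> extensional {..<Suc 0}" "pt2 z w \<in> extensional {..<2}" "pt3 z w u \<in> extensional {..<3}"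
  by (simp_all add: pt1_def pt2_def pt3_def)

lemma conf_1: "f \<in> conf 1 S \<longleftrightarrow> f \<in> extensional {..<1} \<and> f 0 \<in> S"
proof -
  have "{..<1::nat} = {0}" by auto
  then show ?thesis unfolding conf_def PiE_iff by auto
qed

lemma conf_2: "f \<in> conf 2 S \<longleftrightarrow> f \<in> extensional {..<2} \<and> f 0 \<in> S \<and> f 1 \<in> S \<and> f 0 \<noteq> f 1"
proof -
  have *: "{..<2::nat} = {0, 1}" by auto
  show ?thesis unfolding conf_def PiE_iff mem_Collect_eq * inj_on_insert by auto
qed

lemma conf_3: "f \<in> conf 3 S \<longleftrightarrow> f \<in> extensional {..<3} \<and> f 0 \<in> S \<and> f 1 \<in> S \<and> f 2 \<in> S \<and>
    f 0 \<noteq> f 1 \<and> f 0 \<noteq> f 2 \<and> f 1 \<noteq> f 2"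
proof -
  have *: "{..<3::nat} = {0, 1, 2}" by auto
  show ?thesis unfolding conf_def PiE_iff mem_Collect_eq * inj_on_insert by auto
qed

lemma pt1_conf: "pt1 z \<in> conf 1 S \<longleftrightarrow> z \<in> S"
  unfolding conf_1 by (simp add: pt_extensional)

lemma pt2_conf: "pt2 z w \<in> conf 2 S \<longleftrightarrow> z \<in> S \<and> w \<in> S \<and> z \<noteq> w"
  unfolding conf_2 by (simp add: pt_extensional)

lemma pt3_conf: "pt3 z w u \<in> conf 3 S \<longleftrightarrow> z \<in> S \<and> w \<in> S \<and> u \<in> S \<and> z \<noteq> w \<and> z \<noteq> u \<and> w \<noteq> u"
  unfolding conf_3 by (simp add: pt_extensional)

lemma mu_pt:
  "mu F 1 R (pt1 z) ((!) [a]) = mu1 F R a z"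
  "mu F 2 R (pt2 z w) ((!) [a, b]) = mu2' R a b z w"
  "mu F 3 R (pt3 z w u) ((!) [a, b, c]) = mu3 R a b c z w u"
  unfolding mu1_def mu2'_def mu3_def by (rule mu_cong; simp add: pt1_def pt2_def pt3_def)+

lemma mu1_hol: "R > 0 \<Longrightarrow> homogeneous F a \<Longrightarrow>
    lcs_holomorphic_on (disk 0 R) 1 (conf 1 (ball 0 R)) (\<lambda>z. mu F 1 R z ((!) [a]))"
  by (rule mu_holomorphic) auto

lemma mu2_hol: "R > 0 \<Longrightarrow> homogeneous F a \<Longrightarrow> homogeneous F b \<Longrightarrow>
    lcs_holomorphic_on (disk 0 R) 2 (conf 2 (ball 0 R)) (\<lambda>z. mu F 2 R z ((!) [a, b]))"
  by (rule mu_holomorphic) (auto simp: less_2_cases_iff)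

lemma mu3_hol: "R > 0 \<Longrightarrow> homogeneous F a \<Longrightarrow> homogeneous F b \<Longrightarrow> homogeneous F c \<Longrightarrow>
    lcs_holomorphic_on (disk 0 R) 3 (conf 3 (ball 0 R)) (\<lambda>z. mu F 3 R z ((!) [a, b, c]))"
  by (rule mu_holomorphic) (auto simp: less_3_iff)

lemma mu1_dual_derivative:
  assumes R: "R > 0" and a: "homogeneous F a" and \<phi>: "\<phi> \<in> lcs_dual (disk 0 R)" and z: "z \<in> ball 0 R"
  shows "(\<lambda>t. \<phi> (mu1 F R a t)) field_differentiable (at z)"
proof -
  obtain \<xi> where \<xi>: "\<And>\<gamma> v s. \<gamma> s = pt1 z \<Longrightarrow> (\<And>t i. i < 1 \<Longrightarrow> \<gamma> t i = pt1 z i + (t - s) * v i) \<Longrightarrow>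
     (\<And>t. \<gamma> t \<in> extensional {..<1}) \<Longrightarrow>
     ((\<lambda>t. \<phi> (mu F 1 R (\<gamma> t) ((!) [a]))) has_field_derivative (\<Sum>i<1. v i * \<xi> i)) (at s)"
    using locally_convex_space.holomorphic_line_derivative[OF disk_lcs mu1_hol[OF R a] _ \<phi>, of "pt1 z"] z pt1_conf
    by blast
  have "((\<lambda>t. \<phi> (mu F 1 R (pt1 t) ((!) [a]))) has_field_derivative (\<Sum>i<1. (\<lambda>_. 1) i * \<xi> i)) (at z)"
    by (rule \<xi>) (auto simp: pt_extensional)
  then show ?thesis unfolding mu_pt by (auto simp: field_differentiable_def)
qed

lemma mu1_dual_holomorphic:
  assumes "R > 0" "homogeneous F a" "\<phi> \<in> lcs_dual (disk 0 R)"
  shows "(\<lambda>t. \<phi> (mu1 F R a t)) holomorphic_on ball 0 R"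
  using mu1_dual_derivative[OF assms] by (auto simp: holomorphic_on_def intro: field_differentiable_at_within)

text \<open>Both partial derivatives with every direction at once: \<open>(1, 0)\<close> and
  \<open>(0, 1)\<close> isolate them, and \<open>(1, 1)\<close> differentiates along a simultaneous
  translation of both points.\<close>

lemma mu2_dual_derivative:
  assumes R: "R > 0" and a: "homogeneous F a" and b: "homogeneous F b"
    and \<phi>: "\<phi> \<in> lcs_dual (disk 0 R)" and z: "z \<in> ball 0 R" "w \<in> ball 0 R" "z \<noteq> w"
  shows "\<exists>\<xi>0 \<xi>1. \<forall>s v0 v1. ((\<lambda>t. \<phi> (mu2' R a b (z + (t - s) * v0) (w + (t - s) * v1)))
    has_field_derivative (v0 * \<xi>0 + v1 * \<xi>1)) (at s)"
proof -
  obtain \<xi> where \<xi>: "\<And>\<gamma> v s. \<gamma> s = pt2 z w \<Longrightarrow> (\<And>t i. i < 2 \<Longrightarrow> \<gamma> t i = pt2 z w i + (t - s) * v i) \<Longrightarrow>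
     (\<And>t. \<gamma> t \<in> extensional {..<2}) \<Longrightarrow>
     ((\<lambda>t. \<phi> (mu F 2 R (\<gamma> t) ((!) [a, b]))) has_field_derivative (\<Sum>i<2. v i * \<xi> i)) (at s)"
    using locally_convex_space.holomorphic_line_derivative[OF disk_lcs mu2_hol[OF R a b] _ \<phi>, of "pt2 z w"] z pt2_conf
    by blast
  have "((\<lambda>t. \<phi> (mu2' R a b (z + (t - s) * v0) (w + (t - s) * v1)))
    has_field_derivative (v0 * \<xi> 0 + v1 * \<xi> 1)) (at s)" for s v0 v1
  proof -
    have "((\<lambda>t. \<phi> (mu F 2 R (pt2 (z + (t - s) * v0) (w + (t - s) * v1)) ((!) [a, b])))
      has_field_derivative (\<Sum>i<2. [v0, v1] ! i * \<xi> i)) (at s)"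
      by (rule \<xi>) (auto simp: pt_extensional less_2_cases_iff)
    then show ?thesis unfolding mu_pt by (simp add: numeral_2_eq_2)
  qed
  then show ?thesis by blast
qed

lemma mu2_dual_holomorphic:
  assumes "R > 0" "homogeneous F a" "homogeneous F b" "\<phi> \<in> lcs_dual (disk 0 R)" "w \<in> ball 0 R"
  shows "(\<lambda>z. \<phi> (mu2' R a b z w)) holomorphic_on ball 0 R - {w}"
  unfolding holomorphic_on_def
proof
  fix z assume z: "z \<in> ball 0 R - {w}"
  then obtain \<xi>0 \<xi>1 where "\<And>s v0 v1. ((\<lambda>t. \<phi> (mu2' R a b (z + (t - s) * v0) (w + (t - s) * v1)))
    has_field_derivative (v0 * \<xi>0 + v1 * \<xi>1)) (at s)"
    using mu2_dual_derivative[OF assms(1-4) _ assms(5), of z] by blast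
  from this[of z 1 0] have "((\<lambda>t. \<phi> (mu2' R a b t w)) has_field_derivative \<xi>0) (at z)" by simp
  then show "(\<lambda>z. \<phi> (mu2' R a b z w)) field_differentiable at z within ball 0 R - {w}"
    by (auto simp: field_differentiable_def intro: has_field_derivative_at_within)
qed

lemma continuous_on_pt2:
  assumes "continuous_on S f" "continuous_on S g" "i < 2"
  shows "continuous_on S (\<lambda>s. pt2 (f s) (g s) i)"
  using assms by (auto simp: less_2_cases_iff)

lemma continuous_on_pt3:
  assumes "continuous_on S f" "continuous_on S g" "i < 3"
  shows "continuous_on S (\<lambda>s. pt3 (f s) (g s) 0 i)"
  using assms by (auto simp: less_3_iff)

lemma mu2_dual_continuous:
  assumes "R > 0" "homogeneous F a" "homogeneous F b" "\<phi> \<in> lcs_dual (disk 0 R)"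
    and "continuous_on S f" "continuous_on S g" "\<And>s. s \<in> S \<Longrightarrow> f s \<in> ball 0 R \<and> g s \<in> ball 0 R \<and> f s \<noteq> g s"
  shows "continuous_on S (\<lambda>s. \<phi> (mu2' R a b (f s) (g s)))"
  using locally_convex_space.holomorphic_continuous_on_dual[OF disk_lcs mu2_hol[OF assms(1-3)] assms(4),
      of S "\<lambda>s. pt2 (f s) (g s)"] continuous_on_pt2[OF assms(5,6)] assms(7)
  by (simp add: mu_pt pt2_conf)

lemma mu2_seminorm_continuous:
  assumes "R > 0" "homogeneous F a" "homogeneous F b" "cts_seminorm (disk 0 R) p"
    and "continuous_on S f" "continuous_on S g" "\<And>s. s \<in> S \<Longrightarrow> f s \<in> ball 0 R \<and> g s \<in> ball 0 R \<and> f s \<noteq> g s"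
  shows "continuous_on S (\<lambda>s. p (mu2' R a b (f s) (g s)))"
  using locally_convex_space.holomorphic_continuous_on_seminorm[OF disk_lcs mu2_hol[OF assms(1-3)] assms(4),
      of S "\<lambda>s. pt2 (f s) (g s)"] continuous_on_pt2[OF assms(5,6)] assms(7)
  by (simp add: mu_pt pt2_conf)

lemma mu3_dual_continuous:
  assumes "R > 0" "homogeneous F a" "homogeneous F b" "homogeneous F c" "\<phi> \<in> lcs_dual (disk 0 R)"
    and "continuous_on S f" "continuous_on S g"
    and "\<And>s. s \<in> S \<Longrightarrow> f s \<in> ball 0 R - {0} \<and> g s \<in> ball 0 R - {0} \<and> f s \<noteq> g s"
  shows "continuous_on S (\<lambda>s. \<phi> (mu3 R a b c (f s) (g s) 0))"
  using locally_convex_space.holomorphic_continuous_on_dual[OF disk_lcs mu3_hol[OF assms(1-4)] assms(5),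
      of S "\<lambda>s. pt3 (f s) (g s) 0"] continuous_on_pt3[OF assms(6,7)] assms(8) assms(1)
  by (simp add: mu_pt pt3_conf)

lemma mu3_dual_holomorphic:
  assumes R: "R > 0" and a: "homogeneous F a" and b: "homogeneous F b" and c: "homogeneous F c"
    and \<phi>: "\<phi> \<in> lcs_dual (disk 0 R)" and w: "w \<in> ball 0 R - {0}"
  shows "(\<lambda>z. \<phi> (mu3 R a b c z w 0)) holomorphic_on ball 0 R - {0} - {w}"
  unfolding holomorphic_on_def
proof
  fix z assume z: "z \<in> ball 0 R - {0} - {w}"
  have "pt3 z w 0 \<in> conf 3 (ball 0 R)" using z w R by (auto simp: pt3_conf)
  then obtain \<xi> where \<xi>: "\<And>\<gamma> v s. \<gamma> s = pt3 z w 0 \<Longrightarrow> (\<And>t i. i < 3 \<Longrightarrow> \<gamma> t i = pt3 z w 0 i + (t - s) * v i) \<Longrightarrow>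
     (\<And>t. \<gamma> t \<in> extensional {..<3}) \<Longrightarrow>
     ((\<lambda>t. \<phi> (mu F 3 R (\<gamma> t) ((!) [a, b, c]))) has_field_derivative (\<Sum>i<3. v i * \<xi> i)) (at s)"
    using locally_convex_space.holomorphic_line_derivative[OF disk_lcs mu3_hol[OF R a b c] _ \<phi>, of "pt3 z w 0"]
    by blast
  have "((\<lambda>t. \<phi> (mu F 3 R (pt3 t w 0) ((!) [a, b, c]))) has_field_derivative (\<Sum>i<3. [1, 0, 0] ! i * \<xi> i)) (at z)"
    by (rule \<xi>) (auto simp: pt_extensional less_3_iff)
  then show "(\<lambda>z. \<phi> (mu3 R a b c z w 0)) field_differentiable at z within ball 0 R - {0} - {w}"
    unfolding mu_pt by (auto simp: field_differentiable_def intro: has_field_derivative_at_within)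
qed

text \<open>Holomorphy in the space itself and not only after applying functionals. On the slice the
  second coordinate is constantly 0, so the norm and the linear term of the two-variable remainder
  reduce to their one-variable counterparts.\<close>

lemma mu2_holomorphic_slice:
  assumes R: "R > 0" and a: "homogeneous F a" and b: "homogeneous F b"
  shows "lcs_holomorphic_on (disk 0 R) 1 ({..<1} \<rightarrow>\<^sub>E ball 0 R - {0}) (\<lambda>w. mu2 F R a b (w 0))"
proof -
  interpret D: locally_convex_space "disk 0 R" by (rule disk_lcs)
  let ?U = "{..<1::nat} \<rightarrow>\<^sub>E ball (0::complex) R - {0}"
  note h = mu2_hol[OF R a b]
  show ?thesis
    unfolding lcs_holomorphic_on_def
  proof (intro conjI ballI)
    show "openin (cspace 1) ?U"
      by (subst openin_PiE_gen) (auto simp: open_delete)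
    show "(\<lambda>w. mu2 F R a b (w 0)) \<in> ?U \<rightarrow> carrier (disk 0 R)"
    proof
      fix w assume "w \<in> ?U"
      then have "w 0 \<in> ball 0 R - {0}" by (rule PiE_mem) simp
      then show "mu2 F R a b (w 0) \<in> carrier (disk 0 R)"
        unfolding mu2_mu2' using R by (intro mu2'_closed homogeneous_costalk a b) auto
    qed
    fix x assume x: "x \<in> ?U"
    then have x0: "x 0 \<in> ball 0 R - {0}" by (rule PiE_mem) simp
    have xe: "x \<in> extensional {..<1}" using x by (auto simp: PiE_def)
    have "pt2 (x 0) 0 \<in> conf 2 (ball 0 R)" using x0 R by (auto simp: pt2_conf)
    then obtain \<xi> where \<xi>: "\<xi> \<in> {..<2} \<rightarrow> carrier (disk 0 R)" and lim: "limitin (lcs_topology (disk 0 R))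
          (\<lambda>z. complex_of_real (inverse (L2_set (\<lambda>i. cmod (z i - pt2 (x 0) 0 i)) {..<2})) \<odot>\<^bsub>disk 0 R\<^esub>
             ((mu F 2 R z ((!) [a, b]) \<ominus>\<^bsub>disk 0 R\<^esub> mu F 2 R (pt2 (x 0) 0) ((!) [a, b])) \<ominus>\<^bsub>disk 0 R\<^esub>
              (\<Oplus>\<^bsub>disk 0 R\<^esub>i\<in>{..<2}. (z i - pt2 (x 0) 0 i) \<odot>\<^bsub>disk 0 R\<^esub> \<xi> i)))
          \<zero>\<^bsub>disk 0 R\<^esub> (atin (cspace 2) (pt2 (x 0) 0))"
      using h unfolding lcs_holomorphic_on_def by blast
    have two: "{..<2::nat} = {0, 1}" and one: "{..<1::nat} = {0}" by auto
    have \<xi>01: "\<xi> 0 \<in> carrier (disk 0 R)" "\<xi> 1 \<in> carrier (disk 0 R)" using \<xi> by auto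
    \<comment> \<open>The embedding of the slice is continuous and injective, so it maps points near
      but different from \<open>x\<close> to points near but different from the image of
      \<open>x\<close>.\<close>
    have fl: "filterlim (\<lambda>y. pt2 (y 0) 0) (atin (cspace 2) (pt2 (x 0) 0)) (atin (cspace 1) x)"
      unfolding filterlim_iff
    proof (intro allI impI)
      fix P assume P: "eventually P (atin (cspace 2) (pt2 (x 0) 0))"
      have "pt2 (x 0) 0 \<in> topspace (cspace 2)" by (simp add: PiE_def pt_extensional)
      then obtain W where W: "openin (cspace 2) W" "pt2 (x 0) 0 \<in> W" "\<And>y. y \<in> W - {pt2 (x 0) 0} \<Longrightarrow> P y"
        using P by (auto simp: eventually_atin)
      have "continuous_map (cspace 1) (cspace 2) (\<lambda>y. pt2 (y 0) 0)"
        unfolding continuous_map_componentwise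
      proof (intro conjI ballI)
        show "(\<lambda>y. pt2 (y 0) 0) ` topspace (cspace 1) \<subseteq> extensional {..<2}"
          by (rule image_subsetI) (rule pt_extensional)
        fix i :: nat assume "i \<in> {..<2}"
        show "continuous_map (cspace 1) euclidean (\<lambda>y. pt2 (y 0) 0 i)"
        proof (cases "i = 0")
          case True
          have "continuous_map (cspace 1) euclidean (\<lambda>y. y (0::nat) :: complex)"
            by (rule continuous_map_product_projection) simp
          then show ?thesis using True by simp
        next
          case False
          then have "i = Suc 0" using \<open>i \<in> {..<2}\<close> by simp
          then show ?thesis by simp
        qed
      qed
      from openin_continuous_map_preimage[OF this W(1)]
      have o: "openin (cspace 1) {y \<in> topspace (cspace 1). pt2 (y 0) 0 \<in> W}" .
      have "P (pt2 (y 0) 0)" if y: "y \<in> {y \<in> topspace (cspace 1). pt2 (y 0) 0 \<in> W} - {x}" for y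
      proof (rule W(3))
        have ye: "y \<in> extensional {..<1}" using y by (simp add: PiE_iff)
        have "pt2 (y 0) 0 \<noteq> pt2 (x 0) 0"
        proof
          assume "pt2 (y 0) 0 = pt2 (x 0) 0"
          then have "pt2 (y 0) 0 0 = pt2 (x 0) 0 0" by (rule arg_cong)
          then have "y 0 = x 0" by (simp only: pt_eq)
          then have "y = x" by (intro extensionalityI[OF ye xe]) simp
          then show False using y by simp
        qed
        then show "pt2 (y 0) 0 \<in> W - {pt2 (x 0) 0}" using y by auto
      qed
      moreover have "x \<in> {y \<in> topspace (cspace 1). pt2 (y 0) 0 \<in> W}" using W(2) xe by (auto simp: PiE_def)
      ultimately show "\<forall>\<^sub>F y in atin (cspace 1) x. P (pt2 (y 0) 0)" using o by (auto simp: eventually_atin)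
    qed
    have "limitin (lcs_topology (disk 0 R))
          (\<lambda>y. complex_of_real (inverse (L2_set (\<lambda>i. cmod (pt2 (y 0) 0 i - pt2 (x 0) 0 i)) {..<2})) \<odot>\<^bsub>disk 0 R\<^esub>
             ((mu F 2 R (pt2 (y 0) 0) ((!) [a, b]) \<ominus>\<^bsub>disk 0 R\<^esub> mu F 2 R (pt2 (x 0) 0) ((!) [a, b])) \<ominus>\<^bsub>disk 0 R\<^esub>
              (\<Oplus>\<^bsub>disk 0 R\<^esub>i\<in>{..<2}. (pt2 (y 0) 0 i - pt2 (x 0) 0 i) \<odot>\<^bsub>disk 0 R\<^esub> \<xi> i)))
          \<zero>\<^bsub>disk 0 R\<^esub> (atin (cspace 1) x)"
      using lim fl unfolding limitin_def filterlim_iff by blast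
    then have "limitin (lcs_topology (disk 0 R))
          (\<lambda>z. complex_of_real (inverse (L2_set (\<lambda>i. cmod (z i - x i)) {..<1})) \<odot>\<^bsub>disk 0 R\<^esub>
                 ((mu2 F R a b (z 0) \<ominus>\<^bsub>disk 0 R\<^esub> mu2 F R a b (x 0)) \<ominus>\<^bsub>disk 0 R\<^esub>
                  (\<Oplus>\<^bsub>disk 0 R\<^esub>i\<in>{..<1}. (z i - x i) \<odot>\<^bsub>disk 0 R\<^esub> \<xi> i)))
          \<zero>\<^bsub>disk 0 R\<^esub> (atin (cspace 1) x)"
      unfolding two one mu_pt mu2_mu2' using \<xi>01
      by (simp add: D.M.finsum_insert D.M.finsum_singleton L2_set_def)
    then show "\<exists>\<xi>\<in>{..<1} \<rightarrow> carrier (disk 0 R). limitin (lcs_topology (disk 0 R))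
          (\<lambda>z. complex_of_real (inverse (L2_set (\<lambda>i. cmod (z i - x i)) {..<1})) \<odot>\<^bsub>disk 0 R\<^esub>
                 ((mu2 F R a b (z 0) \<ominus>\<^bsub>disk 0 R\<^esub> mu2 F R a b (x 0)) \<ominus>\<^bsub>disk 0 R\<^esub>
                  (\<Oplus>\<^bsub>disk 0 R\<^esub>i\<in>{..<1}. (z i - x i) \<odot>\<^bsub>disk 0 R\<^esub> \<xi> i)))
          \<zero>\<^bsub>disk 0 R\<^esub> (atin (cspace 1) x)"
      using \<xi>01(1) by (intro bexI[of _ \<xi>]) auto
  qed
qed

text \<open>The derivative has to exist as a vector: it is the linear coefficient
  \<open>\<xi> 0\<close> of the holomorphy condition. That condition divides by
  \<open>cmod t\<close> and a derivative by \<open>t\<close>; seminorms do not see the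
  difference.\<close>

lemma mu1_has_derivative:
  assumes R: "R > 0" and a: "homogeneous F a"
  obtains d where "d \<in> carrier (disk 0 R)" "has_lcs_derivative (disk 0 R) (mu1 F R a) 0 d"
proof -
  interpret D: locally_convex_space "disk 0 R" by (rule disk_lcs)
  note ac = homogeneous_costalk[OF a]
  have "pt1 0 \<in> conf 1 (ball 0 R)" using R unfolding pt1_conf by simp
  from D.holomorphic_remainder[OF mu1_hol[OF R a] this] obtain \<xi> where
    \<xi>: "\<xi> 0 \<in> carrier (disk 0 R)" and
    lim: "\<And>p. cts_seminorm (disk 0 R) p \<Longrightarrow> ((\<lambda>z. p ((mu F 1 R z ((!) [a]) \<ominus>\<^bsub>disk 0 R\<^esub> mu F 1 R (pt1 0) ((!) [a])) \<ominus>\<^bsub>disk 0 R\<^esub>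
       (\<Oplus>\<^bsub>disk 0 R\<^esub>i\<in>{..<1}. (z i - pt1 0 i) \<odot>\<^bsub>disk 0 R\<^esub> \<xi> i)) /
       L2_set (\<lambda>i. cmod (z i - pt1 0 i)) {..<1}) \<longlongrightarrow> 0) (atin (cspace 1) (pt1 0))"
    by auto
  have one: "{..<1::nat} = {0}" by auto
  have cont: "continuous_map (top_of_set UNIV) (cspace 1) pt1"
    by (rule continuous_map_cspace) (auto simp: pt_extensional intro!: continuous_intros)
  have ev: "eventually (\<lambda>t. P (pt1 t)) (at 0)" if "eventually P (atin (cspace 1) (pt1 0))" for P
    by (rule eventually_atin_compose[OF cont UNIV_I that]) (metis pt_eq(1))
  have "has_lcs_derivative (disk 0 R) (mu1 F R a) 0 (\<xi> 0)"
    unfolding has_lcs_derivative_def D.limitin_iff_seminorm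
  proof (intro conjI allI impI)
    show "\<xi> 0 \<in> carrier (disk 0 R)" by (rule \<xi>)
    have evb: "\<forall>\<^sub>F w in at 0. w \<in> ball (0::complex) R" using R by (intro eventually_at_in_open') auto
    then show "\<forall>\<^sub>F w in at 0. inverse (w - 0) \<odot>\<^bsub>disk 0 R\<^esub> (mu1 F R a w \<ominus>\<^bsub>disk 0 R\<^esub> mu1 F R a 0) \<in> carrier (disk 0 R)"
      by eventually_elim (use R mu1_closed[OF ac] in auto)
    fix p assume p: "cts_seminorm (disk 0 R) p"
    have "((\<lambda>t. p ((mu F 1 R (pt1 t) ((!) [a]) \<ominus>\<^bsub>disk 0 R\<^esub> mu F 1 R (pt1 0) ((!) [a])) \<ominus>\<^bsub>disk 0 R\<^esub>
       (\<Oplus>\<^bsub>disk 0 R\<^esub>i\<in>{..<1}. (pt1 t i - pt1 0 i) \<odot>\<^bsub>disk 0 R\<^esub> \<xi> i)) /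
       L2_set (\<lambda>i. cmod (pt1 t i - pt1 0 i)) {..<1}) \<longlongrightarrow> 0) (at 0)"
      by (rule tendstoI, rule ev, rule tendstoD[OF lim[OF p]])
    then have "((\<lambda>t. p ((mu1 F R a t \<ominus>\<^bsub>disk 0 R\<^esub> mu1 F R a 0) \<ominus>\<^bsub>disk 0 R\<^esub> t \<odot>\<^bsub>disk 0 R\<^esub> \<xi> 0) / cmod t) \<longlongrightarrow> 0) (at 0)"
      unfolding mu_pt one using \<xi> by (simp add: D.M.finsum_singleton)
    then show "((\<lambda>w. p (inverse (w - 0) \<odot>\<^bsub>disk 0 R\<^esub> (mu1 F R a w \<ominus>\<^bsub>disk 0 R\<^esub> mu1 F R a 0) \<ominus>\<^bsub>disk 0 R\<^esub> \<xi> 0)) \<longlongrightarrow> 0) (at 0)"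
    proof (rule Lim_transform_eventually)
      have "\<forall>\<^sub>F w in at (0::complex). w \<noteq> 0" by (simp add: eventually_at_filter)
      with evb show "\<forall>\<^sub>F t in at 0. p ((mu1 F R a t \<ominus>\<^bsub>disk 0 R\<^esub> mu1 F R a 0) \<ominus>\<^bsub>disk 0 R\<^esub> t \<odot>\<^bsub>disk 0 R\<^esub> \<xi> 0) / cmod t =
          p (inverse (t - 0) \<odot>\<^bsub>disk 0 R\<^esub> (mu1 F R a t \<ominus>\<^bsub>disk 0 R\<^esub> mu1 F R a 0) \<ominus>\<^bsub>disk 0 R\<^esub> \<xi> 0)"
      proof eventually_elim
        case (elim t)
        have cl: "mu1 F R a t \<ominus>\<^bsub>disk 0 R\<^esub> mu1 F R a 0 \<in> carrier (disk 0 R)"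
          using elim R mu1_closed[OF ac] by auto
        have "inverse t \<odot>\<^bsub>disk 0 R\<^esub> (mu1 F R a t \<ominus>\<^bsub>disk 0 R\<^esub> mu1 F R a 0) \<ominus>\<^bsub>disk 0 R\<^esub> \<xi> 0 =
          inverse t \<odot>\<^bsub>disk 0 R\<^esub> ((mu1 F R a t \<ominus>\<^bsub>disk 0 R\<^esub> mu1 F R a 0) \<ominus>\<^bsub>disk 0 R\<^esub> t \<odot>\<^bsub>disk 0 R\<^esub> \<xi> 0)"
          using cl \<xi> elim by (simp add: D.scale_diff D.scale_scale)
        then show ?case using cl \<xi>
          by (simp add: D.seminorm_scale[OF p] norm_inverse divide_inverse mult.commute)
      qed
    qed
  qed
  with \<xi> show ?thesis using that by blast
qed

lemma has_lcs_derivative_dual: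
  assumes E: "locally_convex_space E" and d: "has_lcs_derivative E f z d" and \<phi>: "\<phi> \<in> lcs_dual E"
    and f: "eventually (\<lambda>w. f w \<in> carrier E) (at z)" "f z \<in> carrier E"
  shows "((\<lambda>w. \<phi> (f w)) has_field_derivative \<phi> d) (at z)"
proof -
  interpret locally_convex_space E by fact
  have "((\<lambda>w. \<phi> (inverse (w - z) \<odot>\<^bsub>E\<^esub> (f w \<ominus>\<^bsub>E\<^esub> f z))) \<longlongrightarrow> \<phi> d) (at z)"
    using limitin_dual[OF \<phi>] d unfolding has_lcs_derivative_def by blast
  then have "((\<lambda>w. (\<phi> (f w) - \<phi> (f z)) / (w - z)) \<longlongrightarrow> \<phi> d) (at z)"
    by (rule Lim_transform_eventually)
      (use f(1) in \<open>eventually_elim, simp add: f(2) lcs_dual_scale[OF \<phi>] dual_diff[OF \<phi>] divide_inverse mult.commute\<close>)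
  then show ?thesis by (simp add: has_field_derivative_iff)
qed

lemma has_lcs_derivative_unique:
  assumes "locally_convex_space E" "Hausdorff_space (lcs_topology E)" "has_lcs_derivative E f z d" "has_lcs_derivative E f z d'"
  shows "d = d'"
  using limitin_Hausdorff_unique[OF assms(3,4)[unfolded has_lcs_derivative_def] _ assms(2)] by simp

lemma transl_derivative:
  assumes R: "R > 0" and a: "homogeneous F a"
  shows "\<exists>!d. has_lcs_derivative (disk 0 R) (mu1 F R a) 0 d"
    and "has_lcs_derivative (disk 0 R) (mu1 F R a) 0 (transl_family F a R)"
    and "transl_family F a R \<in> carrier (disk 0 R)"
proof -
  obtain d where d: "d \<in> carrier (disk 0 R)" "has_lcs_derivative (disk 0 R) (mu1 F R a) 0 d"
    by (rule mu1_has_derivative[OF R a])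
  have u: "d' = d" if "has_lcs_derivative (disk 0 R) (mu1 F R a) 0 d'" for d'
    by (rule has_lcs_derivative_unique[OF disk_lcs disk_hausdorff[OF R] that d(2)])
  show "\<exists>!d. has_lcs_derivative (disk 0 R) (mu1 F R a) 0 d" using d u by blast
  have "transl_family F a R = (THE d. has_lcs_derivative (disk 0 R) (mu1 F R a) 0 d)"
    using R by (simp add: transl_family_def lcs_derivative_def)
  also have "\<dots> = d" by (rule the_equality) (fact d(2), rule u)
  finally have "transl_family F a R = d" .
  then show "has_lcs_derivative (disk 0 R) (mu1 F R a) 0 (transl_family F a R)"
    "transl_family F a R \<in> carrier (disk 0 R)" using d by auto
qed

lemma transl_dual:
  assumes R: "R > 0" and a: "homogeneous F a" and \<phi>: "\<phi> \<in> lcs_dual (disk 0 R)"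
  shows "((\<lambda>t. \<phi> (mu1 F R a t)) has_field_derivative \<phi> (transl_family F a R)) (at 0)"
proof (rule has_lcs_derivative_dual[OF disk_lcs transl_derivative(2)[OF R a] \<phi>])
  have "\<forall>\<^sub>F w in at 0. w \<in> ball (0::complex) R" using R by (intro eventually_at_in_open') auto
  then show "\<forall>\<^sub>F w in at 0. mu1 F R a w \<in> carrier (disk 0 R)"
    by eventually_elim (rule mu1_closed[OF homogeneous_costalk[OF a]])
qed (use R mu1_closed[OF homogeneous_costalk[OF a]] in auto)

lemma disk_eqI:
  assumes "R > 0" "x \<in> carrier (disk 0 R)" "y \<in> carrier (disk 0 R)" "\<And>\<phi>. \<phi> \<in> lcs_dual (disk 0 R) \<Longrightarrow> \<phi> x = \<phi> y"
  shows "x = y"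
  using locally_convex_space.dual_eqI[OF disk_lcs disk_hausdorff[OF assms(1)] assms(2-4)] .

lemma mu2_laurent_exists:
  assumes R: "R > 0" and a: "homogeneous F a" and b: "homogeneous F b"
  shows "\<exists>!c. has_lcs_laurent_expansion (disk 0 R) R (mu2 F R a b) c"
proof -
  interpret D: locally_convex_space "disk 0 R" by (rule disk_lcs)
  have "\<exists>c. has_lcs_laurent_expansion (disk 0 R) R (mu2 F R a b) c"
  proof (rule D.laurent_expansion_exists[OF disk_qc[OF R] R, of "mu2 F R a b"])
    show "mu2 F R a b z \<in> carrier (disk 0 R)" if "z \<in> ball 0 R - {0}" for z
      unfolding mu2_mu2' using that R
      by (intro mu2'_closed homogeneous_costalk a b) auto
    show "(\<lambda>z. \<phi> (mu2 F R a b z)) holomorphic_on ball 0 R - {0}" if "\<phi> \<in> lcs_dual (disk 0 R)" for \<phi>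
      unfolding mu2_mu2' using R by (intro mu2_dual_holomorphic that a b) auto
    show "continuous_on (ball 0 R - {0}) (\<lambda>z. p (mu2 F R a b z))" if "cts_seminorm (disk 0 R) p" for p
      unfolding mu2_mu2' using R
      by (intro mu2_seminorm_continuous that a b continuous_on_id continuous_on_const) auto
  qed blast
  then show ?thesis using has_lcs_laurent_unique[OF disk_lcs disk_hausdorff[OF R] _ _ R] by blast
qed

lemma mode_laurent:
  assumes R: "R > 0" and a: "homogeneous F a" and b: "homogeneous F b"
  shows "has_lcs_laurent_expansion (disk 0 R) R (mu2 F R a b) (\<lambda>n. mode_family F a n b R)"
proof -
  have "(\<lambda>n. mode_family F a n b R) = (THE c. has_lcs_laurent_expansion (disk 0 R) R (mu2 F R a b) c)"
    using R by (simp add: mode_family_def lcs_laurent_coeff_def)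
  then show ?thesis using theI'[OF mu2_laurent_exists[OF assms]] by simp
qed

lemma mode_closed:
  assumes "R > 0" "homogeneous F a" "homogeneous F b"
  shows "mode_family F a n b R \<in> carrier (disk 0 R)"
  using mode_laurent[OF assms] by (auto simp: has_lcs_laurent_expansion_def)

lemma mode_has_sum:
  assumes "R > 0" "homogeneous F a" "homogeneous F b" "\<phi> \<in> lcs_dual (disk 0 R)" "z \<in> ball 0 R - {0}"
  shows "((\<lambda>n. z powi (- n - 1) * \<phi> (mode_family F a n b R)) has_sum \<phi> (mu2' R a b z 0)) UNIV"
  using has_lcs_laurent_dual[OF disk_lcs mode_laurent[OF assms(1-3)] assms(4,5)] by (simp add: mu2_mu2')

lemma mode_res_coeff:
  assumes "R > 0" "homogeneous F a" "homogeneous F b" "\<phi> \<in> lcs_dual (disk 0 R)" "0 < r" "r < R"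
  shows "res_coeff r (\<lambda>z. \<phi> (mu2' R a b z 0)) n = \<phi> (mode_family F a n b R)"
  using has_lcs_laurent_res_coeff[OF disk_lcs mode_laurent[OF assms(1-3)] assms(4-6)] by (simp add: mu2_mu2')

lemma mode_eqI:
  assumes "R > 0" "homogeneous F a" "homogeneous F b" "x \<in> carrier (disk 0 R)" "0 < r" "r < R"
    and "\<And>\<phi>. \<phi> \<in> lcs_dual (disk 0 R) \<Longrightarrow> res_coeff r (\<lambda>z. \<phi> (mu2' R a b z 0)) n = \<phi> x"
  shows "mode_family F a n b R = x"
  by (rule disk_eqI[OF assms(1) mode_closed[OF assms(1-3)] assms(4)])
    (use assms(7) mode_res_coeff[OF assms(1-3) _ assms(5,6)] in auto)

end

section \<open>The modes of homogeneous elements\<close>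

context holomorphic_planar_pfa
begin

lemma costalk_space: "complex_space (costalk F)"
proof -
  have D: "complex_space (disk 0 r)" for r by (rule disk_space)
  note cl = complex_space.scale_closed[OF D]
  have add: "pf_ext F (ball 0 r) (ball 0 R) (x \<oplus>\<^bsub>disk 0 r\<^esub> y) =
      pf_ext F (ball 0 r) (ball 0 R) x \<oplus>\<^bsub>disk 0 R\<^esub> pf_ext F (ball 0 r) (ball 0 R) y"
    and scale0: "pf_ext F (ball 0 r) (ball 0 R) (c \<odot>\<^bsub>disk 0 r\<^esub> x) = c \<odot>\<^bsub>disk 0 R\<^esub> pf_ext F (ball 0 r) (ball 0 R) x"
    and zero: "pf_ext F (ball 0 r) (ball 0 R) \<zero>\<^bsub>disk 0 r\<^esub> = \<zero>\<^bsub>disk 0 R\<^esub>"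
    if "r < R" "x \<in> carrier (disk 0 r)" "y \<in> carrier (disk 0 r)" for r R x y c
  proof -
    have h: "pf_ext F (ball 0 r) (ball 0 R) \<in> lcs_hom (disk 0 r) (disk 0 R)"
      using that by (intro ext_ball_hom subset_ball) auto
    interpret E: locally_convex_space "disk 0 r" by (rule disk_lcs)
    show "pf_ext F (ball 0 r) (ball 0 R) (x \<oplus>\<^bsub>disk 0 r\<^esub> y) =
      pf_ext F (ball 0 r) (ball 0 R) x \<oplus>\<^bsub>disk 0 R\<^esub> pf_ext F (ball 0 r) (ball 0 R) y"
      "pf_ext F (ball 0 r) (ball 0 R) (c \<odot>\<^bsub>disk 0 r\<^esub> x) = c \<odot>\<^bsub>disk 0 R\<^esub> pf_ext F (ball 0 r) (ball 0 R) x"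
      "pf_ext F (ball 0 r) (ball 0 R) \<zero>\<^bsub>disk 0 r\<^esub> = \<zero>\<^bsub>disk 0 R\<^esub>"
      using lcs_hom_add[OF h that(2,3)] lcs_hom_scale[OF h that(2)] E.hom_zero[OF D h] by auto
  qed
  have scale: "pf_ext F (ball 0 r) (ball 0 R) (c \<odot>\<^bsub>disk 0 r\<^esub> x) = c \<odot>\<^bsub>disk 0 R\<^esub> pf_ext F (ball 0 r) (ball 0 R) x"
    if "r < R" "x \<in> carrier (disk 0 r)" for r R x c
    by (rule scale0[OF that that(2)])
  have ag: "abelian_group (disk 0 r)" for r
    using D[of r] unfolding complex_space_def Module.module_def by blast
  then have am: "abelian_monoid (disk 0 r)" for r by (simp add: abelian_group_def)
  note ac = abelian_monoid.a_closed[OF am] and zc = abelian_monoid.zero_closed[OF am]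
  note simps = costalk_def PiE_iff ac zc add scale zero cl restrict_def
  show ?thesis
    unfolding complex_space_def
  proof (rule moduleI)
    show "cring complex_ring" by (rule cring_from_type_algebra)
    show "abelian_group (costalk F)"
    proof (rule abelian_groupI)
      fix x assume x: "x \<in> carrier (costalk F)"
      have neg: "(-1) \<odot>\<^bsub>costalk F\<^esub> x \<in> carrier (costalk F)"
        using x by (auto simp: simps extensional_def)
      have "(-1) \<odot>\<^bsub>disk 0 r\<^esub> x r \<oplus>\<^bsub>disk 0 r\<^esub> x r = \<zero>\<^bsub>disk 0 r\<^esub>" if "r > 0" for r
        using complex_space.scale_add_left[OF D costalk_closed[OF x that], of "-1" 1]
          complex_space.scale_one[OF D costalk_closed[OF x that]] complex_space.scale_zero_left[OF D costalk_closed[OF x that]]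
        by simp
      then have "(-1) \<odot>\<^bsub>costalk F\<^esub> x \<oplus>\<^bsub>costalk F\<^esub> x = \<zero>\<^bsub>costalk F\<^esub>"
        by (auto simp: costalk_def restrict_def)
      with neg show "\<exists>y\<in>carrier (costalk F). y \<oplus>\<^bsub>costalk F\<^esub> x = \<zero>\<^bsub>costalk F\<^esub>" by blast
    next
      fix x y assume "x \<in> carrier (costalk F)" "y \<in> carrier (costalk F)"
      then show "x \<oplus>\<^bsub>costalk F\<^esub> y \<in> carrier (costalk F)"
        by (auto simp: simps extensional_def)
      show "x \<oplus>\<^bsub>costalk F\<^esub> y = y \<oplus>\<^bsub>costalk F\<^esub> x"
        using \<open>x \<in> carrier (costalk F)\<close> \<open>y \<in> carrier (costalk F)\<close> abelian_monoid.a_comm[OF am]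
        by (auto simp: costalk_def PiE_iff restrict_def fun_eq_iff)
    next
      fix x y z assume "x \<in> carrier (costalk F)" "y \<in> carrier (costalk F)" "z \<in> carrier (costalk F)"
      then show "x \<oplus>\<^bsub>costalk F\<^esub> y \<oplus>\<^bsub>costalk F\<^esub> z = x \<oplus>\<^bsub>costalk F\<^esub> (y \<oplus>\<^bsub>costalk F\<^esub> z)"
        using abelian_monoid.a_assoc[OF am] by (auto simp: costalk_def PiE_iff restrict_def fun_eq_iff)
    next
      fix x assume "x \<in> carrier (costalk F)"
      then show "\<zero>\<^bsub>costalk F\<^esub> \<oplus>\<^bsub>costalk F\<^esub> x = x"
        using abelian_monoid.l_zero[OF am] by (auto simp: costalk_def PiE_iff restrict_def fun_eq_iff extensional_def)
    qed (auto simp: simps extensional_def intro: zero[OF _ zc zc])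
  qed (auto simp: simps extensional_def fun_eq_iff complex_space.scale_add_left[OF D]
      complex_space.scale_add_right[OF D] complex_space.scale_scale[OF D] complex_space.scale_one[OF D])
qed

lemma costalk_eqI:
  assumes "a \<in> carrier (costalk F)" "b \<in> carrier (costalk F)" "\<And>R. R > 0 \<Longrightarrow> a R = b R"
  shows "a = b"
  using assms by (auto simp: costalk_def intro!: PiE_ext[of a "{0<..}" _ b])

lemma costalk_ops:
  "R > 0 \<Longrightarrow> (a \<oplus>\<^bsub>costalk F\<^esub> b) R = a R \<oplus>\<^bsub>disk 0 R\<^esub> b R"
  "R > 0 \<Longrightarrow> (c \<odot>\<^bsub>costalk F\<^esub> a) R = c \<odot>\<^bsub>disk 0 R\<^esub> a R"
  "R > 0 \<Longrightarrow> \<zero>\<^bsub>costalk F\<^esub> R = \<zero>\<^bsub>disk 0 R\<^esub>"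
  by (simp_all add: costalk_def)

lemma weightI:
  assumes "a \<in> extensional {0<..}" "\<And>R. R > 0 \<Longrightarrow> a R \<in> carrier (disk 0 R)"
    and "\<And>r R. 0 < r \<Longrightarrow> r < R \<Longrightarrow> pf_ext F (ball 0 r) (ball 0 R) (a r) = a R"
    and "\<And>q R. R > 0 \<Longrightarrow> cmod q = 1 \<Longrightarrow> pf_sigma F (q, 0) (ball 0 R) (a R) = (q powi \<Delta>) \<odot>\<^bsub>disk 0 R\<^esub> a R"
  shows "a \<in> carrier (costalk_weight F \<Delta>)"
  using assms by (auto simp: costalk_weight_def costalk_def disk_weight_def PiE_iff)

lemma weight_rotate:
  "a \<in> carrier (costalk_weight F \<Delta>) \<Longrightarrow> R > 0 \<Longrightarrow> cmod q = 1 \<Longrightarrow>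
    pf_sigma F (q, 0) (ball 0 R) (a R) = (q powi \<Delta>) \<odot>\<^bsub>disk 0 R\<^esub> a R"
  by (auto simp: costalk_weight_def disk_weight_def)

lemma rotate_hom0: "cmod q = 1 \<Longrightarrow> pf_sigma F (q, 0) (ball 0 R) \<in> lcs_hom (disk 0 R) (disk 0 R)"
  using sigma_rotate_hom[of q 0 R] by simp

lemma weight_add:
  assumes "a \<in> carrier (costalk_weight F \<Delta>)" "b \<in> carrier (costalk_weight F \<Delta>)"
  shows "a \<oplus>\<^bsub>costalk F\<^esub> b \<in> carrier (costalk_weight F \<Delta>)"
proof -
  interpret C: complex_space "costalk F" by (rule costalk_space)
  have "a \<oplus>\<^bsub>costalk F\<^esub> b \<in> carrier (costalk F)" using assms weight_costalk by blast
  moreover have "pf_sigma F (q, 0) (ball 0 R) ((a \<oplus>\<^bsub>costalk F\<^esub> b) R) = (q powi \<Delta>) \<odot>\<^bsub>disk 0 R\<^esub> (a \<oplus>\<^bsub>costalk F\<^esub> b) R"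
    if R: "R > 0" and q: "cmod q = 1" for q R
  proof -
    have cl: "a R \<in> carrier (disk 0 R)" "b R \<in> carrier (disk 0 R)"
      using assms R weight_costalk costalk_closed by blast+
    show ?thesis
      using lcs_hom_add[OF rotate_hom0[OF q] cl] weight_rotate[OF assms(1) R q] weight_rotate[OF assms(2) R q]
      by (simp add: costalk_ops[OF R] complex_space.scale_add_right[OF disk_space cl])
  qed
  ultimately show ?thesis by (auto simp: costalk_weight_def disk_weight_def costalk_closed)
qed

lemma weight_scale:
  assumes "a \<in> carrier (costalk_weight F \<Delta>)"
  shows "c \<odot>\<^bsub>costalk F\<^esub> a \<in> carrier (costalk_weight F \<Delta>)"
proof -
  interpret C: complex_space "costalk F" by (rule costalk_space)
  have "c \<odot>\<^bsub>costalk F\<^esub> a \<in> carrier (costalk F)" using assms weight_costalk by blast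
  moreover have "pf_sigma F (q, 0) (ball 0 R) ((c \<odot>\<^bsub>costalk F\<^esub> a) R) = (q powi \<Delta>) \<odot>\<^bsub>disk 0 R\<^esub> (c \<odot>\<^bsub>costalk F\<^esub> a) R"
    if R: "R > 0" and q: "cmod q = 1" for q R
  proof -
    have cl: "a R \<in> carrier (disk 0 R)" using assms R weight_costalk costalk_closed by blast
    show ?thesis
      using lcs_hom_scale[OF rotate_hom0[OF q] cl] weight_rotate[OF assms(1) R q]
      by (simp add: costalk_ops[OF R] complex_space.scale_scale[OF disk_space cl] mult.commute)
  qed
  ultimately show ?thesis by (auto simp: costalk_weight_def disk_weight_def costalk_closed)
qed

lemma weight_zero: "\<zero>\<^bsub>costalk F\<^esub> \<in> carrier (costalk_weight F \<Delta>)"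
proof -
  interpret C: complex_space "costalk F" by (rule costalk_space)
  have "0 \<odot>\<^bsub>costalk F\<^esub> \<zero>\<^bsub>costalk F\<^esub> = \<zero>\<^bsub>costalk F\<^esub>" by simp
  moreover have "pf_sigma F (q, 0) (ball 0 R) \<zero>\<^bsub>disk 0 R\<^esub> = \<zero>\<^bsub>disk 0 R\<^esub>" if "cmod q = 1" for q R
  proof -
    interpret D: locally_convex_space "disk 0 R" by (rule disk_lcs)
    show ?thesis by (rule D.hom_zero[OF disk_space rotate_hom0[OF that]])
  qed
  ultimately show ?thesis
    using C.M.zero_closed complex_space.scale_zero_right[OF disk_space] costalk_closed[OF C.M.zero_closed]
    by (auto simp: costalk_weight_def disk_weight_def costalk_ops)
qed

text \<open>A rotation by \<open>q\<close> sends the insertion at \<open>t\<close> to one at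
  \<open>q t\<close> with the factor \<open>q powi \<Delta>\<close>, and the chain rule at
  \<open>t = 0\<close> contributes one more \<open>q\<close>.\<close>

lemma transl_weight:
  assumes a: "a \<in> carrier (costalk_weight F \<Delta>)"
  shows "transl_family F a \<in> carrier (costalk_weight F (\<Delta> + 1))"
proof (rule weightI)
  note ha = homogeneousI[OF a] and ac = weight_costalk[OF a]
  show "transl_family F a \<in> extensional {0<..}" by (simp add: transl_family_def)
  show "transl_family F a R \<in> carrier (disk 0 R)" if "R > 0" for R by (rule transl_derivative(3)[OF that ha])
  fix R :: real
  {
    fix r assume r: "0 < r" "r < R"
    have h: "pf_ext F (ball 0 r) (ball 0 R) \<in> lcs_hom (disk 0 r) (disk 0 R)"
      using r by (intro ext_ball_hom subset_ball) auto
    show "pf_ext F (ball 0 r) (ball 0 R) (transl_family F a r) = transl_family F a R"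
    proof (rule disk_eqI)
      show "R > 0" using r by simp
      show "transl_family F a R \<in> carrier (disk 0 R)" "pf_ext F (ball 0 r) (ball 0 R) (transl_family F a r) \<in> carrier (disk 0 R)"
        using r transl_derivative(3)[OF _ ha] lcs_hom_closed[OF h] by auto
      fix \<phi> assume \<phi>: "\<phi> \<in> lcs_dual (disk 0 R)"
      have "((\<lambda>t. \<phi> (mu1 F R a t)) has_field_derivative \<phi> (transl_family F a R)) (at 0)"
        using r by (intro transl_dual ha \<phi>) auto
      moreover have "((\<lambda>t. \<phi> (pf_ext F (ball 0 r) (ball 0 R) (mu1 F r a t))) has_field_derivative
          \<phi> (pf_ext F (ball 0 r) (ball 0 R) (transl_family F a r))) (at 0)"
        by (rule transl_dual[OF r(1) ha lcs_hom_compose[OF h \<phi>]])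
      then have "((\<lambda>t. \<phi> (mu1 F R a t)) has_field_derivative \<phi> (pf_ext F (ball 0 r) (ball 0 R) (transl_family F a r))) (at 0)"
        by (rule has_field_derivative_transform_within_open[of _ _ _ "ball 0 r"]) (use r mu1_ext[OF ac] in auto)
      ultimately show "\<phi> (pf_ext F (ball 0 r) (ball 0 R) (transl_family F a r)) = \<phi> (transl_family F a R)"
        by (rule DERIV_unique[symmetric])
    qed
  next
    fix q assume R: "R > 0" and q: "cmod q = 1"
    have q0: "q \<noteq> 0" using q by auto
    note h = rotate_hom0[OF q, of R]
    show "pf_sigma F (q, 0) (ball 0 R) (transl_family F a R) = (q powi (\<Delta> + 1)) \<odot>\<^bsub>disk 0 R\<^esub> transl_family F a R"
    proof (rule disk_eqI[OF R])
      show "pf_sigma F (q, 0) (ball 0 R) (transl_family F a R) \<in> carrier (disk 0 R)"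
        "(q powi (\<Delta> + 1)) \<odot>\<^bsub>disk 0 R\<^esub> transl_family F a R \<in> carrier (disk 0 R)"
        using transl_derivative(3)[OF R ha] lcs_hom_closed[OF h] complex_space.scale_closed[OF disk_space] by auto
      fix \<phi> assume \<phi>: "\<phi> \<in> lcs_dual (disk 0 R)"
      have 1: "((\<lambda>t. \<phi> (pf_sigma F (q, 0) (ball 0 R) (mu1 F R a t))) has_field_derivative
          \<phi> (pf_sigma F (q, 0) (ball 0 R) (transl_family F a R))) (at 0)"
        by (rule transl_dual[OF R ha lcs_hom_compose[OF h \<phi>]])
      have "((\<lambda>t. \<phi> (mu1 F R a t)) has_field_derivative \<phi> (transl_family F a R)) (at (q * 0))"
        using transl_dual[OF R ha \<phi>] by simp
      then have "((\<lambda>t. \<phi> (mu1 F R a (q * t))) has_field_derivative \<phi> (transl_family F a R) * q) (at 0)"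
        by (rule DERIV_chain2) (auto intro!: derivative_eq_intros)
      then have "((\<lambda>t. q powi \<Delta> * \<phi> (mu1 F R a (q * t))) has_field_derivative q powi \<Delta> * (\<phi> (transl_family F a R) * q)) (at 0)"
        by (rule DERIV_cmult)
      then have 2: "((\<lambda>t. \<phi> (pf_sigma F (q, 0) (ball 0 R) (mu1 F R a t))) has_field_derivative
          q powi \<Delta> * (\<phi> (transl_family F a R) * q)) (at 0)"
      proof (rule has_field_derivative_transform_within_open[of _ _ _ "ball 0 R"])
        fix t assume t: "t \<in> ball (0::complex) R"
        then have "mu1 F R a (q * t) \<in> carrier (disk 0 R)" using q by (intro mu1_closed ac) (auto simp: norm_mult)
        then show "q powi \<Delta> * \<phi> (mu1 F R a (q * t)) = \<phi> (pf_sigma F (q, 0) (ball 0 R) (mu1 F R a t))"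
          using mu1_rotate[OF a t q] by (simp add: lcs_dual_scale[OF \<phi>])
      qed (use R in auto)
      show "\<phi> (pf_sigma F (q, 0) (ball 0 R) (transl_family F a R)) = \<phi> ((q powi (\<Delta> + 1)) \<odot>\<^bsub>disk 0 R\<^esub> transl_family F a R)"
        using DERIV_unique[OF 1 2] transl_derivative(3)[OF R ha] q0
        by (simp add: lcs_dual_scale[OF \<phi>] power_int_add mult_ac)
    qed
  }
qed

text \<open>Rotating the two-point function replaces \<open>z\<close> by \<open>q z\<close> in its
  Laurent series, which multiplies the coefficient of index \<open>n\<close> by
  \<open>q powi (- n - 1)\<close> on top of the factor from the two weights.\<close>

lemma mode_weight:
  assumes a: "a \<in> carrier (costalk_weight F \<Delta>)" and b: "b \<in> carrier (costalk_weight F \<Delta>')"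
  shows "mode_family F a n b \<in> carrier (costalk_weight F (\<Delta> + \<Delta>' - n - 1))"
proof (rule weightI)
  note ha = homogeneousI[OF a] and hb = homogeneousI[OF b] and ac = weight_costalk[OF a] and bc = weight_costalk[OF b]
  show "mode_family F a n b \<in> extensional {0<..}" by (simp add: mode_family_def)
  show "mode_family F a n b R \<in> carrier (disk 0 R)" if "R > 0" for R by (rule mode_closed[OF that ha hb])
  fix R :: real
  {
    fix r assume r: "0 < r" "r < R"
    have R: "R > 0" using r by simp
    have h: "pf_ext F (ball 0 r) (ball 0 R) \<in> lcs_hom (disk 0 r) (disk 0 R)"
      using r by (intro ext_ball_hom subset_ball) auto
    have "mode_family F a n b R = pf_ext F (ball 0 r) (ball 0 R) (mode_family F a n b r)"
    proof (rule mode_eqI[OF R ha hb, of _ "r / 2"])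
      show "pf_ext F (ball 0 r) (ball 0 R) (mode_family F a n b r) \<in> carrier (disk 0 R)"
        by (rule lcs_hom_closed[OF h mode_closed[OF r(1) ha hb]])
      show "0 < r / 2" "r / 2 < R" using r by auto
      fix \<phi> assume \<phi>: "\<phi> \<in> lcs_dual (disk 0 R)"
      have "res_coeff (r / 2) (\<lambda>z. \<phi> (mu2' R a b z 0)) n =
          res_coeff (r / 2) (\<lambda>z. \<phi> (pf_ext F (ball 0 r) (ball 0 R) (mu2' r a b z 0))) n"
        by (rule res_coeff_cong) (use r mu2'_ext[OF ac bc] in auto)
      also have "\<dots> = \<phi> (pf_ext F (ball 0 r) (ball 0 R) (mode_family F a n b r))"
        by (rule mode_res_coeff[OF r(1) ha hb lcs_hom_compose[OF h \<phi>]]) (use r in auto)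
      finally show "res_coeff (r / 2) (\<lambda>z. \<phi> (mu2' R a b z 0)) n =
          \<phi> (pf_ext F (ball 0 r) (ball 0 R) (mode_family F a n b r))" .
    qed
    then show "pf_ext F (ball 0 r) (ball 0 R) (mode_family F a n b r) = mode_family F a n b R" by simp
  next
    fix q assume R: "R > 0" and q: "cmod q = 1"
    have q0: "q \<noteq> 0" using q by auto
    note h = rotate_hom0[OF q, of R]
    show "pf_sigma F (q, 0) (ball 0 R) (mode_family F a n b R) = (q powi (\<Delta> + \<Delta>' - n - 1)) \<odot>\<^bsub>disk 0 R\<^esub> mode_family F a n b R"
    proof (rule disk_eqI[OF R])
      show "pf_sigma F (q, 0) (ball 0 R) (mode_family F a n b R) \<in> carrier (disk 0 R)"
        "(q powi (\<Delta> + \<Delta>' - n - 1)) \<odot>\<^bsub>disk 0 R\<^esub> mode_family F a n b R \<in> carrier (disk 0 R)"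
        using mode_closed[OF R ha hb] lcs_hom_closed[OF h] complex_space.scale_closed[OF disk_space] by auto
      fix \<phi> assume \<phi>: "\<phi> \<in> lcs_dual (disk 0 R)"
      have "\<phi> (pf_sigma F (q, 0) (ball 0 R) (mode_family F a n b R)) =
         res_coeff (R / 2) (\<lambda>z. \<phi> (pf_sigma F (q, 0) (ball 0 R) (mu2' R a b z 0))) n"
        by (rule mode_res_coeff[OF R ha hb lcs_hom_compose[OF h \<phi>], symmetric]) (use R in auto)
      also have "\<dots> = q powi (\<Delta> + \<Delta>') * (q powi (- n - 1) * \<phi> (mode_family F a n b R))"
      proof (rule res_coeff_has_sum)
        fix z assume z: "cmod z = R / 2"
        have qz: "q * z \<in> ball 0 R - {0}" using z q R q0 by (auto simp: norm_mult)
        have "((\<lambda>n. q powi (\<Delta> + \<Delta>') * ((q * z) powi (- n - 1) * \<phi> (mode_family F a n b R))) has_sum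
          q powi (\<Delta> + \<Delta>') * \<phi> (mu2' R a b (q * z) 0)) UNIV"
          by (intro has_sum_cmult_right mode_has_sum R ha hb \<phi> qz)
        moreover have "q powi (\<Delta> + \<Delta>') * \<phi> (mu2' R a b (q * z) 0) = \<phi> (pf_sigma F (q, 0) (ball 0 R) (mu2' R a b z 0))"
        proof -
          have "mu2' R a b (q * z) 0 \<in> carrier (disk 0 R)" using qz R by (intro mu2'_closed ac bc) auto
          moreover have "z \<in> ball 0 R" "0 \<in> ball (0::complex) R" "z \<noteq> 0" using z R by auto
          ultimately show ?thesis using mu2'_rotate[OF a b _ _ _ q, of z R 0] by (simp add: lcs_dual_scale[OF \<phi>])
        qed
        ultimately show "((\<lambda>n. z powi (- n - 1) * (q powi (\<Delta> + \<Delta>') * (q powi (- n - 1) * \<phi> (mode_family F a n b R)))) has_sum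
          \<phi> (pf_sigma F (q, 0) (ball 0 R) (mu2' R a b z 0))) UNIV"
          by (simp add: power_int_mult_distrib mult_ac)
      qed (use R in auto)
      also have "\<dots> = \<phi> ((q powi (\<Delta> + \<Delta>' - n - 1)) \<odot>\<^bsub>disk 0 R\<^esub> mode_family F a n b R)"
      proof -
        have eq: "\<Delta> + \<Delta>' - n - 1 = (\<Delta> + \<Delta>') + (- n - 1)" by simp
        show ?thesis using mode_closed[OF R ha hb] unfolding eq power_int_add[OF disjI1[OF q0]]
          by (simp add: lcs_dual_scale[OF \<phi>] mult_ac)
      qed
      finally show "\<phi> (pf_sigma F (q, 0) (ball 0 R) (mode_family F a n b R)) =
          \<phi> ((q powi (\<Delta> + \<Delta>' - n - 1)) \<odot>\<^bsub>disk 0 R\<^esub> mode_family F a n b R)" .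
    qed
  }
qed

lemma mode_costalk_eqI:
  assumes a: "a \<in> carrier (costalk_weight F \<Delta>)" and b: "b \<in> carrier (costalk_weight F \<Delta>')"
    and x: "x \<in> carrier (costalk F)"
    and "\<And>R \<phi>. R > 0 \<Longrightarrow> \<phi> \<in> lcs_dual (disk 0 R) \<Longrightarrow> res_coeff (R / 2) (\<lambda>z. \<phi> (mu2' R a b z 0)) n = \<phi> (x R)"
  shows "mode_family F a n b = x"
  by (rule costalk_eqI[OF weight_costalk[OF mode_weight[OF a b]] x],
      rule mode_eqI[OF _ homogeneousI[OF a] homogeneousI[OF b], where r = "R / 2" for R])
    (use assms costalk_closed in auto)

lemma mu2_sphere_continuous:
  assumes "R > 0" "homogeneous F a" "homogeneous F b" "\<phi> \<in> lcs_dual (disk 0 R)" "0 < r" "r < R"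
  shows "continuous_on (sphere 0 r) (\<lambda>z. \<phi> (mu2' R a b z 0))"
  using assms by (intro mu2_dual_continuous continuous_on_id continuous_on_const) auto

lemma mode_add_left:
  assumes a: "a \<in> carrier (costalk_weight F \<Delta>)" "a' \<in> carrier (costalk_weight F \<Delta>)"
    and b: "b \<in> carrier (costalk_weight F \<Delta>')"
  shows "mode_family F (a \<oplus>\<^bsub>costalk F\<^esub> a') n b = mode_family F a n b \<oplus>\<^bsub>costalk F\<^esub> mode_family F a' n b"
proof (rule mode_costalk_eqI[OF weight_add[OF a] b])
  interpret C: complex_space "costalk F" by (rule costalk_space)
  note cl = weight_costalk[OF mode_weight[OF a(1) b]] weight_costalk[OF mode_weight[OF a(2) b]]
  show "mode_family F a n b \<oplus>\<^bsub>costalk F\<^esub> mode_family F a' n b \<in> carrier (costalk F)" using cl by simp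
  fix R \<phi> assume R: "R > 0" and \<phi>: "\<phi> \<in> lcs_dual (disk 0 R)"
  note h = homogeneousI[OF a(1)] homogeneousI[OF a(2)] homogeneousI[OF b]
  have "res_coeff (R / 2) (\<lambda>z. \<phi> (mu2' R (a \<oplus>\<^bsub>costalk F\<^esub> a') b z 0)) n =
     res_coeff (R / 2) (\<lambda>z. \<phi> (mu2' R a b z 0) + \<phi> (mu2' R a' b z 0)) n"
  proof (rule res_coeff_cong)
    fix z assume "cmod z = R / 2"
    then have z: "z \<in> ball 0 R" "0 \<in> ball (0::complex) R" "z \<noteq> 0" using R by auto
    note w = weight_costalk[OF a(1)] weight_costalk[OF a(2)] weight_costalk[OF b]
    show "\<phi> (mu2' R (a \<oplus>\<^bsub>costalk F\<^esub> a') b z 0) = \<phi> (mu2' R a b z 0) + \<phi> (mu2' R a' b z 0)"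
      using mu2'_add_left[OF w C.M.a_closed[OF w(1,2)] z] mu2'_closed[OF w(1,3) z] mu2'_closed[OF w(2,3) z]
      by (simp add: lcs_dual_add[OF \<phi>])
  qed (use R in simp)
  also have "\<dots> = \<phi> (mode_family F a n b R) + \<phi> (mode_family F a' n b R)"
    using R h \<phi> by (subst res_coeff_add) (auto intro!: mu2_sphere_continuous simp: mode_res_coeff)
  finally show "res_coeff (R / 2) (\<lambda>z. \<phi> (mu2' R (a \<oplus>\<^bsub>costalk F\<^esub> a') b z 0)) n =
      \<phi> ((mode_family F a n b \<oplus>\<^bsub>costalk F\<^esub> mode_family F a' n b) R)"
    using costalk_closed[OF cl(1) R] costalk_closed[OF cl(2) R] by (simp add: costalk_ops R lcs_dual_add[OF \<phi>])
qed

lemma mode_scale_left: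
  assumes a: "a \<in> carrier (costalk_weight F \<Delta>)" and b: "b \<in> carrier (costalk_weight F \<Delta>')"
  shows "mode_family F (c \<odot>\<^bsub>costalk F\<^esub> a) n b = c \<odot>\<^bsub>costalk F\<^esub> mode_family F a n b"
proof (rule mode_costalk_eqI[OF weight_scale[OF a] b])
  interpret C: complex_space "costalk F" by (rule costalk_space)
  note cl = weight_costalk[OF mode_weight[OF a b]]
  show "c \<odot>\<^bsub>costalk F\<^esub> mode_family F a n b \<in> carrier (costalk F)" using cl by simp
  fix R \<phi> assume R: "R > 0" and \<phi>: "\<phi> \<in> lcs_dual (disk 0 R)"
  note h = homogeneousI[OF a] homogeneousI[OF b]
  have "res_coeff (R / 2) (\<lambda>z. \<phi> (mu2' R (c \<odot>\<^bsub>costalk F\<^esub> a) b z 0)) n =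
     res_coeff (R / 2) (\<lambda>z. c * \<phi> (mu2' R a b z 0)) n"
  proof (rule res_coeff_cong)
    fix z assume "cmod z = R / 2"
    then have z: "z \<in> ball 0 R" "0 \<in> ball (0::complex) R" "z \<noteq> 0" using R by auto
    note w = weight_costalk[OF a] weight_costalk[OF b]
    show "\<phi> (mu2' R (c \<odot>\<^bsub>costalk F\<^esub> a) b z 0) = c * \<phi> (mu2' R a b z 0)"
      using mu2'_scale_left[OF w C.scale_closed[OF w(1)] z] mu2'_closed[OF w z] by (simp add: lcs_dual_scale[OF \<phi>])
  qed (use R in simp)
  also have "\<dots> = c * \<phi> (mode_family F a n b R)"
    using R h \<phi> by (subst res_coeff_cmult) (auto intro!: mu2_sphere_continuous simp: mode_res_coeff)
  finally show "res_coeff (R / 2) (\<lambda>z. \<phi> (mu2' R (c \<odot>\<^bsub>costalk F\<^esub> a) b z 0)) n =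
      \<phi> ((c \<odot>\<^bsub>costalk F\<^esub> mode_family F a n b) R)"
    using costalk_closed[OF cl(1) R] by (simp add: costalk_ops R lcs_dual_scale[OF \<phi>])
qed

text \<open>Exchanging the two insertions by \<open>mu2'_commute\<close> reduces linearity in the
  second argument to linearity in the first.\<close>

lemma mode_add_right:
  assumes a: "a \<in> carrier (costalk_weight F \<Delta>)"
    and b: "b \<in> carrier (costalk_weight F \<Delta>')" "b' \<in> carrier (costalk_weight F \<Delta>')"
  shows "mode_family F a n (b \<oplus>\<^bsub>costalk F\<^esub> b') = mode_family F a n b \<oplus>\<^bsub>costalk F\<^esub> mode_family F a n b'"
proof (rule mode_costalk_eqI[OF a weight_add[OF b]])
  interpret C: complex_space "costalk F" by (rule costalk_space)
  note cl = weight_costalk[OF mode_weight[OF a b(1)]] weight_costalk[OF mode_weight[OF a b(2)]]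
  show "mode_family F a n b \<oplus>\<^bsub>costalk F\<^esub> mode_family F a n b' \<in> carrier (costalk F)" using cl by simp
  fix R \<phi> assume R: "R > 0" and \<phi>: "\<phi> \<in> lcs_dual (disk 0 R)"
  note h = homogeneousI[OF a] homogeneousI[OF b(1)] homogeneousI[OF b(2)]
  have "res_coeff (R / 2) (\<lambda>z. \<phi> (mu2' R a (b \<oplus>\<^bsub>costalk F\<^esub> b') z 0)) n =
     res_coeff (R / 2) (\<lambda>z. \<phi> (mu2' R a b z 0) + \<phi> (mu2' R a b' z 0)) n"
  proof (rule res_coeff_cong)
    fix z assume "cmod z = R / 2"
    then have z: "z \<in> ball 0 R" "0 \<in> ball (0::complex) R" "z \<noteq> 0" "0 \<noteq> z" using R by auto
    note w = weight_costalk[OF b(1)] weight_costalk[OF b(2)] weight_costalk[OF a]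
    note w' = C.M.a_closed[OF w(1,2)]
    have "mu2' R a (b \<oplus>\<^bsub>costalk F\<^esub> b') z 0 = mu2' R a b z 0 \<oplus>\<^bsub>disk 0 R\<^esub> mu2' R a b' z 0"
      using mu2'_add_left[OF w w' z(2,1,4)] mu2'_commute[OF w' w(3) z(2,1,4)]
        mu2'_commute[OF w(1,3) z(2,1,4)] mu2'_commute[OF w(2,3) z(2,1,4)] by simp
    then show "\<phi> (mu2' R a (b \<oplus>\<^bsub>costalk F\<^esub> b') z 0) = \<phi> (mu2' R a b z 0) + \<phi> (mu2' R a b' z 0)"
      using mu2'_closed[OF w(3,1) z(1-3)] mu2'_closed[OF w(3,2) z(1-3)] by (simp add: lcs_dual_add[OF \<phi>])
  qed (use R in simp)
  also have "\<dots> = \<phi> (mode_family F a n b R) + \<phi> (mode_family F a n b' R)"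
    using R h \<phi> by (subst res_coeff_add) (auto intro!: mu2_sphere_continuous simp: mode_res_coeff)
  finally show "res_coeff (R / 2) (\<lambda>z. \<phi> (mu2' R a (b \<oplus>\<^bsub>costalk F\<^esub> b') z 0)) n =
      \<phi> ((mode_family F a n b \<oplus>\<^bsub>costalk F\<^esub> mode_family F a n b') R)"
    using costalk_closed[OF cl(1) R] costalk_closed[OF cl(2) R] by (simp add: costalk_ops R lcs_dual_add[OF \<phi>])
qed

lemma mode_scale_right:
  assumes a: "a \<in> carrier (costalk_weight F \<Delta>)" and b: "b \<in> carrier (costalk_weight F \<Delta>')"
  shows "mode_family F a n (c \<odot>\<^bsub>costalk F\<^esub> b) = c \<odot>\<^bsub>costalk F\<^esub> mode_family F a n b"
proof (rule mode_costalk_eqI[OF a weight_scale[OF b]])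
  interpret C: complex_space "costalk F" by (rule costalk_space)
  note cl = weight_costalk[OF mode_weight[OF a b]]
  show "c \<odot>\<^bsub>costalk F\<^esub> mode_family F a n b \<in> carrier (costalk F)" using cl by simp
  fix R \<phi> assume R: "R > 0" and \<phi>: "\<phi> \<in> lcs_dual (disk 0 R)"
  note h = homogeneousI[OF a] homogeneousI[OF b]
  have "res_coeff (R / 2) (\<lambda>z. \<phi> (mu2' R a (c \<odot>\<^bsub>costalk F\<^esub> b) z 0)) n =
     res_coeff (R / 2) (\<lambda>z. c * \<phi> (mu2' R a b z 0)) n"
  proof (rule res_coeff_cong)
    fix z assume "cmod z = R / 2"
    then have z: "z \<in> ball 0 R" "0 \<in> ball (0::complex) R" "z \<noteq> 0" "0 \<noteq> z" using R by auto
    note w = weight_costalk[OF b] weight_costalk[OF a]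
    note w' = C.scale_closed[OF w(1)]
    have "mu2' R a (c \<odot>\<^bsub>costalk F\<^esub> b) z 0 = c \<odot>\<^bsub>disk 0 R\<^esub> mu2' R a b z 0"
      using mu2'_scale_left[OF w w' z(2,1,4)] mu2'_commute[OF w' w(2) z(2,1,4)] mu2'_commute[OF w z(2,1,4)] by simp
    then show "\<phi> (mu2' R a (c \<odot>\<^bsub>costalk F\<^esub> b) z 0) = c * \<phi> (mu2' R a b z 0)"
      using mu2'_closed[OF w(2,1) z(1-3)] by (simp add: lcs_dual_scale[OF \<phi>])
  qed (use R in simp)
  also have "\<dots> = c * \<phi> (mode_family F a n b R)"
    using R h \<phi> by (subst res_coeff_cmult) (auto intro!: mu2_sphere_continuous simp: mode_res_coeff)
  finally show "res_coeff (R / 2) (\<lambda>z. \<phi> (mu2' R a (c \<odot>\<^bsub>costalk F\<^esub> b) z 0)) n =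
      \<phi> ((c \<odot>\<^bsub>costalk F\<^esub> mode_family F a n b) R)"
    using costalk_closed[OF cl(1) R] by (simp add: costalk_ops R lcs_dual_scale[OF \<phi>])
qed

lemma transl_add:
  assumes a: "a \<in> carrier (costalk_weight F \<Delta>)" "a' \<in> carrier (costalk_weight F \<Delta>)"
  shows "transl_family F (a \<oplus>\<^bsub>costalk F\<^esub> a') = transl_family F a \<oplus>\<^bsub>costalk F\<^esub> transl_family F a'"
proof (rule costalk_eqI)
  interpret C: complex_space "costalk F" by (rule costalk_space)
  note t = weight_costalk[OF transl_weight[OF a(1)]] weight_costalk[OF transl_weight[OF a(2)]]
  show "transl_family F (a \<oplus>\<^bsub>costalk F\<^esub> a') \<in> carrier (costalk F)"
    by (rule weight_costalk[OF transl_weight[OF weight_add[OF a]]])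
  show s: "transl_family F a \<oplus>\<^bsub>costalk F\<^esub> transl_family F a' \<in> carrier (costalk F)" using t by simp
  fix R :: real assume R: "R > 0"
  note w = weight_costalk[OF a(1)] weight_costalk[OF a(2)]
  note w' = C.M.a_closed[OF w]
  have eq: "mu1 F R (a \<oplus>\<^bsub>costalk F\<^esub> a') z = mu1 F R a z \<oplus>\<^bsub>disk 0 R\<^esub> mu1 F R a' z" if z: "z \<in> ball 0 R" for z
  proof -
    obtain e where e: "e > 0" "ball z e \<subseteq> ball 0 R" using mu1_radius[OF z] .
    show ?thesis
      unfolding mu1_eq[OF w' e] mu1_eq[OF w(1) e] mu1_eq[OF w(2) e] place_add[OF w e(1)]
      by (rule lcs_hom_add[OF ext_ball_hom[OF e(2)]]) (rule place_closed[OF w(1) e(1)] place_closed[OF w(2) e(1)])+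
  qed
  show "transl_family F (a \<oplus>\<^bsub>costalk F\<^esub> a') R = (transl_family F a \<oplus>\<^bsub>costalk F\<^esub> transl_family F a') R"
  proof (rule disk_eqI[OF R])
    show "transl_family F (a \<oplus>\<^bsub>costalk F\<^esub> a') R \<in> carrier (disk 0 R)"
      by (rule transl_derivative(3)[OF R homogeneousI[OF weight_add[OF a]]])
    show "(transl_family F a \<oplus>\<^bsub>costalk F\<^esub> transl_family F a') R \<in> carrier (disk 0 R)" by (rule costalk_closed[OF s R])
    fix \<phi> assume \<phi>: "\<phi> \<in> lcs_dual (disk 0 R)"
    have "((\<lambda>t. \<phi> (mu1 F R a t) + \<phi> (mu1 F R a' t)) has_field_derivative
        \<phi> (transl_family F a R) + \<phi> (transl_family F a' R)) (at 0)"
      by (intro DERIV_add transl_dual R homogeneousI[OF a(1)] homogeneousI[OF a(2)] \<phi>)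
    then have 1: "((\<lambda>t. \<phi> (mu1 F R (a \<oplus>\<^bsub>costalk F\<^esub> a') t)) has_field_derivative
        \<phi> (transl_family F a R) + \<phi> (transl_family F a' R)) (at 0)"
      by (rule has_field_derivative_transform_within_open[of _ _ _ "ball 0 R"])
        (use R mu1_closed w in \<open>auto simp: eq lcs_dual_add[OF \<phi>]\<close>)
    show "\<phi> (transl_family F (a \<oplus>\<^bsub>costalk F\<^esub> a') R) = \<phi> ((transl_family F a \<oplus>\<^bsub>costalk F\<^esub> transl_family F a') R)"
      using DERIV_unique[OF transl_dual[OF R homogeneousI[OF weight_add[OF a]] \<phi>] 1]
        costalk_closed[OF t(1) R] costalk_closed[OF t(2) R]
      by (simp add: costalk_ops[OF R] lcs_dual_add[OF \<phi>])
  qed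
qed

lemma transl_scale:
  assumes a: "a \<in> carrier (costalk_weight F \<Delta>)"
  shows "transl_family F (c \<odot>\<^bsub>costalk F\<^esub> a) = c \<odot>\<^bsub>costalk F\<^esub> transl_family F a"
proof (rule costalk_eqI)
  interpret C: complex_space "costalk F" by (rule costalk_space)
  note t = weight_costalk[OF transl_weight[OF a]]
  show "transl_family F (c \<odot>\<^bsub>costalk F\<^esub> a) \<in> carrier (costalk F)"
    by (rule weight_costalk[OF transl_weight[OF weight_scale[OF a]]])
  show s: "c \<odot>\<^bsub>costalk F\<^esub> transl_family F a \<in> carrier (costalk F)" using t by simp
  fix R :: real assume R: "R > 0"
  note w = weight_costalk[OF a]
  note w' = C.scale_closed[OF w]
  have eq: "mu1 F R (c \<odot>\<^bsub>costalk F\<^esub> a) z = c \<odot>\<^bsub>disk 0 R\<^esub> mu1 F R a z" if z: "z \<in> ball 0 R" for z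
  proof -
    obtain e where e: "e > 0" "ball z e \<subseteq> ball 0 R" using mu1_radius[OF z] .
    show ?thesis
      unfolding mu1_eq[OF w' e] mu1_eq[OF w(1) e] place_scale[OF w e(1)]
      by (rule lcs_hom_scale[OF ext_ball_hom[OF e(2)]]) (rule place_closed[OF w(1) e(1)])
  qed
  show "transl_family F (c \<odot>\<^bsub>costalk F\<^esub> a) R = (c \<odot>\<^bsub>costalk F\<^esub> transl_family F a) R"
  proof (rule disk_eqI[OF R])
    show "transl_family F (c \<odot>\<^bsub>costalk F\<^esub> a) R \<in> carrier (disk 0 R)"
      by (rule transl_derivative(3)[OF R homogeneousI[OF weight_scale[OF a]]])
    show "(c \<odot>\<^bsub>costalk F\<^esub> transl_family F a) R \<in> carrier (disk 0 R)" by (rule costalk_closed[OF s R])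
    fix \<phi> assume \<phi>: "\<phi> \<in> lcs_dual (disk 0 R)"
    have "((\<lambda>t. c * \<phi> (mu1 F R a t)) has_field_derivative c * \<phi> (transl_family F a R)) (at 0)"
      by (intro DERIV_cmult transl_dual R homogeneousI[OF a] \<phi>)
    then have 1: "((\<lambda>t. \<phi> (mu1 F R (c \<odot>\<^bsub>costalk F\<^esub> a) t)) has_field_derivative c * \<phi> (transl_family F a R)) (at 0)"
      by (rule has_field_derivative_transform_within_open[of _ _ _ "ball 0 R"])
        (use R mu1_closed w in \<open>auto simp: eq lcs_dual_scale[OF \<phi>]\<close>)
    show "\<phi> (transl_family F (c \<odot>\<^bsub>costalk F\<^esub> a) R) = \<phi> ((c \<odot>\<^bsub>costalk F\<^esub> transl_family F a) R)"
      using DERIV_unique[OF transl_dual[OF R homogeneousI[OF weight_scale[OF a]] \<phi>] 1] costalk_closed[OF t(1) R]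
      by (simp add: costalk_ops[OF R] lcs_dual_scale[OF \<phi>])
  qed
qed

end

section \<open>Vanishing, vacuum, translation covariance and locality for homogeneous
  elements\<close>

context holomorphic_planar_pfa
begin

text \<open>Larger radii follow by extending from radius 1. Smaller radii use that extension maps
  are injective on a fixed weight.\<close>

lemma weight_eq_zero:
  assumes a: "a \<in> carrier (costalk_weight F \<Delta>)" and 1: "a 1 = \<zero>\<^bsub>disk 0 1\<^esub>"
  shows "a = \<zero>\<^bsub>costalk F\<^esub>"
proof (rule costalk_eqI[OF weight_costalk[OF a] weight_costalk[OF weight_zero]])
  note ac = weight_costalk[OF a] and zc = weight_costalk[OF weight_zero]
  fix R :: real assume R: "R > 0"
  show "a R = \<zero>\<^bsub>costalk F\<^esub> R"
  proof (cases "R \<ge> 1")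
    case True
    then show ?thesis using costalk_ext[OF ac, of 1 R] costalk_ext[OF zc, of 1 R] 1 by (simp add: costalk_ops)
  next
    case False
    have inj: "inj_on (pf_ext F (ball 0 R) (ball 0 1)) (disk_weight F R \<Delta>)"
      using weight_bij[of R 1 \<Delta>] R False by (simp add: bij_betw_def)
    have "a R \<in> disk_weight F R \<Delta>" "\<zero>\<^bsub>costalk F\<^esub> R \<in> disk_weight F R \<Delta>"
      using a weight_zero[of \<Delta>] R by (auto simp: costalk_weight_def)
    moreover have "pf_ext F (ball 0 R) (ball 0 1) (a R) = pf_ext F (ball 0 R) (ball 0 1) (\<zero>\<^bsub>costalk F\<^esub> R)"
      using costalk_ext[OF ac R, of 1] costalk_ext[OF zc R, of 1] False 1 by (simp add: costalk_ops)
    ultimately show ?thesis using inj by (auto simp: inj_on_def)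
  qed
qed

text \<open>The bound below which weights vanish may vary with the radius; the one for radius 1
  serves for the whole costalk, because a homogeneous family is zero as soon as its member at radius
  1 is.\<close>

lemma weight_vanish: "\<exists>N. \<forall>\<Delta><N. carrier (costalk_weight F \<Delta>) = {\<zero>\<^bsub>costalk F\<^esub>}"
proof -
  obtain N where N: "\<And>\<Delta>. \<Delta> < N \<Longrightarrow> disk_weight F 1 \<Delta> = {\<zero>\<^bsub>disk 0 1\<^esub>}" using weight_bounded[of 1] by auto
  have "carrier (costalk_weight F \<Delta>) = {\<zero>\<^bsub>costalk F\<^esub>}" if "\<Delta> < N" for \<Delta>
  proof (intro equalityI subsetI)
    fix a assume a: "a \<in> carrier (costalk_weight F \<Delta>)"
    then have "a 1 \<in> disk_weight F 1 \<Delta>" by (auto simp: costalk_weight_def)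
    then show "a \<in> {\<zero>\<^bsub>costalk F\<^esub>}" using N[OF that] weight_eq_zero[OF a] by auto
  qed (use weight_zero in auto)
  then show ?thesis by blast
qed

lemma mode_vanish:
  assumes a: "a \<in> carrier (costalk_weight F \<Delta>)" and b: "b \<in> carrier (costalk_weight F \<Delta>')"
  shows "\<exists>N. \<forall>n\<ge>int N. mode_family F a n b = \<zero>\<^bsub>costalk F\<^esub>"
proof -
  obtain M where M: "\<And>\<Delta>. \<Delta> < M \<Longrightarrow> carrier (costalk_weight F \<Delta>) = {\<zero>\<^bsub>costalk F\<^esub>}"
    using weight_vanish by blast
  have "mode_family F a n b = \<zero>\<^bsub>costalk F\<^esub>" if "n \<ge> int (nat (\<Delta> + \<Delta>' - M))" for n
  proof -
    have "\<Delta> + \<Delta>' - n - 1 < M" using that by linarith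
    then show ?thesis using M mode_weight[OF a b, of n] by blast
  qed
  then show ?thesis by blast
qed

text \<open>The two-point function is constant in \<open>z\<close>, so its Laurent series consists
  of the term of exponent 0, which has index \<open>-1\<close>.\<close>

lemma mode_vacuum_left:
  assumes b: "b \<in> carrier (costalk_weight F \<Delta>)"
  shows "mode_family F (vacuum_family F) n b = (if n = -1 then b else \<zero>\<^bsub>costalk F\<^esub>)"
proof (rule mode_costalk_eqI[OF vacuum_costalk b])
  note bc = weight_costalk[OF b] and zc = weight_costalk[OF weight_zero]
  show "(if n = -1 then b else \<zero>\<^bsub>costalk F\<^esub>) \<in> carrier (costalk F)" using bc zc by simp
  fix R \<phi> assume R: "R > 0" and \<phi>: "\<phi> \<in> lcs_dual (disk 0 R)"
  interpret D: locally_convex_space "disk 0 R" by (rule disk_lcs)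
  have "res_coeff (R / 2) (\<lambda>z. \<phi> (mu2' R (vacuum_family F) b z 0)) n = (if n = -1 then \<phi> (b R) else 0)"
  proof (rule res_coeff_has_sum)
    fix z assume "cmod z = R / 2"
    then have z: "z \<in> ball 0 R" "0 \<in> ball (0::complex) R" "z \<noteq> 0" using R by auto
    have "((\<lambda>n. z powi (- n - 1) * (if n = -1 then \<phi> (b R) else 0)) has_sum \<phi> (b R)) {-1}"
      by (rule has_sum_finiteI) auto
    then have "((\<lambda>n. z powi (- n - 1) * (if n = -1 then \<phi> (b R) else 0)) has_sum \<phi> (b R)) UNIV"
      by (rule has_sum_cong_neutral[THEN iffD1, rotated -1]) auto
    then show "((\<lambda>n. z powi (- n - 1) * (if n = -1 then \<phi> (b R) else 0)) has_sum \<phi> (mu2' R (vacuum_family F) b z 0)) UNIV"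
      using mu2'_vacuum_left[OF bc z] mu1_0[OF bc R] by simp
  qed (use R in simp)
  then show "res_coeff (R / 2) (\<lambda>z. \<phi> (mu2' R (vacuum_family F) b z 0)) n =
      \<phi> ((if n = -1 then b else \<zero>\<^bsub>costalk F\<^esub>) R)"
    by (simp add: costalk_ops R D.dual_zero[OF \<phi>])
qed

text \<open>The two-point function equals \<open>mu1 F R a z\<close>, which is holomorphic on the
  full disk: the principal part is absent, and the term of index \<open>-1\<close> is the value at
  the origin.\<close>

lemma mode_vacuum_right:
  assumes a: "a \<in> carrier (costalk_weight F \<Delta>)"
  shows "n \<ge> 0 \<Longrightarrow> mode_family F a n (vacuum_family F) = \<zero>\<^bsub>costalk F\<^esub>"
    and "mode_family F a (-1) (vacuum_family F) = a"
proof -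
  note ac = weight_costalk[OF a] and zc = weight_costalk[OF weight_zero]
  have eq: "res_coeff (R / 2) (\<lambda>z. \<phi> (mu2' R a (vacuum_family F) z 0)) n = res_coeff (R / 2) (\<lambda>z. \<phi> (mu1 F R a z)) n"
    if "R > 0" for R \<phi> n
    by (rule res_coeff_cong) (use that mu2'_vacuum_right[OF ac] in auto)
  have hol: "(\<lambda>z. \<phi> (mu1 F R a z)) holomorphic_on ball 0 R" if "R > 0" "\<phi> \<in> lcs_dual (disk 0 R)" for R \<phi>
    by (rule mu1_dual_holomorphic[OF that(1) homogeneousI[OF a] that(2)])
  show "mode_family F a n (vacuum_family F) = \<zero>\<^bsub>costalk F\<^esub>" if n: "n \<ge> 0"
  proof (rule mode_costalk_eqI[OF a vacuum_costalk zc])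
    fix R \<phi> assume R: "R > 0" and \<phi>: "\<phi> \<in> lcs_dual (disk 0 R)"
    interpret D: locally_convex_space "disk 0 R" by (rule disk_lcs)
    show "res_coeff (R / 2) (\<lambda>z. \<phi> (mu2' R a (vacuum_family F) z 0)) n = \<phi> (\<zero>\<^bsub>costalk F\<^esub> R)"
      unfolding eq[OF R] using res_coeff_holomorphic_nonneg[OF hol[OF R \<phi>], of "R / 2" n] R n
      by (simp add: costalk_ops D.dual_zero[OF \<phi>])
  qed
  show "mode_family F a (-1) (vacuum_family F) = a"
  proof (rule mode_costalk_eqI[OF a vacuum_costalk ac])
    fix R \<phi> assume R: "R > 0" and \<phi>: "\<phi> \<in> lcs_dual (disk 0 R)"
    show "res_coeff (R / 2) (\<lambda>z. \<phi> (mu2' R a (vacuum_family F) z 0)) (-1) = \<phi> (a R)"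
      unfolding eq[OF R] using res_coeff_holomorphic_value[OF hol[OF R \<phi>], of "R / 2"] R mu1_0[OF ac R] by simp
  qed
qed

lemma transl_vacuum: "transl_family F (vacuum_family F) = \<zero>\<^bsub>costalk F\<^esub>"
proof (rule costalk_eqI[OF weight_costalk[OF transl_weight[OF vacuum_costalk]] weight_costalk[OF weight_zero]])
  fix R :: real assume R: "R > 0"
  interpret D: locally_convex_space "disk 0 R" by (rule disk_lcs)
  note h = homogeneousI[OF vacuum_costalk]
  show "transl_family F (vacuum_family F) R = \<zero>\<^bsub>costalk F\<^esub> R"
  proof (rule disk_eqI[OF R transl_derivative(3)[OF R h]])
    show "\<zero>\<^bsub>costalk F\<^esub> R \<in> carrier (disk 0 R)" using R by (simp add: costalk_ops)
    fix \<phi> assume \<phi>: "\<phi> \<in> lcs_dual (disk 0 R)"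
    have "((\<lambda>t. \<phi> (pf_ext F {} (ball 0 R) (pf_unit F 1))) has_field_derivative 0) (at 0)" by simp
    then have "((\<lambda>t. \<phi> (mu1 F R (vacuum_family F) t)) has_field_derivative 0) (at 0)"
      by (rule has_field_derivative_transform_within_open[of _ _ _ "ball 0 R"]) (use R mu1_vacuum in auto)
    from DERIV_unique[OF transl_dual[OF R h \<phi>] this]
    show "\<phi> (transl_family F (vacuum_family F) R) = \<phi> (\<zero>\<^bsub>costalk F\<^esub> R)"
      by (simp add: costalk_ops R D.dual_zero[OF \<phi>])
  qed
qed

text \<open>With the first insertion absorbed into \<open>\<psi>\<close>, the two-point function
  becomes \<open>\<psi>\<close> of a one-point function on a disk about the origin, whose derivative
  at 0 is given by the translation operator.\<close>

lemma mu2_derivative_right: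
  assumes a: "homogeneous F a" and b: "b \<in> carrier (costalk_weight F \<Delta>)" and R: "R > 0"
    and \<phi>: "\<phi> \<in> lcs_dual (disk 0 R)" and z: "z \<in> ball 0 R - {0}"
  shows "((\<lambda>t. \<phi> (mu2' R a b z t)) has_field_derivative \<phi> (mu2' R a (transl_family F b) z 0)) (at 0)"
proof -
  note ac = homogeneous_costalk[OF a] and bc = weight_costalk[OF b] and hb = homogeneousI[OF b]
  note tc = weight_costalk[OF transl_weight[OF b]]
  obtain e where e: "e > 0" "disjoint_in (ball z e) (ball 0 e) (ball 0 R)"
    using mu2_radius[of z R 0] z R by auto
  define \<psi> where "\<psi> = (\<lambda>x. \<phi> (prod_op F (ball z e) (ball 0 e) (ball 0 R) (place z e a) x))"
  have \<psi>: "\<psi> \<in> lcs_dual (disk 0 e)"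
    unfolding \<psi>_def
    by (rule lcs_hom_compose[OF prod_op_hom_right \<phi>]) (use e place_closed[OF ac e(1)] in auto)
  have in1: "\<phi> (mu2' R a b z t) = \<psi> (mu1 F e b t)" if "t \<in> ball 0 e" for t
    unfolding \<psi>_def mu2'_inner[OF ac bc e(2,1) that] ..
  have in2: "\<phi> (mu2' R a (transl_family F b) z 0) = \<psi> (transl_family F b e)"
    unfolding \<psi>_def using mu2'_inner[OF ac tc e(2,1), of 0] e mu1_0[OF tc e(1)] by simp
  have "((\<lambda>t. \<psi> (mu1 F e b t)) has_field_derivative \<psi> (transl_family F b e)) (at 0)"
    by (rule transl_dual[OF e(1) hb \<psi>])
  then show ?thesis unfolding in2
    by (rule has_field_derivative_transform_within_open[of _ _ _ "ball 0 e"]) (use e in1 in auto)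
qed

text \<open>The function \<open>f\<close> is the mode inserted at \<open>t\<close>; by equivariance
  it is also the coefficient of index \<open>n\<close> of \<open>k z t\<close> in \<open>z\<close>.
  Differentiating both descriptions at \<open>t = 0\<close> gives the left side and, by
  \<open>deriv_res_coeff\<close>, the coefficient of the derivative of \<open>k\<close>, whose part
  in the first variable produces the factor \<open>- n\<close>.\<close>

lemma transl_mode_dual:
  assumes a: "a \<in> carrier (costalk_weight F \<Delta>)" and b: "b \<in> carrier (costalk_weight F \<Delta>')"
    and R: "R > 0" and \<phi>: "\<phi> \<in> lcs_dual (disk 0 R)"
  shows "\<phi> (transl_family F (mode_family F a n b) R) =
    \<phi> (mode_family F a n (transl_family F b) R) - of_int n * \<phi> (mode_family F a (n - 1) b R)"
proof -
  note ha = homogeneousI[OF a] and hb = homogeneousI[OF b] and ac = weight_costalk[OF a] and bc = weight_costalk[OF b]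
  note mw = mode_weight[OF a b, of n] and tw = transl_weight[OF b]
  \<comment> \<open>Both \<open>z\<close> and \<open>t\<close> run over the circle of radius
    \<open>r\<close>; \<open>r < s\<close> leaves room for holomorphy in \<open>t\<close> on the
    disk of radius \<open>s\<close>, and \<open>r + s < R\<close> keeps \<open>z + t\<close>
    inside.\<close>
  define r s where "r = R / 4" and "s = R / 2"
  have rs: "0 < r" "r < s" "s < R" "r + s < R" using R by (auto simp: r_def s_def)
  define k where "k z t = \<phi> (mu2' R a b (z + t) t)" for z t
  define f where "f t = \<phi> (mu1 F R (mode_family F a n b) t)" for t
  have zt: "z + t \<in> ball 0 R" "t \<in> ball 0 R" "z + t \<noteq> t" if "cmod z = r" "cmod t < s" for z t
    using that rs norm_triangle_ineq[of z t] by auto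
  have k_deriv: "\<exists>\<xi>0 \<xi>1. \<forall>s v0 v1. ((\<lambda>u. \<phi> (mu2' R a b (z + t + (u - s) * v0) (t + (u - s) * v1)))
    has_field_derivative (v0 * \<xi>0 + v1 * \<xi>1)) (at s)" if "cmod z = r" "cmod t < s" for z t
    by (rule mu2_dual_derivative[OF R ha hb \<phi> zt[OF that]])
  have holk: "k z holomorphic_on ball 0 s" if z: "cmod z = r" for z
    unfolding holomorphic_on_def
  proof
    fix t assume "t \<in> ball (0::complex) s"
    then obtain \<xi>0 \<xi>1 where "\<And>s v0 v1. ((\<lambda>u. \<phi> (mu2' R a b (z + t + (u - s) * v0) (t + (u - s) * v1)))
      has_field_derivative (v0 * \<xi>0 + v1 * \<xi>1)) (at s)" using k_deriv[OF z, of t] by auto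
    note \<xi> = this
    have "(\<lambda>u. \<phi> (mu2' R a b (z + t + (u - t) * 1) (t + (u - t) * 1))) = k z"
      by (simp add: k_def fun_eq_iff)
    then have "(k z has_field_derivative \<xi>0 + \<xi>1) (at t)"
      using \<xi>[of t 1 1] by simp
    then show "k z field_differentiable at t within ball 0 s"
      by (auto simp: field_differentiable_def intro: has_field_derivative_at_within)
  qed
  have "deriv f 0 = res_coeff r (\<lambda>z. deriv (k z) 0) n"
  proof (rule deriv_res_coeff[OF rs(1) rs(1,2)])
    show "continuous_on (sphere 0 r \<times> sphere 0 r) (\<lambda>(t, z). k z t)"
      unfolding k_def case_prod_beta
      by (rule mu2_dual_continuous[OF R ha hb \<phi>]) (use zt rs in \<open>auto intro!: continuous_intros\<close>)
    show "k z holomorphic_on ball 0 s" if "cmod z = r" for z by (rule holk[OF that])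
    show "f holomorphic_on ball 0 s"
      unfolding f_def
      by (rule holomorphic_on_subset[OF mu1_dual_holomorphic[OF R homogeneousI[OF mw] \<phi>]]) (use rs in auto)
    fix t assume t: "cmod t = r"
    have sub: "ball t s \<subseteq> ball 0 R" by (rule ball_subset_ball0) (use t rs in auto)
    \<comment> \<open>Moving the disk of radius \<open>s\<close> from the origin to \<open>t\<close>
      turns the two-point function at \<open>(z + t, t)\<close> into the one at
      \<open>(z, 0)\<close> seen by a pulled-back functional, whose Laurent coefficients are the
      modes.\<close>
    define \<psi> where "\<psi> = (\<lambda>x. \<phi> (pf_ext F (ball t s) (ball 0 R) (pf_sigma F (1, t) (ball 0 s) x)))"
    have "pf_sigma F (1, t) (ball 0 s) \<in> lcs_hom (disk 0 s) (disk t s)" using sigma_translate_hom[of t 0 s] by simp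
    then have \<psi>: "\<psi> \<in> lcs_dual (disk 0 s)"
      unfolding \<psi>_def using lcs_hom_compose[OF lcs_hom_compose[OF _ ext_ball_hom[OF sub]] \<phi>] by blast
    have s0: "s > 0" using rs by simp
    have "f t = \<psi> (mode_family F a n b s)"
      using mu1_translate[OF weight_costalk[OF mw] _ sub, of 0] mu1_0[OF weight_costalk[OF mw] s0] s0
      by (simp add: f_def \<psi>_def)
    also have "\<dots> = res_coeff r (\<lambda>z. \<psi> (mu2' s a b z 0)) n"
      by (rule mode_res_coeff[OF s0 ha hb \<psi>, symmetric]) (use rs in auto)
    also have "\<dots> = res_coeff r (\<lambda>z. k z t) n"
    proof (rule res_coeff_cong[OF rs(1)])
      fix z assume "cmod z = r"
      then have "z \<in> ball 0 s" "0 \<in> ball (0::complex) s" "z \<noteq> 0" using rs by auto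
      from mu2'_translate[OF ac bc this sub] show "\<psi> (mu2' s a b z 0) = k z t" by (simp add: k_def \<psi>_def)
    qed
    finally show "f t = res_coeff r (\<lambda>z. k z t) n" .
  qed
  moreover have "deriv f 0 = \<phi> (transl_family F (mode_family F a n b) R)"
    unfolding f_def by (rule DERIV_imp_deriv[OF transl_dual[OF R homogeneousI[OF mw] \<phi>]])
  moreover have "res_coeff r (\<lambda>z. deriv (k z) 0) n =
      res_coeff r (\<lambda>z. deriv (\<lambda>z. \<phi> (mu2' R a b z 0)) z + \<phi> (mu2' R a (transl_family F b) z 0)) n"
  proof (rule res_coeff_cong[OF rs(1)])
    fix z assume z: "cmod z = r"
    then have zR: "z \<in> ball 0 R - {0}" using rs by auto
    \<comment> \<open>The same pair of partial derivatives at \<open>(z, 0)\<close> computes all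
      three derivatives in question: directions \<open>(1, 0)\<close>, \<open>(0, 1)\<close> and
      \<open>(1, 1)\<close>.\<close>
    obtain \<xi>0 \<xi>1 where \<xi>: "\<And>s v0 v1. ((\<lambda>u. \<phi> (mu2' R a b (z + 0 + (u - s) * v0) (0 + (u - s) * v1)))
      has_field_derivative (v0 * \<xi>0 + v1 * \<xi>1)) (at s)" using k_deriv[OF z, of 0] rs by auto
    have 0: "deriv (\<lambda>z. \<phi> (mu2' R a b z 0)) z = \<xi>0"
      using \<xi>[where s = z and ?v0.0 = 1 and ?v1.0 = 0] by (intro DERIV_imp_deriv) simp
    have "((\<lambda>t. \<phi> (mu2' R a b z t)) has_field_derivative \<xi>1) (at 0)"
      using \<xi>[where s = 0 and ?v0.0 = 0 and ?v1.0 = 1] by simp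
    then have 1: "\<phi> (mu2' R a (transl_family F b) z 0) = \<xi>1"
      using DERIV_unique mu2_derivative_right[OF ha b R \<phi> zR] by blast
    have "(k z has_field_derivative \<xi>0 + \<xi>1) (at 0)"
      using \<xi>[where s = 0 and ?v0.0 = 1 and ?v1.0 = 1] unfolding k_def by simp
    then show "deriv (k z) 0 = deriv (\<lambda>z. \<phi> (mu2' R a b z 0)) z + \<phi> (mu2' R a (transl_family F b) z 0)"
      unfolding 0 1 by (rule DERIV_imp_deriv)
  qed
  moreover have "\<dots> = - of_int n * \<phi> (mode_family F a (n - 1) b R) + \<phi> (mode_family F a n (transl_family F b) R)"
  proof -
    have h: "(\<lambda>z. \<phi> (mu2' R a b z 0)) holomorphic_on ball 0 R - {0}"
      by (rule mu2_dual_holomorphic[OF R ha hb \<phi>]) (use R in simp)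
    then have "deriv (\<lambda>z. \<phi> (mu2' R a b z 0)) holomorphic_on ball 0 R - {0}"
      by (rule holomorphic_deriv) (simp add: open_delete)
    then have c1: "continuous_on (sphere 0 r) (deriv (\<lambda>z. \<phi> (mu2' R a b z 0)))"
      by (rule continuous_on_subset[OF holomorphic_on_imp_continuous_on]) (use rs in auto)
    have c2: "continuous_on (sphere 0 r) (\<lambda>z. \<phi> (mu2' R a (transl_family F b) z 0))"
      by (rule mu2_sphere_continuous[OF R ha homogeneousI[OF tw] \<phi>]) (use rs in auto)
    have rR: "r < R" using rs by simp
    show ?thesis
      unfolding res_coeff_add[OF rs(1) c1 c2] res_coeff_deriv[OF h rs(1) rR]
        mode_res_coeff[OF R ha hb \<phi> rs(1) rR] mode_res_coeff[OF R ha homogeneousI[OF tw] \<phi> rs(1) rR] ..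
  qed
  ultimately show ?thesis by simp
qed

lemma transl_mode:
  assumes a: "a \<in> carrier (costalk_weight F \<Delta>)" and b: "b \<in> carrier (costalk_weight F \<Delta>')"
  shows "transl_family F (mode_family F a n b) \<ominus>\<^bsub>costalk F\<^esub> mode_family F a n (transl_family F b) =
    (- of_int n) \<odot>\<^bsub>costalk F\<^esub> mode_family F a (n - 1) b"
proof -
  interpret C: complex_space "costalk F" by (rule costalk_space)
  note c = weight_costalk[OF transl_weight[OF mode_weight[OF a b, of n]]]
    weight_costalk[OF mode_weight[OF a transl_weight[OF b], of n]] weight_costalk[OF mode_weight[OF a b, of "n - 1"]]
  show ?thesis
  proof (rule costalk_eqI)
    fix R :: real assume R: "R > 0"
    interpret D: locally_convex_space "disk 0 R" by (rule disk_lcs)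
    note cR = costalk_closed[OF c(1) R] costalk_closed[OF c(2) R] costalk_closed[OF c(3) R]
    show "(transl_family F (mode_family F a n b) \<ominus>\<^bsub>costalk F\<^esub> mode_family F a n (transl_family F b)) R =
        ((- of_int n) \<odot>\<^bsub>costalk F\<^esub> mode_family F a (n - 1) b) R"
      unfolding C.diff_eq_scale[OF c(1,2)] costalk_ops[OF R]
    proof (rule disk_eqI[OF R])
      fix \<phi> assume \<phi>: "\<phi> \<in> lcs_dual (disk 0 R)"
      show "\<phi> (transl_family F (mode_family F a n b) R \<oplus>\<^bsub>disk 0 R\<^esub> (-1) \<odot>\<^bsub>disk 0 R\<^esub> mode_family F a n (transl_family F b) R) =
         \<phi> ((- of_int n) \<odot>\<^bsub>disk 0 R\<^esub> mode_family F a (n - 1) b R)"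
        using cR transl_mode_dual[OF a b R \<phi>, of n] by (simp add: lcs_dual_add[OF \<phi>] lcs_dual_scale[OF \<phi>])
    qed (use cR in auto)
  qed (use c in auto)
qed

text \<open>A radius \<open>s\<close> strictly between \<open>cmod w\<close> and
  \<open>cmod z\<close> separates the outer insertion from the two inner ones. Continuity of the
  product in its inner argument carries the expansion of the inner two-point function through, term
  by term.\<close>

lemma mu3_expansion:
  assumes a: "a \<in> carrier (costalk_weight F \<Delta>)" and b: "b \<in> carrier (costalk_weight F \<Delta>')"
    and c: "c \<in> carrier (costalk_weight F \<Delta>'')" and R: "R > 0" and \<phi>: "\<phi> \<in> lcs_dual (disk 0 R)"
    and zw: "0 < cmod w" "cmod w < cmod z" "cmod z < R"
  shows "((\<lambda>n. w powi (- n - 1) * \<phi> (mu2' R a (mode_family F b n c) z 0)) has_sum \<phi> (mu3 R a b c z w 0)) UNIV"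
proof -
  note ac = weight_costalk[OF a] and bc = weight_costalk[OF b] and cc = weight_costalk[OF c]
  define s e where "s = (cmod w + cmod z) / 2" and "e = min (cmod z - s) (R - cmod z)"
  have s: "cmod w < s" "s < cmod z" using zw by (simp_all add: s_def field_simps)
  have "e \<le> cmod z - s" "e \<le> R - cmod z" by (simp_all add: e_def)
  moreover have "e > 0" using s zw by (simp add: e_def)
  ultimately have se: "0 < s" "cmod w < s" "e > 0" "e + s \<le> cmod z" "cmod z + e \<le> R" "s < R"
    using s zw by linarith+
  have "ball z e \<inter> ball 0 s = {}" by (rule disjoint_balls) (use se in auto)
  moreover have "ball z e \<subseteq> ball 0 R" using se by (intro ball_subset_ball0) auto
  moreover have "ball 0 s \<subseteq> ball (0::complex) R" using se by (intro subset_ball) auto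
  ultimately have d: "disjoint_in (ball z e) (ball 0 s) (ball 0 R)" by (auto simp: disjoint_in_def)
  define \<psi> where "\<psi> = (\<lambda>x. \<phi> (prod_op F (ball z e) (ball 0 s) (ball 0 R) (place z e a) x))"
  have \<psi>: "\<psi> \<in> lcs_dual (disk 0 s)"
    unfolding \<psi>_def by (rule lcs_hom_compose[OF prod_op_hom_right \<phi>]) (use d place_closed[OF ac se(3)] in auto)
  have w: "w \<in> ball 0 s" "w \<noteq> 0" using se zw by auto
  have "((\<lambda>n. w powi (- n - 1) * \<psi> (mode_family F b n c s)) has_sum \<psi> (mu2' s b c w 0)) UNIV"
    by (rule mode_has_sum[OF se(1) homogeneousI[OF b] homogeneousI[OF c] \<psi>]) (use w in auto)
  moreover have "\<psi> (mu2' s b c w 0) = \<phi> (mu3 R a b c z w 0)"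
    unfolding \<psi>_def mu3_inner[OF ac bc cc d se(3) w] ..
  moreover have "\<psi> (mode_family F b n c s) = \<phi> (mu2' R a (mode_family F b n c) z 0)" for n
  proof -
    note m = weight_costalk[OF mode_weight[OF b c, of n]]
    show ?thesis unfolding \<psi>_def using mu2'_inner[OF ac m d se(3), of 0] mu1_0[OF m se(1)] se(1) by simp
  qed
  ultimately show ?thesis by simp
qed

text \<open>
  Near the diagonal the first two insertions are expanded about the second one; the pole order
  does not depend on the third insertion.
\<close>

lemma mu3_pole_bounded:
  assumes a: "a \<in> carrier (costalk_weight F \<Delta>)" and b: "b \<in> carrier (costalk_weight F \<Delta>')"
    and c: "c \<in> carrier (costalk_weight F \<Delta>'')" and R: "R > 0" and \<phi>: "\<phi> \<in> lcs_dual (disk 0 R)"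
    and w: "w \<in> ball 0 R - {0}" and N: "\<And>n. n \<ge> int N \<Longrightarrow> mode_family F a n b = \<zero>\<^bsub>costalk F\<^esub>"
  shows "\<exists>B. eventually (\<lambda>z. cmod ((z - w) ^ N * \<phi> (mu3 R a b c z w 0)) \<le> B) (at w)"
proof -
  note ac = weight_costalk[OF a] and bc = weight_costalk[OF b] and cc = weight_costalk[OF c]
  obtain s where s: "s > 0" "disjoint_in (ball w s) (ball 0 s) (ball 0 R)" using mu2_radius[of w R 0] w R by auto
  \<comment> \<open>The third insertion and the translation to \<open>w\<close> are absorbed into
    the functional, so the singularity at \<open>w\<close> is that of the two-point function of
    \<open>a\<close> and \<open>b\<close> at the origin.\<close>
  define \<psi> where "\<psi> = (\<lambda>x. \<phi> (prod_op F (ball w s) (ball 0 s) (ball 0 R) (pf_sigma F (1, w) (ball 0 s) x) (place 0 s c)))"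
  have h: "pf_sigma F (1, w) (ball 0 s) \<in> lcs_hom (disk 0 s) (disk w s)" using sigma_translate_hom[of w 0 s] by simp
  have \<psi>: "\<psi> \<in> lcs_dual (disk 0 s)"
    unfolding \<psi>_def
    by (rule lcs_hom_compose[OF lcs_hom_compose[OF h prod_op_hom_left] \<phi>]) (use s place_closed[OF cc s(1)] in auto)
  interpret D: locally_convex_space "disk 0 s" by (rule disk_lcs)
  have "(\<lambda>x. \<psi> (mu2' s a b x 0)) holomorphic_on ball 0 s - {0}"
    by (rule mu2_dual_holomorphic[OF s(1) homogeneousI[OF a] homogeneousI[OF b] \<psi>]) (use s in simp)
  moreover have "res_coeff (s / 2) (\<lambda>x. \<psi> (mu2' s a b x 0)) n = 0" if "n \<ge> int N" for n
    using mode_res_coeff[OF s(1) homogeneousI[OF a] homogeneousI[OF b] \<psi>, of "s / 2" n] s N[OF that]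
    by (simp add: costalk_ops D.dual_zero[OF \<psi>])
  ultimately obtain B where B: "\<And>x. 0 < cmod x \<Longrightarrow> cmod x \<le> s / 2 \<Longrightarrow> cmod (x ^ N * \<psi> (mu2' s a b x 0)) \<le> B"
    using bounded_by_pole[OF _ s(1), of "\<lambda>x. \<psi> (mu2' s a b x 0)" N] by blast
  have "cmod ((z - w) ^ N * \<phi> (mu3 R a b c z w 0)) \<le> B" if z: "z \<noteq> w" "dist z w < s / 2" for z
  proof -
    have "z - w \<in> ball 0 s" "z - w \<noteq> 0" using z s by (auto simp: dist_norm norm_minus_commute[of w z])
    from mu3_near[OF ac bc cc s(2,1) this] have "\<phi> (mu3 R a b c z w 0) = \<psi> (mu2' s a b (z - w) 0)"
      by (simp add: \<psi>_def)
    then show ?thesis using B[of "z - w"] z by (simp add: dist_norm)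
  qed
  then have "eventually (\<lambda>z. cmod ((z - w) ^ N * \<phi> (mu3 R a b c z w 0)) \<le> B) (at w)"
    unfolding eventually_at using s(1) by (intro exI[of _ "s / 2"]) auto
  then show ?thesis by blast
qed

text \<open>The expansion for \<open>cmod z < cmod w\<close> is the first one with the roles of
  \<open>a\<close> and \<open>b\<close> exchanged; by the symmetry of the three-point function both
  refer to the same \<open>h\<close>.\<close>

lemma locality_dual:
  assumes a: "a \<in> carrier (costalk_weight F \<Delta>)" and b: "b \<in> carrier (costalk_weight F \<Delta>')"
    and c: "c \<in> carrier (costalk_weight F \<Delta>'')" and R: "R > 0" and \<phi>: "\<phi> \<in> lcs_dual (disk 0 R)"
    and N: "\<And>n. n \<ge> int N \<Longrightarrow> mode_family F a n b = \<zero>\<^bsub>costalk F\<^esub>"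
  shows "(coeff_diff ^^ N) (\<lambda>m n. \<phi> (mode_family F a m (mode_family F b n c) R)) m n =
    (coeff_diff ^^ N) (\<lambda>m n. \<phi> (mode_family F b n (mode_family F a m c) R)) m n"
proof -
  note ac = weight_costalk[OF a] and bc = weight_costalk[OF b] and cc = weight_costalk[OF c]
  note ha = homogeneousI[OF a] and hb = homogeneousI[OF b] and hc = homogeneousI[OF c]
  note hbc = homogeneousI[OF mode_weight[OF b c]] and hac = homogeneousI[OF mode_weight[OF a c]]
  show ?thesis
  proof (rule opposite_expansions[OF R, where h = "\<lambda>z w. \<phi> (mu3 R a b c z w 0)"
        and a = "\<lambda>n z. \<phi> (mu2' R a (mode_family F b n c) z 0)" and b = "\<lambda>m w. \<phi> (mu2' R b (mode_family F a m c) w 0)"])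
    show "continuous_on {(z, w). z \<in> ball 0 R - {0} \<and> w \<in> ball 0 R - {0} \<and> z \<noteq> w} (\<lambda>(z, w). \<phi> (mu3 R a b c z w 0))"
      unfolding case_prod_beta
      by (rule mu3_dual_continuous[OF R ha hb hc \<phi>]) (auto intro!: continuous_intros)
    show "(\<lambda>z. \<phi> (mu3 R a b c z w 0)) holomorphic_on ball 0 R - {0} - {w}" if "w \<in> ball 0 R - {0}" for w
      by (rule mu3_dual_holomorphic[OF R ha hb hc \<phi> that])
    show "\<exists>B. \<forall>\<^sub>F z in at w. cmod ((z - w) ^ N * \<phi> (mu3 R a b c z w 0)) \<le> B" if "w \<in> ball 0 R - {0}" for w
      by (rule mu3_pole_bounded[OF a b c R \<phi> that N])
    show "((\<lambda>n. w powi (- n - 1) * \<phi> (mu2' R a (mode_family F b n c) z 0)) has_sum \<phi> (mu3 R a b c z w 0)) UNIV"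
      if "0 < cmod w" "cmod w < cmod z" "cmod z < R" for z w
      by (rule mu3_expansion[OF a b c R \<phi> that])
    show "((\<lambda>m. z powi (- m - 1) * \<phi> (mu2' R b (mode_family F a m c) w 0)) has_sum \<phi> (mu3 R a b c z w 0)) UNIV"
      if "0 < cmod z" "cmod z < cmod w" "cmod w < R" for z w
    proof -
      have "mu3 R a b c z w 0 = mu3 R b a c w z 0"
        by (rule mu3_commute[OF ac bc cc]) (use that in auto)
      then show ?thesis using mu3_expansion[OF b a c R \<phi> that] by simp
    qed
    show "continuous_on (ball 0 R - {0}) (\<lambda>z. \<phi> (mu2' R a (mode_family F b n c) z 0))" for n
      using R by (intro mu2_dual_continuous ha hbc \<phi> continuous_on_id continuous_on_const) auto
    show "continuous_on (ball 0 R - {0}) (\<lambda>z. \<phi> (mu2' R b (mode_family F a n c) z 0))" for n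
      using R by (intro mu2_dual_continuous hb hac \<phi> continuous_on_id continuous_on_const) auto
    show "res_coeff r (\<lambda>z. \<phi> (mu2' R a (mode_family F b n c) z 0)) m = \<phi> (mode_family F a m (mode_family F b n c) R)"
      if "0 < r" "r < R" for r m n by (rule mode_res_coeff[OF R ha hbc \<phi> that])
    show "res_coeff r (\<lambda>z. \<phi> (mu2' R b (mode_family F a m c) z 0)) n = \<phi> (mode_family F b n (mode_family F a m c) R)"
      if "0 < r" "r < R" for r m n by (rule mode_res_coeff[OF R hb hac \<phi> that])
  qed
qed


section \<open>Locally constant prefactorization algebras\<close>

text \<open>The inverse is chosen among morphisms, so its continuity is part of the choice and it
  may be composed with functionals.\<close>

definition ext_inverse :: "real \<Rightarrow> complex \<Rightarrow> real \<Rightarrow> 'a \<Rightarrow> 'a" where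
  "ext_inverse R z r = (SOME g. g \<in> lcs_hom (disk 0 R) (disk z r) \<and>
     (\<forall>x\<in>carrier (disk z r). g (pf_ext F (ball z r) (ball 0 R) x) = x) \<and>
     (\<forall>y\<in>carrier (disk 0 R). pf_ext F (ball z r) (ball 0 R) (g y) = y))"

lemma ext_inverse:
  assumes lc: "locally_constant F" and r: "0 < r" "r < R" "ball z r \<subseteq> ball 0 R"
  shows "ext_inverse R z r \<in> lcs_hom (disk 0 R) (disk z r)"
    and "x \<in> carrier (disk z r) \<Longrightarrow> ext_inverse R z r (pf_ext F (ball z r) (ball 0 R) x) = x"
    and "y \<in> carrier (disk 0 R) \<Longrightarrow> pf_ext F (ball z r) (ball 0 R) (ext_inverse R z r y) = y"
proof -
  have eq: "{\<zeta>. ereal (dist 0 \<zeta>) < ereal R} = ball (0::complex) R" by auto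
  have "lcs_isomorphism (disk z r) (disk 0 R) (pf_ext F (ball z r) (ball 0 R))"
    using lc r unfolding locally_constant_def Let_def by (metis eq less_ereal.simps(1))
  then have "\<exists>g. g \<in> lcs_hom (disk 0 R) (disk z r) \<and>
     (\<forall>x\<in>carrier (disk z r). g (pf_ext F (ball z r) (ball 0 R) x) = x) \<and>
     (\<forall>y\<in>carrier (disk 0 R). pf_ext F (ball z r) (ball 0 R) (g y) = y)"
    unfolding lcs_isomorphism_def by blast
  from someI_ex[OF this, folded ext_inverse_def]
  show "ext_inverse R z r \<in> lcs_hom (disk 0 R) (disk z r)"
    "x \<in> carrier (disk z r) \<Longrightarrow> ext_inverse R z r (pf_ext F (ball z r) (ball 0 R) x) = x"
    "y \<in> carrier (disk 0 R) \<Longrightarrow> pf_ext F (ball z r) (ball 0 R) (ext_inverse R z r y) = y"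
    by blast+
qed

text \<open>
  Squeezing the first factor into a small disk about \<open>z\<close> makes room for an insertion at the origin.
  Moving \<open>z\<close> along the connected punctured disk does not change the result, which therefore
  extends over \<open>z = 0\<close>.
\<close>

definition squeeze :: "real \<Rightarrow> (real \<Rightarrow> 'a) \<Rightarrow> complex \<Rightarrow> real \<Rightarrow> 'a \<Rightarrow> 'a" where
  "squeeze R b z r x = prod_op F (ball z r) (ball 0 r) (ball 0 R) (ext_inverse R z r x) (b r)"

text \<open>The preimage of \<open>x\<close> in the larger disk is the extension of its preimage in
  the smaller one, and products are compatible with extension of both factors.\<close>

lemma squeeze_shrink:
  assumes lc: "locally_constant F" and b: "b \<in> carrier (costalk F)"
    and r: "0 < r" "r < R" "disjoint_in (ball z r) (ball 0 r) (ball 0 R)"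
    and r': "0 < r'" "r' \<le> r" "ball z' r' \<subseteq> ball z r" and x: "x \<in> carrier (disk 0 R)"
  shows "squeeze R b z r x = squeeze R b z' r' x"
proof -
  have sub: "ball z r \<subseteq> ball 0 R" "ball z' r' \<subseteq> ball 0 R" "ball 0 r' \<subseteq> ball (0::complex) r"
    using r r' by (auto simp: disjoint_in_def)
  have r'R: "r' < R" using r r' by simp
  define y where "y = ext_inverse R z' r' x"
  have y: "y \<in> carrier (disk z' r')" unfolding y_def
    by (rule lcs_hom_closed[OF ext_inverse(1)[OF lc r'(1) r'R sub(2)] x])
  have "x = pf_ext F (ball z' r') (ball 0 R) y"
    unfolding y_def by (rule ext_inverse(3)[OF lc r'(1) r'R sub(2) x, symmetric])
  also have "\<dots> = pf_ext F (ball z r) (ball 0 R) (pf_ext F (ball z' r') (ball z r) y)"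
    by (rule ext_ext[symmetric]) (use y r' sub in auto)
  finally have "ext_inverse R z r x = pf_ext F (ball z' r') (ball z r) y"
    using ext_inverse(2)[OF lc r(1,2) sub(1)] ext_closed[OF open_ball open_ball r'(3) y] by simp
  moreover have "b r = pf_ext F (ball 0 r') (ball 0 r) (b r')" by (rule costalk_ext[OF b r'(1,2), symmetric])
  ultimately have "squeeze R b z r x = prod_op F (ball z' r') (ball 0 r') (ball 0 R) y (b r')"
    unfolding squeeze_def
    using prod_op_ext[OF open_ball open_ball open_ball open_ball open_ball r'(3) sub(3) r(3) y costalk_closed[OF b r'(1)]]
    by simp
  then show ?thesis by (simp add: squeeze_def y_def)
qed

text \<open>\<open>cmod z / 2\<close> keeps the disks about \<open>z\<close> and 0 disjoint,
  \<open>R - cmod z\<close> keeps the disk about \<open>z\<close> inside the large one.\<close>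

definition squeeze_radius :: "real \<Rightarrow> complex \<Rightarrow> real" where
  "squeeze_radius R z = min (cmod z / 2) (R - cmod z)"

lemma squeeze_radius:
  assumes "z \<in> ball 0 R - {0}"
  shows "0 < squeeze_radius R z" "squeeze_radius R z < R"
    "disjoint_in (ball z (squeeze_radius R z)) (ball 0 (squeeze_radius R z)) (ball 0 R)"
proof -
  define r where "r = squeeze_radius R z"
  have r: "0 < r" "r + r \<le> cmod z" "cmod z + r \<le> R" "r < R"
  proof -
    have z: "0 < cmod z" "cmod z < R" using assms by auto
    then show "0 < r" by (simp add: r_def squeeze_radius_def)
    have "r \<le> cmod z / 2" "r \<le> R - cmod z" unfolding r_def squeeze_radius_def by (rule min.cobounded1, rule min.cobounded2)
    then show "r + r \<le> cmod z" "cmod z + r \<le> R" "r < R" using z by linarith+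
  qed
  have "ball z r \<inter> ball 0 r = {}" by (rule disjoint_balls) (use r in auto)
  moreover have "ball z r \<subseteq> ball 0 R" using r by (intro ball_subset_ball0) auto
  moreover have "ball 0 r \<subseteq> ball (0::complex) R" using r by (intro subset_ball) auto
  ultimately show "0 < squeeze_radius R z" "squeeze_radius R z < R"
    "disjoint_in (ball z (squeeze_radius R z)) (ball 0 (squeeze_radius R z)) (ball 0 R)"
    using r unfolding r_def[symmetric] by (auto simp: disjoint_in_def)
qed

lemma squeeze_constant:
  assumes lc: "locally_constant F" and b: "b \<in> carrier (costalk F)" and x: "x \<in> carrier (disk 0 R)"
    and z: "z \<in> ball 0 R - {0}" "w \<in> ball 0 R - {0}"
  shows "squeeze R b z (squeeze_radius R z) x = squeeze R b w (squeeze_radius R w) x"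
proof (rule connected_local_const[of "ball (0::complex) R - {0}"])
  show "connected (ball (0::complex) R - {0})" by (rule connected_punctured_ball) simp
  show "\<forall>z\<in>ball 0 R - {0}. \<forall>\<^sub>F w in at z within ball 0 R - {0}.
      squeeze R b z (squeeze_radius R z) x = squeeze R b w (squeeze_radius R w) x"
  proof
    fix z assume z: "z \<in> ball (0::complex) R - {0}"
    note r = squeeze_radius[OF z]
    have "squeeze R b z (squeeze_radius R z) x = squeeze R b w (squeeze_radius R w) x"
      if w: "w \<in> ball 0 R - {0}" "dist w z < squeeze_radius R z / 2" for w
    proof -
      note rw = squeeze_radius[OF w(1)]
      \<comment> \<open>Small enough to lie below both radii; halving the radius at \<open>z\<close>
        leaves room for the distance between \<open>w\<close> and \<open>z\<close>, so that the disk
        about \<open>w\<close> fits into the one about \<open>z\<close>.\<close>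
      define e where "e = min (squeeze_radius R z / 2) (squeeze_radius R w)"
      have e: "0 < e" "e \<le> squeeze_radius R z" "e \<le> squeeze_radius R w"
        "e + dist w z \<le> squeeze_radius R z" using r(1) rw(1) w(2) by (auto simp: e_def)
      have sub: "ball w e \<subseteq> ball z (squeeze_radius R z)" using e by (simp add: ball_subset_ball_iff)
      have "squeeze R b z (squeeze_radius R z) x = squeeze R b w e x"
        by (rule squeeze_shrink[OF lc b r e(1,2) sub x])
      also have "\<dots> = squeeze R b w (squeeze_radius R w) x"
        by (rule squeeze_shrink[OF lc b rw e(1,3) _ x, symmetric]) (use e in auto)
      finally show ?thesis .
    qed
    then show "\<forall>\<^sub>F w in at z within ball 0 R - {0}.
      squeeze R b z (squeeze_radius R z) x = squeeze R b w (squeeze_radius R w) x"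
      unfolding eventually_at using r(1) by (intro exI[of _ "squeeze_radius R z / 2"]) auto
  qed
qed (use z in auto)

text \<open>The operator \<open>L\<close> is frozen at a base point \<open>p\<close>, so
  \<open>z\<close> enters only through \<open>mu1 F R a z\<close>. This is holomorphic on the full
  disk including the origin, and \<open>L\<close> is continuous, so the two-point function has no
  principal part.\<close>

lemma locally_constant_mode_zero:
  assumes lc: "locally_constant F" and a: "a \<in> carrier (costalk_weight F \<Delta>)" and b: "b \<in> carrier (costalk_weight F \<Delta>')"
    and n: "n \<ge> 0"
  shows "mode_family F a n b = \<zero>\<^bsub>costalk F\<^esub>"
proof (rule mode_costalk_eqI[OF a b weight_costalk[OF weight_zero]])
  note ac = weight_costalk[OF a] and bc = weight_costalk[OF b]
  fix R \<phi> assume R: "R > 0" and \<phi>: "\<phi> \<in> lcs_dual (disk 0 R)"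
  interpret D: locally_convex_space "disk 0 R" by (rule disk_lcs)
  define p where "p = complex_of_real (R / 2)"
  have p: "p \<in> ball 0 R - {0}" using R by (simp add: p_def)
  define L where "L = squeeze R b p (squeeze_radius R p)"
  note rp = squeeze_radius[OF p]
  have L: "L \<in> lcs_hom (disk 0 R) (disk 0 R)"
  proof -
    have "ball p (squeeze_radius R p) \<subseteq> ball 0 R" using rp(3) by (auto simp: disjoint_in_def)
    from lcs_hom_compose[OF ext_inverse(1)[OF lc rp(1,2) this]
        prod_op_hom_left[OF open_ball open_ball open_ball rp(3) costalk_closed[OF bc rp(1)]]]
    show ?thesis unfolding L_def squeeze_def[abs_def] .
  qed
  have eq: "mu2' R a b z 0 = L (mu1 F R a z)" if z: "z \<in> ball 0 R - {0}" for z
  proof -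
    define r where "r = squeeze_radius R z"
    note rz = squeeze_radius[OF z, folded r_def]
    have sub: "ball z r \<subseteq> ball 0 R" using rz(3) by (auto simp: disjoint_in_def)
    have m: "mu1 F R a z \<in> carrier (disk 0 R)" using z by (intro mu1_closed ac) auto
    have "mu2' R a b z 0 = prod_op F (ball z r) (ball 0 r) (ball 0 R) (place z r a) (b r)"
      using mu2'_eq[OF ac bc rz(1) rz(1) rz(3)] place_0[OF bc rz(1)] by simp
    also have "place z r a = ext_inverse R z r (mu1 F R a z)"
      unfolding mu1_eq[OF ac rz(1) sub] by (rule ext_inverse(2)[OF lc rz(1,2) sub place_closed[OF ac rz(1)], symmetric])
    also have "prod_op F (ball z r) (ball 0 r) (ball 0 R) \<dots> (b r) = squeeze R b z r (mu1 F R a z)"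
      by (simp add: squeeze_def)
    also have "\<dots> = L (mu1 F R a z)"
      unfolding L_def r_def by (rule squeeze_constant[OF lc bc m z p])
    finally show ?thesis .
  qed
  have "res_coeff (R / 2) (\<lambda>z. \<phi> (mu2' R a b z 0)) n = res_coeff (R / 2) (\<lambda>z. \<phi> (L (mu1 F R a z))) n"
    by (rule res_coeff_cong) (use R eq in auto)
  also have "\<dots> = 0"
    by (rule res_coeff_holomorphic_nonneg[OF mu1_dual_holomorphic[OF R homogeneousI[OF a] lcs_hom_compose[OF L \<phi>]]])
      (use R n in auto)
  finally show "res_coeff (R / 2) (\<lambda>z. \<phi> (mu2' R a b z 0)) n = \<phi> (\<zero>\<^bsub>costalk F\<^esub> R)"
    by (simp add: costalk_ops R D.dual_zero[OF \<phi>])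
qed

end

section \<open>Direct sums\<close>

text \<open>Abstracts the weight spaces of the costalk: subspaces of one space \<open>C\<close> that
  inherit its operations. The graded space \<open>V\<close> built from them is their external direct
  sum.\<close>

locale graded_space = complex_space C for C :: "(complex, 'v) module" (structure) +
  fixes W :: "int \<Rightarrow> (complex, 'v) module"
  assumes W_eq: "W i = C\<lparr>carrier := carrier (W i)\<rparr>"
    and W_sub: "x \<in> carrier (W i) \<Longrightarrow> x \<in> carrier C"
    and W_zero: "\<zero> \<in> carrier (W i)"
    and W_add: "x \<in> carrier (W i) \<Longrightarrow> y \<in> carrier (W i) \<Longrightarrow> x \<oplus> y \<in> carrier (W i)"
    and W_scale: "x \<in> carrier (W i) \<Longrightarrow> c \<odot> x \<in> carrier (W i)"
begin

abbreviation "V \<equiv> direct_sum W"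
abbreviation "incl \<equiv> summand_incl W"

lemma W_ops: "\<zero>\<^bsub>W i\<^esub> = \<zero>" "x \<oplus>\<^bsub>W i\<^esub> y = x \<oplus> y" "c \<odot>\<^bsub>W i\<^esub> x = c \<odot> x"
  by (subst W_eq, simp)+

lemma V_carrier: "v \<in> carrier V \<longleftrightarrow> (\<forall>i. v i \<in> carrier (W i)) \<and> finite {i. v i \<noteq> \<zero>}"
  by (simp add: direct_sum_def W_ops)

lemma V_ops: "\<zero>\<^bsub>V\<^esub> i = \<zero>" "(u \<oplus>\<^bsub>V\<^esub> v) i = u i \<oplus> v i" "(c \<odot>\<^bsub>V\<^esub> v) i = c \<odot> v i"
  by (simp_all add: direct_sum_def W_ops)

lemma V_comp: "v \<in> carrier V \<Longrightarrow> v i \<in> carrier (W i)" "v \<in> carrier V \<Longrightarrow> v i \<in> carrier C"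
  by (auto simp: V_carrier intro: W_sub[of _ i])

lemma V_supp: "v \<in> carrier V \<Longrightarrow> finite {i. v i \<noteq> \<zero>}"
  by (simp add: V_carrier)

lemma incl_apply: "incl i x j = (if j = i then x else \<zero>)"
  by (simp add: summand_incl_def W_ops)

lemma incl_closed [simp]: "x \<in> carrier (W i) \<Longrightarrow> incl i x \<in> carrier V"
  by (auto simp: V_carrier incl_apply W_zero intro: finite_subset[of _ "{i}"])

lemma incl_zero [simp]: "incl i \<zero> = \<zero>\<^bsub>V\<^esub>"
  by (auto simp: fun_eq_iff incl_apply V_ops)

lemma W_space: "complex_space (W i)"
  unfolding complex_space_def
proof (rule moduleI)
  show "cring complex_ring" by (rule cring_from_type_algebra)
  show "abelian_group (W i)"
  proof (rule abelian_groupI)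
    fix x assume x: "x \<in> carrier (W i)"
    have "(-1) \<odot> x \<oplus> x = \<zero>"
      using scale_add_left[OF W_sub[OF x], of "-1" 1] W_sub[OF x] by simp
    then show "\<exists>y\<in>carrier (W i). y \<oplus>\<^bsub>W i\<^esub> x = \<zero>\<^bsub>W i\<^esub>" using x W_scale by (auto simp: W_ops)
  next
    fix x y z assume xyz: "x \<in> carrier (W i)" "y \<in> carrier (W i)" "z \<in> carrier (W i)"
    show "x \<oplus>\<^bsub>W i\<^esub> y \<oplus>\<^bsub>W i\<^esub> z = x \<oplus>\<^bsub>W i\<^esub> (y \<oplus>\<^bsub>W i\<^esub> z)" "x \<oplus>\<^bsub>W i\<^esub> y = y \<oplus>\<^bsub>W i\<^esub> x"
      using xyz[THEN W_sub] by (simp_all only: W_ops a_assoc) (rule a_comm)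
  qed (auto simp: W_ops W_zero W_add dest: W_sub)
  show "a \<odot>\<^bsub>W i\<^esub> (x \<oplus>\<^bsub>W i\<^esub> y) = a \<odot>\<^bsub>W i\<^esub> x \<oplus>\<^bsub>W i\<^esub> a \<odot>\<^bsub>W i\<^esub> y"
    if "x \<in> carrier (W i)" "y \<in> carrier (W i)" for a x y
    using that[THEN W_sub] by (simp add: W_ops scale_add_right)
qed (auto simp: W_ops W_scale scale_add_left scale_scale dest: W_sub)

lemma W_finsum:
  assumes "finite I" "\<And>i. i \<in> I \<Longrightarrow> f i \<in> carrier (W j)"
  shows "finsum (W j) f I = finsum C f I" "finsum C f I \<in> carrier (W j)"
proof -
  interpret W: complex_space "W j" by (rule W_space)
  have "finsum (W j) f I = finsum C f I \<and> finsum C f I \<in> carrier (W j)"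
    using assms
  proof (induction I)
    case (insert i I)
    then have "f \<in> I \<rightarrow> carrier (W j)" "f \<in> I \<rightarrow> carrier C" "f i \<in> carrier (W j)" "f i \<in> carrier C"
      using W_sub by auto
    with insert show ?case by (simp add: W_ops W_add)
  qed (simp add: W_ops W_zero)
  then show "finsum (W j) f I = finsum C f I" "finsum C f I \<in> carrier (W j)" by auto
qed

lemma V_space: "complex_space V"
  unfolding complex_space_def
proof (rule moduleI)
  have add: "u \<oplus>\<^bsub>V\<^esub> v \<in> carrier V" if "u \<in> carrier V" "v \<in> carrier V" for u v
  proof -
    have "{i. u i \<oplus> v i \<noteq> \<zero>} \<subseteq> {i. u i \<noteq> \<zero>} \<union> {i. v i \<noteq> \<zero>}" by auto
    then show ?thesis using that by (auto simp: V_carrier V_ops W_add intro: finite_subset)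
  qed
  have scale: "c \<odot>\<^bsub>V\<^esub> v \<in> carrier V" if "v \<in> carrier V" for c v
  proof -
    have "{i. c \<odot> v i \<noteq> \<zero>} \<subseteq> {i. v i \<noteq> \<zero>}" by auto
    then show ?thesis using that by (auto simp: V_carrier V_ops W_scale intro: finite_subset)
  qed
  note simps = fun_eq_iff V_ops V_comp
  show "cring complex_ring" by (rule cring_from_type_algebra)
  show "abelian_group V"
  proof (rule abelian_groupI)
    fix v assume v: "v \<in> carrier V"
    have "(-1) \<odot> v i \<oplus> v i = \<zero>" for i
      using scale_add_left[OF V_comp(2)[OF v], of "-1" 1] V_comp(2)[OF v] by simp
    then have "(-1) \<odot>\<^bsub>V\<^esub> v \<oplus>\<^bsub>V\<^esub> v = \<zero>\<^bsub>V\<^esub>" by (simp add: simps)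
    then show "\<exists>y\<in>carrier V. y \<oplus>\<^bsub>V\<^esub> v = \<zero>\<^bsub>V\<^esub>" using scale[OF v] by blast
  next
    show "\<zero>\<^bsub>V\<^esub> \<in> carrier V" by (simp add: V_carrier V_ops W_zero)
  qed (auto simp: simps add a_ac)
  show "a \<odot>\<^bsub>V\<^esub> x \<in> carrier V" if "x \<in> carrier V" for a x by (rule scale[OF that])
qed (auto simp: fun_eq_iff V_ops V_comp scale_add_left scale_add_right scale_scale)

sublocale V: complex_space V by (rule V_space)

lemma incl_add: "incl i x \<oplus>\<^bsub>V\<^esub> incl i y = incl i (x \<oplus> y)"
  by (auto simp: fun_eq_iff incl_apply V_ops)

lemma incl_scale: "c \<odot>\<^bsub>V\<^esub> incl i x = incl i (c \<odot> x)"
  by (auto simp: fun_eq_iff incl_apply V_ops)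

lemma incl_diff:
  assumes "x \<in> carrier (W i)" "y \<in> carrier (W i)"
  shows "incl i x \<ominus>\<^bsub>V\<^esub> incl i y = incl i (x \<ominus> y)" "x \<ominus> y \<in> carrier (W i)"
  using assms by (simp_all add: V.diff_eq_scale diff_eq_scale W_sub incl_add incl_scale W_add W_scale)

text \<open>Finite support makes every element a finite sum of homogeneous ones; one component is
  split off at a time.\<close>

lemma V_induct [consumes 1, case_names incl add]:
  assumes v: "v \<in> carrier V"
    and incl: "\<And>i x. x \<in> carrier (W i) \<Longrightarrow> P (incl i x)"
    and add: "\<And>u v. \<lbrakk>u \<in> carrier V; v \<in> carrier V; P u; P v\<rbrakk> \<Longrightarrow> P (u \<oplus>\<^bsub>V\<^esub> v)"
  shows "P v"
proof -
  have "P v" if "finite I" "v \<in> carrier V" "{i. v i \<noteq> \<zero>} \<subseteq> I" for I v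
    using that
  proof (induction I arbitrary: v)
    case empty
    then have "v = incl 0 \<zero>" by (auto simp: fun_eq_iff V_ops)
    then show ?case using incl[OF W_zero] by simp
  next
    case (insert i I)
    define u where "u = v(i := \<zero>)"
    have "finite {j. u j \<noteq> \<zero>}" by (rule finite_subset[OF _ insert.hyps(1)]) (use insert.prems in \<open>auto simp: u_def\<close>)
    then have u: "u \<in> carrier V" using insert.prems(1) by (auto simp: V_carrier u_def W_zero)
    have "P u" by (rule insert.IH[OF u]) (use insert.prems in \<open>auto simp: u_def\<close>)
    moreover have vi: "v i \<in> carrier (W i)" by (rule V_comp(1)[OF insert.prems(1)])
    moreover have "v = incl i (v i) \<oplus>\<^bsub>V\<^esub> u"
      using insert.prems(1) by (auto simp: fun_eq_iff V_ops incl_apply u_def V_comp)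
    ultimately show ?case using add[OF incl_closed u incl] by metis
  qed
  from this[OF V_supp[OF v] v] show ?thesis by simp
qed

lemma V_finsum_incl:
  assumes "finite I" "\<And>i. i \<in> I \<Longrightarrow> x i \<in> carrier (W i)"
  shows "(\<Oplus>\<^bsub>V\<^esub>i\<in>I. incl i (x i)) j = (if j \<in> I then x j else \<zero>)"
  using assms
proof (induction I)
  case (insert i I)
  have "x j \<in> carrier C" if "j \<in> insert i I" using insert.prems[OF that] W_sub by blast
  moreover have eq: "(\<Oplus>\<^bsub>V\<^esub>i\<in>insert i I. incl i (x i)) = incl i (x i) \<oplus>\<^bsub>V\<^esub> (\<Oplus>\<^bsub>V\<^esub>i\<in>I. incl i (x i))"
    by (rule V.finsum_insert) (use insert in auto)
  moreover have IH: "(\<Oplus>\<^bsub>V\<^esub>i\<in>I. incl i (x i)) j = (if j \<in> I then x j else \<zero>)"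
    by (rule insert.IH) (use insert in auto)
  ultimately show ?case using insert.hyps unfolding eq V_ops(2) IH by (auto simp: incl_apply)
qed (simp add: V_ops)

lemma internal_direct_sum_incl: "internal_direct_sum V (\<lambda>i. incl i ` carrier (W i))"
  unfolding internal_direct_sum_def
proof (intro conjI allI ballI)
  fix i
  show "submodule (incl i ` carrier (W i)) complex_ring V"
  proof (rule V.submoduleI)
    show "\<zero>\<^bsub>V\<^esub> \<in> incl i ` carrier (W i)" using W_zero by (metis incl_zero imageI)
    show "\<ominus>\<^bsub>V\<^esub> a \<in> incl i ` carrier (W i)" if "a \<in> incl i ` carrier (W i)" for a
      using that W_scale by (auto simp: V.minus_eq_scale incl_scale)
  qed (auto simp: incl_add incl_scale W_add W_scale)
next
  fix v assume v: "v \<in> carrier V"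
  have zero_iff: "incl i x = \<zero>\<^bsub>V\<^esub> \<longleftrightarrow> x = \<zero>" for i x
    by (auto simp: fun_eq_iff incl_apply V_ops)
  show "\<exists>!u. (\<forall>i. u i \<in> incl i ` carrier (W i)) \<and> finite {i. u i \<noteq> \<zero>\<^bsub>V\<^esub>} \<and>
      v = (\<Oplus>\<^bsub>V\<^esub>i\<in>{i. u i \<noteq> \<zero>\<^bsub>V\<^esub>}. u i)"
  proof (rule ex1I[of _ "\<lambda>i. incl i (v i)"])
    have "v = (\<Oplus>\<^bsub>V\<^esub>i\<in>{i. v i \<noteq> \<zero>}. incl i (v i))"
      using V_finsum_incl[OF V_supp[OF v], of v] V_comp(1)[OF v] by (auto simp: fun_eq_iff)
    then show "(\<forall>i. incl i (v i) \<in> incl i ` carrier (W i)) \<and> finite {i. incl i (v i) \<noteq> \<zero>\<^bsub>V\<^esub>} \<and>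
      v = (\<Oplus>\<^bsub>V\<^esub>i\<in>{i. incl i (v i) \<noteq> \<zero>\<^bsub>V\<^esub>}. incl i (v i))"
      using v V_supp V_comp by (auto simp: zero_iff)
  next
    fix u assume u: "(\<forall>i. u i \<in> incl i ` carrier (W i)) \<and> finite {i. u i \<noteq> \<zero>\<^bsub>V\<^esub>} \<and>
      v = (\<Oplus>\<^bsub>V\<^esub>i\<in>{i. u i \<noteq> \<zero>\<^bsub>V\<^esub>}. u i)"
    then have "\<forall>i. \<exists>x. x \<in> carrier (W i) \<and> u i = incl i x" by auto
    then obtain x where x: "\<And>i. x i \<in> carrier (W i)" "\<And>i. u i = incl i (x i)" by metis
    then have ux: "u = (\<lambda>i. incl i (x i))" by auto
    have fin: "finite {i. x i \<noteq> \<zero>}" and v: "v = (\<Oplus>\<^bsub>V\<^esub>i\<in>{i. x i \<noteq> \<zero>}. incl i (x i))"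
      using u unfolding ux zero_iff by auto
    have "v = x" unfolding v using V_finsum_incl[OF fin x(1)] by (auto simp: fun_eq_iff)
    then show "u = (\<lambda>i. incl i (v i))" by (simp add: ux)
  qed
qed

end


section \<open>Assembling a graded vertex algebra from its homogeneous components\<close>

locale graded_modes = graded_space C W for C :: "(complex, 'v) module" (structure) and W +
  fixes T :: "'v \<Rightarrow> 'v" and md :: "'v \<Rightarrow> int \<Rightarrow> 'v \<Rightarrow> 'v" and vac :: 'v
  assumes vac_closed: "vac \<in> carrier (W 0)"
    and T_closed: "a \<in> carrier (W i) \<Longrightarrow> T a \<in> carrier (W (i + 1))"
    and T_add: "\<lbrakk>a \<in> carrier (W i); b \<in> carrier (W i)\<rbrakk> \<Longrightarrow> T (a \<oplus> b) = T a \<oplus> T b"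
    and T_scale: "a \<in> carrier (W i) \<Longrightarrow> T (c \<odot> a) = c \<odot> T a"
    and md_closed: "\<lbrakk>a \<in> carrier (W i); b \<in> carrier (W j)\<rbrakk> \<Longrightarrow> md a n b \<in> carrier (W (i + j - n - 1))"
    and md_add_left: "\<lbrakk>a \<in> carrier (W i); a' \<in> carrier (W i); b \<in> carrier (W j)\<rbrakk> \<Longrightarrow>
      md (a \<oplus> a') n b = md a n b \<oplus> md a' n b"
    and md_scale_left: "\<lbrakk>a \<in> carrier (W i); b \<in> carrier (W j)\<rbrakk> \<Longrightarrow> md (c \<odot> a) n b = c \<odot> md a n b"
    and md_add_right: "\<lbrakk>a \<in> carrier (W i); b \<in> carrier (W j); b' \<in> carrier (W j)\<rbrakk> \<Longrightarrow>
      md a n (b \<oplus> b') = md a n b \<oplus> md a n b'"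
    and md_scale_right: "\<lbrakk>a \<in> carrier (W i); b \<in> carrier (W j)\<rbrakk> \<Longrightarrow> md a n (c \<odot> b) = c \<odot> md a n b"
begin

text \<open>The formulas of \<open>vertex_algebra_of\<close> over abstract homogeneous operations,
  so that the extension to sums can be carried out without analysis.\<close>

definition assembled :: "(int \<Rightarrow> 'v) vertex_data" where
  "assembled = \<lparr>va_space = V, va_vacuum = incl 0 vac, va_transl = (\<lambda>v i. T (v (i - 1))),
     va_mode = (\<lambda>u n v j. \<Oplus>\<^bsub>W j\<^esub>i\<in>{i. u i \<noteq> \<zero>\<^bsub>W i\<^esub>}. md (u i) n (v (j + n + 1 - i)))\<rparr>"

abbreviation "Tr \<equiv> va_transl assembled"
abbreviation "Md \<equiv> va_mode assembled"

lemma assembled_space [simp]: "va_space assembled = V"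
  and assembled_vacuum [simp]: "va_vacuum assembled = incl 0 vac"
  and Tr_apply: "Tr v i = T (v (i - 1))"
  by (simp_all add: assembled_def)

lemma T_zero: "T \<zero> = \<zero>"
  using T_scale[OF W_zero, of 0] W_sub[OF T_closed[OF W_zero[of 0]]] by simp

lemma md_zero_left: "b \<in> carrier (W j) \<Longrightarrow> md \<zero> n b = \<zero>"
  using md_scale_left[OF W_zero[of 0], where c = 0 and n = n] W_sub[OF md_closed[OF W_zero[of 0]]] by simp

lemma md_zero_right: "a \<in> carrier (W j) \<Longrightarrow> md a n \<zero> = \<zero>"
  using md_scale_right[OF _ W_zero[of 0], where c = 0 and n = n] W_sub[OF md_closed[OF _ W_zero[of 0]]] by simp

lemma md_term_closed:
  assumes "u \<in> carrier V" "v \<in> carrier V"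
  shows "md (u i) n (v (j + n + 1 - i)) \<in> carrier (W j)"
  using md_closed[OF V_comp(1)[OF assms(1), of i] V_comp(1)[OF assms(2), of "j + n + 1 - i"], of n] by simp

text \<open>The index set may be any finite set containing the support of \<open>u\<close>, because
  modes of 0 vanish. This puts sums over different supports on a common index set.\<close>

lemma Md_apply:
  assumes u: "u \<in> carrier V" and v: "v \<in> carrier V" and I: "finite I" "{i. u i \<noteq> \<zero>} \<subseteq> I"
  shows "Md u n v j = (\<Oplus>i\<in>I. md (u i) n (v (j + n + 1 - i)))"
proof -
  note cl = md_term_closed[OF u v] W_sub[OF md_term_closed[OF u v]]
  have "Md u n v j = (\<Oplus>i\<in>{i. u i \<noteq> \<zero>}. md (u i) n (v (j + n + 1 - i)))"
    using W_finsum(1)[OF V_supp[OF u], of "\<lambda>i. md (u i) n (v (j + n + 1 - i))" j] cl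
    by (simp add: assembled_def W_ops)
  also have "\<dots> = (\<Oplus>i\<in>I. md (u i) n (v (j + n + 1 - i)))"
    by (rule add.finprod_mono_neutral_cong_left[OF I]) (use cl md_zero_left[OF V_comp(1)[OF v]] in auto)
  finally show ?thesis .
qed

lemma Tr_closed: "v \<in> carrier V \<Longrightarrow> Tr v \<in> carrier V"
proof -
  assume v: "v \<in> carrier V"
  have "{i. Tr v i \<noteq> \<zero>} \<subseteq> (\<lambda>i. i + 1) ` {i. v i \<noteq> \<zero>}"
  proof
    fix i assume "i \<in> {i. Tr v i \<noteq> \<zero>}"
    then have "v (i - 1) \<noteq> \<zero>" using T_zero by (auto simp: Tr_apply)
    then show "i \<in> (\<lambda>i. i + 1) ` {i. v i \<noteq> \<zero>}" by (intro image_eqI[of _ _ "i - 1"]) auto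
  qed
  moreover have "Tr v i \<in> carrier (W i)" for i using T_closed[OF V_comp(1)[OF v, of "i - 1"]] by (simp add: Tr_apply)
  ultimately show ?thesis using V_supp[OF v] by (auto simp: V_carrier intro: finite_subset)
qed

lemma Tr_linear: "linear_on V Tr"
  unfolding linear_on_def
  by (auto simp: Tr_closed fun_eq_iff Tr_apply V_ops T_add[OF V_comp(1) V_comp(1)] T_scale[OF V_comp(1)])

lemma Tr_incl: "Tr (incl i a) = incl (i + 1) (T a)"
  by (auto simp: fun_eq_iff Tr_apply incl_apply T_zero)

lemma Md_closed:
  assumes u: "u \<in> carrier V" and v: "v \<in> carrier V" shows "Md u n v \<in> carrier V"
proof -
  note eq = Md_apply[OF u v V_supp[OF u] subset_refl]
  have "Md u n v j \<in> carrier (W j)" for j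
    unfolding eq by (rule W_finsum(2)[OF V_supp[OF u] md_term_closed[OF u v]])
  \<comment> \<open>A component of weight \<open>j\<close> can be nonzero only if weights
    \<open>i\<close> and \<open>k\<close> from the two supports satisfy
    \<open>j = i + k - n - 1\<close>.\<close>
  moreover have "{j. Md u n v j \<noteq> \<zero>} \<subseteq> (\<lambda>(i, k). i + k - n - 1) ` ({i. u i \<noteq> \<zero>} \<times> {i. v i \<noteq> \<zero>})"
  proof
    fix j assume j: "j \<in> {j. Md u n v j \<noteq> \<zero>}"
    have "\<exists>i. u i \<noteq> \<zero> \<and> v (j + n + 1 - i) \<noteq> \<zero>"
    proof (rule ccontr)
      assume "\<not> ?thesis"
      then have "md (u i) n (v (j + n + 1 - i)) = \<zero>" if "u i \<noteq> \<zero>" for i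
        using that md_zero_right[OF V_comp(1)[OF u]] by metis
      then have "Md u n v j = \<zero>" unfolding eq by (intro add.finprod_one_eqI) auto
      then show False using j by simp
    qed
    then obtain i where "u i \<noteq> \<zero>" "v (j + n + 1 - i) \<noteq> \<zero>" by blast
    then show "j \<in> (\<lambda>(i, k). i + k - n - 1) ` ({i. u i \<noteq> \<zero>} \<times> {i. v i \<noteq> \<zero>})"
      by (intro image_eqI[of _ _ "(i, j + n + 1 - i)"]) auto
  qed
  ultimately show ?thesis
    using V_supp[OF u] V_supp[OF v] by (auto simp: V_carrier intro: finite_subset)
qed

lemma Md_add_left:
  assumes u: "u \<in> carrier V" "u' \<in> carrier V" and v: "v \<in> carrier V"
  shows "Md (u \<oplus>\<^bsub>V\<^esub> u') n v = Md u n v \<oplus>\<^bsub>V\<^esub> Md u' n v"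
proof
  fix j
  let ?I = "{i. u i \<noteq> \<zero>} \<union> {i. u' i \<noteq> \<zero>}"
  have I: "finite ?I" using u V_supp by auto
  note cl = md_term_closed[OF u(1) v, THEN W_sub] md_term_closed[OF u(2) v, THEN W_sub]
  have "Md (u \<oplus>\<^bsub>V\<^esub> u') n v j = (\<Oplus>i\<in>?I. md ((u \<oplus>\<^bsub>V\<^esub> u') i) n (v (j + n + 1 - i)))"
    by (rule Md_apply[OF _ v I]) (use u in \<open>auto simp: V_ops\<close>)
  also have "\<dots> = (\<Oplus>i\<in>?I. md (u i) n (v (j + n + 1 - i)) \<oplus> md (u' i) n (v (j + n + 1 - i)))"
    using md_add_left[OF V_comp(1)[OF u(1)] V_comp(1)[OF u(2)] V_comp(1)[OF v]] by (simp add: V_ops)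
  also have "\<dots> = Md u n v j \<oplus> Md u' n v j"
    unfolding Md_apply[OF u(1) v I Un_upper1] Md_apply[OF u(2) v I Un_upper2]
    by (rule finsum_addf) (use cl in auto)
  finally show "Md (u \<oplus>\<^bsub>V\<^esub> u') n v j = (Md u n v \<oplus>\<^bsub>V\<^esub> Md u' n v) j" by (simp add: V_ops)
qed

lemma Md_add_right:
  assumes u: "u \<in> carrier V" and v: "v \<in> carrier V" "v' \<in> carrier V"
  shows "Md u n (v \<oplus>\<^bsub>V\<^esub> v') = Md u n v \<oplus>\<^bsub>V\<^esub> Md u n v'"
proof
  fix j
  note I = V_supp[OF u] subset_refl
  note cl = md_term_closed[OF u v(1), THEN W_sub] md_term_closed[OF u v(2), THEN W_sub]
  show "Md u n (v \<oplus>\<^bsub>V\<^esub> v') j = (Md u n v \<oplus>\<^bsub>V\<^esub> Md u n v') j"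
    unfolding V_ops Md_apply[OF u v(1) I] Md_apply[OF u v(2) I] Md_apply[OF u V.a_closed[OF v] I]
      md_add_right[OF V_comp(1)[OF u] V_comp(1)[OF v(1)] V_comp(1)[OF v(2)]]
    by (rule finsum_addf) (use cl in auto)
qed

lemma Md_scale_left:
  assumes u: "u \<in> carrier V" and v: "v \<in> carrier V"
  shows "Md (c \<odot>\<^bsub>V\<^esub> u) n v = c \<odot>\<^bsub>V\<^esub> Md u n v"
proof
  fix j
  note I = V_supp[OF u] subset_refl
  have I': "{i. (c \<odot>\<^bsub>V\<^esub> u) i \<noteq> \<zero>} \<subseteq> {i. u i \<noteq> \<zero>}" by (auto simp: V_ops)
  note cl = md_term_closed[OF u v, THEN W_sub]
  show "Md (c \<odot>\<^bsub>V\<^esub> u) n v j = (c \<odot>\<^bsub>V\<^esub> Md u n v) j"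
    unfolding V_ops(3) Md_apply[OF u v I] Md_apply[OF V.scale_closed[OF u] v V_supp[OF u] I']
      md_scale_left[OF V_comp(1)[OF u] V_comp(1)[OF v]]
    by (rule finsum_smult_ldistr[symmetric]) (use V_supp[OF u] cl in auto)
qed

lemma Md_scale_right:
  assumes u: "u \<in> carrier V" and v: "v \<in> carrier V"
  shows "Md u n (c \<odot>\<^bsub>V\<^esub> v) = c \<odot>\<^bsub>V\<^esub> Md u n v"
proof
  fix j
  note I = V_supp[OF u] subset_refl
  note cl = md_term_closed[OF u v, THEN W_sub]
  show "Md u n (c \<odot>\<^bsub>V\<^esub> v) j = (c \<odot>\<^bsub>V\<^esub> Md u n v) j"
    unfolding V_ops(3) Md_apply[OF u v I] Md_apply[OF u V.scale_closed[OF v] I]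
      md_scale_right[OF V_comp(1)[OF u] V_comp(1)[OF v]]
    by (rule finsum_smult_ldistr[symmetric]) (use V_supp[OF u] cl in auto)
qed

lemma Md_incl:
  assumes a: "a \<in> carrier (W i)" and b: "b \<in> carrier (W j)"
  shows "Md (incl i a) n (incl j b) = incl (i + j - n - 1) (md a n b)"
proof
  fix k
  have "Md (incl i a) n (incl j b) k = (\<Oplus>l\<in>{i}. md (incl i a l) n (incl j b (k + n + 1 - l)))"
    by (rule Md_apply) (use a b in \<open>auto simp: incl_apply\<close>)
  also have "\<dots> = md a n (incl j b (k + n + 1 - i))"
    using W_sub[OF md_closed[OF a b, of n]] md_zero_right[OF a] by (simp add: incl_apply)
  also have "\<dots> = incl (i + j - n - 1) (md a n b) k"
    using md_zero_right[OF a, of n] by (auto simp: incl_apply algebra_simps)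
  finally show "Md (incl i a) n (incl j b) k = incl (i + j - n - 1) (md a n b) k" .
qed

end

lemma funpow_mult_diff_zero:
  assumes "complex_space V"
  shows "(mult_diff V ^^ N) (\<lambda>m n. \<zero>\<^bsub>V\<^esub>) = (\<lambda>m n. \<zero>\<^bsub>V\<^esub>)"
proof -
  interpret complex_space V by (rule assms)
  show ?thesis by (induction N) (simp_all add: mult_diff_def fun_eq_iff)
qed

text \<open>Different pairs of homogeneous elements come with different exponents; this permits
  passing to their maximum.\<close>

lemma funpow_mult_diff_mono:
  assumes "complex_space V" "\<And>m n. (mult_diff V ^^ N) f m n = \<zero>\<^bsub>V\<^esub>" "N \<le> M"
  shows "(mult_diff V ^^ M) f m n = \<zero>\<^bsub>V\<^esub>"
proof -
  have "(mult_diff V ^^ N) f = (\<lambda>m n. \<zero>\<^bsub>V\<^esub>)" using assms(2) by blast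
  moreover have "(mult_diff V ^^ M) f = (mult_diff V ^^ (M - N)) ((mult_diff V ^^ N) f)"
    using assms(3) by (metis comp_apply funpow_add le_add_diff_inverse2)
  ultimately show ?thesis using funpow_mult_diff_zero[OF assms(1)] by simp
qed

lemma funpow_mult_diff_add:
  assumes "complex_space V" "\<And>m n. f m n \<in> carrier V" "\<And>m n. g m n \<in> carrier V"
  shows "(mult_diff V ^^ N) (\<lambda>m n. f m n \<oplus>\<^bsub>V\<^esub> g m n) m n =
    (mult_diff V ^^ N) f m n \<oplus>\<^bsub>V\<^esub> (mult_diff V ^^ N) g m n"
  using assms(2,3)
proof (induction N arbitrary: f g)
  case (Suc N)
  interpret complex_space V by (rule assms)
  have "mult_diff V (\<lambda>m n. f m n \<oplus>\<^bsub>V\<^esub> g m n) = (\<lambda>m n. mult_diff V f m n \<oplus>\<^bsub>V\<^esub> mult_diff V g m n)"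
    using Suc.prems by (simp add: fun_eq_iff mult_diff_def diff_eq_scale scale_add_right a_ac)
  moreover have "mult_diff V f m n \<in> carrier V" "mult_diff V g m n \<in> carrier V" for m n
    using Suc.prems by (simp_all add: mult_diff_def)
  ultimately show ?case
    using Suc.IH[of "mult_diff V f" "mult_diff V g"] by (simp add: funpow_Suc_right del: funpow.simps)
qed simp

section \<open>Commutators of fields on the direct sum, and verification of the axioms\<close>

context graded_modes
begin

definition commutator :: "'v \<Rightarrow> 'v \<Rightarrow> 'v \<Rightarrow> int \<Rightarrow> int \<Rightarrow> 'v" where
  "commutator a b c m n = md a (- m - 1) (md b (- n - 1) c) \<ominus> md b (- n - 1) (md a (- m - 1) c)"

lemma commutator_closed:
  assumes "a \<in> carrier (W i)" "b \<in> carrier (W j)" "c \<in> carrier (W k)"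
  shows "commutator a b c m n \<in> carrier (W (i + j + k + m + n))"
proof -
  have "md a (- m - 1) (md b (- n - 1) c) \<in> carrier (W (i + j + k + m + n))"
    using md_closed[OF assms(1) md_closed[OF assms(2,3), of "- n - 1"], of "- m - 1"] by (simp add: algebra_simps)
  moreover have "md b (- n - 1) (md a (- m - 1) c) \<in> carrier (W (i + j + k + m + n))"
    using md_closed[OF assms(2) md_closed[OF assms(1,3), of "- m - 1"], of "- n - 1"] by (simp add: algebra_simps)
  ultimately show ?thesis unfolding commutator_def by (rule incl_diff(2))
qed

abbreviation "Fld \<equiv> va_field assembled"
abbreviation "Com \<equiv> va_commutator assembled"

lemma Fld_closed: "u \<in> carrier V \<Longrightarrow> v \<in> carrier V \<Longrightarrow> Fld u m v \<in> carrier V"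
  by (simp add: va_field_def Md_closed)

lemma Fld_incl:
  assumes "a \<in> carrier (W i)" "b \<in> carrier (W j)"
  shows "Fld (incl i a) m (incl j b) = incl (i + j + m) (md a (- m - 1) b)"
    "md a (- m - 1) b \<in> carrier (W (i + j + m))"
proof -
  have "i + j - (- m - 1) - 1 = i + j + m" by simp
  then show "Fld (incl i a) m (incl j b) = incl (i + j + m) (md a (- m - 1) b)"
    "md a (- m - 1) b \<in> carrier (W (i + j + m))"
    using Md_incl[OF assms, of "- m - 1"] md_closed[OF assms, of "- m - 1"] unfolding va_field_def by metis+
qed

lemma Com_incl:
  assumes a: "a \<in> carrier (W i)" and b: "b \<in> carrier (W j)" and c: "c \<in> carrier (W k)"
  shows "Com (incl i a) (incl j b) (incl k c) m n = incl (i + j + k + m + n) (commutator a b c m n)"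
proof -
  have s: "i + (j + k + n) + m = i + j + k + m + n" "j + (i + k + m) + n = i + j + k + m + n" by simp_all
  show ?thesis
    unfolding va_commutator_def assembled_space Fld_incl(1)[OF b c] Fld_incl(1)[OF a c]
      Fld_incl(1)[OF a Fld_incl(2)[OF b c]] Fld_incl(1)[OF b Fld_incl(2)[OF a c]] s
    unfolding commutator_def
    by (rule incl_diff(1)) (use Fld_incl(2)[OF a Fld_incl(2)[OF b c, of n], of m]
      Fld_incl(2)[OF b Fld_incl(2)[OF a c, of m], of n] in \<open>simp_all add: s\<close>)
qed

lemma Com_closed:
  "\<lbrakk>a \<in> carrier V; b \<in> carrier V; c \<in> carrier V\<rbrakk> \<Longrightarrow> Com a b c m n \<in> carrier V"
  by (simp add: va_commutator_def Fld_closed)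

lemma Fld_add:
  "\<lbrakk>u \<in> carrier V; u' \<in> carrier V; v \<in> carrier V\<rbrakk> \<Longrightarrow> Fld (u \<oplus>\<^bsub>V\<^esub> u') m v = Fld u m v \<oplus>\<^bsub>V\<^esub> Fld u' m v"
  "\<lbrakk>u \<in> carrier V; v \<in> carrier V; v' \<in> carrier V\<rbrakk> \<Longrightarrow> Fld u m (v \<oplus>\<^bsub>V\<^esub> v') = Fld u m v \<oplus>\<^bsub>V\<^esub> Fld u m v'"
  by (simp_all add: va_field_def Md_add_left Md_add_right)

lemma Com_add:
  assumes "a \<in> carrier V" "b \<in> carrier V" "c \<in> carrier V"
  shows "a' \<in> carrier V \<Longrightarrow> Com (a \<oplus>\<^bsub>V\<^esub> a') b c m n = Com a b c m n \<oplus>\<^bsub>V\<^esub> Com a' b c m n"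
    and "b' \<in> carrier V \<Longrightarrow> Com a (b \<oplus>\<^bsub>V\<^esub> b') c m n = Com a b c m n \<oplus>\<^bsub>V\<^esub> Com a b' c m n"
    and "c' \<in> carrier V \<Longrightarrow> Com a b (c \<oplus>\<^bsub>V\<^esub> c') m n = Com a b c m n \<oplus>\<^bsub>V\<^esub> Com a b c' m n"
  using assms
  by (simp_all add: va_commutator_def Fld_add Fld_closed V.diff_eq_scale V.scale_add_right V.a_ac)

text \<open>For a homogeneous commutator the value at exponents \<open>m\<close> and
  \<open>n\<close> has weight \<open>s + m + n\<close>. Each multiplication by \<open>z - w\<close>
  lowers one exponent in every term, hence the offset \<open>s\<close> by 1.\<close>

lemma funpow_mult_diff_incl:
  assumes "\<And>m n. g m n \<in> carrier (W (s + m + n))"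
  shows "(mult_diff V ^^ N) (\<lambda>m n. incl (s + m + n) (g m n)) m n =
    incl (s - int N + m + n) ((mult_diff C ^^ N) g m n)"
  using assms
proof (induction N arbitrary: g s)
  case (Suc N)
  have g: "g (m - 1) n \<in> carrier (W (s - 1 + m + n))" "g m (n - 1) \<in> carrier (W (s - 1 + m + n))" for m n
    using Suc.prems[of "m - 1" n] Suc.prems[of m "n - 1"] by (simp_all add: algebra_simps)
  have s: "s + (m - 1) + n = s - 1 + m + n" "s + m + (n - 1) = s - 1 + m + n" for m n by simp_all
  have eq: "mult_diff V (\<lambda>m n. incl (s + m + n) (g m n)) = (\<lambda>m n. incl (s - 1 + m + n) (mult_diff C g m n))"
    unfolding mult_diff_def s incl_diff(1)[OF g] ..
  have "mult_diff C g m n \<in> carrier (W (s - 1 + m + n))" for m n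
    unfolding mult_diff_def by (rule incl_diff(2)[OF g])
  from Suc.IH[OF this] have "(mult_diff V ^^ Suc N) (\<lambda>m n. incl (s + m + n) (g m n)) m n =
      incl (s - 1 - int N + m + n) ((mult_diff C ^^ Suc N) g m n)"
    by (simp only: funpow_Suc_right comp_apply eq)
  moreover have "s - 1 - int N + m + n = s - int (Suc N) + m + n" by simp
  ultimately show ?case by (simp only:)
qed simp

text \<open>The exponent \<open>N\<close> is common to all homogeneous \<open>c\<close>, so it
  survives the induction over sums in the third argument.\<close>

lemma Com_local_extend:
  assumes a: "a \<in> carrier (W i)" and b: "b \<in> carrier (W j)"
    and loc: "\<And>k c m n. c \<in> carrier (W k) \<Longrightarrow> (mult_diff C ^^ N) (commutator a b c) m n = \<zero>"
    and c: "c \<in> carrier V"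
  shows "(mult_diff V ^^ N) (Com (incl i a) (incl j b) c) m n = \<zero>\<^bsub>V\<^esub>"
  using c
proof (induction rule: V_induct)
  case (incl k c)
  have "Com (incl i a) (incl j b) (incl k c) = (\<lambda>m n. incl (i + j + k + m + n) (commutator a b c m n))"
    using Com_incl[OF a b incl] by blast
  then show ?case
    using funpow_mult_diff_incl[OF commutator_closed[OF a b incl]] loc[OF incl] by simp
next
  case (add u v)
  have "Com (incl i a) (incl j b) (u \<oplus>\<^bsub>V\<^esub> v) =
      (\<lambda>m n. Com (incl i a) (incl j b) u m n \<oplus>\<^bsub>V\<^esub> Com (incl i a) (incl j b) v m n)"
    using Com_add(3) add(1,2) a b by (auto simp: fun_eq_iff)
  then show ?case
    using funpow_mult_diff_add[OF V_space, of "Com (incl i a) (incl j b) u" "Com (incl i a) (incl j b) v"] add a b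
    by (simp add: Com_closed)
qed

text \<open>Unlike in the third argument, the exponent changes with the homogeneous parts of
  \<open>a\<close> and \<open>b\<close>. Only finitely many parts occur, and at each sum the larger
  of the two exponents works for both.\<close>

lemma Com_local_right:
  assumes a: "a \<in> carrier V" and b: "b \<in> carrier V"
    and loc: "\<And>i j a b. \<lbrakk>a \<in> carrier (W i); b \<in> carrier (W j)\<rbrakk> \<Longrightarrow>
      \<exists>N. \<forall>c\<in>carrier V. \<forall>m n. (mult_diff V ^^ N) (Com (incl i a) (incl j b) c) m n = \<zero>\<^bsub>V\<^esub>"
  shows "\<exists>N. \<forall>c\<in>carrier V. \<forall>m n. (mult_diff V ^^ N) (Com a b c) m n = \<zero>\<^bsub>V\<^esub>"
proof -
  have sum: "\<exists>N. \<forall>c\<in>carrier V. \<forall>m n. (mult_diff V ^^ N) (h c) m n = \<zero>\<^bsub>V\<^esub>"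
    if f: "\<exists>N. \<forall>c\<in>carrier V. \<forall>m n. (mult_diff V ^^ N) (f c) m n = \<zero>\<^bsub>V\<^esub>"
      and g: "\<exists>N. \<forall>c\<in>carrier V. \<forall>m n. (mult_diff V ^^ N) (g c) m n = \<zero>\<^bsub>V\<^esub>"
      and h: "\<And>c m n. c \<in> carrier V \<Longrightarrow> h c m n = f c m n \<oplus>\<^bsub>V\<^esub> g c m n"
      and cl: "\<And>c m n. c \<in> carrier V \<Longrightarrow> f c m n \<in> carrier V" "\<And>c m n. c \<in> carrier V \<Longrightarrow> g c m n \<in> carrier V"
    for f g h :: "(int \<Rightarrow> 'v) \<Rightarrow> int \<Rightarrow> int \<Rightarrow> int \<Rightarrow> 'v"
  proof -
    obtain N where N: "\<And>c m n. c \<in> carrier V \<Longrightarrow> (mult_diff V ^^ N) (f c) m n = \<zero>\<^bsub>V\<^esub>" using f by blast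
    obtain M where M: "\<And>c m n. c \<in> carrier V \<Longrightarrow> (mult_diff V ^^ M) (g c) m n = \<zero>\<^bsub>V\<^esub>" using g by blast
    have "(mult_diff V ^^ max N M) (h c) m n = \<zero>\<^bsub>V\<^esub>" if c: "c \<in> carrier V" for c m n
    proof -
      have "h c = (\<lambda>m n. f c m n \<oplus>\<^bsub>V\<^esub> g c m n)" using h[OF c] by blast
      moreover have "(mult_diff V ^^ max N M) (f c) m n = \<zero>\<^bsub>V\<^esub>"
        by (rule funpow_mult_diff_mono[OF V_space N[OF c]]) simp
      moreover have "(mult_diff V ^^ max N M) (g c) m n = \<zero>\<^bsub>V\<^esub>"
        by (rule funpow_mult_diff_mono[OF V_space M[OF c]]) simp
      ultimately show ?thesis
        using funpow_mult_diff_add[OF V_space, of "f c" "g c" "max N M" m n] cl[OF c] by simp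
    qed
    then show ?thesis by blast
  qed
  have homog: "\<exists>N. \<forall>c\<in>carrier V. \<forall>m n. (mult_diff V ^^ N) (Com (incl i a) b c) m n = \<zero>\<^bsub>V\<^esub>"
    if a: "a \<in> carrier (W i)" for i a
    using b
  proof (induction rule: V_induct)
    case (incl j b) show ?case by (rule loc[OF a incl])
  next
    case (add u v) show ?case by (rule sum[OF add(3,4)]) (use Com_add(2) Com_closed add a in auto)
  qed
  show ?thesis using a
  proof (induction rule: V_induct)
    case (incl i a) show ?case by (rule homog[OF incl])
  next
    case (add u v) show ?case by (rule sum[OF add(3,4)]) (use Com_add(1) Com_closed add b in auto)
  qed
qed

text \<open>Axioms about fields are carried from homogeneous elements to sums by
  \<open>V_induct\<close>: identities by additivity, the lower bound on exponents by taking the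
  smaller of two bounds. Locality is delegated to \<open>Com_local_right\<close>.\<close>

lemma assembled_vertex_algebra:
  assumes vanish: "\<And>i j a b. \<lbrakk>a \<in> carrier (W i); b \<in> carrier (W j)\<rbrakk> \<Longrightarrow> \<exists>N. \<forall>n\<ge>int N. md a n b = \<zero>"
    and vac_left: "\<And>i b n. b \<in> carrier (W i) \<Longrightarrow> md vac n b = (if n = -1 then b else \<zero>)"
    and vac_right: "\<And>i a n. \<lbrakk>a \<in> carrier (W i); n \<ge> 0\<rbrakk> \<Longrightarrow> md a n vac = \<zero>"
    and vac_const: "\<And>i a. a \<in> carrier (W i) \<Longrightarrow> md a (-1) vac = a"
    and T_vac: "T vac = \<zero>"
    and covariance: "\<And>i j a b n. \<lbrakk>a \<in> carrier (W i); b \<in> carrier (W j)\<rbrakk> \<Longrightarrow>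
      T (md a n b) \<ominus> md a n (T b) = (- of_int n) \<odot> md a (n - 1) b"
    and loc: "\<And>i j a b. \<lbrakk>a \<in> carrier (W i); b \<in> carrier (W j)\<rbrakk> \<Longrightarrow>
      \<exists>N. \<forall>k. \<forall>c\<in>carrier (W k). \<forall>m n. (mult_diff C ^^ N) (commutator a b c) m n = \<zero>"
  shows "graded_vertex_algebra assembled (\<lambda>i. incl i ` carrier (W i))"
proof (intro graded_vertex_algebra.intro vertex_algebra.intro vertex_algebra_axioms.intro
    graded_vertex_algebra_axioms.intro; (unfold assembled_space assembled_vacuum)?)
  show "Module.module complex_ring V" by (rule V_space[unfolded complex_space_def])
  show vac: "incl 0 vac \<in> carrier V" by (simp add: vac_closed)
  show "linear_on V Tr" by (rule Tr_linear)
  show "linear_on V (Md a n)" if "a \<in> carrier V" for a n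
    using that by (auto simp: linear_on_def Md_closed Md_add_right Md_scale_right)
  show "linear_on V (\<lambda>a. Md a n b)" if "b \<in> carrier V" for b n
    using that by (auto simp: linear_on_def Md_closed Md_add_left Md_scale_left)
  show "\<exists>M. \<forall>m<M. Fld a m b = \<zero>\<^bsub>V\<^esub>" if a: "a \<in> carrier V" and b: "b \<in> carrier V" for a b
    using a
  proof (induction rule: V_induct)
    case (incl i a)
    note a = this
    show ?case using b
    proof (induction rule: V_induct)
      case (incl j b)
      obtain N where N: "\<And>n. n \<ge> int N \<Longrightarrow> md a n b = \<zero>" using vanish[OF a incl] by blast
      have "Fld (summand_incl W i a) m (summand_incl W j b) = \<zero>\<^bsub>V\<^esub>" if "m < - int N" for m
        using that N[of "- m - 1"] by (simp add: Fld_incl[OF a incl])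
      then show ?case by blast
    next
      case (add u v)
      then obtain M M' where M: "\<And>m. m < M \<Longrightarrow> Fld (summand_incl W i a) m u = \<zero>\<^bsub>V\<^esub>"
        "\<And>m. m < M' \<Longrightarrow> Fld (summand_incl W i a) m v = \<zero>\<^bsub>V\<^esub>" by blast
      then have "Fld (summand_incl W i a) m (u \<oplus>\<^bsub>V\<^esub> v) = \<zero>\<^bsub>V\<^esub>" if "m < min M M'" for m
        using that add a by (simp add: Fld_add)
      then show ?case by blast
    qed
  next
    case (add u v)
    then obtain M M' where M: "\<And>m. m < M \<Longrightarrow> Fld u m b = \<zero>\<^bsub>V\<^esub>" "\<And>m. m < M' \<Longrightarrow> Fld v m b = \<zero>\<^bsub>V\<^esub>" by blast
    then have "Fld (u \<oplus>\<^bsub>V\<^esub> v) m b = \<zero>\<^bsub>V\<^esub>" if "m < min M M'" for m using that add b by (simp add: Fld_add)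
    then show ?case by blast
  qed
  show "Fld (incl 0 vac) m b = (if m = 0 then b else \<zero>\<^bsub>V\<^esub>)" if "b \<in> carrier V" for b m
    using that
  proof (induction rule: V_induct)
    case (incl j b)
    then show ?case by (simp add: Fld_incl[OF vac_closed] vac_left[OF incl])
  qed (simp add: Fld_add vac)
  show "Fld a m (incl 0 vac) = \<zero>\<^bsub>V\<^esub>" if "a \<in> carrier V" "m < 0" for a m
    using that(1)
  proof (induction rule: V_induct)
    case (incl i a)
    then show ?case using that(2) by (simp add: Fld_incl[OF _ vac_closed] vac_right[OF incl])
  qed (simp add: Fld_add vac)
  show "Fld a 0 (incl 0 vac) = a" if "a \<in> carrier V" for a
    using that
  proof (induction rule: V_induct)
    case (incl i a)
    then show ?case by (simp add: Fld_incl[OF _ vac_closed] vac_const[OF incl])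
  qed (simp add: Fld_add vac)
  show "Tr (incl 0 vac) = \<zero>\<^bsub>V\<^esub>" by (simp add: Tr_incl T_vac)
  have Tr_add: "Tr (u \<oplus>\<^bsub>V\<^esub> v) = Tr u \<oplus>\<^bsub>V\<^esub> Tr v" if "u \<in> carrier V" "v \<in> carrier V" for u v
    using Tr_linear that by (simp add: linear_on_def)
  note linear = Tr_add Tr_closed Fld_add Fld_closed V.diff_eq_scale V.scale_add_right V.a_ac
  show "Tr (Fld a m b) \<ominus>\<^bsub>V\<^esub> Fld a m (Tr b) = complex_of_int (m + 1) \<odot>\<^bsub>V\<^esub> Fld a (m + 1) b"
    if a: "a \<in> carrier V" and b: "b \<in> carrier V" for a b m
    using a
  proof (induction rule: V_induct)
    case (incl i a)
    note a = this
    show ?case using b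
    proof (induction rule: V_induct)
      case (incl j b)
      note T1 = T_closed[OF Fld_incl(2)[OF a incl, of m]] and T2 = Fld_incl(2)[OF a T_closed[OF incl], of m]
      have s: "i + (j + 1) + m = i + j + m + 1" "i + j + (m + 1) = i + j + m + 1" by simp_all
      have "md a (- m - 1) (T b) \<in> carrier (W (i + j + m + 1))" using T2 by (simp add: s)
      from incl_diff(1)[OF T1 this]
      have "incl (i + j + m + 1) (T (md a (- m - 1) b)) \<ominus>\<^bsub>V\<^esub> incl (i + j + m + 1) (md a (- m - 1) (T b)) =
          incl (i + j + m + 1) (complex_of_int (m + 1) \<odot> md a (- (m + 1) - 1) b)"
        using covariance[OF a incl, of "- m - 1"] by (simp add: add.commute)
      then show ?case
        unfolding Fld_incl(1)[OF a incl] Fld_incl(1)[OF a T_closed[OF incl]] Tr_incl incl_scale s .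
    next
      case (add u v)
      let ?f = "\<lambda>b. Tr (Fld (summand_incl W i a) m b) \<ominus>\<^bsub>V\<^esub> Fld (summand_incl W i a) m (Tr b)"
      have "?f (u \<oplus>\<^bsub>V\<^esub> v) = ?f u \<oplus>\<^bsub>V\<^esub> ?f v" using add(1,2) a by (simp add: linear)
      then show ?case unfolding add(3,4) using add(1,2) a by (simp add: linear)
    qed
  next
    case (add u v)
    let ?f = "\<lambda>a. Tr (Fld a m b) \<ominus>\<^bsub>V\<^esub> Fld a m (Tr b)"
    have "?f (u \<oplus>\<^bsub>V\<^esub> v) = ?f u \<oplus>\<^bsub>V\<^esub> ?f v" using add(1,2) b by (simp add: linear)
    then show ?case unfolding add(3,4) using add(1,2) b by (simp add: linear)
  qed
  show "\<exists>N. \<forall>c\<in>carrier V. \<forall>m n. (mult_diff V ^^ N) (Com a b c) m n = \<zero>\<^bsub>V\<^esub>"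
    if a: "a \<in> carrier V" and b: "b \<in> carrier V" for a b
  proof (rule Com_local_right[OF a b])
    fix i j a b assume ab: "a \<in> carrier (W i)" "b \<in> carrier (W j)"
    obtain N where N: "\<And>k c m n. c \<in> carrier (W k) \<Longrightarrow> (mult_diff C ^^ N) (commutator a b c) m n = \<zero>"
      using loc[OF ab] by blast
    show "\<exists>N. \<forall>c\<in>carrier V. \<forall>m n. (mult_diff V ^^ N) (Com (incl i a) (incl j b) c) m n = \<zero>\<^bsub>V\<^esub>"
    proof (intro exI[of _ N] ballI allI)
      fix c m n assume c: "c \<in> carrier V"
      show "(mult_diff V ^^ N) (Com (incl i a) (incl j b) c) m n = \<zero>\<^bsub>V\<^esub>"
        by (rule Com_local_extend[OF ab _ c]) (rule N)
    qed
  qed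
  show "internal_direct_sum V (\<lambda>i. incl i ` carrier (W i))" by (rule internal_direct_sum_incl)
  show "incl 0 vac \<in> incl 0 ` carrier (W 0)" using vac_closed by blast
  show "Md a n b \<in> incl (i + j - n - 1) ` carrier (W (i + j - n - 1))"
    if "a \<in> incl i ` carrier (W i)" "b \<in> incl j ` carrier (W j)" for a b i j n
    using that Md_incl md_closed by blast
qed

lemma assembled_commutative:
  assumes com: "\<And>i j k a b c m n. \<lbrakk>a \<in> carrier (W i); b \<in> carrier (W j); c \<in> carrier (W k)\<rbrakk> \<Longrightarrow>
      commutator a b c m n = \<zero>"
  shows "commutative_va assembled"
  unfolding commutative_va_def assembled_space
proof (intro ballI allI)
  fix a b c m n assume a: "a \<in> carrier V" and b: "b \<in> carrier V" and c: "c \<in> carrier V"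
  have 1: "Com (incl i a) (incl j b) c m n = \<zero>\<^bsub>V\<^esub>" if "a \<in> carrier (W i)" "b \<in> carrier (W j)" for i j a b
    using Com_local_extend[OF that, of 0 c m n] com[OF that] c by simp
  have 2: "Com (incl i a) b c m n = \<zero>\<^bsub>V\<^esub>" if a: "a \<in> carrier (W i)" for i a
    using b
  proof (induction rule: V_induct)
    case (incl j b) show ?case by (rule 1[OF a incl])
  qed (use Com_add(2) a c in auto)
  show "Com a b c m n = \<zero>\<^bsub>V\<^esub>"
    using a
  proof (induction rule: V_induct)
    case (incl i a) show ?case by (rule 2[OF incl])
  qed (use Com_add(1) b c in auto)
qed

end


section \<open>The costalk of a holomorphic prefactorization algebra as an instance\<close>

context holomorphic_planar_pfa
begin

sublocale G: graded_modes "costalk F" "costalk_weight F" "transl_family F" "mode_family F" "vacuum_family F"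
proof -
  interpret C: complex_space "costalk F" by (rule costalk_space)
  show "graded_modes (costalk F) (costalk_weight F) (transl_family F) (mode_family F) (vacuum_family F)"
  proof
    show "costalk_weight F i = (costalk F)\<lparr>carrier := carrier (costalk_weight F i)\<rparr>" for i
      by (simp add: costalk_weight_def)
  qed (rule weight_costalk weight_zero weight_add weight_scale vacuum_costalk transl_weight transl_add transl_scale
      mode_weight mode_add_left mode_add_right mode_scale_left mode_scale_right; assumption)+
qed

lemma vertex_algebra_of_eq: "vertex_algebra_of F = G.assembled"
  by (simp add: vertex_algebra_of_def G.assembled_def)

lemma funpow_mult_diff_closed:
  assumes "\<And>m n. g m n \<in> carrier (costalk F)"
  shows "(mult_diff (costalk F) ^^ N) g m n \<in> carrier (costalk F)"
  using assms by (induction N arbitrary: m n) (simp_all add: mult_diff_def)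

text \<open>Two index conventions meet here: \<open>mult_diff\<close> acts on exponents and
  \<open>coeff_diff\<close> on mode indices. They are related by \<open>m = - p - 1\<close>, under
  which lowering an exponent is raising a mode index.\<close>

lemma dual_funpow_mult_diff:
  assumes R: "R > 0" and \<phi>: "\<phi> \<in> lcs_dual (disk 0 R)" and g: "\<And>m n. g m n \<in> carrier (costalk F)"
  shows "\<phi> ((mult_diff (costalk F) ^^ N) g m n R) =
    (coeff_diff ^^ N) (\<lambda>p q. \<phi> (g (- p - 1) (- q - 1) R)) (- m - 1) (- n - 1)"
  using g
proof (induction N arbitrary: g)
  case (Suc N)
  have "mult_diff (costalk F) g m n \<in> carrier (costalk F)" for m n using Suc.prems by (simp add: mult_diff_def)
  moreover have "\<phi> (mult_diff (costalk F) g (- p - 1) (- q - 1) R) =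
      coeff_diff (\<lambda>p q. \<phi> (g (- p - 1) (- q - 1) R)) p q" for p q
  proof -
    have "- p - 1 - 1 = - (p + 1) - 1" "- q - 1 - 1 = - (q + 1) - 1" by simp_all
    then show ?thesis
      using Suc.prems costalk_closed[OF Suc.prems R]
      by (simp add: mult_diff_def coeff_diff_def G.diff_eq_scale costalk_ops R lcs_dual_add[OF \<phi>] lcs_dual_scale[OF \<phi>]
        complex_space.scale_closed[OF disk_space])
  qed
  ultimately show ?case using Suc.IH[of "mult_diff (costalk F) g"] by (simp add: funpow_Suc_right del: funpow.simps)
qed simp

text \<open>Costalk elements are compared radius by radius and functional by functional. The
  exponent \<open>N\<close> comes from the pair \<open>a\<close>, \<open>b\<close> alone, so it is
  the same in all these scalar statements and for all \<open>c\<close>.\<close>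

lemma commutator_local:
  assumes a: "a \<in> carrier (costalk_weight F \<Delta>)" and b: "b \<in> carrier (costalk_weight F \<Delta>')"
    and c: "c \<in> carrier (costalk_weight F \<Delta>'')"
    and N: "\<And>n. n \<ge> int N \<Longrightarrow> mode_family F a n b = \<zero>\<^bsub>costalk F\<^esub>"
  shows "(mult_diff (costalk F) ^^ N) (G.commutator a b c) m n = \<zero>\<^bsub>costalk F\<^esub>"
proof (rule costalk_eqI[OF _ weight_costalk[OF weight_zero]])
  have g: "G.commutator a b c m n \<in> carrier (costalk F)" for m n
    by (rule weight_costalk[OF G.commutator_closed[OF a b c]])
  show cl: "(mult_diff (costalk F) ^^ N) (G.commutator a b c) m n \<in> carrier (costalk F)"
    by (rule funpow_mult_diff_closed[OF g])
  fix R :: real assume R: "R > 0"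
  interpret D: locally_convex_space "disk 0 R" by (rule disk_lcs)
  show "(mult_diff (costalk F) ^^ N) (G.commutator a b c) m n R = \<zero>\<^bsub>costalk F\<^esub> R"
  proof (rule disk_eqI[OF R costalk_closed[OF cl R]])
    show "\<zero>\<^bsub>costalk F\<^esub> R \<in> carrier (disk 0 R)" using R by (simp add: costalk_ops)
    fix \<phi> assume \<phi>: "\<phi> \<in> lcs_dual (disk 0 R)"
    have "\<phi> (G.commutator a b c (- p - 1) (- q - 1) R) =
        \<phi> (mode_family F a p (mode_family F b q c) R) - \<phi> (mode_family F b q (mode_family F a p c) R)" for p q
    proof -
      have "mode_family F a p (mode_family F b q c) \<in> carrier (costalk F)"
        "mode_family F b q (mode_family F a p c) \<in> carrier (costalk F)"
        by (rule weight_costalk[OF mode_weight[OF a mode_weight[OF b c]]] weight_costalk[OF mode_weight[OF b mode_weight[OF a c]]])+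
      then show ?thesis
        using costalk_closed[OF _ R]
        by (simp add: G.commutator_def G.diff_eq_scale costalk_ops R lcs_dual_add[OF \<phi>] lcs_dual_scale[OF \<phi>]
          complex_space.scale_closed[OF disk_space])
    qed
    then show "\<phi> ((mult_diff (costalk F) ^^ N) (G.commutator a b c) m n R) = \<phi> (\<zero>\<^bsub>costalk F\<^esub> R)"
      unfolding dual_funpow_mult_diff[where g = "G.commutator a b c", OF R \<phi> g]
      using locality_dual[where N = N and m = "- m - 1" and n = "- n - 1", OF a b c R \<phi> N]
      by (simp add: funpow_coeff_diff_minus costalk_ops R D.dual_zero[OF \<phi>])
  qed
qed

lemma graded_vertex_algebra_of: "graded_vertex_algebra (vertex_algebra_of F) (weight_component F)"
proof -
  have "\<exists>N. \<forall>k. \<forall>c\<in>carrier (costalk_weight F k). \<forall>m n.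
      (mult_diff (costalk F) ^^ N) (G.commutator a b c) m n = \<zero>\<^bsub>costalk F\<^esub>"
    if ab: "a \<in> carrier (costalk_weight F i)" "b \<in> carrier (costalk_weight F j)" for i j a b
  proof -
    obtain N where "\<And>n. n \<ge> int N \<Longrightarrow> mode_family F a n b = \<zero>\<^bsub>costalk F\<^esub>" using mode_vanish[OF ab] by blast
    then show ?thesis using commutator_local[OF ab] by blast
  qed
  then have "graded_vertex_algebra G.assembled (\<lambda>i. summand_incl (costalk_weight F) i ` carrier (costalk_weight F i))"
    by (intro G.assembled_vertex_algebra mode_vanish mode_vacuum_left mode_vacuum_right transl_vacuum transl_mode)
  then show ?thesis unfolding vertex_algebra_of_eq weight_component_def[abs_def] .
qed

lemma commutative_vertex_algebra_of: "locally_constant F \<Longrightarrow> commutative_va (vertex_algebra_of F)"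
  unfolding vertex_algebra_of_eq
  by (rule G.assembled_commutative, rule commutator_local[where N = 0, simplified]) (assumption | rule locally_constant_mode_zero)+

end

theorem theorem1:
  fixes F :: "'a planar_pfa"
  assumes "equivariant_prefactorization_algebra rigid_motions rigid_action F"
    and "holomorphic_pfa F"
  shows "vacuum_family F \<in> carrier (costalk_weight F 0) \<and>
    (\<forall>\<Delta>. \<forall>a\<in>carrier (costalk_weight F \<Delta>).
       (\<forall>R>0. \<exists>!d. has_lcs_derivative (pf_space F (ball 0 R)) (mu1 F R a) 0 d) \<and>
       transl_family F a \<in> carrier (costalk_weight F (\<Delta> + 1)) \<and>
       va_transl (vertex_algebra_of F) (summand_incl (costalk_weight F) \<Delta> a) =
         summand_incl (costalk_weight F) (\<Delta> + 1) (transl_family F a)) \<and>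
    (\<forall>\<Delta> \<Delta>'. \<forall>a\<in>carrier (costalk_weight F \<Delta>). \<forall>b\<in>carrier (costalk_weight F \<Delta>').
       (\<forall>R>0. lcs_holomorphic_on (pf_space F (ball 0 R)) 1 ({..<1} \<rightarrow>\<^sub>E ball 0 R - {0})
                 (\<lambda>w. mu2 F R a b (w 0)) \<and>
               (\<exists>!c. has_lcs_laurent_expansion (pf_space F (ball 0 R)) R (mu2 F R a b) c)) \<and>
       (\<forall>n. mode_family F a n b \<in> carrier (costalk_weight F (\<Delta> + \<Delta>' - n - 1)) \<and>
            va_mode (vertex_algebra_of F) (summand_incl (costalk_weight F) \<Delta> a) n
                (summand_incl (costalk_weight F) \<Delta>' b) =
              summand_incl (costalk_weight F) (\<Delta> + \<Delta>' - n - 1) (mode_family F a n b))) \<and>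
    graded_vertex_algebra (vertex_algebra_of F) (weight_component F) \<and>
    (locally_constant F \<longrightarrow> commutative_va (vertex_algebra_of F))"
proof -
  interpret E: equivariant_prefactorization_algebra rigid_motions rigid_action F by (rule assms(1))
  interpret holomorphic_planar_pfa F
    by unfold_locales (rule assms(2))
  show ?thesis
    using vacuum_costalk transl_derivative(1)[OF _ homogeneousI] transl_weight G.Tr_incl[folded vertex_algebra_of_eq]
      mu2_holomorphic_slice[OF _ homogeneousI homogeneousI] mu2_laurent_exists[OF _ homogeneousI homogeneousI]
      mode_weight G.Md_incl[folded vertex_algebra_of_eq] graded_vertex_algebra_of commutative_vertex_algebra_of
    by (intro conjI allI ballI impI)
qed

end
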